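(* Let $M$ be a connected smooth manifold and let $E\to M$ be a smooth oriented real vector bundle of rank $n\ge2$ with a topological spin structure $\Theta:\widetilde{GL}{}^+E\to GL^+E$. The map $$\Theta_*:\mathcal G(\widetilde{GL}{}^+E)\to\mathcal G^{\mathrm{spin}}(GL^+E),\qquad \tilde F\mapsto\Theta\circ\tilde F\circ\Theta^{-1},$$ is a well-defined group homomorphism with kernel $\mathbb Z_2$. If both groups are equipped with the weak $\mathcal C^\infty$-topology, this map is a $2:1$ covering.
   Context: $GL^+E\to M$ is the principal $GL^+_n$-bundle of positively oriented frames of $E$; $\vartheta_n:\widetilde{GL}{}^+_n\to GL^+_n$ is the connected non-trivial double cover of the group of real $n\times n$ matrices with positive determinant. A topological spin structure for $E$ is a two-fold covering $\Theta:\widetilde{GL}{}^+E\to GL^+E$, where $\widetilde{GL}{}^+E\to M$ is a principal $\widetilde{GL}{}^+_n$-bundle, with $\Theta$ covering $\mathrm{id}_M$ and $\Theta(\tilde b.\tilde A)=\Theta(\tilde b).\vartheta_n(\tilde A)$. For a principal $G$-bundle $P\to M$, $\mathcal G(P)$ is the group (under composition) of gauge transformations, i.e. smooth $G$-equivariant maps $P\to P$ covering $\mathrm{id}_M$. A gauge transformation $F\in\mathcal G(GL^+E)$ is called spin if there exists $\tilde F\in\mathcal G(\widetilde{GL}{}^+E)$ with $\Theta\circ\tilde F=F\circ\Theta$; $\mathcal G^{\mathrm{spin}}(GL^+E)$ is the set of these. The expression $\Theta\circ\tilde F\circ\Theta^{-1}$ means $b\mapsto\Theta(\tilde F(\tilde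 b))$ for any $\tilde b\in\Theta^{-1}(b)$. Weak $\mathcal C^\infty$-topology (compact-open $\mathcal C^\infty$-topology): for smooth manifolds $X,Y$, the topology on $\mathcal C^\infty(X,Y)$ generated by the sets $\{g: g(K)\subset V,\ \|\psi\circ f\circ\varphi^{-1}-\psi\circ g\circ\varphi^{-1}\|_{\mathcal C^k(\varphi(K))}<\varepsilon\}$, where $f\in\mathcal C^\infty(X,Y)$, $\varphi$ is a chart on $U\subset X$, $\psi$ a chart on $V\subset Y$, $K\subset U$ compact with $f(K)\subset V$, $k\in\mathbb N$, $\varepsilon>0$; gauge groups carry the subspace topology from $\mathcal C^\infty(P,P)$. A covering is a continuous surjection $p:\hat X\to X$ such that every point of $X$ has an open neighborhood whose preimage is a disjoint union of open sets each mapped homeomorphically onto it.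
   Formalization: The spin structure Θ is assumed to be smooth as well as a two-fold covering; for a merely continuous Θ the map Θ∘F̃∘Θ⁻¹ need not be smooth, so Θ_* would not be well defined. *)

theory Defs
  imports "HOL-Analysis.Analysis" "HOL-Algebra.Elementary_Groups"
begin

section \<open>Smooth maps between open subsets of normed spaces\<close>

fun iter_deriv :: "'a::real_normed_vector list \<Rightarrow> ('a \<Rightarrow> 'b::real_normed_vector) \<Rightarrow> 'a \<Rightarrow> 'b" where
  "iter_deriv [] f = f"
| "iter_deriv (v # vs) f = iter_deriv vs (\<lambda>x. frechet_derivative f (at x) v)"

text \<open>Only used for open \<open>S\<close> and a finite-dimensional domain, where it is \<open>C\<^sup>\<infinity>\<close> in the usual sense.\<close>

definition smooth_on :: "'a::real_normed_vector set \<Rightarrow> ('a \<Rightarrow> 'b::real_normed_vector) \<Rightarrow> bool" where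
  "smooth_on S f \<longleftrightarrow> (\<forall>vs. \<forall>x\<in>S. iter_deriv vs f differentiable (at x))"

text \<open>The \<open>C\<^sup>k\<close>-norm over a compact set, for functions that are smooth on a neighbourhood of that set.
  The element \<open>0\<close> only matters for empty \<open>K\<close>.\<close>

definition Ck_norm :: "nat \<Rightarrow> 'a::real_normed_vector set \<Rightarrow> ('a \<Rightarrow> 'b::real_normed_vector) \<Rightarrow> real" where
  "Ck_norm k K f = Sup (insert 0 {norm (iter_deriv vs f x) | vs x.
      x \<in> K \<and> length vs \<le> k \<and> (\<forall>v\<in>set vs. norm v \<le> 1)})"

section \<open>Smooth manifolds\<close>

text \<open>A chart is a pair of its open domain and a map that is only relevant on that domain. The model
  space is an arbitrary finite-dimensional normed space. It is not required to be a
  \<open>euclidean_space\<close>, because that class excludes dimension \<open>0\<close>.\<close>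

record ('p, 'a) manifold =
  mtop :: "'p topology"
  atlas :: "('p set \<times> ('p \<Rightarrow> 'a)) set"

abbreviation mpoints :: "('p, 'a) manifold \<Rightarrow> 'p set" where
  "mpoints X \<equiv> topspace (mtop X)"

definition is_chart :: "'p topology \<Rightarrow> 'p set \<times> ('p \<Rightarrow> 'a::real_normed_vector) \<Rightarrow> bool" where
  "is_chart T = (\<lambda>(U, \<phi>). openin T U \<and> open (\<phi> ` U) \<and>
      homeomorphic_map (subtopology T U) (top_of_set (\<phi> ` U)) \<phi>)"

definition compatible_charts ::
    "'p set \<times> ('p \<Rightarrow> 'a::real_normed_vector) \<Rightarrow> 'p set \<times> ('p \<Rightarrow> 'a) \<Rightarrow> bool" where
  "compatible_charts = (\<lambda>(U, \<phi>) (V, \<psi>).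
      smooth_on (\<phi> ` (U \<inter> V)) (\<psi> \<circ> inv_into U \<phi>) \<and>
      smooth_on (\<psi> ` (U \<inter> V)) (\<phi> \<circ> inv_into V \<psi>))"

definition smooth_manifold :: "('p, 'a::real_normed_vector) manifold \<Rightarrow> bool" where
  "smooth_manifold X \<longleftrightarrow>
     (\<exists>B::'a set. finite B \<and> span B = UNIV) \<and>
     Hausdorff_space (mtop X) \<and> second_countable (mtop X) \<and>
     (\<forall>c\<in>atlas X. is_chart (mtop X) c) \<and>
     (\<Union>c\<in>atlas X. fst c) = mpoints X \<and>
     (\<forall>c\<in>atlas X. \<forall>d\<in>atlas X. compatible_charts c d)"

definition charts :: "('p, 'a::real_normed_vector) manifold \<Rightarrow> ('p set \<times> ('p \<Rightarrow> 'a)) set" where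
  "charts X = {c. is_chart (mtop X) c \<and> (\<forall>d\<in>atlas X. compatible_charts c d)}"

definition model_mfd :: "('a::real_normed_vector, 'a) manifold" where
  "model_mfd = \<lparr>mtop = euclidean, atlas = {(UNIV, id)}\<rparr>"

definition open_submfd :: "('p, 'a) manifold \<Rightarrow> 'p set \<Rightarrow> ('p, 'a) manifold" where
  "open_submfd X W = \<lparr>mtop = subtopology (mtop X) W,
     atlas = {(U \<inter> W, \<phi>) | U \<phi>. (U, \<phi>) \<in> atlas X}\<rparr>"

definition prod_mfd :: "('p, 'a) manifold \<Rightarrow> ('q, 'b) manifold \<Rightarrow> ('p \<times> 'q, 'a \<times> 'b) manifold" where
  "prod_mfd X Y = \<lparr>mtop = prod_topology (mtop X) (mtop Y),
     atlas = {(U \<times> V, map_prod \<phi> \<psi>) | U \<phi> V \<psi>. (U, \<phi>) \<in> atlas X \<and> (V, \<psi>) \<in> atlas Y}\<rparr>"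

definition smooth_map ::
    "('p, 'a::real_normed_vector) manifold \<Rightarrow> ('q, 'b::real_normed_vector) manifold \<Rightarrow> ('p \<Rightarrow> 'q) \<Rightarrow> bool" where
  "smooth_map X Y f \<longleftrightarrow> continuous_map (mtop X) (mtop Y) f \<and>
     (\<forall>(U, \<phi>)\<in>atlas X. \<forall>(V, \<psi>)\<in>atlas Y.
        smooth_on (\<phi> ` {x\<in>U. f x \<in> V}) (\<psi> \<circ> f \<circ> inv_into U \<phi>))"

definition diffeo ::
    "('p, 'a::real_normed_vector) manifold \<Rightarrow> ('q, 'b::real_normed_vector) manifold \<Rightarrow> ('p \<Rightarrow> 'q) \<Rightarrow> bool" where
  "diffeo X Y f \<longleftrightarrow> bij_betw f (mpoints X) (mpoints Y) \<and>
     smooth_map X Y f \<and> smooth_map Y X (inv_into (mpoints X) f)"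

text \<open>\<open>C\<^sup>\<infinity>(X,Y)\<close>: maps are normalised to \<open>undefined\<close> outside the manifold \<open>X\<close>, so that equality of
  HOL functions is equality of maps on \<open>X\<close>.\<close>

definition smooth_maps ::
    "('p, 'a::real_normed_vector) manifold \<Rightarrow> ('q, 'b::real_normed_vector) manifold \<Rightarrow> ('p \<Rightarrow> 'q) set" where
  "smooth_maps X Y = {f. smooth_map X Y f \<and> f \<in> extensional (mpoints X)}"

definition weak_nbhd ::
    "('p, 'a::real_normed_vector) manifold \<Rightarrow> ('q, 'b::real_normed_vector) manifold \<Rightarrow> ('p \<Rightarrow> 'q) \<Rightarrow>
     'p set \<times> ('p \<Rightarrow> 'a) \<Rightarrow> 'q set \<times> ('q \<Rightarrow> 'b) \<Rightarrow> 'p set \<Rightarrow> nat \<Rightarrow> real \<Rightarrow> ('p \<Rightarrow> 'q) set" where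
  "weak_nbhd X Y f = (\<lambda>(U, \<phi>) (V, \<psi>) K k \<epsilon>.
     {g \<in> smooth_maps X Y. g ` K \<subseteq> V \<and>
        Ck_norm k (\<phi> ` K) (\<lambda>y. \<psi> (f (inv_into U \<phi> y)) - \<psi> (g (inv_into U \<phi> y))) < \<epsilon>})"

definition weak_Cinf_topology ::
    "('p, 'a::real_normed_vector) manifold \<Rightarrow> ('q, 'b::real_normed_vector) manifold \<Rightarrow> ('p \<Rightarrow> 'q) topology" where
  "weak_Cinf_topology X Y = topology_generated_by
     {weak_nbhd X Y f c d K k \<epsilon> | f c d K k \<epsilon>.
        f \<in> smooth_maps X Y \<and> c \<in> charts X \<and> d \<in> charts Y \<and>
        compactin (mtop X) K \<and> K \<subseteq> fst c \<and> f ` K \<subseteq> fst d \<and> \<epsilon> > 0}"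

section \<open>Coverings\<close>

definition covering :: "'p topology \<Rightarrow> 'q topology \<Rightarrow> ('p \<Rightarrow> 'q) \<Rightarrow> bool" where
  "covering X Y p \<longleftrightarrow> continuous_map X Y p \<and> p ` topspace X = topspace Y \<and>
     (\<forall>y\<in>topspace Y. \<exists>V. openin Y V \<and> y \<in> V \<and>
        (\<exists>\<U>. \<Union>\<U> = {x\<in>topspace X. p x \<in> V} \<and> pairwise disjnt \<U> \<and>
           (\<forall>U\<in>\<U>. openin X U \<and> homeomorphic_map (subtopology X U) (subtopology Y V) p)))"

definition two_fold_covering :: "'p topology \<Rightarrow> 'q topology \<Rightarrow> ('p \<Rightarrow> 'q) \<Rightarrow> bool" where
  "two_fold_covering X Y p \<longleftrightarrow> covering X Y p \<and>
     (\<forall>y\<in>topspace Y. card {x\<in>topspace X. p x = y} = 2)"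

section \<open>Lie groups\<close>

record ('g, 'h) lie = "'g monoid" +
  gmfd :: "('g, 'h) manifold"

definition lie_group :: "('g, 'h::real_normed_vector) lie \<Rightarrow> bool" where
  "lie_group G \<longleftrightarrow> group G \<and> smooth_manifold (gmfd G) \<and> mpoints (gmfd G) = carrier G \<and>
     smooth_map (prod_mfd (gmfd G) (gmfd G)) (gmfd G) (\<lambda>(g, h). g \<otimes>\<^bsub>G\<^esub> h) \<and>
     smooth_map (gmfd G) (gmfd G) (\<lambda>g. inv\<^bsub>G\<^esub> g)"

definition GLp :: "(real^'n^'n, real^'n^'n) lie" where
  "GLp = \<lparr>carrier = {A. det A > 0}, monoid.mult = (**), one = mat 1,
     gmfd = open_submfd model_mfd {A. det A > 0}\<rparr>"

text \<open>The connected double cover of the group of matrices of positive determinant. For \<open>CARD('n) \<ge> 2\<close>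
  it exists and is unique up to isomorphism over that group, and connectedness says that it is non-trivial.\<close>

definition connected_double_cover_GLp ::
    "('g, 'h::real_normed_vector) lie \<Rightarrow> ('g \<Rightarrow> real^'n^'n) \<Rightarrow> bool" where
  "connected_double_cover_GLp Gt \<theta> \<longleftrightarrow> lie_group Gt \<and> connected_space (mtop (gmfd Gt)) \<and>
     \<theta> \<in> hom Gt GLp \<and> smooth_map (gmfd Gt) (gmfd GLp) \<theta> \<and>
     two_fold_covering (mtop (gmfd Gt)) (mtop (gmfd GLp)) \<theta>"

section \<open>Oriented vector bundles\<close>

text \<open>A frame at \<open>x\<close> is a linear isomorphism from \<open>\<real>\<^sup>n\<close> onto the fibre over \<open>x\<close>, i.e. the basis
  consisting of the images of the standard basis vectors; it lies over the base point of its value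
  at \<open>0\<close>. An orientation is recorded as the set \<open>vpos\<close> of positively oriented frames.\<close>

record ('m, 'a, 'v, 'c, 'n) vbundle =
  vbase :: "('m, 'a) manifold"
  vtotal :: "('v, 'c) manifold"
  vproj :: "'v \<Rightarrow> 'm"
  vadd :: "'v \<Rightarrow> 'v \<Rightarrow> 'v"
  vscale :: "real \<Rightarrow> 'v \<Rightarrow> 'v"
  vpos :: "(real^'n \<Rightarrow> 'v) set"

definition vfibre :: "('m, 'a, 'v, 'c, 'n::finite) vbundle \<Rightarrow> 'm \<Rightarrow> 'v set" where
  "vfibre E x = {v \<in> mpoints (vtotal E). vproj E v = x}"

text \<open>The pair \<open>(U, \<tau>)\<close> stands for the local trivialisation \<open>v \<mapsto> (vproj E v, \<tau> v)\<close> over \<open>U\<close>. As \<open>\<tau>\<close> is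
  injective on fibres, the last two conditions transport the vector space laws to the fibres.\<close>

definition vtriv ::
    "('m, 'a::real_normed_vector, 'v, 'c::real_normed_vector, 'n::finite) vbundle \<Rightarrow> 'm set \<Rightarrow> ('v \<Rightarrow> real^'n) \<Rightarrow> bool" where
  "vtriv E U \<tau> \<longleftrightarrow> openin (mtop (vbase E)) U \<and>
     diffeo (open_submfd (vtotal E) {v \<in> mpoints (vtotal E). vproj E v \<in> U})
       (prod_mfd (open_submfd (vbase E) U) model_mfd) (\<lambda>v. (vproj E v, \<tau> v)) \<and>
     (\<forall>x\<in>U. \<forall>v\<in>vfibre E x. \<forall>w\<in>vfibre E x.
        vadd E v w \<in> vfibre E x \<and> \<tau> (vadd E v w) = \<tau> v + \<tau> w) \<and>
     (\<forall>x\<in>U. \<forall>v\<in>vfibre E x. \<forall>c.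
        vscale E c v \<in> vfibre E x \<and> \<tau> (vscale E c v) = c *\<^sub>R \<tau> v)"

definition vector_bundle ::
    "('m, 'a::real_normed_vector, 'v, 'c::real_normed_vector, 'n::finite) vbundle \<Rightarrow> bool" where
  "vector_bundle E \<longleftrightarrow> smooth_manifold (vbase E) \<and> smooth_manifold (vtotal E) \<and>
     smooth_map (vtotal E) (vbase E) (vproj E) \<and>
     (\<forall>x\<in>mpoints (vbase E). \<exists>U \<tau>. x \<in> U \<and> vtriv E U \<tau>)"

definition vframe :: "('m, 'a, 'v, 'c, 'n::finite) vbundle \<Rightarrow> 'm \<Rightarrow> (real^'n \<Rightarrow> 'v) \<Rightarrow> bool" where
  "vframe E x b \<longleftrightarrow> x \<in> mpoints (vbase E) \<and> bij_betw b UNIV (vfibre E x) \<and>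
     (\<forall>u w. b (u + w) = vadd E (b u) (b w)) \<and> (\<forall>c u. b (c *\<^sub>R u) = vscale E c (b u))"

definition oriented_vector_bundle ::
    "('m, 'a::real_normed_vector, 'v, 'c::real_normed_vector, 'n::finite) vbundle \<Rightarrow> bool" where
  "oriented_vector_bundle E \<longleftrightarrow> vector_bundle E \<and>
     (\<forall>b\<in>vpos E. \<exists>x. vframe E x b) \<and>
     (\<forall>p\<in>mpoints (vbase E). \<exists>U \<tau>. p \<in> U \<and> vtriv E U \<tau> \<and>
        (\<forall>x\<in>U. \<forall>b. vframe E x b \<longrightarrow> (b \<in> vpos E \<longleftrightarrow> det (matrix (\<tau> \<circ> b)) > 0)))"

section \<open>Principal bundles and gauge transformations\<close>

record ('m, 'a, 'p, 'b, 'g, 'h) pbundle =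
  pbase :: "('m, 'a) manifold"
  ptotal :: "('p, 'b) manifold"
  pproj :: "'p \<Rightarrow> 'm"
  pgroup :: "('g, 'h) lie"
  pact :: "'p \<Rightarrow> 'g \<Rightarrow> 'p"

abbreviation pspace :: "('m, 'a, 'p, 'b, 'g, 'h) pbundle \<Rightarrow> 'p set" where
  "pspace P \<equiv> mpoints (ptotal P)"

definition principal_bundle ::
    "('m, 'a::real_normed_vector, 'p, 'b::real_normed_vector, 'g, 'h::real_normed_vector) pbundle \<Rightarrow> bool" where
  "principal_bundle P \<longleftrightarrow>
     smooth_manifold (pbase P) \<and> smooth_manifold (ptotal P) \<and> lie_group (pgroup P) \<and>
     smooth_map (ptotal P) (pbase P) (pproj P) \<and>
     smooth_map (prod_mfd (ptotal P) (gmfd (pgroup P))) (ptotal P) (\<lambda>(b, g). pact P b g) \<and>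
     (\<forall>b\<in>pspace P. pact P b \<one>\<^bsub>pgroup P\<^esub> = b) \<and>
     (\<forall>b\<in>pspace P. \<forall>g\<in>carrier (pgroup P). \<forall>h\<in>carrier (pgroup P).
        pact P (pact P b g) h = pact P b (g \<otimes>\<^bsub>pgroup P\<^esub> h)) \<and>
     (\<forall>b\<in>pspace P. \<forall>g\<in>carrier (pgroup P). pproj P (pact P b g) = pproj P b) \<and>
     (\<forall>x\<in>mpoints (pbase P). \<exists>U \<tau>. x \<in> U \<and> openin (mtop (pbase P)) U \<and>
        diffeo (open_submfd (ptotal P) {b \<in> pspace P. pproj P b \<in> U})
          (prod_mfd (open_submfd (pbase P) U) (gmfd (pgroup P))) (\<lambda>b. (pproj P b, \<tau> b)) \<and>
        (\<forall>b\<in>pspace P. \<forall>g\<in>carrier (pgroup P).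
           pproj P b \<in> U \<longrightarrow> \<tau> (pact P b g) = \<tau> b \<otimes>\<^bsub>pgroup P\<^esub> g))"

definition gauge_transformation ::
    "('m, 'a::real_normed_vector, 'p, 'b::real_normed_vector, 'g, 'h::real_normed_vector) pbundle \<Rightarrow> ('p \<Rightarrow> 'p) \<Rightarrow> bool" where
  "gauge_transformation P F \<longleftrightarrow> F \<in> smooth_maps (ptotal P) (ptotal P) \<and>
     (\<forall>b\<in>pspace P. \<forall>g\<in>carrier (pgroup P). F (pact P b g) = pact P (F b) g) \<and>
     (\<forall>b\<in>pspace P. pproj P (F b) = pproj P b)"

definition gauge_group ::
    "('m, 'a::real_normed_vector, 'p, 'b::real_normed_vector, 'g, 'h::real_normed_vector) pbundle \<Rightarrow> ('p \<Rightarrow> 'p) monoid" where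
  "gauge_group P = \<lparr>carrier = {F. gauge_transformation P F},
     monoid.mult = (\<lambda>F G. compose (pspace P) F G), one = (\<lambda>b\<in>pspace P. b)\<rparr>"

definition gauge_topology ::
    "('m, 'a::real_normed_vector, 'p, 'b::real_normed_vector, 'g, 'h::real_normed_vector) pbundle \<Rightarrow>
     ('p \<Rightarrow> 'p) set \<Rightarrow> ('p \<Rightarrow> 'p) topology" where
  "gauge_topology P \<G> = subtopology (weak_Cinf_topology (ptotal P) (ptotal P)) \<G>"

section \<open>The bundle of positively oriented frames and spin structures\<close>

text \<open>The chart of the frame bundle induced by a chart \<open>(U, \<phi>)\<close> of the base and a local trivialisation
  \<open>(U, \<tau>)\<close> sends a frame \<open>b\<close> over \<open>x \<in> U\<close> to \<open>\<phi> x\<close> and the matrix of \<open>\<tau> \<circ> b\<close>.\<close>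

definition frame_atlas ::
    "('m, 'a::real_normed_vector, 'v, 'c::real_normed_vector, 'n::finite) vbundle \<Rightarrow>
     ((real^'n \<Rightarrow> 'v) set \<times> ((real^'n \<Rightarrow> 'v) \<Rightarrow> 'a \<times> (real^'n^'n))) set" where
  "frame_atlas E = {({b \<in> vpos E. vproj E (b 0) \<in> U}, \<lambda>b. (\<phi> (vproj E (b 0)), matrix (\<tau> \<circ> b)))
     | U \<phi> \<tau>. (U, \<phi>) \<in> charts (vbase E) \<and> vtriv E U \<tau>}"

definition GLp_bundle ::
    "('m, 'a::real_normed_vector, 'v, 'c::real_normed_vector, 'n::finite) vbundle \<Rightarrow>
     ('m, 'a, real^'n \<Rightarrow> 'v, 'a \<times> (real^'n^'n), real^'n^'n, real^'n^'n) pbundle" where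
  "GLp_bundle E = \<lparr>pbase = vbase E,
     ptotal = \<lparr>mtop = topology_generated_by {{b \<in> W. \<Phi> b \<in> D} | W \<Phi> D. (W, \<Phi>) \<in> frame_atlas E \<and> open D},
               atlas = frame_atlas E\<rparr>,
     pproj = (\<lambda>b. vproj E (b 0)), pgroup = GLp, pact = (\<lambda>b A. b \<circ> (*v) A)\<rparr>"

definition spin_structure ::
    "('m, 'a::real_normed_vector, 'v, 'c::real_normed_vector, 'n::finite) vbundle \<Rightarrow>
     ('g, 'h::real_normed_vector) lie \<Rightarrow> ('g \<Rightarrow> real^'n^'n) \<Rightarrow>
     ('m, 'a, 'p, 'b::real_normed_vector, 'g, 'h) pbundle \<Rightarrow> ('p \<Rightarrow> real^'n \<Rightarrow> 'v) \<Rightarrow> bool" where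
  "spin_structure E Gt \<theta> P \<Theta> \<longleftrightarrow>
     principal_bundle P \<and> pbase P = vbase E \<and> pgroup P = Gt \<and>
     smooth_map (ptotal P) (ptotal (GLp_bundle E)) \<Theta> \<and>
     two_fold_covering (mtop (ptotal P)) (mtop (ptotal (GLp_bundle E))) \<Theta> \<and>
     (\<forall>b\<in>pspace P. pproj (GLp_bundle E) (\<Theta> b) = pproj P b) \<and>
     (\<forall>b\<in>pspace P. \<forall>A\<in>carrier Gt. \<Theta> (pact P b A) = pact (GLp_bundle E) (\<Theta> b) (\<theta> A))"

definition spin_gauge_group ::
    "('m, 'a::real_normed_vector, 'v, 'c::real_normed_vector, 'n::finite) vbundle \<Rightarrow>
     ('m, 'a, 'p, 'b::real_normed_vector, 'g, 'h::real_normed_vector) pbundle \<Rightarrow> ('p \<Rightarrow> real^'n \<Rightarrow> 'v) \<Rightarrow>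
     ((real^'n \<Rightarrow> 'v) \<Rightarrow> (real^'n \<Rightarrow> 'v)) monoid" where
  "spin_gauge_group E P \<Theta> = (gauge_group (GLp_bundle E))
     \<lparr>carrier := {F \<in> carrier (gauge_group (GLp_bundle E)).
        \<exists>Ft\<in>carrier (gauge_group P). \<forall>b\<in>pspace P. \<Theta> (Ft b) = F (\<Theta> b)}\<rparr>"

text \<open>Here \<open>inv_into\<close> selects some preimage of the frame under \<open>\<Theta>\<close>.\<close>

definition Theta_star ::
    "('m, 'a::real_normed_vector, 'v, 'c::real_normed_vector, 'n::finite) vbundle \<Rightarrow>
     ('m, 'a, 'p, 'b, 'g, 'h) pbundle \<Rightarrow> ('p \<Rightarrow> real^'n \<Rightarrow> 'v) \<Rightarrow>
     ('p \<Rightarrow> 'p) \<Rightarrow> (real^'n \<Rightarrow> 'v) \<Rightarrow> (real^'n \<Rightarrow> 'v)" where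
  "Theta_star E P \<Theta> Ft = (\<lambda>b\<in>pspace (GLp_bundle E). \<Theta> (Ft (inv_into (pspace P) \<Theta> b)))"

end

theory Submission imports Defs begin

text \<open>
  Let \<open>\<epsilon>\<close> generate the kernel of \<open>\<theta>\<close>. Acting by the central element \<open>\<epsilon>\<close> is the deck involution \<open>\<kappa>\<close> of \<open>\<Theta>\<close>,
  every gauge transformation commutes with \<open>\<kappa>\<close> and so descends, and, the total space being connected, two gauge
  transformations with the same image \<open>F\<close> agree up to \<open>\<kappa>\<close>. Which of the two lifts of a given \<open>F\<close> one has is
  decided by the value at a single point \<open>p0\<close>: near \<open>F\<close> the sheets are the lifts whose value at \<open>p0\<close> lies in a
  fixed small open set.

  That \<open>\<Theta>\<^sub>*\<close> and the inverses of its restrictions to sheets are continuous for the weak topology comes from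
  comparing norms in charts transported along \<open>\<Theta>\<close>, provided that \<open>\<Theta>\<close> is a local diffeomorphism. For \<open>\<theta>\<close> this
  follows from Sard's theorem (some point is regular) and homogeneity; for \<open>\<Theta>\<close> it follows from the case of \<open>\<theta>\<close>
  by means of local sections of the spin bundle that lie over the frames given by a local trivialisation. A subbasic
  neighbourhood upstairs is controlled by finitely many conditions downstairs: a lift close to a given one at \<open>p0\<close>
  stays close along a compact set, because the set of points with this property is open and closed.
\<close>

section \<open>Finite-dimensional normed spaces\<close>

text \<open>A covering only provides continuous local inverses, and a smooth homeomorphism such as
  the cube function on the line has no smooth inverse. Both \<theta> and \<Theta> are given as
  smooth maps that are topological coverings, so smooth local inverses have to be earned before
  derivatives above and below can be compared. The model spaces are moreover unrelated types of
  finite dimension. Invariance of dimension identifies that of the double cover with the space of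
  matrices; elsewhere the derivative of a local diffeomorphism does. Charts are then carried over by
  linear isomorphisms, under which iterated derivatives in constant directions merely have their
  directions replaced, so that norms change by a constant factor that is the same for all maps. The
  covering argument itself is free of bundles: it concerns a set of smooth maps of a connected space
  that is stable under a fixed-point free involution \<kappa>. Its crux is that closeness of the
  maps below says nothing about the branch of a lift; a small connected set can go to either of two
  disjoint places, and fixing the branch at one point has to settle it everywhere.\<close>

definition fin_dim :: "'a::real_normed_vector itself \<Rightarrow> bool" where
  "fin_dim _ \<longleftrightarrow> (\<exists>B::'a set. finite B \<and> span B = UNIV)"

text \<open>Induction on the independent set. By the induction hypothesis a convergent sequence in
  the smaller span has Cauchy coordinates, so that span is closed and the new vector keeps a
  positive distance from it.\<close>

lemma coordinates_bounded:
  fixes B :: "'a::real_normed_vector set"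
  assumes "finite B" "independent B"
  shows "\<exists>C>0. \<forall>c. \<forall>b\<in>B. \<bar>c b\<bar> \<le> C * norm (\<Sum>x\<in>B. c x *\<^sub>R x)"
  using assms
proof (induction B)
  case empty
  then show ?case by (auto intro: exI[of _ 1])
next
  case (insert b B)
  have indB: "independent B" and nb: "b \<notin> span B"
    using insert.prems insert.hyps by (auto simp: independent_insert)
  obtain C where C: "C > 0" "\<And>c x. x \<in> B \<Longrightarrow> \<bar>c x\<bar> \<le> C * norm (\<Sum>x\<in>B. c x *\<^sub>R x)"
    using insert.IH[OF indB] by blast
  have "\<exists>m>0. \<forall>y\<in>span B. m \<le> norm (b - y)"
  proof (rule ccontr)
    assume H: "\<not> ?thesis"
    have "\<exists>y\<in>span B. norm (b - y) < inverse (real (Suc n))" for n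
    proof -
      have "inverse (real (Suc n)) > 0" by simp
      then show ?thesis using H by (meson not_le_imp_less)
    qed
    then obtain y where y: "\<And>n. y n \<in> span B" "\<And>n. norm (b - y n) < inverse (real (Suc n))"
      by metis
    have "\<exists>c. y n = (\<Sum>x\<in>B. c x *\<^sub>R x)" for n
      using y(1)[of n] span_finite[OF insert.hyps(1)] by auto
    then obtain c where c: "\<And>n. y n = (\<Sum>x\<in>B. c n x *\<^sub>R x)" by metis
    have "(\<lambda>n. b - y n) \<longlonglongrightarrow> 0"
      by (rule Lim_null_comparison[OF _ LIMSEQ_inverse_real_of_nat])
         (use y(2) in \<open>auto intro!: eventuallyI less_imp_le\<close>)
    then have lim: "y \<longlonglongrightarrow> b"
      using tendsto_diff[of "\<lambda>n. b" b sequentially "\<lambda>n. b - y n" 0] by simp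
    then have Cy: "Cauchy y" by (rule LIMSEQ_imp_Cauchy)
    have Cc: "Cauchy (\<lambda>n. c n x)" if x: "x \<in> B" for x
    proof (rule metric_CauchyI)
      fix e :: real assume e: "e > 0"
      then have "e / C > 0" using C by simp
      from metric_CauchyD[OF Cy this] obtain M where M: "\<And>m n. m\<ge>M \<Longrightarrow> n\<ge>M \<Longrightarrow> dist (y m) (y n) < e / C"
        by blast
      show "\<exists>M. \<forall>m\<ge>M. \<forall>n\<ge>M. dist (c m x) (c n x) < e"
      proof (intro exI[of _ M] allI impI)
        fix m n assume mn: "M \<le> m" "M \<le> n"
        have "\<bar>c m x - c n x\<bar> \<le> C * norm (\<Sum>x\<in>B. (c m x - c n x) *\<^sub>R x)"
          using C(2)[OF x, of "\<lambda>x. c m x - c n x"] by simp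
        also have "(\<Sum>x\<in>B. (c m x - c n x) *\<^sub>R x) = y m - y n"
          by (simp add: c sum_subtractf scaleR_left_diff_distrib)
        also have "C * norm (y m - y n) < C * (e / C)"
          using M[OF mn] C(1) by (simp add: dist_norm mult_less_cancel_left_pos del: times_divide_eq_right)
        finally show "dist (c m x) (c n x) < e" using C(1) by (simp add: dist_norm)
      qed
    qed
    then have "\<exists>l. (\<lambda>n. c n x) \<longlonglongrightarrow> l" if "x \<in> B" for x
      using that Cauchy_convergent convergent_def by blast
    then obtain l where l: "\<And>x. x \<in> B \<Longrightarrow> (\<lambda>n. c n x) \<longlonglongrightarrow> l x" by metis
    have "(\<lambda>n. \<Sum>x\<in>B. c n x *\<^sub>R x) \<longlonglongrightarrow> (\<Sum>x\<in>B. l x *\<^sub>R x)"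
      by (intro tendsto_sum tendsto_scaleR l tendsto_const)
    then have "y \<longlonglongrightarrow> (\<Sum>x\<in>B. l x *\<^sub>R x)" by (simp add: c[abs_def])
    then have "b = (\<Sum>x\<in>B. l x *\<^sub>R x)" using lim LIMSEQ_unique by blast
    then show False using nb by (simp add: span_sum span_scale span_base)
  qed
  then obtain m where m: "m > 0" "\<And>y. y \<in> span B \<Longrightarrow> m \<le> norm (b - y)" by blast
  \<comment> \<open>Up to the factor \<open>c b\<close> the sum is \<open>b\<close> minus a vector
    of \<open>span B\<close>, which has norm at least \<open>m\<close>.\<close>
  have one: "\<bar>c b\<bar> \<le> norm (\<Sum>x\<in>insert b B. c x *\<^sub>R x) / m" for c
  proof (cases "c b = 0")
    case False
    define y where "y = - (\<Sum>x\<in>B. (c x / c b) *\<^sub>R x)"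
    have "y \<in> span B" unfolding y_def by (intro span_neg span_sum span_scale span_base)
    then have "m \<le> norm (b - y)" by (rule m)
    then have "\<bar>c b\<bar> * m \<le> \<bar>c b\<bar> * norm (b - y)" by (rule mult_left_mono) simp
    also have "\<dots> = norm (c b *\<^sub>R (b - y))" by simp
    also have "c b *\<^sub>R (b - y) = (\<Sum>x\<in>insert b B. c x *\<^sub>R x)"
      using insert.hyps False by (simp add: y_def scaleR_right_distrib scaleR_sum_right)
    finally show ?thesis using m(1) by (simp add: pos_le_divide_eq)
  qed (use m in simp)
  \<comment> \<open>Removing the term at \<open>b\<close> adds at most \<open>norm b / m\<close>
    times the norm of the whole sum, by \<open>one\<close>; \<open>C\<close> then bounds the
    coordinates of the rest.\<close>
  define D where "D = C * (1 + norm b / m)"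
  have Dpos: "D \<ge> 0" using C m unfolding D_def by simp
  have two: "\<bar>c x\<bar> \<le> D * norm (\<Sum>x\<in>insert b B. c x *\<^sub>R x)" if x: "x \<in> B" for c x
  proof -
    let ?t = "\<Sum>x\<in>insert b B. c x *\<^sub>R x"
    have "(\<Sum>x\<in>B. c x *\<^sub>R x) = ?t - c b *\<^sub>R b" using insert.hyps by simp
    then have "norm (\<Sum>x\<in>B. c x *\<^sub>R x) \<le> norm ?t + \<bar>c b\<bar> * norm b"
      by (metis norm_scaleR norm_triangle_ineq4)
    also have "\<dots> \<le> norm ?t + norm ?t / m * norm b"
      using one[of c] by (intro add_left_mono mult_right_mono) auto
    finally have "C * norm (\<Sum>x\<in>B. c x *\<^sub>R x) \<le> C * (norm ?t + norm ?t / m * norm b)"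
      using C(1) by simp
    with C(2)[OF x, of c] show ?thesis by (simp add: D_def algebra_simps)
  qed
  show ?case
  proof (intro exI[of _ "1 / m + D"] conjI allI ballI)
    show "1 / m + D > 0" using m Dpos by (simp add: add_pos_nonneg)
    fix c x assume "x \<in> insert b B"
    then have "\<bar>c x\<bar> \<le> 1 / m * norm (\<Sum>x\<in>insert b B. c x *\<^sub>R x) \<or> \<bar>c x\<bar> \<le> D * norm (\<Sum>x\<in>insert b B. c x *\<^sub>R x)"
      using one[of c] two[of x c] by auto
    moreover have "1 / m * norm (\<Sum>x\<in>insert b B. c x *\<^sub>R x) \<le> (1 / m + D) * norm (\<Sum>x\<in>insert b B. c x *\<^sub>R x)"
      "D * norm (\<Sum>x\<in>insert b B. c x *\<^sub>R x) \<le> (1 / m + D) * norm (\<Sum>x\<in>insert b B. c x *\<^sub>R x)"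
      by (rule mult_right_mono; use m Dpos in simp)+
    ultimately show "\<bar>c x\<bar> \<le> (1 / m + D) * norm (\<Sum>x\<in>insert b B. c x *\<^sub>R x)" by linarith
  qed
qed

text \<open>Continuity of the coordinate functionals makes expansions of derivatives over a basis
  differentiable term by term.\<close>

lemma bounded_linear_representation:
  fixes B :: "'a::real_normed_vector set"
  assumes "finite B" "independent B" "span B = UNIV"
  shows "bounded_linear (\<lambda>v. representation B v b)"
proof (cases "b \<in> B")
  case False
  then have "representation B v b = 0" for v
    using representation_ne_zero[of B v b] by auto
  then show ?thesis by simp
next
  case True
  obtain C where C: "\<And>c b. b \<in> B \<Longrightarrow> \<bar>c b\<bar> \<le> C * norm (\<Sum>x\<in>B. c x *\<^sub>R x)"
    using coordinates_bounded[OF assms(1,2)] by blast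
  show ?thesis
  proof (rule bounded_linear_intro[where K = C])
    fix v w :: 'a and r :: real
    show "representation B (v + w) b = representation B v b + representation B w b"
      using assms by (simp add: representation_add)
    show "representation B (r *\<^sub>R v) b = r *\<^sub>R representation B v b"
      using assms by (simp add: representation_scale)
    show "norm (representation B v b) \<le> norm v * C"
      using C[OF True, of "representation B v"] sum_representation_eq[of B v B] assms
      by (simp add: mult.commute)
  qed
qed

lemma fin_dim_basis:
  assumes "fin_dim TYPE('a::real_normed_vector)"
  obtains B :: "'a::real_normed_vector set" where "finite B" "independent B" "span B = UNIV"
proof -
  obtain A :: "'a set" where A: "finite A" "span A = UNIV" using assms by (auto simp: fin_dim_def)
  obtain B where "B \<subseteq> A" "independent B" "A \<subseteq> span B"
    using maximal_independent_subset[of A] by blast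
  moreover from this have "span B = UNIV" using A(2) span_mono span_span by (metis top.extremum_uniqueI)
  ultimately show ?thesis using that A(1) finite_subset by blast
qed

lemma representation_expansion:
  fixes B :: "'a::real_normed_vector set"
  assumes "finite B" "independent B" "span B = UNIV"
  shows "(\<Sum>b\<in>B. representation B v b *\<^sub>R b) = v"
  using assms by (intro sum_representation_eq) auto

text \<open>The box is the continuous image of an interval times a smaller box. With
  \<open>coordinates_bounded\<close> it yields the Heine-Borel property from a finite spanning
  set.\<close>

lemma compact_box:
  fixes B :: "'a::real_normed_vector set"
  assumes "finite B"
  shows "compact {\<Sum>x\<in>B. c x *\<^sub>R x |c. \<forall>x\<in>B. \<bar>c x\<bar> \<le> R}"
  using assms
proof (induction B)
  case empty
  then show ?case by simp
next
  case (insert b B)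
  let ?K = "{\<Sum>x\<in>B. c x *\<^sub>R x |c. \<forall>x\<in>B. \<bar>c x\<bar> \<le> R}"
  have "compact ((\<lambda>p. fst p *\<^sub>R b + snd p) ` ({-R..R} \<times> ?K))"
    by (intro compact_continuous_image compact_Times continuous_intros insert.IH) auto
  also have "(\<lambda>p. fst p *\<^sub>R b + snd p) ` ({-R..R} \<times> ?K) = {\<Sum>x\<in>insert b B. c x *\<^sub>R x |c. \<forall>x\<in>insert b B. \<bar>c x\<bar> \<le> R}"
    (is "?L = ?R")
  proof
    show "?L \<subseteq> ?R"
    proof
      fix z assume "z \<in> ?L"
      then obtain t c where z: "z = t *\<^sub>R b + (\<Sum>x\<in>B. c x *\<^sub>R x)" "\<bar>t\<bar> \<le> R" "\<forall>x\<in>B. \<bar>c x\<bar> \<le> R"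
        by auto
      have "(\<Sum>x\<in>insert b B. (c(b := t)) x *\<^sub>R x) = t *\<^sub>R b + (\<Sum>x\<in>B. (c(b := t)) x *\<^sub>R x)"
        using insert.hyps by simp
      also have "(\<Sum>x\<in>B. (c(b := t)) x *\<^sub>R x) = (\<Sum>x\<in>B. c x *\<^sub>R x)"
        using insert.hyps by (intro sum.cong) auto
      finally show "z \<in> ?R" using z by (auto intro!: exI[of _ "c(b := t)"])
    qed
    show "?R \<subseteq> ?L"
    proof
      fix z assume "z \<in> ?R"
      then obtain c where z: "z = (\<Sum>x\<in>insert b B. c x *\<^sub>R x)" "\<forall>x\<in>insert b B. \<bar>c x\<bar> \<le> R" by auto
      then have "z = (\<lambda>p. fst p *\<^sub>R b + snd p) (c b, \<Sum>x\<in>B. c x *\<^sub>R x)" using insert.hyps by simp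
      moreover have "(c b, \<Sum>x\<in>B. c x *\<^sub>R x) \<in> {-R..R} \<times> ?K" using z(2) by (auto simp: abs_le_iff)
      ultimately show "z \<in> ?L" by (rule image_eqI)
    qed
  qed
  finally show ?case .
qed

lemma compact_cball_fin_dim:
  fixes a :: "'a::real_normed_vector"
  assumes "fin_dim TYPE('a)"
  shows "compact (cball a r)"
proof -
  obtain B :: "'a set" where B: "finite B" "independent B" "span B = UNIV"
    using fin_dim_basis[OF assms] .
  obtain C where C: "C > 0" "\<And>c b. b \<in> B \<Longrightarrow> \<bar>c b\<bar> \<le> C * norm (\<Sum>x\<in>B. c x *\<^sub>R x)"
    using coordinates_bounded[OF B(1,2)] by blast
  \<comment> \<open>Vectors of the ball have norm at most \<open>norm a + r\<close>, and
    \<open>C\<close> turns this into a bound for their coordinates.\<close>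
  let ?K = "{\<Sum>x\<in>B. c x *\<^sub>R x |c. \<forall>x\<in>B. \<bar>c x\<bar> \<le> C * (norm a + r)}"
  have "cball a r \<subseteq> ?K"
  proof
    fix v assume "v \<in> cball a r"
    then have v: "norm v \<le> norm a + r"
      by (metis add.commute add_le_cancel_left dist_commute dist_norm mem_cball norm_triangle_sub order_trans)
    have "\<bar>representation B v b\<bar> \<le> C * (norm a + r)" if "b \<in> B" for b
      using C(2)[OF that, of "representation B v"] mult_left_mono[OF v less_imp_le[OF C(1)]]
      by (simp add: representation_expansion[OF B])
    then show "v \<in> ?K"
      using representation_expansion[OF B, of v] by (intro CollectI exI[of _ "representation B v"]) simp
  qed
  moreover have "compact (?K \<inter> cball a r)"
    by (intro compact_Int_closed compact_box B closed_cball)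
  ultimately show ?thesis by (simp add: Int_absorb1)
qed

lemma fin_dim_euclidean [simp]: "fin_dim TYPE('a::euclidean_space)"
  unfolding fin_dim_def by (intro exI[of _ Basis]) simp

lemma fin_dim_prod:
  assumes "fin_dim TYPE('a::real_normed_vector)" "fin_dim TYPE('b::real_normed_vector)"
  shows "fin_dim TYPE('a \<times> 'b)"
proof -
  obtain A :: "'a set" and B :: "'b set" where AB: "finite A" "span A = UNIV" "finite B" "span B = UNIV"
    using assms by (auto simp: fin_dim_def)
  let ?C = "(\<lambda>a. (a, 0)) ` A \<union> (\<lambda>b. (0, b)) ` B"
  have l: "linear (\<lambda>a::'a. (a, 0::'b))" and r: "linear (\<lambda>b::'b. (0::'a, b))"
    by (auto intro!: linearI)
  have "(a, b) \<in> span ?C" for a b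
  proof -
    have "(a, 0) \<in> (\<lambda>a. (a, 0)) ` span A" "(0, b) \<in> (\<lambda>b. (0, b)) ` span B" using AB by auto
    moreover have "(\<lambda>a. (a, 0)) ` span A \<subseteq> span ?C" "(\<lambda>b. (0, b)) ` span B \<subseteq> span ?C"
      unfolding span_linear_image[OF l, symmetric] span_linear_image[OF r, symmetric]
      by (rule span_mono, blast)+
    ultimately have "(a, 0) \<in> span ?C" "(0, b) \<in> span ?C" by blast+
    then show ?thesis using span_add[of "(a, 0)" ?C "(0, b)"] by simp
  qed
  then show ?thesis unfolding fin_dim_def using AB by (intro exI[of _ ?C]) auto
qed

section \<open>Iterated derivatives\<close>

text \<open>\<open>frechet_derivative\<close> chooses among the derivatives at a point. Functions
  that agree near the point have the same derivatives, so the choices coincide, even where there is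
  nothing to choose from.\<close>

lemma frechet_derivative_cong_open:
  assumes "open S" "x \<in> S" "\<And>y. y \<in> S \<Longrightarrow> f y = g y"
  shows "frechet_derivative f (at x) = frechet_derivative g (at x)"
    "f differentiable (at x) \<longleftrightarrow> g differentiable (at x)"
proof -
  have *: "(f has_derivative f') (at x) \<longleftrightarrow> (g has_derivative f') (at x)" for f'
  proof
    show "(g has_derivative f') (at x)" if "(f has_derivative f') (at x)"
      by (rule has_derivative_transform_within_open[OF that assms])
    show "(f has_derivative f') (at x)" if "(g has_derivative f') (at x)"
      by (rule has_derivative_transform_within_open[OF that assms(1,2)]) (simp add: assms(3))
  qed
  show "frechet_derivative f (at x) = frechet_derivative g (at x)"
    unfolding frechet_derivative_def * ..
  show "f differentiable (at x) \<longleftrightarrow> g differentiable (at x)"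
    unfolding differentiable_def * ..
qed

lemma iter_deriv_cong:
  assumes "open S" "x \<in> S" "\<And>y. y \<in> S \<Longrightarrow> f y = g y"
  shows "iter_deriv vs f x = iter_deriv vs g x"
  using assms
proof (induction vs arbitrary: f g x)
  case (Cons v vs)
  show ?case unfolding iter_deriv.simps
  proof (rule Cons.IH[OF Cons.prems(1,2)])
    show "frechet_derivative f (at y) v = frechet_derivative g (at y) v" if "y \<in> S" for y
      using frechet_derivative_cong_open(1)[OF assms(1) that Cons.prems(3)] by simp
  qed
qed simp

text \<open>Counts derivatives so that order \<open>0\<close> already means differentiability.\<close>

definition diff_order_on :: "nat \<Rightarrow> 'a::real_normed_vector set \<Rightarrow> ('a \<Rightarrow> 'b::real_normed_vector) \<Rightarrow> bool" where
  "diff_order_on k S f \<longleftrightarrow> (\<forall>vs. length vs \<le> k \<longrightarrow> (\<forall>x\<in>S. iter_deriv vs f differentiable (at x)))"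

lemma smooth_on_iff: "smooth_on S f \<longleftrightarrow> (\<forall>k. diff_order_on k S f)"
  unfolding smooth_on_def diff_order_on_def by auto

lemma smooth_onI: "(\<And>k. diff_order_on k S f) \<Longrightarrow> smooth_on S f"
  by (simp add: smooth_on_iff)

lemma smooth_onD: "smooth_on S f \<Longrightarrow> diff_order_on k S f"
  by (simp add: smooth_on_iff)

lemma diff_order_on_0: "diff_order_on 0 S f \<longleftrightarrow> (\<forall>x\<in>S. f differentiable (at x))"
  by (simp add: diff_order_on_def)

text \<open>The recursion behind the closure properties below: differentiate once, recognise the
  formula for the derivative, and apply the induction hypothesis to its ingredients.\<close>

lemma diff_order_on_Suc: "diff_order_on (Suc k) S f \<longleftrightarrow>
   (\<forall>x\<in>S. f differentiable (at x)) \<and> (\<forall>v. diff_order_on k S (\<lambda>x. frechet_derivative f (at x) v))"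
proof
  assume L: "diff_order_on (Suc k) S f"
  then show "(\<forall>x\<in>S. f differentiable (at x)) \<and> (\<forall>v. diff_order_on k S (\<lambda>x. frechet_derivative f (at x) v))"
    unfolding diff_order_on_def
    by (auto dest: spec[of _ "[]"]) (drule spec, drule mp[where P = "length (_ # _) \<le> _"], auto)
next
  assume R: "(\<forall>x\<in>S. f differentiable (at x)) \<and> (\<forall>v. diff_order_on k S (\<lambda>x. frechet_derivative f (at x) v))"
  show "diff_order_on (Suc k) S f"
    unfolding diff_order_on_def
  proof (intro allI impI)
    fix vs :: "'a list" assume "length vs \<le> Suc k"
    then show "\<forall>x\<in>S. iter_deriv vs f differentiable (at x)"
      using R by (cases vs) (auto simp: diff_order_on_def)
  qed
qed

lemma diff_order_on_differentiable: "diff_order_on k S f \<Longrightarrow> x \<in> S \<Longrightarrow> f differentiable (at x)"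
  unfolding diff_order_on_def by (auto dest: spec[of _ "[]"])

lemma smooth_on_differentiable: "smooth_on S f \<Longrightarrow> x \<in> S \<Longrightarrow> f differentiable (at x)"
  using smooth_onD diff_order_on_differentiable by blast

lemma smooth_on_derivative: "smooth_on S f \<Longrightarrow> smooth_on S (\<lambda>x. frechet_derivative f (at x) v)"
  by (simp add: smooth_on_iff diff_order_on_Suc[THEN iffD1])

lemma smooth_on_continuous_on: "smooth_on S f \<Longrightarrow> continuous_on S f"
  by (auto intro!: continuous_at_imp_continuous_on differentiable_imp_continuous_within dest: smooth_on_differentiable)

lemma diff_order_on_SucD: "diff_order_on (Suc k) S f \<Longrightarrow> diff_order_on k S f"
  by (simp add: diff_order_on_def)

lemma diff_order_on_SucD2: "diff_order_on (Suc k) S f \<Longrightarrow> diff_order_on k S (\<lambda>x. frechet_derivative f (at x) v)"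
  by (simp add: diff_order_on_Suc)

lemma diff_order_on_cong:
  assumes "open S" "\<And>y. y \<in> S \<Longrightarrow> f y = g y"
  shows "diff_order_on k S f \<longleftrightarrow> diff_order_on k S g"
proof -
  have "iter_deriv vs f differentiable (at x) \<longleftrightarrow> iter_deriv vs g differentiable (at x)" if "x \<in> S" for vs x
    by (rule frechet_derivative_cong_open(2)[OF assms(1) that]) (rule iter_deriv_cong[OF assms(1) _ assms(2)])
  then show ?thesis unfolding diff_order_on_def by blast
qed

lemma smooth_on_cong:
  "open S \<Longrightarrow> (\<And>y. y \<in> S \<Longrightarrow> f y = g y) \<Longrightarrow> smooth_on S f \<longleftrightarrow> smooth_on S g"
  using diff_order_on_cong[of S f g] by (simp add: smooth_on_iff)

lemma smooth_on_subset: "smooth_on S f \<Longrightarrow> T \<subseteq> S \<Longrightarrow> smooth_on T f"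
  unfolding smooth_on_def by blast

text \<open>A known derivative \<open>f'\<close> replaces the choice operator, so that only a
  concrete formula in a fixed direction remains to be examined.\<close>

lemma diff_order_on_SucI:
  assumes "open S"
    and "\<And>x. x \<in> S \<Longrightarrow> (f has_derivative f' x) (at x)"
    and "\<And>v. diff_order_on k S (\<lambda>x. f' x v)"
  shows "diff_order_on (Suc k) S f"
proof -
  have "frechet_derivative f (at x) = f' x" if "x \<in> S" for x
    using assms(2)[OF that] frechet_derivative_at by metis
  then have "diff_order_on k S (\<lambda>x. frechet_derivative f (at x) v) \<longleftrightarrow> diff_order_on k S (\<lambda>x. f' x v)" for v
    by (intro diff_order_on_cong assms(1)) auto
  then show ?thesis using assms differentiableI unfolding diff_order_on_Suc by blast
qed

lemma frechet_has_derivative: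
  "diff_order_on k S f \<Longrightarrow> x \<in> S \<Longrightarrow> (f has_derivative frechet_derivative f (at x)) (at x)"
  using diff_order_on_differentiable frechet_derivative_works by blast

lemma diff_order_on_const: "diff_order_on k S (\<lambda>_. c)"
proof -
  have "iter_deriv vs (\<lambda>_::'a. c) = (\<lambda>_. c) \<or> iter_deriv vs (\<lambda>_::'a. c) = (\<lambda>_. 0)" for vs :: "'a list" and c :: 'b
    by (induction vs arbitrary: c) (simp_all, metis)
  then show ?thesis unfolding diff_order_on_def by (metis differentiable_const)
qed

lemma diff_order_on_linear:
  assumes "open S" "bounded_linear L" "diff_order_on k S f"
  shows "diff_order_on k S (\<lambda>x. L (f x))"
  using assms(3)
proof (induction k arbitrary: f)
  case 0
  then show ?case unfolding diff_order_on_0 differentiable_def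
    using bounded_linear.has_derivative[OF assms(2)] by blast
next
  case (Suc k)
  show ?case
    by (rule diff_order_on_SucI[OF assms(1)],
        rule bounded_linear.has_derivative[OF assms(2)], rule frechet_has_derivative[OF Suc.prems])
       (auto intro: Suc.IH diff_order_on_SucD2[OF Suc.prems])
qed

lemma diff_order_on_ident:
  assumes "open S" shows "diff_order_on k S (\<lambda>x. x)"
proof (cases k)
  case 0
  then show ?thesis by (simp add: diff_order_on_0)
next
  case (Suc m)
  show ?thesis unfolding Suc
    by (rule diff_order_on_SucI[OF assms, where f' = "\<lambda>x v. v"]) (auto intro: diff_order_on_const)
qed

lemma diff_order_on_add:
  assumes "open S" "diff_order_on k S f" "diff_order_on k S g"
  shows "diff_order_on k S (\<lambda>x. f x + g x)"
  using assms(2,3)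
proof (induction k arbitrary: f g)
  case 0
  then show ?case by (auto simp: diff_order_on_0)
next
  case (Suc k)
  show ?case
    by (rule diff_order_on_SucI[OF assms(1)], rule has_derivative_add)
       (auto intro!: Suc.IH intro: diff_order_on_SucD2[OF Suc.prems(1)] diff_order_on_SucD2[OF Suc.prems(2)]
         frechet_has_derivative Suc.prems)
qed

lemma diff_order_on_sum:
  assumes "open S" "\<And>i. i \<in> I \<Longrightarrow> diff_order_on k S (f i)"
  shows "diff_order_on k S (\<lambda>x. \<Sum>i\<in>I. f i x)"
proof (cases "finite I")
  case True
  then show ?thesis using assms(2)
    by (induction I) (auto intro!: diff_order_on_const diff_order_on_add[OF assms(1)])
qed (simp add: diff_order_on_const)

lemma diff_order_on_bilinear:
  assumes "open S" "bounded_bilinear b" "diff_order_on k S f" "diff_order_on k S g"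
  shows "diff_order_on k S (\<lambda>x. b (f x) (g x))"
  using assms(3,4)
proof (induction k arbitrary: f g)
  case 0
  then show ?case unfolding diff_order_on_0 differentiable_def
    using bounded_bilinear.FDERIV[OF assms(2)] by blast
next
  case (Suc k)
  show ?case
  proof (rule diff_order_on_SucI[OF assms(1)])
    fix x assume "x \<in> S"
    then show "((\<lambda>x. b (f x) (g x)) has_derivative
        (\<lambda>v. b (f x) (frechet_derivative g (at x) v) + b (frechet_derivative f (at x) v) (g x))) (at x)"
      by (intro bounded_bilinear.FDERIV[OF assms(2)] frechet_has_derivative[OF Suc.prems(1)] frechet_has_derivative[OF Suc.prems(2)])
  next
    show "diff_order_on k S (\<lambda>x. b (f x) (frechet_derivative g (at x) v) + b (frechet_derivative f (at x) v) (g x))" for v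
      by (intro diff_order_on_add[OF assms(1)] Suc.IH diff_order_on_SucD2 Suc.prems diff_order_on_SucD[OF Suc.prems(1)]
          diff_order_on_SucD[OF Suc.prems(2)])
  qed
qed

text \<open>The chain rule applies the derivative of \<open>g\<close> to a direction that varies
  with the point, while iterated derivatives use constant directions. Expanding the varying
  direction over a basis of the middle space turns it into scalar coefficients times derivatives of
  \<open>g\<close> in basis directions; this is what finite dimension is for.\<close>

lemma diff_order_on_compose:
  fixes f :: "'a::real_normed_vector \<Rightarrow> 'b::real_normed_vector" and g :: "'b \<Rightarrow> 'c::real_normed_vector"
  assumes fd: "fin_dim TYPE('b)" and "open S" "open T"
    and "diff_order_on k S f" "diff_order_on k T g" "f ` S \<subseteq> T"
  shows "diff_order_on k S (\<lambda>x. g (f x))"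
  using assms(4-)
proof (induction k arbitrary: g)
  case 0
  then show ?case unfolding diff_order_on_0
    using differentiable_chain_at[of f _ g] by (auto simp: o_def)
next
  case (Suc k)
  obtain B :: "'b set" where B: "finite B" "independent B" "span B = UNIV"
    using fin_dim_basis[OF fd] .
  show ?case
  proof (rule diff_order_on_SucI[OF assms(2)])
    fix x assume x: "x \<in> S"
    have f: "(f has_derivative frechet_derivative f (at x)) (at x)"
      using frechet_has_derivative[OF Suc.prems(1) x] .
    have g: "(g has_derivative frechet_derivative g (at (f x))) (at (f x))"
      using frechet_has_derivative[OF Suc.prems(2)] x Suc.prems(3) by blast
    have "frechet_derivative g (at (f x)) w = (\<Sum>b\<in>B. representation B w b *\<^sub>R frechet_derivative g (at (f x)) b)" for w
    proof -
      interpret l: bounded_linear "frechet_derivative g (at (f x))" using g by (rule has_derivative_bounded_linear)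
      show ?thesis
        using arg_cong[OF representation_expansion[OF B, of w], of "frechet_derivative g (at (f x))"]
        by (simp add: l.sum l.scaleR)
    qed
    then have "(\<lambda>v. frechet_derivative g (at (f x)) (frechet_derivative f (at x) v)) =
       (\<lambda>v. \<Sum>b\<in>B. representation B (frechet_derivative f (at x) v) b *\<^sub>R frechet_derivative g (at (f x)) b)"
      by blast
    then show "((\<lambda>x. g (f x)) has_derivative
       (\<lambda>v. \<Sum>b\<in>B. representation B (frechet_derivative f (at x) v) b *\<^sub>R frechet_derivative g (at (f x)) b)) (at x)"
      using has_derivative_compose[OF f g] by simp
  next
    fix v
    show "diff_order_on k S (\<lambda>x. \<Sum>b\<in>B. representation B (frechet_derivative f (at x) v) b *\<^sub>R frechet_derivative g (at (f x)) b)"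
      by (intro diff_order_on_sum assms(2) diff_order_on_bilinear[OF _ bounded_bilinear_scaleR]
          diff_order_on_linear[OF assms(2) bounded_linear_representation[OF B]] diff_order_on_SucD2
          Suc.IH[where g = "\<lambda>y. frechet_derivative g (at y) _"] Suc.prems diff_order_on_SucD[OF Suc.prems(1)])
  qed
qed

text \<open>The derivative of the reciprocal contains only the reciprocal itself and the derivative
  of \<open>f\<close>, so order \<open>k\<close> gives order \<open>Suc k\<close>.\<close>

lemma diff_order_on_inverse:
  fixes f :: "'a::real_normed_vector \<Rightarrow> real"
  assumes "open S" "diff_order_on k S f" "\<And>x. x \<in> S \<Longrightarrow> f x \<noteq> 0"
  shows "diff_order_on k S (\<lambda>x. inverse (f x))"
  using assms(2)
proof (induction k)
  case 0
  then show ?case using assms(3) unfolding diff_order_on_0 by (auto intro: differentiable_inverse)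
next
  case (Suc k)
  show ?case
    by (rule diff_order_on_SucI[OF assms(1)], rule Deriv.has_derivative_inverse)
       (auto intro!: assms(3) frechet_has_derivative[OF Suc.prems] diff_order_on_SucD2[OF Suc.prems]
         Suc.IH[OF diff_order_on_SucD[OF Suc.prems]] diff_order_on_bilinear[OF _ bounded_bilinear_mult]
         diff_order_on_linear[OF _ bounded_linear_minus] assms(1) bounded_linear_ident)
qed

lemmas smooth_on_const = smooth_onI[OF diff_order_on_const]
  and smooth_on_ident = smooth_onI[OF diff_order_on_ident]

lemma smooth_on_linear: "open S \<Longrightarrow> bounded_linear L \<Longrightarrow> smooth_on S f \<Longrightarrow> smooth_on S (\<lambda>x. L (f x))"
  by (simp add: smooth_on_iff diff_order_on_linear)

lemma smooth_on_add: "open S \<Longrightarrow> smooth_on S f \<Longrightarrow> smooth_on S g \<Longrightarrow> smooth_on S (\<lambda>x. f x + g x)"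
  by (simp add: smooth_on_iff diff_order_on_add)

lemma smooth_on_diff: "open S \<Longrightarrow> smooth_on S f \<Longrightarrow> smooth_on S g \<Longrightarrow> smooth_on S (\<lambda>x. f x - g x)"
  using smooth_on_add[of S f "\<lambda>x. - g x"] smooth_on_linear[of S "\<lambda>x. - x" g]
  by (simp add: bounded_linear_minus bounded_linear_ident)

lemma smooth_on_compose:
  fixes f :: "'a::real_normed_vector \<Rightarrow> 'b::real_normed_vector" and g :: "'b \<Rightarrow> 'c::real_normed_vector"
  assumes "fin_dim TYPE('b)" "open S" "open T" "smooth_on S f" "smooth_on T g" "f ` S \<subseteq> T"
  shows "smooth_on S (\<lambda>x. g (f x))"
  using assms diff_order_on_compose[of S T _ f g] by (simp add: smooth_on_iff)

lemma smooth_on_Pair: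
  assumes "open S" "smooth_on S f" "smooth_on S g"
  shows "smooth_on S (\<lambda>x. (f x, g x))"
proof -
  have "smooth_on S (\<lambda>x. (f x, 0) + (0, g x))"
    by (intro smooth_on_add smooth_on_linear[where L = "\<lambda>a. (a, 0)"] smooth_on_linear[where L = "\<lambda>a. (0, a)"] assms
        bounded_linear_Pair bounded_linear_ident bounded_linear_zero)
  then show ?thesis by simp
qed

lemma smooth_on_fst: "open S \<Longrightarrow> smooth_on S f \<Longrightarrow> smooth_on S (\<lambda>x. fst (f x))"
  and smooth_on_snd: "open S \<Longrightarrow> smooth_on S f \<Longrightarrow> smooth_on S (\<lambda>x. snd (f x))"
  by (auto intro: smooth_on_linear bounded_linear_fst bounded_linear_snd)

section \<open>The norm of order k over a compact set\<close>

text \<open>The form with coefficients and an index set covers differences as well as expansions of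
  a direction over a basis.\<close>

lemma iter_deriv_sum_scaleR:
  assumes "open S" "finite I" "\<And>i. i \<in> I \<Longrightarrow> smooth_on S (f i)" "x \<in> S"
  shows "iter_deriv vs (\<lambda>x. \<Sum>i\<in>I. c i *\<^sub>R f i x) x = (\<Sum>i\<in>I. c i *\<^sub>R iter_deriv vs (f i) x)"
  using assms(3,4)
proof (induction vs arbitrary: f x)
  case (Cons v vs)
  have *: "frechet_derivative (\<lambda>x. \<Sum>i\<in>I. c i *\<^sub>R f i x) (at y) v = (\<Sum>i\<in>I. c i *\<^sub>R frechet_derivative (f i) (at y) v)"
    if "y \<in> S" for y
  proof -
    have "((\<lambda>x. \<Sum>i\<in>I. c i *\<^sub>R f i x) has_derivative (\<lambda>v. \<Sum>i\<in>I. c i *\<^sub>R frechet_derivative (f i) (at y) v)) (at y)"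
    proof (rule has_derivative_sum)
      fix i assume "i \<in> I"
      from frechet_has_derivative[OF smooth_onD[OF Cons.prems(1)[OF this]] that]
      show "((\<lambda>x. c i *\<^sub>R f i x) has_derivative (\<lambda>v. c i *\<^sub>R frechet_derivative (f i) (at y) v)) (at y)"
        by (rule has_derivative_scaleR_right)
    qed
    from fun_cong[OF frechet_derivative_at[OF this], of v] show ?thesis by (rule sym)
  qed
  have "iter_deriv (v # vs) (\<lambda>x. \<Sum>i\<in>I. c i *\<^sub>R f i x) x =
     iter_deriv vs (\<lambda>x. \<Sum>i\<in>I. c i *\<^sub>R frechet_derivative (f i) (at x) v) x"
    unfolding iter_deriv.simps by (rule iter_deriv_cong[OF assms(1) Cons.prems(2) *])
  also have "\<dots> = (\<Sum>i\<in>I. c i *\<^sub>R iter_deriv vs (\<lambda>x. frechet_derivative (f i) (at x) v) x)"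
    by (rule Cons.IH) (auto intro: smooth_on_derivative Cons.prems)
  finally show ?case by simp
qed simp

lemma iter_deriv_diff:
  assumes "open S" "smooth_on S f" "smooth_on S g" "x \<in> S"
  shows "iter_deriv vs (\<lambda>x. f x - g x) x = iter_deriv vs f x - iter_deriv vs g x"
  using iter_deriv_sum_scaleR[OF assms(1), where I = "UNIV::bool set" and f = "\<lambda>b. if b then f else g"
      and x = x and vs = vs and c = "\<lambda>b. if b then 1 else -1"] assms
  by (simp add: UNIV_bool)

text \<open>The directions range over a unit ball, not over a finite set. Expanding the first
  direction over a basis, with coefficients at most \<open>C\<close>, reduces to finitely many
  functions, each bounded by the induction hypothesis.\<close>

lemma iter_deriv_bounded:
  fixes f :: "'a::real_normed_vector \<Rightarrow> 'b::real_normed_vector"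
  assumes fd: "fin_dim TYPE('a)" and "open S" "compact K" "K \<subseteq> S" "smooth_on S f"
  shows "\<exists>M. \<forall>vs x. x \<in> K \<longrightarrow> length vs \<le> k \<longrightarrow> (\<forall>v\<in>set vs. norm v \<le> 1) \<longrightarrow> norm (iter_deriv vs f x) \<le> M"
  using assms(5)
proof (induction k arbitrary: f)
  case 0
  have "bounded (f ` K)"
    by (meson compact_imp_bounded compact_continuous_image smooth_on_continuous_on 0 assms continuous_on_subset)
  then show ?case by (auto simp: bounded_iff)
next
  case (Suc k)
  obtain B :: "'a set" where B: "finite B" "independent B" "span B = UNIV"
    using fin_dim_basis[OF fd] .
  obtain C where C: "C > 0" "\<And>c b. b \<in> B \<Longrightarrow> \<bar>c b\<bar> \<le> C * norm (\<Sum>x\<in>B. c x *\<^sub>R x)"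
    using coordinates_bounded[OF B(1,2)] by blast
  have "\<forall>b. \<exists>M. \<forall>vs x. x \<in> K \<longrightarrow> length vs \<le> k \<longrightarrow> (\<forall>v\<in>set vs. norm v \<le> 1) \<longrightarrow>
      norm (iter_deriv vs (\<lambda>x. frechet_derivative f (at x) b) x) \<le> M"
    by (intro allI Suc.IH smooth_on_derivative Suc.prems)
  then obtain M where M: "\<And>b vs x. x \<in> K \<Longrightarrow> length vs \<le> k \<Longrightarrow> (\<forall>v\<in>set vs. norm v \<le> 1) \<Longrightarrow>
      norm (iter_deriv vs (\<lambda>x. frechet_derivative f (at x) b) x) \<le> M b" by metis
  obtain M0 where M0: "\<And>vs x. x \<in> K \<Longrightarrow> length vs \<le> k \<Longrightarrow> (\<forall>v\<in>set vs. norm v \<le> 1) \<Longrightarrow>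
      norm (iter_deriv vs f x) \<le> M0" using Suc.IH[OF Suc.prems] by blast
  \<comment> \<open>\<open>M0\<close> covers the empty list of directions; the sum covers lists that
    have a first direction.\<close>
  show ?case
  proof (intro exI[of _ "max M0 (\<Sum>b\<in>B. C * M b)"] allI impI)
    fix vs :: "'a list" and x assume *: "x \<in> K" "length vs \<le> Suc k" "\<forall>v\<in>set vs. norm v \<le> 1"
    show "norm (iter_deriv vs f x) \<le> max M0 (\<Sum>b\<in>B. C * M b)"
    proof (cases vs)
      case Nil
      then show ?thesis using M0[OF *(1), of "[]"] by simp
    next
      case (Cons v ws)
      have "frechet_derivative f (at y) v = (\<Sum>b\<in>B. representation B v b *\<^sub>R frechet_derivative f (at y) b)" if "y \<in> S" for y
      proof -
        interpret l: bounded_linear "frechet_derivative f (at y)"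
          using frechet_has_derivative[OF smooth_onD[OF Suc.prems] that] by (rule has_derivative_bounded_linear)
        show ?thesis
          using arg_cong[OF representation_expansion[OF B, of v], of "frechet_derivative f (at y)"]
          by (simp add: l.sum l.scaleR)
      qed
      then have "iter_deriv vs f x = iter_deriv ws (\<lambda>y. \<Sum>b\<in>B. representation B v b *\<^sub>R frechet_derivative f (at y) b) x"
        unfolding Cons iter_deriv.simps using * assms by (intro iter_deriv_cong[of S]) auto
      also have "\<dots> = (\<Sum>b\<in>B. representation B v b *\<^sub>R iter_deriv ws (\<lambda>y. frechet_derivative f (at y) b) x)"
        using * assms B by (intro iter_deriv_sum_scaleR[of S]) (auto intro: smooth_on_derivative Suc.prems)
      also have "norm \<dots> \<le> (\<Sum>b\<in>B. C * M b)"
      proof (rule sum_norm_le)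
        fix b assume b: "b \<in> B"
        have "\<bar>representation B v b\<bar> \<le> C * norm v"
          using C(2)[OF b, of "representation B v"] by (simp add: representation_expansion[OF B])
        also have "\<dots> \<le> C" using * Cons C(1) by simp
        finally show "norm (representation B v b *\<^sub>R iter_deriv ws (\<lambda>y. frechet_derivative f (at y) b) x) \<le> C * M b"
          using M[OF *(1), of ws b] * Cons C(1) by (auto intro!: mult_mono)
      qed
      finally show ?thesis by simp
    qed
  qed
qed

text \<open>A supremum of reals is meaningful only for a bounded set; this is where smoothness near
  the compact set enters the norm.\<close>

lemma Ck_norm_bdd:
  fixes f :: "'a::real_normed_vector \<Rightarrow> 'b::real_normed_vector"
  assumes "fin_dim TYPE('a)" "open S" "compact K" "K \<subseteq> S" "smooth_on S f"
  shows "bdd_above (insert 0 {norm (iter_deriv vs f x) | vs x.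
      x \<in> K \<and> length vs \<le> k \<and> (\<forall>v\<in>set vs. norm v \<le> 1)})"
proof -
  obtain M where M: "\<And>vs x. x \<in> K \<Longrightarrow> length vs \<le> k \<Longrightarrow> (\<forall>v\<in>set vs. norm v \<le> 1) \<Longrightarrow> norm (iter_deriv vs f x) \<le> M"
    using iter_deriv_bounded[OF assms, of k] by blast
  show ?thesis by (rule bdd_aboveI[of _ "max 0 M"]) (auto dest: M simp: le_max_iff_disj)
qed

text \<open>Derivatives at points of \<open>K\<close> see a neighbourhood, hence agreement is
  required on an open set around \<open>K\<close>.\<close>

lemma Ck_norm_cong:
  assumes "open S" "K \<subseteq> S" "\<And>y. y \<in> S \<Longrightarrow> f y = g y"
  shows "Ck_norm k K f = Ck_norm k K g"
proof -
  have "norm (iter_deriv vs f x) = norm (iter_deriv vs g x)" if "x \<in> K" for vs x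
    using iter_deriv_cong[OF assms(1) _ assms(3), where x = x and vs = vs] assms(2) that by auto
  then have "{norm (iter_deriv vs f x) |vs x. x \<in> K \<and> length vs \<le> k \<and> (\<forall>v\<in>set vs. norm v \<le> 1)} =
    {norm (iter_deriv vs g x) |vs x. x \<in> K \<and> length vs \<le> k \<and> (\<forall>v\<in>set vs. norm v \<le> 1)}"
    by (intro Collect_cong iff_exI) auto
  then show ?thesis unfolding Ck_norm_def by simp
qed

lemma iter_deriv_le_Ck_norm:
  fixes f :: "'a::real_normed_vector \<Rightarrow> 'b::real_normed_vector"
  assumes "fin_dim TYPE('a)" "open S" "compact K" "K \<subseteq> S" "smooth_on S f"
    "x \<in> K" "length vs \<le> k" "\<forall>v\<in>set vs. norm v \<le> 1"
  shows "norm (iter_deriv vs f x) \<le> Ck_norm k K f"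
  unfolding Ck_norm_def by (rule cSup_upper[OF _ Ck_norm_bdd[OF assms(1-5)]]) (use assms in auto)

lemma Ck_norm_leI:
  assumes "0 \<le> c" "\<And>vs x. x \<in> K \<Longrightarrow> length vs \<le> k \<Longrightarrow> \<forall>v\<in>set vs. norm v \<le> 1 \<Longrightarrow> norm (iter_deriv vs f x) \<le> c"
  shows "Ck_norm k K f \<le> c"
  unfolding Ck_norm_def using assms by (intro cSup_least) auto

lemma Ck_norm_nonneg:
  fixes f :: "'a::real_normed_vector \<Rightarrow> 'b::real_normed_vector"
  assumes "fin_dim TYPE('a)" "open S" "compact K" "K \<subseteq> S" "smooth_on S f"
  shows "0 \<le> Ck_norm k K f"
  unfolding Ck_norm_def by (rule cSup_upper[OF _ Ck_norm_bdd[OF assms]]) simp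

lemma Ck_norm_triangle:
  fixes f g h :: "'a::real_normed_vector \<Rightarrow> 'b::real_normed_vector"
  assumes "fin_dim TYPE('a)" "open S" "compact K" "K \<subseteq> S" "smooth_on S f" "smooth_on S g" "smooth_on S h"
  shows "Ck_norm k K (\<lambda>x. f x - h x) \<le> Ck_norm k K (\<lambda>x. f x - g x) + Ck_norm k K (\<lambda>x. g x - h x)"
proof (rule Ck_norm_leI)
  note b = assms(1-4)
  have s: "smooth_on S (\<lambda>x. f x - g x)" "smooth_on S (\<lambda>x. g x - h x)"
    using smooth_on_diff assms by blast+
  show "0 \<le> Ck_norm k K (\<lambda>x. f x - g x) + Ck_norm k K (\<lambda>x. g x - h x)"
    using Ck_norm_nonneg[OF b s(1)] Ck_norm_nonneg[OF b s(2)] by (meson add_nonneg_nonneg)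
  fix vs :: "'a list" and x assume *: "x \<in> K" "length vs \<le> k" "\<forall>v\<in>set vs. norm v \<le> 1"
  then have x: "x \<in> S" using assms by blast
  have "iter_deriv vs (\<lambda>x. f x - h x) x = iter_deriv vs (\<lambda>x. f x - g x) x + iter_deriv vs (\<lambda>x. g x - h x) x"
    using iter_deriv_diff[OF assms(2,5,6) x, of vs] iter_deriv_diff[OF assms(2,5,7) x, of vs]
      iter_deriv_diff[OF assms(2,6,7) x, of vs] by simp
  then show "norm (iter_deriv vs (\<lambda>x. f x - h x) x) \<le> Ck_norm k K (\<lambda>x. f x - g x) + Ck_norm k K (\<lambda>x. g x - h x)"
    using norm_triangle_le[OF add_mono[OF iter_deriv_le_Ck_norm[OF b s(1) *] iter_deriv_le_Ck_norm[OF b s(2) *]]]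
    by (simp only:)
qed

section \<open>Charts and pointwise smoothness\<close>

text \<open>The frame bundle is given by an atlas and the topology generated by it. This notion
  collects the properties of a manifold that are verified for it and on which local arguments
  rest.\<close>

definition premanifold :: "('p, 'a::real_normed_vector) manifold \<Rightarrow> bool" where
  "premanifold X \<longleftrightarrow> fin_dim TYPE('a) \<and> (\<forall>c\<in>atlas X. is_chart (mtop X) c) \<and>
     (\<Union>c\<in>atlas X. fst c) = mpoints X \<and> (\<forall>c\<in>atlas X. \<forall>d\<in>atlas X. compatible_charts c d)"

lemma smooth_manifold_premanifold: "smooth_manifold X \<Longrightarrow> premanifold X"
  by (auto simp: smooth_manifold_def premanifold_def fin_dim_def)

lemma is_chart_openin: "is_chart T (U, \<phi>) \<Longrightarrow> openin T U"
  by (simp add: is_chart_def)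

lemma is_chart_inj: "is_chart T (U, \<phi>) \<Longrightarrow> inj_on \<phi> U"
  using homeomorphic_imp_injective_map[of "subtopology T U" "top_of_set (\<phi> ` U)" \<phi>] openin_subset[of T U]
  by (simp add: is_chart_def inf.absorb2)

lemma is_chart_inv: "is_chart T (U, \<phi>) \<Longrightarrow> x \<in> U \<Longrightarrow> inv_into U \<phi> (\<phi> x) = x"
  using is_chart_inj inv_into_f_f by metis

lemma is_chart_open_image:
  assumes "is_chart T (U, \<phi>)" "openin T A" "A \<subseteq> U"
  shows "open (\<phi> ` A)"
proof -
  have h: "homeomorphic_map (subtopology T U) (top_of_set (\<phi> ` U)) \<phi>" and o: "open (\<phi> ` U)"
    using assms by (auto simp: is_chart_def)
  have "openin (subtopology T U) A" using assms by (auto simp: openin_subtopology)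
  then have "openin (top_of_set (\<phi> ` U)) (\<phi> ` A)"
    using homeomorphic_imp_open_map[OF h] by (auto simp: open_map_def)
  then show ?thesis using o openin_open_trans by blast
qed

lemma is_chart_open_vimage:
  assumes "is_chart T (U, \<phi>)" "open D"
  shows "openin T {x \<in> U. \<phi> x \<in> D}"
proof -
  have h: "continuous_map (subtopology T U) (top_of_set (\<phi> ` U)) \<phi>" and o: "openin T U"
    using assms homeomorphic_imp_continuous_map by (auto simp: is_chart_def)
  have U: "topspace (subtopology T U) = U" using openin_subset[OF o] by auto
  have "continuous_map (subtopology T U) euclidean \<phi>" using h continuous_map_into_fulltopology by blast
  then have "openin (subtopology T U) {x \<in> U. \<phi> x \<in> D}"
    using openin_continuous_map_preimage[of "subtopology T U" euclidean \<phi> D] assms(2) unfolding U by simp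
  then show ?thesis using o openin_trans_full by blast
qed

text \<open>Open images and open preimages in the ambient topologies replace a homeomorphism between
  subspaces.\<close>

lemma is_chartI:
  fixes \<phi> :: "'p \<Rightarrow> 'a::real_normed_vector"
  assumes "openin T U" "inj_on \<phi> U"
    and im: "\<And>A. openin T A \<Longrightarrow> A \<subseteq> U \<Longrightarrow> open (\<phi> ` A)"
    and vim: "\<And>D. open D \<Longrightarrow> openin T {x \<in> U. \<phi> x \<in> D}"
  shows "is_chart T (U, \<phi>)"
proof -
  have U: "topspace (subtopology T U) = U" using openin_subset[OF assms(1)] by auto
  have "continuous_map (subtopology T U) euclidean \<phi>"
  proof (rule continuous_map_openin_preimage_eq[THEN iffD2], intro conjI allI impI)
    fix D :: "'a set" assume "openin euclidean D"
    then have "openin T {x \<in> U. \<phi> x \<in> D}" using vim by simp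
    then have "openin (subtopology T U) {x \<in> U. \<phi> x \<in> D}"
      using assms(1) by (simp add: openin_open_subtopology Collect_restrict)
    moreover have "topspace (subtopology T U) \<inter> \<phi> -` D = {x \<in> U. \<phi> x \<in> D}" using U by auto
    ultimately show "openin (subtopology T U) (topspace (subtopology T U) \<inter> \<phi> -` D)" by simp
  qed simp
  then have c: "continuous_map (subtopology T U) (top_of_set (\<phi> ` U)) \<phi>"
    using U by (auto simp: continuous_map_in_subtopology)
  have "open_map (subtopology T U) (top_of_set (\<phi> ` U)) \<phi>"
    unfolding open_map_def
  proof (intro allI impI)
    fix A assume "openin (subtopology T U) A"
    then have "openin T A" "A \<subseteq> U" using assms(1) by (auto simp: openin_open_subtopology)
    then have "open (\<phi> ` A)" "\<phi> ` A \<subseteq> \<phi> ` U" using im by auto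
    then show "openin (top_of_set (\<phi> ` U)) (\<phi> ` A)" by (simp add: open_subset)
  qed
  then have "homeomorphic_map (subtopology T U) (top_of_set (\<phi> ` U)) \<phi>"
    using c U assms(2) by (simp add: bijective_open_imp_homeomorphic_map)
  then show ?thesis using assms im by (auto simp: is_chart_def)
qed

lemma chart_is_chart: "c \<in> charts X \<Longrightarrow> is_chart (mtop X) c"
  by (simp add: charts_def)

lemmas chart_openin = is_chart_openin[OF chart_is_chart]
  and chart_inj = is_chart_inj[OF chart_is_chart]
  and chart_inv = is_chart_inv[OF chart_is_chart]
  and chart_open_image = is_chart_open_image[OF chart_is_chart]
  and chart_open_vimage = is_chart_open_vimage[OF chart_is_chart]

lemma chart_subset: "(U, \<phi>) \<in> charts X \<Longrightarrow> U \<subseteq> mpoints X"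
  using chart_openin openin_subset by metis

lemma atlas_charts: "premanifold X \<Longrightarrow> c \<in> atlas X \<Longrightarrow> c \<in> charts X"
  by (auto simp: premanifold_def charts_def)

lemma atlas_cover:
  assumes "premanifold X" "x \<in> mpoints X"
  obtains U \<phi> where "(U, \<phi>) \<in> atlas X" "(U, \<phi>) \<in> charts X" "x \<in> U"
proof -
  have "x \<in> (\<Union>c\<in>atlas X. fst c)" using assms by (simp add: premanifold_def)
  then obtain U \<phi> where "(U, \<phi>) \<in> atlas X" "x \<in> U" by auto
  then show ?thesis using that atlas_charts[OF assms(1)] by blast
qed

lemma smooth_on_locallyI:
  assumes "\<And>x. x \<in> S \<Longrightarrow> \<exists>T. x \<in> T \<and> smooth_on T f"
  shows "smooth_on S f"
  using assms unfolding smooth_on_def by blast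

lemma smooth_on_congI:
  "smooth_on S f \<Longrightarrow> open S \<Longrightarrow> (\<And>y. y \<in> S \<Longrightarrow> f y = g y) \<Longrightarrow> smooth_on S g"
  using smooth_on_cong[of S f g] by blast

text \<open>Members of \<open>charts\<close> are compatible with the atlas by definition. The
  transition between two of them is factored, near each point, through an atlas chart around that
  point.\<close>

lemma charts_compatible:
  fixes X :: "('p, 'a::real_normed_vector) manifold"
  assumes X: "premanifold X" and c: "(U, \<phi>) \<in> charts X" and d: "(V, \<psi>) \<in> charts X"
  shows "smooth_on (\<phi> ` (U \<inter> V)) (\<lambda>y. \<psi> (inv_into U \<phi> y))"
proof (rule smooth_on_locallyI)
  fix y assume "y \<in> \<phi> ` (U \<inter> V)"
  then obtain x where x: "x \<in> U" "x \<in> V" "y = \<phi> x" by auto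
  obtain W \<zeta> where W: "(W, \<zeta>) \<in> atlas X" "(W, \<zeta>) \<in> charts X" "x \<in> W"
    using atlas_cover[OF X] x chart_subset[OF c] by blast
  have "compatible_charts (U, \<phi>) (W, \<zeta>)" "compatible_charts (V, \<psi>) (W, \<zeta>)"
    using c d W by (auto simp: charts_def)
  then have s1: "smooth_on (\<phi> ` (U \<inter> W)) (\<zeta> \<circ> inv_into U \<phi>)"
    and s2: "smooth_on (\<zeta> ` (V \<inter> W)) (\<psi> \<circ> inv_into W \<zeta>)"
    by (auto simp: compatible_charts_def)
  let ?O = "U \<inter> V \<inter> W"
  have "openin (mtop X) ?O" using chart_openin c d W by blast
  then have op: "open (\<phi> ` ?O)" "open (\<zeta> ` ?O)"
    by (auto intro!: chart_open_image[OF c] chart_open_image[OF W(2)])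
  have "smooth_on (\<phi> ` ?O) (\<lambda>y. (\<psi> \<circ> inv_into W \<zeta>) ((\<zeta> \<circ> inv_into U \<phi>) y))"
  proof (rule smooth_on_compose[OF _ op, where f = "\<zeta> \<circ> inv_into U \<phi>" and g = "\<psi> \<circ> inv_into W \<zeta>"])
    show "fin_dim TYPE('a)" using X by (simp add: premanifold_def)
    show "smooth_on (\<phi> ` ?O) (\<zeta> \<circ> inv_into U \<phi>)" by (rule smooth_on_subset[OF s1]) auto
    show "smooth_on (\<zeta> ` ?O) (\<psi> \<circ> inv_into W \<zeta>)" by (rule smooth_on_subset[OF s2]) auto
    show "(\<zeta> \<circ> inv_into U \<phi>) ` \<phi> ` ?O \<subseteq> \<zeta> ` ?O" by (auto simp: chart_inv[OF c])
  qed
  then have "smooth_on (\<phi> ` ?O) (\<lambda>y. \<psi> (inv_into U \<phi> y))"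
    by (rule smooth_on_congI[OF _ op(1)]) (auto simp: chart_inv[OF c] chart_inv[OF W(2)])
  moreover have "y \<in> \<phi> ` ?O" using x W by simp
  ultimately show "\<exists>T. y \<in> T \<and> smooth_on T (\<lambda>y. \<psi> (inv_into U \<phi> y))" by (intro exI conjI)
qed

text \<open>Shrinking the domain may change \<open>inv_into\<close> off the smaller image, so the
  representations are compared by congruence on an open set.\<close>

lemma charts_restrict:
  assumes X: "premanifold X" and c: "(U, \<phi>) \<in> charts X" and A: "openin (mtop X) A"
  shows "(U \<inter> A, \<phi>) \<in> charts X"
proof -
  have oU: "openin (mtop X) U" using chart_openin[OF c] .
  have "is_chart (mtop X) (U \<inter> A, \<phi>)"
  proof (rule is_chartI)
    show "openin (mtop X) (U \<inter> A)" using oU A by blast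
    show "inj_on \<phi> (U \<inter> A)" using chart_inj[OF c] inj_on_subset by blast
    show "open (\<phi> ` B)" if "openin (mtop X) B" "B \<subseteq> U \<inter> A" for B
      using chart_open_image[OF c that(1)] that by blast
    have "{x \<in> U \<inter> A. \<phi> x \<in> D} = {x \<in> U. \<phi> x \<in> D} \<inter> A" for D by auto
    then show "openin (mtop X) {x \<in> U \<inter> A. \<phi> x \<in> D}" if "open D" for D
      using chart_open_vimage[OF c that] A by auto
  qed
  moreover have "compatible_charts (U \<inter> A, \<phi>) d" if "d \<in> atlas X" for d
  proof -
    obtain V \<psi> where d: "d = (V, \<psi>)" by (cases d)
    then have "compatible_charts (U, \<phi>) (V, \<psi>)" using c that by (auto simp: charts_def)
    then have s1: "smooth_on (\<phi> ` (U \<inter> V)) (\<psi> \<circ> inv_into U \<phi>)"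
      and s2: "smooth_on (\<psi> ` (U \<inter> V)) (\<phi> \<circ> inv_into V \<psi>)"
      by (auto simp: compatible_charts_def)
    have "openin (mtop X) V" using chart_openin atlas_charts[OF X] that d by blast
    then have o: "open (\<phi> ` (U \<inter> A \<inter> V))" by (intro chart_open_image[OF c]) (use oU A in auto)
    have "smooth_on (\<phi> ` (U \<inter> A \<inter> V)) (\<psi> \<circ> inv_into U \<phi>)"
      by (rule smooth_on_subset[OF s1]) auto
    then have "smooth_on (\<phi> ` (U \<inter> A \<inter> V)) (\<psi> \<circ> inv_into (U \<inter> A) \<phi>)"
      by (rule smooth_on_congI[OF _ o])
         (auto simp: chart_inv[OF c] inv_into_f_f[OF inj_on_subset[OF chart_inj[OF c]]])
    moreover have "smooth_on (\<psi> ` (U \<inter> A \<inter> V)) (\<phi> \<circ> inv_into V \<psi>)"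
      by (rule smooth_on_subset[OF s2]) auto
    ultimately show ?thesis unfolding d compatible_charts_def by auto
  qed
  ultimately show ?thesis by (simp add: charts_def)
qed

text \<open>Together with the empty compact set it gives, around any smooth map, a subbasic set of
  the weak topology; this determines the underlying set of that topology.\<close>

lemma empty_chart: "({}, \<phi>) \<in> charts X"
proof -
  have "is_chart (mtop X) ({}, \<phi>)" by (rule is_chartI) auto
  then show ?thesis by (auto simp: charts_def compatible_charts_def smooth_on_def split: prod.splits)
qed

text \<open>Smoothness at a point, witnessed by one pair of charts and an open set that
  \<open>f\<close> maps into the second chart. Continuity near the point is thereby a consequence,
  and smoothness can be composed point by point.\<close>

definition smooth_near ::
    "('p, 'a::real_normed_vector) manifold \<Rightarrow> ('q, 'b::real_normed_vector) manifold \<Rightarrow> ('p \<Rightarrow> 'q) \<Rightarrow> 'p \<Rightarrow> bool" where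
  "smooth_near X Y f x \<longleftrightarrow> (\<exists>U \<phi> V \<psi> A. (U, \<phi>) \<in> charts X \<and> (V, \<psi>) \<in> charts Y \<and> openin (mtop X) A \<and>
     x \<in> A \<and> A \<subseteq> U \<and> f ` A \<subseteq> V \<and> smooth_on (\<phi> ` A) (\<lambda>y. \<psi> (f (inv_into U \<phi> y))))"

lemma smooth_nearI:
  "(U, \<phi>) \<in> charts X \<Longrightarrow> (V, \<psi>) \<in> charts Y \<Longrightarrow> openin (mtop X) A \<Longrightarrow> x \<in> A \<Longrightarrow> A \<subseteq> U \<Longrightarrow> f ` A \<subseteq> V \<Longrightarrow>
   smooth_on (\<phi> ` A) (\<lambda>y. \<psi> (f (inv_into U \<phi> y))) \<Longrightarrow> smooth_near X Y f x"
  unfolding smooth_near_def by blast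

lemma smooth_near_in_space:
  "smooth_near X Y f x \<Longrightarrow> x \<in> mpoints X" "smooth_near X Y f x \<Longrightarrow> f x \<in> mpoints Y"
  unfolding smooth_near_def using chart_subset openin_subset by (metis subsetD image_subset_iff)+

text \<open>The coordinate representation is differentiable, hence continuous; the preimage is taken
  in coordinates and pulled back through the chart.\<close>

lemma smooth_near_open_vimage:
  assumes f: "smooth_near X Y f x" and W: "openin (mtop Y) W" "f x \<in> W"
  obtains A where "openin (mtop X) A" "x \<in> A" "f ` A \<subseteq> W"
proof -
  obtain U \<phi> V \<psi> A where c: "(U, \<phi>) \<in> charts X" and d: "(V, \<psi>) \<in> charts Y"
    and A: "openin (mtop X) A" "x \<in> A" "A \<subseteq> U" "f ` A \<subseteq> V"
    and s: "smooth_on (\<phi> ` A) (\<lambda>y. \<psi> (f (inv_into U \<phi> y)))"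
    using f unfolding smooth_near_def by auto
  let ?g = "\<lambda>y. \<psi> (f (inv_into U \<phi> y))"
  have oV: "open (\<psi> ` (V \<inter> W))" using chart_openin[OF d] W by (intro chart_open_image[OF d]) auto
  have oA: "open (\<phi> ` A)" by (rule chart_open_image[OF c A(1,3)])
  have "open (?g -` (\<psi> ` (V \<inter> W)) \<inter> \<phi> ` A)"
    using continuous_on_open_vimage[OF oA] smooth_on_continuous_on[OF s] oV by blast
  from chart_open_vimage[OF c this]
  have "openin (mtop X) ({z \<in> U. \<phi> z \<in> ?g -` (\<psi> ` (V \<inter> W)) \<inter> \<phi> ` A} \<inter> A)" using A(1) by auto
  moreover have "x \<in> {z \<in> U. \<phi> z \<in> ?g -` (\<psi> ` (V \<inter> W)) \<inter> \<phi> ` A} \<inter> A"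
    using A W by (auto simp: chart_inv[OF c] subset_iff image_subset_iff)
  moreover have "f ` ({z \<in> U. \<phi> z \<in> ?g -` (\<psi> ` (V \<inter> W)) \<inter> \<phi> ` A} \<inter> A) \<subseteq> W"
  proof (rule image_subsetI)
    fix z assume z: "z \<in> {z \<in> U. \<phi> z \<in> ?g -` (\<psi> ` (V \<inter> W)) \<inter> \<phi> ` A} \<inter> A"
    then have "inv_into U \<phi> (\<phi> z) = z" "z \<in> A" using chart_inv[OF c] by auto
    moreover have "?g (\<phi> z) \<in> \<psi> ` (V \<inter> W)" using z by blast
    ultimately obtain w where "w \<in> V" "w \<in> W" "\<psi> (f z) = \<psi> w" by auto
    moreover have "f z \<in> V" using A z by auto
    ultimately show "f z \<in> W" using chart_inj[OF d] by (metis inj_onD)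
  qed
  ultimately show ?thesis by (rule that)
qed

text \<open>Independence of the charts: the new representation is the old one between two transition
  maps, on a set \<open>B\<close> so small that all three are defined.\<close>

lemma smooth_near_chart:
  fixes X :: "('p, 'a::real_normed_vector) manifold" and Y :: "('q, 'b::real_normed_vector) manifold"
  assumes X: "premanifold X" and Y: "premanifold Y" and f: "smooth_near X Y f x"
    and c': "(U', \<phi>') \<in> charts X" "x \<in> U'" and d': "(V', \<psi>') \<in> charts Y" "f x \<in> V'"
  obtains A where "openin (mtop X) A" "x \<in> A" "A \<subseteq> U'" "f ` A \<subseteq> V'"
    "smooth_on (\<phi>' ` A) (\<lambda>y. \<psi>' (f (inv_into U' \<phi>' y)))"
proof -
  obtain U \<phi> V \<psi> A where c: "(U, \<phi>) \<in> charts X" and d: "(V, \<psi>) \<in> charts Y"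
    and A: "openin (mtop X) A" "x \<in> A" "A \<subseteq> U" "f ` A \<subseteq> V"
    and s: "smooth_on (\<phi> ` A) (\<lambda>y. \<psi> (f (inv_into U \<phi> y)))"
    using f unfolding smooth_near_def by auto
  have "openin (mtop Y) (V \<inter> V')" "f x \<in> V \<inter> V'"
    using chart_openin d d' A by auto
  then obtain A1 where A1: "openin (mtop X) A1" "x \<in> A1" "f ` A1 \<subseteq> V \<inter> V'"
    using smooth_near_open_vimage[OF f] by blast
  define B where "B = A \<inter> A1 \<inter> U'"
  have B: "openin (mtop X) B" "x \<in> B" "B \<subseteq> U" "B \<subseteq> U'" "f ` B \<subseteq> V \<inter> V'" "B \<subseteq> A"
    using A A1 c' chart_openin[OF c'(1)] by (auto simp: B_def)
  have oV: "open (\<psi> ` (V \<inter> V'))"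
    using chart_openin d d' by (intro chart_open_image[OF d]) auto
  have oB: "open (\<phi> ` B)" "open (\<phi>' ` B)"
    using chart_open_image[OF c B(1)] chart_open_image[OF c'(1) B(1)] B by auto
  have fd: "fin_dim TYPE('a)" "fin_dim TYPE('b)" using X Y by (auto simp: premanifold_def)
  have s1: "smooth_on (\<phi>' ` B) (\<lambda>y. \<phi> (inv_into U' \<phi>' y))"
    by (rule smooth_on_subset[OF charts_compatible[OF X c'(1) c]]) (use B in auto)
  have s2: "smooth_on (\<psi> ` (V \<inter> V')) (\<lambda>y. \<psi>' (inv_into V \<psi> y))"
    by (rule charts_compatible[OF Y d d'(1)])
  have s3: "smooth_on (\<phi> ` B) (\<lambda>y. \<psi> (f (inv_into U \<phi> y)))"
    by (rule smooth_on_subset[OF s]) (use B in auto)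
  have s4: "smooth_on (\<phi>' ` B) (\<lambda>y. \<psi> (f (inv_into U \<phi> (\<phi> (inv_into U' \<phi>' y)))))"
    by (rule smooth_on_compose[OF fd(1) oB(2,1) s1 s3])
       (use B in \<open>auto simp: chart_inv[OF c'(1)] subset_iff\<close>)
  have "smooth_on (\<phi>' ` B) (\<lambda>y. \<psi>' (inv_into V \<psi> (\<psi> (f (inv_into U \<phi> (\<phi> (inv_into U' \<phi>' y)))))))"
    by (rule smooth_on_compose[OF fd(2) oB(2) oV s4 s2])
       (use B in \<open>auto simp: chart_inv[OF c'(1)] chart_inv[OF c] subset_iff image_subset_iff\<close>)
  then have "smooth_on (\<phi>' ` B) (\<lambda>y. \<psi>' (f (inv_into U' \<phi>' y)))"
    by (rule smooth_on_congI[OF _ oB(2)])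
       (use B in \<open>auto simp: chart_inv[OF c'(1)] chart_inv[OF c] chart_inv[OF d] subset_iff image_subset_iff\<close>)
  then show ?thesis using that[of B] B by blast
qed

lemma smooth_near_chart_rep:
  assumes X: "premanifold X" and Y: "premanifold Y" and c: "(U, \<phi>) \<in> charts X" and d: "(V, \<psi>) \<in> charts Y"
    and "A \<subseteq> U" "f ` A \<subseteq> V" "\<And>x. x \<in> A \<Longrightarrow> smooth_near X Y f x"
  shows "smooth_on (\<phi> ` A) (\<lambda>y. \<psi> (f (inv_into U \<phi> y)))"
proof (rule smooth_on_locallyI)
  fix y assume "y \<in> \<phi> ` A"
  then obtain x where x: "x \<in> A" "y = \<phi> x" by auto
  then have "x \<in> U" "f x \<in> V" "smooth_near X Y f x" using assms by auto
  from smooth_near_chart[OF X Y this(3) c this(1) d this(2)]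
  obtain B where "openin (mtop X) B" "x \<in> B" "B \<subseteq> U" "f ` B \<subseteq> V"
    "smooth_on (\<phi> ` B) (\<lambda>y. \<psi> (f (inv_into U \<phi> y)))" by blast
  moreover have "y \<in> \<phi> ` B" using x \<open>x \<in> B\<close> by simp
  ultimately show "\<exists>T. y \<in> T \<and> smooth_on T (\<lambda>y. \<psi> (f (inv_into U \<phi> y)))" by (intro exI conjI)
qed

lemma openin_smooth_vimage:
  assumes "openin (mtop X) A" "\<And>x. x \<in> A \<Longrightarrow> smooth_near X Y f x" "openin (mtop Y) W"
  shows "openin (mtop X) {x \<in> A. f x \<in> W}"
proof (subst openin_subopen, clarify)
  fix x assume x: "x \<in> A" "f x \<in> W"
  obtain B where "openin (mtop X) B" "x \<in> B" "f ` B \<subseteq> W"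
    using smooth_near_open_vimage[OF assms(2)[OF x(1)] assms(3) x(2)] .
  then show "\<exists>T. openin (mtop X) T \<and> x \<in> T \<and> T \<subseteq> {x \<in> A. f x \<in> W}"
    using x assms(1) by (intro exI[of _ "A \<inter> B"]) auto
qed

lemma smooth_near_continuous_map:
  assumes "\<And>x. x \<in> mpoints X \<Longrightarrow> smooth_near X Y f x"
  shows "continuous_map (mtop X) (mtop Y) f"
  unfolding continuous_map_def
  using assms openin_smooth_vimage[of X "mpoints X" Y f] by (auto intro: smooth_near_in_space(2))

text \<open>The bridge from the definition over whole atlases to the pointwise notion, in which the
  later smoothness proofs are carried out.\<close>

lemma smooth_map_iff:
  assumes X: "premanifold X" and Y: "premanifold Y"
  shows "smooth_map X Y f \<longleftrightarrow> (\<forall>x\<in>mpoints X. smooth_near X Y f x)"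
proof
  assume f: "smooth_map X Y f"
  show "\<forall>x\<in>mpoints X. smooth_near X Y f x"
  proof
    fix x assume x: "x \<in> mpoints X"
    then have "f x \<in> mpoints Y" using f continuous_map_image_subset_topspace
      unfolding smooth_map_def by blast
    then obtain V \<psi> where d: "(V, \<psi>) \<in> atlas Y" "(V, \<psi>) \<in> charts Y" "f x \<in> V"
      using atlas_cover[OF Y] by blast
    obtain U \<phi> where c: "(U, \<phi>) \<in> atlas X" "(U, \<phi>) \<in> charts X" "x \<in> U"
      using atlas_cover[OF X x] .
    let ?A = "{z \<in> U. f z \<in> V}"
    have "openin (mtop X) {z \<in> mpoints X. f z \<in> V}"
      using f unfolding smooth_map_def
      by (intro openin_continuous_map_preimage[OF _ chart_openin[OF d(2)]]) simp
    then have "openin (mtop X) (U \<inter> {z \<in> mpoints X. f z \<in> V})"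
      by (rule openin_Int[OF chart_openin[OF c(2)]])
    moreover have "U \<inter> {z \<in> mpoints X. f z \<in> V} = ?A" using chart_subset[OF c(2)] by auto
    ultimately have "openin (mtop X) ?A" by simp
    moreover have "smooth_on (\<phi> ` ?A) (\<lambda>y. \<psi> (f (inv_into U \<phi> y)))"
    proof -
      have "\<forall>(U, \<phi>)\<in>atlas X. \<forall>(V, \<psi>)\<in>atlas Y. smooth_on (\<phi> ` {x\<in>U. f x \<in> V}) (\<psi> \<circ> f \<circ> inv_into U \<phi>)"
        using f by (simp add: smooth_map_def)
      from bspec[OF this c(1)] d(1) show ?thesis by (auto simp: o_def)
    qed
    ultimately show "smooth_near X Y f x"
      using c d by (intro smooth_nearI[OF c(2) d(2)]) auto
  qed
next
  assume f: "\<forall>x\<in>mpoints X. smooth_near X Y f x"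
  have "smooth_on (\<phi> ` {x\<in>U. f x \<in> V}) (\<psi> \<circ> f \<circ> inv_into U \<phi>)"
    if "(U, \<phi>) \<in> atlas X" "(V, \<psi>) \<in> atlas Y" for U \<phi> V \<psi>
    using smooth_near_chart_rep[OF X Y, of U \<phi> V \<psi> "{x\<in>U. f x \<in> V}" f]
      atlas_charts[OF X that(1)] atlas_charts[OF Y that(2)] f chart_subset[of U \<phi> X]
    by (auto simp: o_def)
  moreover have "continuous_map (mtop X) (mtop Y) f"
    by (rule smooth_near_continuous_map) (use f in auto)
  ultimately show "smooth_map X Y f" unfolding smooth_map_def by auto
qed

lemma smooth_near_cong:
  assumes "smooth_near X Y f x" "openin (mtop X) A" "x \<in> A" "\<And>z. z \<in> A \<Longrightarrow> f z = g z"
  shows "smooth_near X Y g x"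
proof -
  obtain U \<phi> V \<psi> B where c: "(U, \<phi>) \<in> charts X" and d: "(V, \<psi>) \<in> charts Y"
    and B: "openin (mtop X) B" "x \<in> B" "B \<subseteq> U" "f ` B \<subseteq> V"
    and s: "smooth_on (\<phi> ` B) (\<lambda>y. \<psi> (f (inv_into U \<phi> y)))"
    using assms(1) unfolding smooth_near_def by auto
  have o: "openin (mtop X) (A \<inter> B)" using assms B by blast
  have "smooth_on (\<phi> ` (A \<inter> B)) (\<lambda>y. \<psi> (f (inv_into U \<phi> y)))"
    by (rule smooth_on_subset[OF s]) auto
  then have "smooth_on (\<phi> ` (A \<inter> B)) (\<lambda>y. \<psi> (g (inv_into U \<phi> y)))"
    by (rule smooth_on_congI)
       (use B assms(4) chart_open_image[OF c o] in \<open>auto simp: chart_inv[OF c] subset_iff\<close>)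
  moreover have "g ` (A \<inter> B) \<subseteq> V" using B assms(4) by force
  ultimately show ?thesis using B assms(3) by (intro smooth_nearI[OF c d o]) auto
qed

lemma smooth_near_compose:
  assumes X: "premanifold X" and Y: "premanifold Y" and Z: "premanifold Z"
    and f: "smooth_near X Y f x" and g: "smooth_near Y Z g (f x)"
  shows "smooth_near X Z (\<lambda>x. g (f x)) x"
proof -
  obtain V \<psi> W \<zeta> B where d: "(V, \<psi>) \<in> charts Y" and e: "(W, \<zeta>) \<in> charts Z"
    and B: "openin (mtop Y) B" "f x \<in> B" "B \<subseteq> V" "g ` B \<subseteq> W"
    and s: "smooth_on (\<psi> ` B) (\<lambda>y. \<zeta> (g (inv_into V \<psi> y)))"
    using g unfolding smooth_near_def by auto
  obtain U \<phi> where c: "(U, \<phi>) \<in> charts X" "x \<in> U"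
    using atlas_cover[OF X smooth_near_in_space(1)[OF f]] by metis
  \<comment> \<open>Shrinking the middle chart keeps the image under \<open>f\<close> where the
    representation of \<open>g\<close> is smooth.\<close>
  have d': "(V \<inter> B, \<psi>) \<in> charts Y" by (rule charts_restrict[OF Y d B(1)])
  have "f x \<in> V \<inter> B" using B by auto
  from smooth_near_chart[OF X Y f c d' this]
  obtain A where A: "openin (mtop X) A" "x \<in> A" "A \<subseteq> U" "f ` A \<subseteq> V \<inter> B"
    and t: "smooth_on (\<phi> ` A) (\<lambda>y. \<psi> (f (inv_into U \<phi> y)))" by blast
  have op: "open (\<phi> ` A)" "open (\<psi> ` B)"
    using chart_open_image[OF c(1) A(1,3)] chart_open_image[OF d B(1,3)] by auto
  have "smooth_on (\<phi> ` A) (\<lambda>y. \<zeta> (g (inv_into V \<psi> (\<psi> (f (inv_into U \<phi> y))))))"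
    by (rule smooth_on_compose[OF _ op t s])
       (use A Y in \<open>auto simp: premanifold_def chart_inv[OF c(1)] subset_iff\<close>)
  then have "smooth_on (\<phi> ` A) (\<lambda>y. \<zeta> (g (f (inv_into U \<phi> y))))"
    by (rule smooth_on_congI[OF _ op(1)])
       (use A in \<open>auto simp: chart_inv[OF c(1)] chart_inv[OF d] subset_iff\<close>)
  then show ?thesis
    by (intro smooth_nearI[OF c(1) e A(1-3)]) (use A B in \<open>auto simp: image_subset_iff subset_iff\<close>)
qed

lemma smooth_near_ident:
  assumes "premanifold X" "x \<in> mpoints X"
  shows "smooth_near X X (\<lambda>x. x) x"
proof -
  obtain U \<phi> where c: "(U, \<phi>) \<in> charts X" "x \<in> U"
    using atlas_cover[OF assms] by metis
  have "smooth_on (\<phi> ` U) (\<lambda>y. \<phi> (inv_into U \<phi> y))"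
    using charts_compatible[OF assms(1) c(1) c(1)] by simp
  then show ?thesis
    by (intro smooth_nearI[OF c(1) c(1) chart_openin[OF c(1)]]) (use c in auto)
qed

lemma smooth_near_const:
  assumes "premanifold X" "premanifold Y" "x \<in> mpoints X" "a \<in> mpoints Y"
  shows "smooth_near X Y (\<lambda>_. a) x"
proof -
  obtain U \<phi> where c: "(U, \<phi>) \<in> charts X" "x \<in> U"
    using atlas_cover[OF assms(1,3)] by metis
  obtain V \<psi> where d: "(V, \<psi>) \<in> charts Y" "a \<in> V"
    using atlas_cover[OF assms(2,4)] by metis
  show ?thesis
    by (intro smooth_nearI[OF c(1) d(1) chart_openin[OF c(1)]]) (use c d in \<open>auto intro: smooth_on_const\<close>)
qed

section \<open>Model spaces, open submanifolds and products\<close>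

lemma premanifold_model:
  assumes "fin_dim TYPE('a::real_normed_vector)"
  shows "premanifold (model_mfd :: ('a, 'a) manifold)"
proof -
  have "is_chart euclidean (UNIV, id :: 'a \<Rightarrow> 'a)" by (rule is_chartI) auto
  moreover have "smooth_on UNIV (id :: 'a \<Rightarrow> 'a)" using smooth_on_ident[of UNIV] by (simp add: id_def)
  ultimately show ?thesis using assms
    by (auto simp: premanifold_def model_mfd_def compatible_charts_def inv_id id_def[symmetric])
qed

lemma model_chart: "(UNIV, id) \<in> charts (model_mfd :: ('a::real_normed_vector, 'a) manifold)"
proof -
  have "is_chart euclidean (UNIV, id :: 'a \<Rightarrow> 'a)" by (rule is_chartI) auto
  moreover have "smooth_on UNIV (id :: 'a \<Rightarrow> 'a)" using smooth_on_ident[of UNIV] by (simp add: id_def)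
  ultimately show ?thesis
    by (auto simp: charts_def model_mfd_def compatible_charts_def inv_id id_def[symmetric])
qed

lemma smooth_near_model_modelI:
  assumes "open A" "x \<in> A" "smooth_on A f"
  shows "smooth_near model_mfd model_mfd f x"
  by (rule smooth_nearI[OF model_chart model_chart, of A])
     (use assms in \<open>auto simp: model_mfd_def inv_id\<close>)

lemma smooth_near_modelI:
  assumes "(U, \<phi>) \<in> charts X" "openin (mtop X) A" "x \<in> A" "A \<subseteq> U"
    "smooth_on (\<phi> ` A) (\<lambda>y. f (inv_into U \<phi> y))"
  shows "smooth_near X model_mfd f x"
  by (rule smooth_nearI[OF assms(1) model_chart assms(2-4)]) (use assms(5) in auto)

lemma open_submfd_simps [simp]:
  "mtop (open_submfd X W) = subtopology (mtop X) W"
  "atlas (open_submfd X W) = {(U \<inter> W, \<phi>) | U \<phi>. (U, \<phi>) \<in> atlas X}"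
  by (auto simp: open_submfd_def)

lemma is_chart_subtopology:
  assumes "openin T W"
  shows "is_chart (subtopology T W) (U, \<phi>) \<longleftrightarrow> is_chart T (U, \<phi>) \<and> U \<subseteq> W"
  using assms by (auto simp: is_chart_def openin_open_subtopology subtopology_subtopology Int_absorb1)

lemma premanifold_open_submfd:
  assumes X: "premanifold X" and W: "openin (mtop X) W"
  shows "premanifold (open_submfd X W)"
proof -
  have r: "(U \<inter> W, \<phi>) \<in> charts X" if "(U, \<phi>) \<in> atlas X" for U \<phi>
    using charts_restrict[OF X atlas_charts[OF X that] W] .
  have "compatible_charts (U \<inter> W, \<phi>) (V \<inter> W, \<psi>)" if "(U, \<phi>) \<in> atlas X" "(V, \<psi>) \<in> atlas X" for U \<phi> V \<psi>
    using charts_compatible[OF X r[OF that(1)] r[OF that(2)]] charts_compatible[OF X r[OF that(2)] r[OF that(1)]]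
    by (auto simp: compatible_charts_def o_def Int_ac)
  moreover have "is_chart (subtopology (mtop X) W) (U \<inter> W, \<phi>)" if "(U, \<phi>) \<in> atlas X" for U \<phi>
    using chart_is_chart[OF r[OF that]] is_chart_subtopology[OF W] by auto
  moreover have "(\<Union>c\<in>atlas (open_submfd X W). fst c) = W"
  proof -
    have "atlas (open_submfd X W) = (\<lambda>c. (fst c \<inter> W, snd c)) ` atlas X" by force
    then have "(\<Union>c\<in>atlas (open_submfd X W). fst c) = (\<Union>c\<in>atlas X. fst c) \<inter> W" by auto
    then show ?thesis using X openin_subset[OF W] by (auto simp: premanifold_def)
  qed
  ultimately show ?thesis using X openin_subset[OF W]
    by (auto simp: premanifold_def)
qed

text \<open>A chart is tested against restricted atlas charts on one side and full ones on the
  other, and a domain inside \<open>W\<close> cannot tell them apart. Smoothness can then be moved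
  between an open submanifold and the whole.\<close>

lemma open_submfd_charts:
  assumes X: "premanifold X" and W: "openin (mtop X) W"
  shows "c \<in> charts (open_submfd X W) \<longleftrightarrow> c \<in> charts X \<and> fst c \<subseteq> W"
proof -
  obtain U \<phi> where c: "c = (U, \<phi>)" by (cases c)
  have eq: "compatible_charts (U, \<phi>) (V \<inter> W, \<psi>) \<longleftrightarrow> compatible_charts (U, \<phi>) (V, \<psi>)"
    if i: "is_chart (mtop X) (U, \<phi>)" "U \<subseteq> W" and V: "(V, \<psi>) \<in> atlas X" for V \<psi>
  proof -
    have d: "(V, \<psi>) \<in> charts X" and e: "(V \<inter> W, \<psi>) \<in> charts X"
      using charts_restrict[OF X _ W] atlas_charts[OF X V] by auto
    have "open (\<psi> ` (U \<inter> V))"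
      by (rule chart_open_image[OF d]) (use is_chart_openin[OF i(1)] chart_openin[OF d] in auto)
    moreover have "inv_into (V \<inter> W) \<psi> y = inv_into V \<psi> y" if "y \<in> \<psi> ` (U \<inter> V)" for y
      using that chart_inv[OF d] chart_inv[OF e] i(2) by auto
    ultimately have "smooth_on (\<psi> ` (U \<inter> V)) (\<phi> \<circ> inv_into (V \<inter> W) \<psi>) \<longleftrightarrow> smooth_on (\<psi> ` (U \<inter> V)) (\<phi> \<circ> inv_into V \<psi>)"
      by (intro smooth_on_cong) auto
    moreover have "U \<inter> (V \<inter> W) = U \<inter> V" using i(2) by blast
    ultimately show ?thesis by (simp add: compatible_charts_def)
  qed
  show ?thesis
  proof (cases "is_chart (mtop X) (U, \<phi>) \<and> U \<subseteq> W")
    case True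
    have "(\<forall>d\<in>atlas (open_submfd X W). compatible_charts (U, \<phi>) d) \<longleftrightarrow>
       (\<forall>(V, \<psi>)\<in>atlas X. compatible_charts (U, \<phi>) (V \<inter> W, \<psi>))" by auto
    also have "\<dots> \<longleftrightarrow> (\<forall>d\<in>atlas X. compatible_charts (U, \<phi>) d)" using eq True by auto
    finally show ?thesis
      unfolding charts_def c using is_chart_subtopology[OF W, of U \<phi>] True by simp
  next
    case False
    then show ?thesis unfolding charts_def c using is_chart_subtopology[OF W, of U \<phi>] by auto
  qed
qed

lemma smooth_near_open_submfd_dom:
  assumes X: "premanifold X" and Y: "premanifold Y" and W: "openin (mtop X) W"
  shows "smooth_near (open_submfd X W) Y f x \<longleftrightarrow> x \<in> W \<and> smooth_near X Y f x"
proof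
  assume L: "smooth_near (open_submfd X W) Y f x"
  then have x: "x \<in> W" using smooth_near_in_space(1)[OF L] by auto
  obtain U \<phi> V \<psi> A where c: "(U, \<phi>) \<in> charts (open_submfd X W)" and d: "(V, \<psi>) \<in> charts Y"
    and A: "openin (subtopology (mtop X) W) A" "x \<in> A" "A \<subseteq> U" "f ` A \<subseteq> V"
    "smooth_on (\<phi> ` A) (\<lambda>y. \<psi> (f (inv_into U \<phi> y)))"
    using L unfolding smooth_near_def by auto
  have "(U, \<phi>) \<in> charts X" "openin (mtop X) A"
    using c A open_submfd_charts[OF X W] openin_open_subtopology[OF W] by auto
  from smooth_nearI[OF this(1) d this(2) A(2-5)]
  show "x \<in> W \<and> smooth_near X Y f x" using x by blast
next
  assume R: "x \<in> W \<and> smooth_near X Y f x"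
  obtain U \<phi> where c: "(U, \<phi>) \<in> charts X" "x \<in> U"
    using atlas_cover[OF X smooth_near_in_space(1)] R by metis
  obtain V \<psi> where d: "(V, \<psi>) \<in> charts Y" "f x \<in> V"
    using atlas_cover[OF Y smooth_near_in_space(2)] R by metis
  have e: "(U \<inter> W, \<phi>) \<in> charts X" by (rule charts_restrict[OF X c(1) W])
  obtain A where A: "openin (mtop X) A" "x \<in> A" "A \<subseteq> U \<inter> W" "f ` A \<subseteq> V"
    "smooth_on (\<phi> ` A) (\<lambda>y. \<psi> (f (inv_into (U \<inter> W) \<phi> y)))"
    using smooth_near_chart[OF X Y conjunct2[OF R] e IntI[OF c(2) conjunct1[OF R]] d] by blast
  have "(U \<inter> W, \<phi>) \<in> charts (open_submfd X W)" using e open_submfd_charts[OF X W] by auto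
  moreover have "openin (mtop (open_submfd X W)) A" using A(1,3) openin_open_subtopology[OF W] by auto
  ultimately show "smooth_near (open_submfd X W) Y f x" using smooth_nearI[OF _ d(1) _ A(2-5)] by blast
qed

lemma smooth_near_open_submfd_cod:
  assumes X: "premanifold X" and Y: "premanifold Y" and W: "openin (mtop Y) W"
  shows "smooth_near X (open_submfd Y W) f x \<longleftrightarrow> f x \<in> W \<and> smooth_near X Y f x"
proof
  assume L: "smooth_near X (open_submfd Y W) f x"
  then have "f x \<in> W" using smooth_near_in_space(2)[OF L] by auto
  obtain U \<phi> V \<psi> A where c: "(U, \<phi>) \<in> charts X" and d: "(V, \<psi>) \<in> charts (open_submfd Y W)"
    and A: "openin (mtop X) A" "x \<in> A" "A \<subseteq> U" "f ` A \<subseteq> V"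
    "smooth_on (\<phi> ` A) (\<lambda>y. \<psi> (f (inv_into U \<phi> y)))"
    using L unfolding smooth_near_def by auto
  have "(V, \<psi>) \<in> charts Y" using d open_submfd_charts[OF Y W] by auto
  from smooth_nearI[OF c this A]
  show "f x \<in> W \<and> smooth_near X Y f x" using \<open>f x \<in> W\<close> by blast
next
  assume R: "f x \<in> W \<and> smooth_near X Y f x"
  obtain U \<phi> where c: "(U, \<phi>) \<in> charts X" "x \<in> U"
    using atlas_cover[OF X smooth_near_in_space(1)] R by metis
  obtain V \<psi> where d: "(V, \<psi>) \<in> charts Y" "f x \<in> V"
    using atlas_cover[OF Y smooth_near_in_space(2)] R by metis
  have e: "(V \<inter> W, \<psi>) \<in> charts Y" by (rule charts_restrict[OF Y d(1) W])
  then have e': "(V \<inter> W, \<psi>) \<in> charts (open_submfd Y W)" using open_submfd_charts[OF Y W] by auto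
  obtain A where A: "openin (mtop X) A" "x \<in> A" "A \<subseteq> U" "f ` A \<subseteq> V \<inter> W"
    "smooth_on (\<phi> ` A) (\<lambda>y. \<psi> (f (inv_into U \<phi> y)))"
    using smooth_near_chart[OF X Y conjunct2[OF R] c e IntI[OF d(2) conjunct1[OF R]]] by blast
  show "smooth_near X (open_submfd Y W) f x" by (rule smooth_nearI[OF c(1) e' A])
qed

lemma prod_mfd_simps [simp]:
  "mtop (prod_mfd X Y) = prod_topology (mtop X) (mtop Y)"
  "atlas (prod_mfd X Y) = {(U \<times> V, map_prod \<phi> \<psi>) | U \<phi> V \<psi>. (U, \<phi>) \<in> atlas X \<and> (V, \<psi>) \<in> atlas Y}"
  by (auto simp: prod_mfd_def)

lemma inv_into_map_prod:
  assumes "inj_on \<phi> U" "inj_on \<psi> V" "x \<in> U" "y \<in> V"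
  shows "inv_into (U \<times> V) (map_prod \<phi> \<psi>) (\<phi> x, \<psi> y) = (x, y)"
  using inv_into_f_f[OF map_prod_inj_on[OF assms(1,2)], of "(x, y)"] assms by simp

text \<open>Every open set of a product contains an open box around each of its points, so openness
  of images and preimages is checked on boxes; transitions are computed componentwise.\<close>

lemma premanifold_prod:
  fixes X :: "('p, 'a::real_normed_vector) manifold" and Y :: "('q, 'b::real_normed_vector) manifold"
  assumes X: "premanifold X" and Y: "premanifold Y"
  shows "premanifold (prod_mfd X Y)"
proof -
  have ch: "is_chart (prod_topology (mtop X) (mtop Y)) (U \<times> V, map_prod \<phi> \<psi>)"
    if c: "(U, \<phi>) \<in> charts X" and d: "(V, \<psi>) \<in> charts Y" for U \<phi> V \<psi>
  proof (rule is_chartI)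
    show "openin (prod_topology (mtop X) (mtop Y)) (U \<times> V)"
      using chart_openin[OF c] chart_openin[OF d] by (simp add: openin_prod_Times_iff)
    show "inj_on (map_prod \<phi> \<psi>) (U \<times> V)"
      using chart_inj[OF c] chart_inj[OF d] by (rule map_prod_inj_on)
  next
    fix A assume A: "openin (prod_topology (mtop X) (mtop Y)) A" "A \<subseteq> U \<times> V"
    show "open (map_prod \<phi> \<psi> ` A)"
    proof (rule open_subopen[THEN iffD2], rule ballI)
      fix p assume "p \<in> map_prod \<phi> \<psi> ` A"
      then obtain a b where ab: "(a, b) \<in> A" and p: "p = (\<phi> a, \<psi> b)" by auto
      from A(1)[unfolded openin_prod_topology_alt, rule_format, OF ab(1)]
      obtain O1 O2 where O: "openin (mtop X) O1" "openin (mtop Y) O2" "a \<in> O1" "b \<in> O2" "O1 \<times> O2 \<subseteq> A"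
        by (elim exE conjE)
      have "O1 \<subseteq> U" "O2 \<subseteq> V" using O A(2) by blast+
      then have "open (\<phi> ` O1)" "open (\<psi> ` O2)"
        using chart_open_image[OF c O(1)] chart_open_image[OF d O(2)] by auto
      then have "open (\<phi> ` O1 \<times> \<psi> ` O2)" by (rule open_Times)
      moreover have "\<phi> ` O1 \<times> \<psi> ` O2 = map_prod \<phi> \<psi> ` (O1 \<times> O2)" by (auto simp: map_prod_surj_on)
      moreover have "map_prod \<phi> \<psi> ` (O1 \<times> O2) \<subseteq> map_prod \<phi> \<psi> ` A" using O(5) by (rule image_mono)
      ultimately show "\<exists>T. open T \<and> p \<in> T \<and> T \<subseteq> map_prod \<phi> \<psi> ` A"
        using O(3,4) p by (intro exI[of _ "\<phi> ` O1 \<times> \<psi> ` O2"]) auto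
    qed
  next
    fix D :: "('a \<times> 'b) set" assume D: "open D"
    show "openin (prod_topology (mtop X) (mtop Y)) {x \<in> U \<times> V. map_prod \<phi> \<psi> x \<in> D}"
      unfolding openin_prod_topology_alt
    proof (intro allI impI)
      fix a b assume "(a, b) \<in> {x \<in> U \<times> V. map_prod \<phi> \<psi> x \<in> D}"
      then have ab: "a \<in> U" "b \<in> V" "(\<phi> a, \<psi> b) \<in> D" by auto
      obtain A B where AB: "open A" "open B" "(\<phi> a, \<psi> b) \<in> A \<times> B" "A \<times> B \<subseteq> D"
        by (rule open_prod_elim[OF D ab(3)])
      show "\<exists>W Z. openin (mtop X) W \<and> openin (mtop Y) Z \<and> a \<in> W \<and> b \<in> Z \<and>
          W \<times> Z \<subseteq> {x \<in> U \<times> V. map_prod \<phi> \<psi> x \<in> D}"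
        using chart_open_vimage[OF c AB(1)] chart_open_vimage[OF d AB(2)] ab AB(3,4)
        by (intro exI[of _ "{x \<in> U. \<phi> x \<in> A}"] exI[of _ "{x \<in> V. \<psi> x \<in> B}"] conjI) auto
    qed
  qed
  have cp: "smooth_on (map_prod \<phi> \<psi> ` ((U \<times> V) \<inter> (U' \<times> V'))) (map_prod \<phi>' \<psi>' \<circ> inv_into (U \<times> V) (map_prod \<phi> \<psi>))"
    if c: "(U, \<phi>) \<in> charts X" "(U', \<phi>') \<in> charts X" and d: "(V, \<psi>) \<in> charts Y" "(V', \<psi>') \<in> charts Y"
    for U \<phi> V \<psi> U' \<phi>' V' \<psi>'
  proof -
    let ?S = "\<phi> ` (U \<inter> U')" and ?T = "\<psi> ` (V \<inter> V')"
    have o: "open ?S" "open ?T"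
      using chart_openin[OF c(1)] chart_openin[OF c(2)] chart_openin[OF d(1)] chart_openin[OF d(2)]
      by (auto intro!: chart_open_image[OF c(1)] chart_open_image[OF d(1)])
    have eq: "map_prod \<phi> \<psi> ` ((U \<times> V) \<inter> (U' \<times> V')) = ?S \<times> ?T"
      by (simp add: Times_Int_Times map_prod_surj_on)
    have fd: "fin_dim TYPE('a)" "fin_dim TYPE('b)" using X Y by (auto simp: premanifold_def)
    have "smooth_on (?S \<times> ?T) (\<lambda>p. (\<phi>' (inv_into U \<phi> (fst p)), \<psi>' (inv_into V \<psi> (snd p))))"
      by (intro smooth_on_Pair open_Times o
          smooth_on_compose[OF fd(1) _ o(1) _ charts_compatible[OF X c(1) c(2)]]
          smooth_on_compose[OF fd(2) _ o(2) _ charts_compatible[OF Y d(1) d(2)]]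
          smooth_on_fst smooth_on_snd smooth_on_ident) auto
    then show ?thesis unfolding eq
      by (rule smooth_on_congI)
         (auto intro: open_Times o simp: chart_inv[OF c(1)] chart_inv[OF d(1)]
            inv_into_map_prod[OF chart_inj[OF c(1)] chart_inj[OF d(1)]])
  qed
  have "compatible_charts a b" if "a \<in> atlas (prod_mfd X Y)" "b \<in> atlas (prod_mfd X Y)" for a b
  proof -
    obtain U \<phi> V \<psi> where a: "a = (U \<times> V, map_prod \<phi> \<psi>)" and "(U, \<phi>) \<in> atlas X" "(V, \<psi>) \<in> atlas Y"
      using \<open>a \<in> atlas (prod_mfd X Y)\<close> by auto
    then have ac: "(U, \<phi>) \<in> charts X" "(V, \<psi>) \<in> charts Y" using atlas_charts X Y by auto
    obtain U' \<phi>' V' \<psi>' where b: "b = (U' \<times> V', map_prod \<phi>' \<psi>')" and "(U', \<phi>') \<in> atlas X" "(V', \<psi>') \<in> atlas Y"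
      using \<open>b \<in> atlas (prod_mfd X Y)\<close> by auto
    then have bc: "(U', \<phi>') \<in> charts X" "(V', \<psi>') \<in> charts Y" using atlas_charts X Y by auto
    show ?thesis unfolding a b compatible_charts_def
      using cp[OF ac(1) bc(1) ac(2) bc(2)] cp[OF bc(1) ac(1) bc(2) ac(2)]
      by (simp add: Int_commute)
  qed
  moreover have "is_chart (mtop (prod_mfd X Y)) a" if "a \<in> atlas (prod_mfd X Y)" for a
    using that ch atlas_charts[OF X] atlas_charts[OF Y] by auto
  moreover have "(\<Union>c\<in>atlas (prod_mfd X Y). fst c) = mpoints (prod_mfd X Y)"
  proof -
    have "atlas (prod_mfd X Y) = (\<lambda>(c, d). (fst c \<times> fst d, map_prod (snd c) (snd d))) ` (atlas X \<times> atlas Y)"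
      by force
    then have "(\<Union>c\<in>atlas (prod_mfd X Y). fst c) = (\<Union>c\<in>atlas X. fst c) \<times> (\<Union>c\<in>atlas Y. fst c)"
      by auto
    then show ?thesis using X Y by (simp add: premanifold_def)
  qed
  moreover have "fin_dim TYPE('a \<times> 'b)"
    using X Y by (auto simp: premanifold_def intro: fin_dim_prod)
  ultimately show ?thesis unfolding premanifold_def by (intro conjI ballI)
qed

lemma prod_mfd_atlas_chart:
  assumes X: "premanifold X" and Y: "premanifold Y" and "(U, \<phi>) \<in> atlas X" "(V, \<psi>) \<in> atlas Y"
  shows "(U \<times> V, map_prod \<phi> \<psi>) \<in> charts (prod_mfd X Y)"
  by (rule atlas_charts[OF premanifold_prod[OF X Y]]) (use assms in auto)

lemma smooth_near_fst:
  assumes X: "premanifold X" and Y: "premanifold Y" and p: "p \<in> mpoints (prod_mfd X Y)"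
  shows "smooth_near (prod_mfd X Y) X fst p" "smooth_near (prod_mfd X Y) Y snd p"
proof -
  have p1: "fst p \<in> mpoints X" "snd p \<in> mpoints Y" using p by auto
  obtain U \<phi> where c: "(U, \<phi>) \<in> atlas X" "(U, \<phi>) \<in> charts X" "fst p \<in> U"
    by (rule atlas_cover[OF X p1(1)])
  obtain V \<psi> where d: "(V, \<psi>) \<in> atlas Y" "(V, \<psi>) \<in> charts Y" "snd p \<in> V"
    by (rule atlas_cover[OF Y p1(2)])
  note e = prod_mfd_atlas_chart[OF X Y c(1) d(1)]
  have eq: "map_prod \<phi> \<psi> ` (U \<times> V) = \<phi> ` U \<times> \<psi> ` V" by (simp add: map_prod_surj_on)
  have o: "open (\<phi> ` U \<times> \<psi> ` V)"
    using c(2) d(2) by (auto intro!: open_Times chart_open_image chart_openin)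
  note i = inv_into_map_prod[OF chart_inj[OF c(2)] chart_inj[OF d(2)]]
  have p': "p \<in> U \<times> V" using c d by (cases p) auto
  show "smooth_near (prod_mfd X Y) X fst p"
  proof (rule smooth_nearI[OF e c(2) chart_openin[OF e] p' order_refl], goal_cases)
    case 2
    have "smooth_on (\<phi> ` U \<times> \<psi> ` V) fst" using smooth_on_fst[OF o smooth_on_ident[OF o]] .
    then show ?case
      unfolding eq by (rule smooth_on_congI) (auto simp: o i)
  qed auto
  show "smooth_near (prod_mfd X Y) Y snd p"
  proof (rule smooth_nearI[OF e d(2) chart_openin[OF e] p' order_refl], goal_cases)
    case 2
    have "smooth_on (\<phi> ` U \<times> \<psi> ` V) snd" using smooth_on_snd[OF o smooth_on_ident[OF o]] .
    then show ?case
      unfolding eq by (rule smooth_on_congI) (auto simp: o i)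
  qed auto
qed

lemma smooth_near_Pair:
  assumes X: "premanifold X" and Y: "premanifold Y" and Z: "premanifold Z"
    and f: "smooth_near Z X f z" and g: "smooth_near Z Y g z"
  shows "smooth_near Z (prod_mfd X Y) (\<lambda>z. (f z, g z)) z"
proof -
  obtain U \<phi> where c: "(U, \<phi>) \<in> atlas X" "(U, \<phi>) \<in> charts X" "f z \<in> U"
    using atlas_cover[OF X smooth_near_in_space(2)[OF f]] .
  obtain V \<psi> where d: "(V, \<psi>) \<in> atlas Y" "(V, \<psi>) \<in> charts Y" "g z \<in> V"
    using atlas_cover[OF Y smooth_near_in_space(2)[OF g]] .
  obtain W \<zeta> where e: "(W, \<zeta>) \<in> charts Z" "z \<in> W"
    using atlas_cover[OF Z smooth_near_in_space(1)[OF f]] by blast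
  obtain A where A: "openin (mtop Z) A" "z \<in> A" "A \<subseteq> W" "f ` A \<subseteq> U"
    "smooth_on (\<zeta> ` A) (\<lambda>y. \<phi> (f (inv_into W \<zeta> y)))"
    using smooth_near_chart[OF Z X f e c(2,3)] by blast
  obtain B where B: "openin (mtop Z) B" "z \<in> B" "B \<subseteq> W" "g ` B \<subseteq> V"
    "smooth_on (\<zeta> ` B) (\<lambda>y. \<psi> (g (inv_into W \<zeta> y)))"
    using smooth_near_chart[OF Z Y g e d(2,3)] by blast
  have o: "openin (mtop Z) (A \<inter> B)" using A B by blast
  have "open (\<zeta> ` (A \<inter> B))" by (rule chart_open_image[OF e(1) o]) (use A in auto)
  then have "smooth_on (\<zeta> ` (A \<inter> B)) (\<lambda>y. (\<phi> (f (inv_into W \<zeta> y)), \<psi> (g (inv_into W \<zeta> y))))"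
    by (intro smooth_on_Pair smooth_on_subset[OF A(5)] smooth_on_subset[OF B(5)]) auto
  then show ?thesis
    by (intro smooth_nearI[OF e(1) prod_mfd_atlas_chart[OF X Y c(1) d(1)] o]) (use A B in auto)
qed

section \<open>Local diffeomorphisms\<close>

text \<open>The inverse \<open>r\<close> is carried along instead of being recovered by
  \<open>inv_into\<close>, so the relation is symmetric and restricts to smaller open sets with the
  same pair of maps.\<close>

definition diffeo_between ::
    "('p, 'a::real_normed_vector) manifold \<Rightarrow> ('q, 'b::real_normed_vector) manifold \<Rightarrow>
     'p set \<Rightarrow> 'q set \<Rightarrow> ('p \<Rightarrow> 'q) \<Rightarrow> ('q \<Rightarrow> 'p) \<Rightarrow> bool" where
  "diffeo_between X Y S T q r \<longleftrightarrow> openin (mtop X) S \<and> openin (mtop Y) T \<and> q ` S \<subseteq> T \<and> r ` T \<subseteq> S \<and>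
     (\<forall>x\<in>S. r (q x) = x) \<and> (\<forall>y\<in>T. q (r y) = y) \<and>
     (\<forall>x\<in>S. smooth_near X Y q x) \<and> (\<forall>y\<in>T. smooth_near Y X r y)"

lemma diffeo_between_sym: "diffeo_between X Y S T q r \<Longrightarrow> diffeo_between Y X T S r q"
  unfolding diffeo_between_def by blast

lemma diffeo_between_image:
  assumes "diffeo_between X Y S T q r" "A \<subseteq> S"
  shows "q ` A = {y \<in> T. r y \<in> A}"
  using assms unfolding diffeo_between_def by (auto simp: image_iff subset_iff) metis

lemma diffeo_between_open_image:
  assumes d: "diffeo_between X Y S T q r" and "openin (mtop X) A" "A \<subseteq> S"
  shows "openin (mtop Y) (q ` A)"
  unfolding diffeo_between_image[OF d assms(3)]
  using d assms by (intro openin_smooth_vimage[of Y T X r A]) (auto simp: diffeo_between_def)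

lemma diffeo_between_subset:
  assumes d: "diffeo_between X Y S T q r" and "openin (mtop X) A" "A \<subseteq> S"
  shows "diffeo_between X Y A (q ` A) q r"
  using d diffeo_between_open_image[OF assms] assms(2,3)
  unfolding diffeo_between_def by (auto simp: subset_iff image_subset_iff)

definition linear_iso_pair :: "('a::real_normed_vector \<Rightarrow> 'b::real_normed_vector) \<Rightarrow> ('b \<Rightarrow> 'a) \<Rightarrow> bool" where
  "linear_iso_pair L M \<longleftrightarrow> bounded_linear L \<and> bounded_linear M \<and> (\<forall>x. M (L x) = x) \<and> (\<forall>y. L (M y) = y)"

lemma linear_iso_pair_sym: "linear_iso_pair L M \<Longrightarrow> linear_iso_pair M L"
  by (auto simp: linear_iso_pair_def)

lemma linear_iso_pair_open_image:
  assumes "linear_iso_pair L M" "open A"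
  shows "open (L ` A)"
proof -
  have "L ` A = M -` A" using assms(1) unfolding linear_iso_pair_def by (auto simp: image_iff) metis
  moreover have "continuous_on UNIV M" using assms(1) by (simp add: linear_iso_pair_def linear_continuous_on)
  ultimately show ?thesis using assms(2) by (simp add: open_vimage)
qed

text \<open>Coordinate representations of \<open>q\<close> and \<open>r\<close> are inverse to each
  other, so by the chain rule their derivatives at corresponding points are too. This produces an
  isomorphism between the two model spaces.\<close>

lemma diffeo_between_linear_iso:
  fixes X :: "('p, 'a::real_normed_vector) manifold" and Y :: "('q, 'b::real_normed_vector) manifold"
  assumes X: "premanifold X" and Y: "premanifold Y" and fd: "diffeo_between X Y S T q r" and x: "x \<in> S"
  obtains L :: "'a \<Rightarrow> 'b" and M where "linear_iso_pair L M"
proof -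
  have qr: "\<And>x. x \<in> S \<Longrightarrow> r (q x) = x" "\<And>y. y \<in> T \<Longrightarrow> q (r y) = y" "q ` S \<subseteq> T" "r ` T \<subseteq> S"
    and sq: "\<And>x. x \<in> S \<Longrightarrow> smooth_near X Y q x" and sr: "\<And>y. y \<in> T \<Longrightarrow> smooth_near Y X r y"
    and oS: "openin (mtop X) S" and oT: "openin (mtop Y) T"
    using fd by (auto simp: diffeo_between_def)
  have "x \<in> mpoints X" "q x \<in> mpoints Y" using sq[OF x] smooth_near_in_space by metis+
  then obtain U \<phi> V \<psi> where c: "(U, \<phi>) \<in> charts X" "x \<in> U" and d: "(V, \<psi>) \<in> charts Y" "q x \<in> V"
    using atlas_cover[OF X] atlas_cover[OF Y] by metis
  define A where "A = {z \<in> U \<inter> S. q z \<in> V}"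
  have oA: "openin (mtop X) A" unfolding A_def
    by (rule openin_smooth_vimage[OF _ _ chart_openin[OF d(1)]]) (use chart_openin[OF c(1)] oS sq in auto)
  have AS: "A \<subseteq> S" "A \<subseteq> U" "q ` A \<subseteq> V" "x \<in> A" using c d x by (auto simp: A_def)
  have oqA: "openin (mtop Y) (q ` A)" by (rule diffeo_between_open_image[OF fd oA AS(1)])
  define f where "f = (\<lambda>y. \<psi> (q (inv_into U \<phi> y)))"
  define g where "g = (\<lambda>y. \<phi> (r (inv_into V \<psi> y)))"
  have sf: "smooth_on (\<phi> ` A) f" unfolding f_def
    by (rule smooth_near_chart_rep[OF X Y c(1) d(1)]) (use AS sq in auto)
  have sg: "smooth_on (\<psi> ` q ` A) g" unfolding g_def
    by (rule smooth_near_chart_rep[OF Y X d(1) c(1)]) (use AS sr qr in \<open>auto simp: subset_iff image_subset_iff\<close>)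
  have gf: "g (f y) = y" "f y \<in> \<psi> ` q ` A" if "y \<in> \<phi> ` A" for y
    using that AS qr by (auto simp: f_def g_def chart_inv[OF c(1)] chart_inv[OF d(1)] subset_iff image_subset_iff)
  have fg: "f (g y) = y" if "y \<in> \<psi> ` q ` A" for y
    using that AS qr by (auto simp: f_def g_def chart_inv[OF c(1)] chart_inv[OF d(1)] subset_iff image_subset_iff)
  have o: "open (\<phi> ` A)" "open (\<psi> ` q ` A)"
    by (rule chart_open_image[OF c(1) oA AS(2)], rule chart_open_image[OF d(1) oqA AS(3)])
  have x': "\<phi> x \<in> \<phi> ` A" using AS by auto
  define L where "L = frechet_derivative f (at (\<phi> x))"
  define M where "M = frechet_derivative g (at (f (\<phi> x)))"
  have L: "(f has_derivative L) (at (\<phi> x))"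
    unfolding L_def by (rule frechet_has_derivative[OF smooth_onD[OF sf] x'])
  have M: "(g has_derivative M) (at (f (\<phi> x)))"
    unfolding M_def by (rule frechet_has_derivative[OF smooth_onD[OF sg] gf(2)[OF x']])
  have "((\<lambda>y. g (f y)) has_derivative (\<lambda>v. M (L v))) (at (\<phi> x))"
    by (rule has_derivative_compose[OF L M])
  then have "((\<lambda>y. y) has_derivative (\<lambda>v. M (L v))) (at (\<phi> x))"
    by (rule has_derivative_transform_within_open[OF _ o(1) x']) (rule gf)
  then have comp1: "(\<lambda>v. M (L v)) = (\<lambda>v. v)" using has_derivative_unique has_derivative_ident by blast
  have L': "(f has_derivative L) (at (g (f (\<phi> x))))" using L gf(1)[OF x'] by simp
  have "((\<lambda>y. f (g y)) has_derivative (\<lambda>v. L (M v))) (at (f (\<phi> x)))"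
    by (rule has_derivative_compose[OF M L'])
  then have "((\<lambda>y. y) has_derivative (\<lambda>v. L (M v))) (at (f (\<phi> x)))"
    by (rule has_derivative_transform_within_open[OF _ o(2) gf(2)[OF x']]) (rule fg)
  then have comp2: "(\<lambda>v. L (M v)) = (\<lambda>v. v)" using has_derivative_unique has_derivative_ident by blast
  have "linear_iso_pair L M" unfolding linear_iso_pair_def
    using has_derivative_bounded_linear[OF L] has_derivative_bounded_linear[OF M] fun_cong[OF comp1] fun_cong[OF comp2]
    by blast
  then show ?thesis by (rule that)
qed

text \<open>The linear isomorphism is needed because the model spaces of the two manifolds are
  different types.\<close>

lemma diffeo_between_chart:
  fixes X :: "('p, 'a::real_normed_vector) manifold" and Y :: "('q, 'b::real_normed_vector) manifold"
    and L :: "'a \<Rightarrow> 'b"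
  assumes X: "premanifold X" and Y: "premanifold Y" and fd: "diffeo_between X Y S T q r"
    and LM: "linear_iso_pair L M"
    and c: "(U, \<phi>) \<in> charts X" and US: "U \<subseteq> S"
  shows "(q ` U, \<lambda>y. L (\<phi> (r y))) \<in> charts Y"
    and "\<And>A. A \<subseteq> U \<Longrightarrow> (\<lambda>y. L (\<phi> (r y))) ` q ` A = L ` \<phi> ` A"
    and "\<And>x. x \<in> U \<Longrightarrow> inv_into (q ` U) (\<lambda>y. L (\<phi> (r y))) (L (\<phi> x)) = q x"
proof -
  let ?\<phi> = "\<lambda>y. L (\<phi> (r y))"
  have qr: "\<And>x. x \<in> S \<Longrightarrow> r (q x) = x" "\<And>y. y \<in> T \<Longrightarrow> q (r y) = y" "q ` S \<subseteq> T" "r ` T \<subseteq> S"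
    and sq: "\<And>x. x \<in> S \<Longrightarrow> smooth_near X Y q x" and sr: "\<And>y. y \<in> T \<Longrightarrow> smooth_near Y X r y"
    and oT: "openin (mtop Y) T"
    using fd by (auto simp: diffeo_between_def)
  have L: "bounded_linear L" "bounded_linear M" "\<And>x. M (L x) = x" "\<And>y. L (M y) = y"
    using LM by (auto simp: linear_iso_pair_def)
  have oU: "openin (mtop X) U" using chart_openin[OF c] .
  have oqU: "openin (mtop Y) (q ` U)" by (rule diffeo_between_open_image[OF fd oU US])
  have inj: "inj_on ?\<phi> (q ` U)"
  proof (rule inj_onI)
    fix y z assume "y \<in> q ` U" "z \<in> q ` U" and eq: "L (\<phi> (r y)) = L (\<phi> (r z))"
    then obtain a b where ab: "a \<in> U" "b \<in> U" "y = q a" "z = q b" by blast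
    have "\<phi> (r y) = \<phi> (r z)" using eq by (metis L(3))
    then have "\<phi> a = \<phi> b" using ab US qr(1) by (simp add: subset_iff)
    then show "y = z" using inj_onD[OF chart_inj[OF c] _ ab(1,2)] ab by simp
  qed
  show im: "?\<phi> ` q ` A = L ` \<phi> ` A" if "A \<subseteq> U" for A
  proof -
    have "?\<phi> (q x) = L (\<phi> x)" if "x \<in> A" for x using that \<open>A \<subseteq> U\<close> US qr(1) by (simp add: subset_iff)
    then show ?thesis by (simp add: image_image)
  qed
  show inv: "inv_into (q ` U) ?\<phi> (L (\<phi> x)) = q x" if "x \<in> U" for x
    using inv_into_f_f[OF inj, of "q x"] that qr(1) US by (auto simp: subset_iff)
  have "is_chart (mtop Y) (q ` U, ?\<phi>)"
  proof (rule is_chartI[OF oqU inj])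
    fix A assume A: "openin (mtop Y) A" "A \<subseteq> q ` U"
    have AT: "A \<subseteq> T" using A(2) US qr(3) by blast
    have "openin (mtop X) (r ` A)"
      by (rule diffeo_between_open_image[OF diffeo_between_sym[OF fd] A(1) AT])
    moreover have "r ` A \<subseteq> U" using A(2) US qr(1) by (auto simp: subset_iff)
    ultimately have "open (\<phi> ` (r ` A))" by (rule chart_open_image[OF c])
    then have "open (L ` \<phi> ` r ` A)" by (rule linear_iso_pair_open_image[OF LM])
    then show "open (?\<phi> ` A)" by (simp add: image_image)
  next
    fix D :: "'b set" assume "open D"
    then have "open (M ` D)" by (rule linear_iso_pair_open_image[OF linear_iso_pair_sym[OF LM]])
    then have "openin (mtop X) {x \<in> U. \<phi> x \<in> M ` D}" by (rule chart_open_vimage[OF c])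
    then have "openin (mtop Y) (q ` {x \<in> U. \<phi> x \<in> M ` D})"
      by (rule diffeo_between_open_image[OF fd]) (use US in auto)
    moreover have "q ` {x \<in> U. \<phi> x \<in> M ` D} = {y \<in> q ` U. L (\<phi> (r y)) \<in> D}"
    proof -
      have "a \<in> M ` D \<longleftrightarrow> L a \<in> D" for a using L(3,4) by (metis image_iff)
      then show ?thesis using qr(1) US by (auto simp: subset_iff)
    qed
    ultimately show "openin (mtop Y) {y \<in> q ` U. L (\<phi> (r y)) \<in> D}" by simp
  qed
  moreover have "compatible_charts (q ` U, ?\<phi>) d" if "d \<in> atlas Y" for d
  proof -
    obtain V \<psi> where d: "d = (V, \<psi>)" by (cases d)
    then have dV: "(V, \<psi>) \<in> charts Y" using atlas_charts[OF Y that] by simp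
    let ?A = "{x \<in> U. q x \<in> V}"
    have oA: "openin (mtop X) ?A"
      by (rule openin_smooth_vimage[OF oU _ chart_openin[OF dV]]) (use US sq in auto)
    have "q ` U \<inter> V = q ` ?A" by auto
    then have eq: "?\<phi> ` (q ` U \<inter> V) = L ` \<phi> ` ?A" using im[of ?A] by auto
    have opA: "open (\<phi> ` ?A)" by (rule chart_open_image[OF c oA]) auto
    have opL: "open (L ` \<phi> ` ?A)" by (rule linear_iso_pair_open_image[OF LM opA])
    have s: "smooth_on (\<phi> ` ?A) (\<lambda>y. \<psi> (q (inv_into U \<phi> y)))"
      by (rule smooth_near_chart_rep[OF X Y c dV]) (use US sq in auto)
    have "smooth_on (L ` \<phi> ` ?A) (\<lambda>y. \<psi> (q (inv_into U \<phi> (M y))))"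
      by (rule smooth_on_compose[OF _ opL opA smooth_on_linear[OF opL L(2) smooth_on_ident[OF opL]] s])
         (use X L(3) in \<open>auto simp: premanifold_def\<close>)
    then have 1: "smooth_on (?\<phi> ` (q ` U \<inter> V)) (\<psi> \<circ> inv_into (q ` U) ?\<phi>)"
      unfolding eq by (rule smooth_on_congI[OF _ opL]) (auto simp: inv chart_inv[OF c] L(3))
    have o2: "open (\<psi> ` (q ` U \<inter> V))"
      by (rule chart_open_image[OF dV]) (use oqU chart_openin[OF dV] in auto)
    have "smooth_on (\<psi> ` (q ` U \<inter> V)) (\<lambda>y. \<phi> (r (inv_into V \<psi> y)))"
      by (rule smooth_near_chart_rep[OF Y X dV c]) (use US sr qr in \<open>auto simp: subset_iff\<close>)
    then have 2: "smooth_on (\<psi> ` (q ` U \<inter> V)) (\<lambda>y. L (\<phi> (r (inv_into V \<psi> y))))"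
      by (rule smooth_on_linear[OF o2 L(1)])
    show ?thesis unfolding d compatible_charts_def using 1 2 by (simp add: o_def)
  qed
  ultimately show "(q ` U, ?\<phi>) \<in> charts Y" by (simp add: charts_def)
qed

section \<open>The norm of order k under linear changes of coordinates\<close>

text \<open>The derivative of a linear map is constant, so repeated differentiation never meets
  derivatives of the coordinate change: \<open>M\<close> only acts on the directions and
  \<open>L'\<close> on the value.\<close>

lemma iter_deriv_linear_coordinates:
  assumes LM: "linear_iso_pair L M" and L': "bounded_linear L'" and D: "open D" "smooth_on D h" "x \<in> D"
  shows "iter_deriv vs (\<lambda>y. L' (h (M y))) (L x) = L' (iter_deriv (map M vs) h x)"
  using D(2,3)
proof (induction vs arbitrary: h x)
  case Nil
  then show ?case using LM by (simp add: linear_iso_pair_def)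
next
  case (Cons v vs)
  have M: "bounded_linear M" "\<And>x. M (L x) = x" using LM by (auto simp: linear_iso_pair_def)
  have d: "frechet_derivative (\<lambda>y. L' (h (M y))) (at y) v = L' (frechet_derivative h (at (M y)) (M v))"
    if "y \<in> L ` D" for y
  proof -
    have "M y \<in> D" using that M by auto
    then have h: "(h has_derivative frechet_derivative h (at (M y))) (at (M y))"
      using frechet_has_derivative smooth_onD Cons.prems by blast
    have "((\<lambda>y. h (M y)) has_derivative (\<lambda>v. frechet_derivative h (at (M y)) (M v))) (at y)"
      by (rule has_derivative_compose[OF bounded_linear_imp_has_derivative[OF M(1)] h])
    then have "((\<lambda>y. L' (h (M y))) has_derivative (\<lambda>v. L' (frechet_derivative h (at (M y)) (M v)))) (at y)"
      by (rule bounded_linear.has_derivative[OF L'])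
    from fun_cong[OF frechet_derivative_at[OF this], of v] show ?thesis by (rule sym)
  qed
  have "iter_deriv (v # vs) (\<lambda>y. L' (h (M y))) (L x) = iter_deriv vs (\<lambda>y. L' (frechet_derivative h (at (M y)) (M v))) (L x)"
    unfolding iter_deriv.simps
    by (rule iter_deriv_cong[OF linear_iso_pair_open_image[OF LM D(1)] _ d]) (use Cons.prems in auto)
  also have "\<dots> = L' (iter_deriv (map M vs) (\<lambda>y. frechet_derivative h (at y) (M v)) x)"
    using Cons.IH[of "\<lambda>y. frechet_derivative h (at y) (M v)" x] smooth_on_derivative Cons.prems by blast
  finally show ?case by simp
qed

text \<open>Homogeneity in every direction, used to bring directions back into the unit ball after a
  linear change of coordinates.\<close>

lemma iter_deriv_scaled:
  assumes "open D" "smooth_on D h" "x \<in> D"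
  shows "iter_deriv (map (\<lambda>v. c *\<^sub>R v) vs) h x = c ^ length vs *\<^sub>R iter_deriv vs h x"
  using assms(2,3)
proof (induction vs arbitrary: h x)
  case (Cons v vs)
  have s: "smooth_on D (\<lambda>y. frechet_derivative h (at y) v)" using smooth_on_derivative Cons.prems by blast
  have "iter_deriv (map (\<lambda>v. c *\<^sub>R v) (v # vs)) h x = iter_deriv (map (\<lambda>v. c *\<^sub>R v) vs) (\<lambda>y. \<Sum>i\<in>{()}. c *\<^sub>R frechet_derivative h (at y) v) x"
    unfolding list.map iter_deriv.simps
  proof (rule iter_deriv_cong[OF assms(1) Cons.prems(2)])
    fix y assume "y \<in> D"
    then have "bounded_linear (frechet_derivative h (at y))"
      using frechet_has_derivative[OF smooth_onD[OF Cons.prems(1)]] has_derivative_bounded_linear by blast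
    then show "frechet_derivative h (at y) (c *\<^sub>R v) = (\<Sum>i\<in>{()}. c *\<^sub>R frechet_derivative h (at y) v)"
      by (simp add: linear_simps)
  qed
  also have "\<dots> = (\<Sum>i\<in>{()}. c *\<^sub>R iter_deriv (map (\<lambda>v. c *\<^sub>R v) vs) (\<lambda>y. frechet_derivative h (at y) v) x)"
    by (rule iter_deriv_sum_scaleR[OF assms(1)]) (use s Cons.prems in auto)
  finally show ?case using Cons.IH[OF s Cons.prems(2)] by (simp add: mult.commute)
qed simp

text \<open>The constant is fixed before the compact set and the function, so that one estimate
  serves a whole neighbourhood of maps.\<close>

lemma Ck_norm_linear_coordinates:
  fixes L :: "'a::real_normed_vector \<Rightarrow> 'b::real_normed_vector" and L' :: "'c::real_normed_vector \<Rightarrow> 'd::real_normed_vector"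
  assumes fd: "fin_dim TYPE('a)" and LM: "linear_iso_pair L M" and L': "bounded_linear L'"
  obtains C where "C > 0"
    "\<And>D K h. open D \<Longrightarrow> compact K \<Longrightarrow> K \<subseteq> D \<Longrightarrow> smooth_on D h \<Longrightarrow>
       Ck_norm k (L ` K) (\<lambda>y. L' (h (M y))) \<le> C * Ck_norm k K h"
proof -
  have M: "bounded_linear M" "\<And>x. M (L x) = x" using LM by (auto simp: linear_iso_pair_def)
  obtain a where a: "a > 0" "\<And>x. norm (L' x) \<le> norm x * a"
    using bounded_linear.pos_bounded[OF L'] by blast
  obtain m0 where m0: "m0 > 0" "\<And>x. norm (M x) \<le> norm x * m0"
    using bounded_linear.pos_bounded[OF M(1)] by blast
  define m where "m = max 1 m0"
  have m: "m \<ge> 1" "\<And>x. norm (M x) \<le> norm x * m"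
    using m0 mult_left_mono[of m0 m "norm _"] by (auto simp: m_def intro: order_trans)
  show ?thesis
  proof (rule that[of "a * m ^ k"])
    show "a * m ^ k > 0" using a m by simp
    fix D :: "'a set" and K and h :: "'a \<Rightarrow> 'c" assume D: "open D" "compact K" "K \<subseteq> D" "smooth_on D h"
    show "Ck_norm k (L ` K) (\<lambda>y. L' (h (M y))) \<le> a * m ^ k * Ck_norm k K h"
    proof (rule Ck_norm_leI)
      have pos: "Ck_norm k K h \<ge> 0" by (rule Ck_norm_nonneg[OF fd D])
      then show "0 \<le> a * m ^ k * Ck_norm k K h" using a m by simp
      fix vs :: "'b list" and y assume *: "y \<in> L ` K" "length vs \<le> k" "\<forall>v\<in>set vs. norm v \<le> 1"
      then obtain x where x: "x \<in> K" "y = L x" by auto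
      define ws where "ws = map (\<lambda>v. (1 / m) *\<^sub>R M v) vs"
      have ws: "map M vs = map (\<lambda>v. m *\<^sub>R v) ws" using m(1) by (simp add: ws_def)
      have nw: "\<forall>w\<in>set ws. norm w \<le> 1"
      proof -
        have "norm (M v) / m \<le> 1" if "v \<in> set vs" for v
        proof -
          have "norm (M v) \<le> norm v * m" by (rule m)
          also have "\<dots> \<le> 1 * m" using * that m(1) by (intro mult_right_mono) auto
          finally show ?thesis using m(1) by simp
        qed
        then show ?thesis using m(1) by (auto simp: ws_def)
      qed
      have "iter_deriv vs (\<lambda>y. L' (h (M y))) y = L' (m ^ length ws *\<^sub>R iter_deriv ws h x)"
        using iter_deriv_linear_coordinates[OF LM L' D(1,4), of x vs] iter_deriv_scaled[OF D(1,4), of x m ws] x D(3)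
        by (auto simp: ws)
      then have "norm (iter_deriv vs (\<lambda>y. L' (h (M y))) y) \<le> norm (m ^ length ws *\<^sub>R iter_deriv ws h x) * a"
        by (simp only: a(2))
      also have "\<dots> = m ^ length ws * norm (iter_deriv ws h x) * a" using m(1) by simp
      also have "\<dots> \<le> m ^ k * Ck_norm k K h * a"
        by (intro mult_right_mono mult_mono power_increasing iter_deriv_le_Ck_norm[OF fd D])
           (use m * a nw x pos in \<open>auto simp: ws_def\<close>)
      finally show "norm (iter_deriv vs (\<lambda>y. L' (h (M y))) y) \<le> a * m ^ k * Ck_norm k K h"
        by (simp add: mult_ac)
    qed
  qed
qed

section \<open>The weak topology\<close>

lemma chart_inverse_continuous:
  assumes c: "(U, \<phi>) \<in> charts X"
  shows "continuous_map (top_of_set (\<phi> ` U)) (mtop X) (inv_into U \<phi>)"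
  unfolding continuous_map_def
proof (intro conjI allI impI)
  show "inv_into U \<phi> \<in> topspace (top_of_set (\<phi> ` U)) \<rightarrow> mpoints X"
    using chart_inv[OF c] chart_subset[OF c] by auto
  fix W assume W: "openin (mtop X) W"
  have "openin (mtop X) (U \<inter> W)" using chart_openin[OF c] W by blast
  then have "open (\<phi> ` (U \<inter> W))" by (rule chart_open_image[OF c]) auto
  moreover have "{y \<in> topspace (top_of_set (\<phi> ` U)). inv_into U \<phi> y \<in> W} = \<phi> ` (U \<inter> W)"
    using chart_inv[OF c] by auto
  ultimately show "openin (top_of_set (\<phi> ` U)) {y \<in> topspace (top_of_set (\<phi> ` U)). inv_into U \<phi> y \<in> W}"
    by (auto intro!: open_subset)
qed

lemma chart_compact_image:
  assumes c: "(U, \<phi>) \<in> charts X" and K: "compactin (mtop X) K" "K \<subseteq> U"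
  shows "compact (\<phi> ` K)"
proof -
  have "homeomorphic_map (subtopology (mtop X) U) (top_of_set (\<phi> ` U)) \<phi>"
    using chart_is_chart[OF c] by (simp add: is_chart_def)
  then have "continuous_map (subtopology (mtop X) U) euclidean \<phi>"
    using homeomorphic_imp_continuous_map continuous_map_into_fulltopology by blast
  moreover have "compactin (subtopology (mtop X) U) K" using K by (simp add: compactin_subtopology)
  ultimately have "compactin euclidean (\<phi> ` K)" using image_compactin by blast
  then show ?thesis by simp
qed

text \<open>A ball in a chart and the closed ball around it. Compactness of the larger set supplies
  weak neighbourhoods, connectedness of the smaller one forces its image to choose between disjoint
  open sets.\<close>

lemma compact_connected_neighbourhood:
  fixes X :: "('p, 'a::real_normed_vector) manifold"
  assumes X: "premanifold X" and W: "openin (mtop X) W" "x \<in> W"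
  obtains A C where "openin (mtop X) A" "x \<in> A" "A \<subseteq> C" "C \<subseteq> W" "compactin (mtop X) C" "connectedin (mtop X) A"
proof -
  have "x \<in> mpoints X" using W openin_subset by blast
  then obtain U \<phi> where c: "(U, \<phi>) \<in> charts X" "x \<in> U" by (rule atlas_cover[OF X])
  let ?g = "inv_into U \<phi>"
  have "openin (mtop X) (U \<inter> W)" using chart_openin[OF c(1)] W by blast
  then have "open (\<phi> ` (U \<inter> W))" by (rule chart_open_image[OF c(1)]) auto
  moreover have "\<phi> x \<in> \<phi> ` (U \<inter> W)" using c W by blast
  ultimately obtain e where e: "e > 0" "cball (\<phi> x) e \<subseteq> \<phi> ` (U \<inter> W)"
    using open_contains_cball by blast
  have eU: "cball (\<phi> x) e \<subseteq> \<phi> ` U" using e(2) by blast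
  have bc: "ball (\<phi> x) e \<subseteq> cball (\<phi> x) e" by (rule ball_subset_cball)
  have gW: "?g ` cball (\<phi> x) e \<subseteq> U \<inter> W"
  proof (rule image_subsetI)
    fix y assume "y \<in> cball (\<phi> x) e"
    then obtain z where "z \<in> U \<inter> W" "y = \<phi> z" using e(2) by blast
    then show "?g y \<in> U \<inter> W" using chart_inv[OF c(1)] by simp
  qed
  have "fin_dim TYPE('a)" using X by (simp add: premanifold_def)
  then have cp: "compactin (top_of_set (\<phi> ` U)) (cball (\<phi> x) e)"
    using eU by (simp add: compactin_subtopology compact_cball_fin_dim)
  have cn: "connectedin (top_of_set (\<phi> ` U)) (ball (\<phi> x) e)"
    using order_trans[OF bc eU] by (simp add: connectedin_subtopology convex_connected)
  have eq: "?g ` ball (\<phi> x) e = {z \<in> U. \<phi> z \<in> ball (\<phi> x) e}"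
  proof
    show "?g ` ball (\<phi> x) e \<subseteq> {z \<in> U. \<phi> z \<in> ball (\<phi> x) e}"
    proof (rule image_subsetI)
      fix y assume y: "y \<in> ball (\<phi> x) e"
      then obtain z where "z \<in> U" "y = \<phi> z" using eU bc by blast
      then show "?g y \<in> {z \<in> U. \<phi> z \<in> ball (\<phi> x) e}" using chart_inv[OF c(1)] y by simp
    qed
    show "{z \<in> U. \<phi> z \<in> ball (\<phi> x) e} \<subseteq> ?g ` ball (\<phi> x) e"
    proof
      fix z assume "z \<in> {z \<in> U. \<phi> z \<in> ball (\<phi> x) e}"
      then show "z \<in> ?g ` ball (\<phi> x) e" using chart_inv[OF c(1), of z] by (intro image_eqI[of _ _ "\<phi> z"]) auto
    qed
  qed
  show ?thesis
  proof (rule that[of "?g ` ball (\<phi> x) e" "?g ` cball (\<phi> x) e"])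
    show "openin (mtop X) (?g ` ball (\<phi> x) e)"
      unfolding eq by (rule chart_open_vimage[OF c(1)]) simp
    show "x \<in> ?g ` ball (\<phi> x) e" unfolding eq using c e by simp
    show "?g ` ball (\<phi> x) e \<subseteq> ?g ` cball (\<phi> x) e" using bc by (rule image_mono)
    show "?g ` cball (\<phi> x) e \<subseteq> W" using gW by blast
    show "compactin (mtop X) (?g ` cball (\<phi> x) e)"
      by (rule image_compactin[OF cp chart_inverse_continuous[OF c(1)]])
    show "connectedin (mtop X) (?g ` ball (\<phi> x) e)"
      by (rule connectedin_continuous_map_image[OF chart_inverse_continuous[OF c(1)] cn])
  qed
qed

lemma smooth_maps_smooth_near:
  "premanifold X \<Longrightarrow> premanifold Y \<Longrightarrow> f \<in> smooth_maps X Y \<Longrightarrow> x \<in> mpoints X \<Longrightarrow> smooth_near X Y f x"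
  by (simp add: smooth_maps_def smooth_map_iff)

lemma Ck_norm_zero [simp]: "Ck_norm k K (\<lambda>_. 0) = 0"
proof -
  have z: "iter_deriv vs (\<lambda>_::'a. 0::'b) = (\<lambda>_. 0)" for vs :: "'a list"
    by (induction vs) simp_all
  have "insert 0 {norm (iter_deriv vs (\<lambda>_::'a. 0::'b) x) |vs x. x \<in> K \<and> length vs \<le> k \<and> (\<forall>v\<in>set vs. norm v \<le> 1)} = {0}"
    unfolding z by auto
  then show ?thesis unfolding Ck_norm_def by (simp only: cSup_singleton)
qed

lemma openin_weak_nbhd:
  assumes "f \<in> smooth_maps X Y" "(U, \<phi>) \<in> charts X" "(V, \<psi>) \<in> charts Y" "compactin (mtop X) K" "K \<subseteq> U" "f ` K \<subseteq> V" "\<epsilon> > 0"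
  shows "openin (weak_Cinf_topology X Y) (weak_nbhd X Y f (U, \<phi>) (V, \<psi>) K k \<epsilon>)"
  unfolding weak_Cinf_topology_def
  by (rule topology_generated_by_Basis, rule CollectI, intro exI conjI, rule refl) (use assms in auto)

lemma mem_weak_nbhd:
  "g \<in> weak_nbhd X Y f (U, \<phi>) (V, \<psi>) K k \<epsilon> \<longleftrightarrow> g \<in> smooth_maps X Y \<and> g ` K \<subseteq> V \<and>
     Ck_norm k (\<phi> ` K) (\<lambda>y. \<psi> (f (inv_into U \<phi> y)) - \<psi> (g (inv_into U \<phi> y))) < \<epsilon>"
  by (simp add: weak_nbhd_def)

text \<open>The weak neighbourhood of order 0 and radius 1 is used only for its condition on
  values.\<close>

lemma compact_open_neighbourhood:
  assumes "f \<in> smooth_maps X Y" "(U, \<phi>) \<in> charts X" "(V, \<psi>) \<in> charts Y" "compactin (mtop X) K" "K \<subseteq> U" "f ` K \<subseteq> V"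
  obtains N where "openin (weak_Cinf_topology X Y) N" "f \<in> N" "\<And>g. g \<in> N \<Longrightarrow> g ` K \<subseteq> V"
proof (rule that[of "weak_nbhd X Y f (U, \<phi>) (V, \<psi>) K 0 1"])
  show "openin (weak_Cinf_topology X Y) (weak_nbhd X Y f (U, \<phi>) (V, \<psi>) K 0 1)"
    by (rule openin_weak_nbhd[OF assms]) simp
qed (use assms in \<open>auto simp: mem_weak_nbhd\<close>)

lemma topspace_weak_Cinf: "topspace (weak_Cinf_topology X Y) = smooth_maps X Y"
proof
  show "topspace (weak_Cinf_topology X Y) \<subseteq> smooth_maps X Y"
    unfolding weak_Cinf_topology_def topology_generated_by_topspace by (auto simp: weak_nbhd_def)
  show "smooth_maps X Y \<subseteq> topspace (weak_Cinf_topology X Y)"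
  proof
    fix f assume "f \<in> smooth_maps X Y"
    then obtain N where "openin (weak_Cinf_topology X Y) N" "f \<in> N"
      by (rule compact_open_neighbourhood[OF _ empty_chart[of undefined] empty_chart[of undefined], of f X Y "{}"]) auto
    then show "f \<in> topspace (weak_Cinf_topology X Y)" using openin_subset by blast
  qed
qed

text \<open>A norm over a compact set needs smoothness on an open neighbourhood. Taking a finite
  family allows several maps to be compared on a common one.\<close>

lemma open_chart_vimages:
  assumes X: "premanifold X" and Y: "premanifold Y" and c: "(U, \<phi>) \<in> charts X" and d: "(V, \<psi>) \<in> charts Y"
    and F: "F \<subseteq> smooth_maps X Y" "finite F"
  shows "openin (mtop X) {x \<in> U. \<forall>f\<in>F. f x \<in> V}" (is "?A F")
    and "\<And>f. f \<in> F \<Longrightarrow> smooth_on (\<phi> ` {x \<in> U. \<forall>f\<in>F. f x \<in> V}) (\<lambda>y. \<psi> (f (inv_into U \<phi> y)))"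
proof -
  have sn: "smooth_near X Y f x" if "f \<in> F" "x \<in> U" for f x
    using smooth_maps_smooth_near[OF X Y] F that chart_subset[OF c] by blast
  show "?A F" using F(2,1)
  proof (induction F)
    case empty
    then show ?case using chart_openin[OF c] by simp
  next
    case (insert f F)
    have "smooth_near X Y f x" if "x \<in> U" for x
      using smooth_maps_smooth_near[OF X Y] insert.prems that chart_subset[OF c] by blast
    then have "openin (mtop X) {x \<in> U. f x \<in> V}"
      by (rule openin_smooth_vimage[OF chart_openin[OF c] _ chart_openin[OF d]])
    moreover have "{x \<in> U. \<forall>g\<in>insert f F. g x \<in> V} = {x \<in> U. f x \<in> V} \<inter> {x \<in> U. \<forall>f\<in>F. f x \<in> V}" by auto
    ultimately show ?case using insert by auto
  qed
  show "smooth_on (\<phi> ` {x \<in> U. \<forall>f\<in>F. f x \<in> V}) (\<lambda>y. \<psi> (f (inv_into U \<phi> y)))" if "f \<in> F" for f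
    by (rule smooth_near_chart_rep[OF X Y c d]) (use sn that in auto)
qed

text \<open>Continuity into the weak topology is reduced to a local test: near each point, on a
  small compact neighbourhood, with \<open>H z0\<close> itself as the centre. A general subbasic set
  follows by compactness of \<open>K\<close> and the triangle inequality.\<close>

lemma continuous_map_weak_Cinf:
  fixes X :: "('p, 'a::real_normed_vector) manifold" and Y :: "('q, 'b::real_normed_vector) manifold"
  assumes X: "premanifold X" and Y: "premanifold Y"
    and H: "\<And>z. z \<in> topspace Z \<Longrightarrow> H z \<in> smooth_maps X Y"
    and loc: "\<And>z0 x U \<phi> V \<psi> k \<epsilon>. z0 \<in> topspace Z \<Longrightarrow> (U, \<phi>) \<in> charts X \<Longrightarrow> x \<in> U \<Longrightarrow> (V, \<psi>) \<in> charts Y \<Longrightarrow>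
      H z0 x \<in> V \<Longrightarrow> \<epsilon> > 0 \<Longrightarrow>
      \<exists>A C N. openin (mtop X) A \<and> x \<in> A \<and> A \<subseteq> C \<and> compactin (mtop X) C \<and> C \<subseteq> U \<and> openin Z N \<and> z0 \<in> N \<and>
        (\<forall>z\<in>N. H z ` C \<subseteq> V \<and>
          Ck_norm k (\<phi> ` C) (\<lambda>y. \<psi> (H z0 (inv_into U \<phi> y)) - \<psi> (H z (inv_into U \<phi> y))) < \<epsilon>)"
  shows "continuous_map Z (weak_Cinf_topology X Y) H"
  unfolding weak_Cinf_topology_def
proof (rule continuous_on_generated_topo)
  show "H ` topspace Z \<subseteq> \<Union> {weak_nbhd X Y f c d K k \<epsilon> |f c d K k \<epsilon>. f \<in> smooth_maps X Y \<and> c \<in> charts X \<and>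
      d \<in> charts Y \<and> compactin (mtop X) K \<and> K \<subseteq> fst c \<and> f ` K \<subseteq> fst d \<and> 0 < \<epsilon>}"
    using H topspace_weak_Cinf[of X Y] unfolding weak_Cinf_topology_def topology_generated_by_topspace by blast
next
  have fda: "fin_dim TYPE('a)" using X by (simp add: premanifold_def)
  have midpoint: "a + (e - a) / 2 < e" if "a < e" for a e :: real using that by (simp add: field_simps)
  fix W assume "W \<in> {weak_nbhd X Y f c d K k \<epsilon> |f c d K k \<epsilon>. f \<in> smooth_maps X Y \<and> c \<in> charts X \<and>
      d \<in> charts Y \<and> compactin (mtop X) K \<and> K \<subseteq> fst c \<and> f ` K \<subseteq> fst d \<and> 0 < \<epsilon>}"
  then obtain f U \<phi> V \<psi> K k \<epsilon> where W: "W = weak_nbhd X Y f (U, \<phi>) (V, \<psi>) K k \<epsilon>" and f: "f \<in> smooth_maps X Y"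
    and c: "(U, \<phi>) \<in> charts X" and d: "(V, \<psi>) \<in> charts Y" and K: "compactin (mtop X) K" "K \<subseteq> U" "f ` K \<subseteq> V"
    by auto
  let ?h = "\<lambda>g y. \<psi> (g (inv_into U \<phi> y))"
  show "openin Z (H -` W \<inter> topspace Z)"
  proof (subst openin_subopen, rule ballI)
    fix z0 assume "z0 \<in> H -` W \<inter> topspace Z"
    then have z0: "z0 \<in> topspace Z" and z0W: "H z0 \<in> W" by auto
    have K0: "H z0 ` K \<subseteq> V" and less: "Ck_norm k (\<phi> ` K) (\<lambda>y. ?h f y - ?h (H z0) y) < \<epsilon>"
      using z0W unfolding W mem_weak_nbhd by auto
    \<comment> \<open>Half of the slack in the strict inequality: the local bounds only add up to a
      weak bound by \<open>\<eta>\<close>, which still leaves the total below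
      \<open>\<epsilon>\<close>.\<close>
    define \<eta> where "\<eta> = (\<epsilon> - Ck_norm k (\<phi> ` K) (\<lambda>y. ?h f y - ?h (H z0) y)) / 2"
    have \<eta>: "\<eta> > 0" using less by (simp add: \<eta>_def)
    have "\<forall>x\<in>K. \<exists>A C N. openin (mtop X) A \<and> x \<in> A \<and> A \<subseteq> C \<and> compactin (mtop X) C \<and> C \<subseteq> U \<and> openin Z N \<and> z0 \<in> N \<and>
        (\<forall>z\<in>N. H z ` C \<subseteq> V \<and> Ck_norm k (\<phi> ` C) (\<lambda>y. ?h (H z0) y - ?h (H z) y) < \<eta>)"
    proof
      fix x assume x: "x \<in> K"
      then have "x \<in> U" "H z0 x \<in> V" using K K0 by auto
      from loc[OF z0 c this(1) d this(2) \<eta>, of k]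
      show "\<exists>A C N. openin (mtop X) A \<and> x \<in> A \<and> A \<subseteq> C \<and> compactin (mtop X) C \<and> C \<subseteq> U \<and> openin Z N \<and> z0 \<in> N \<and>
        (\<forall>z\<in>N. H z ` C \<subseteq> V \<and> Ck_norm k (\<phi> ` C) (\<lambda>y. ?h (H z0) y - ?h (H z) y) < \<eta>)" .
    qed
    from bchoice[OF this] obtain A where "\<forall>x\<in>K. \<exists>C N. openin (mtop X) (A x) \<and> x \<in> A x \<and> A x \<subseteq> C \<and> compactin (mtop X) C \<and> C \<subseteq> U \<and> openin Z N \<and> z0 \<in> N \<and>
        (\<forall>z\<in>N. H z ` C \<subseteq> V \<and> Ck_norm k (\<phi> ` C) (\<lambda>y. ?h (H z0) y - ?h (H z) y) < \<eta>)" by (elim exE)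
    from bchoice[OF this] obtain C where "\<forall>x\<in>K. \<exists>N. openin (mtop X) (A x) \<and> x \<in> A x \<and> A x \<subseteq> C x \<and> compactin (mtop X) (C x) \<and> C x \<subseteq> U \<and> openin Z N \<and> z0 \<in> N \<and>
        (\<forall>z\<in>N. H z ` C x \<subseteq> V \<and> Ck_norm k (\<phi> ` C x) (\<lambda>y. ?h (H z0) y - ?h (H z) y) < \<eta>)" by (elim exE)
    from bchoice[OF this] obtain N where ACN: "\<forall>x\<in>K. openin (mtop X) (A x) \<and> x \<in> A x \<and> A x \<subseteq> C x \<and> compactin (mtop X) (C x) \<and> C x \<subseteq> U \<and> openin Z (N x) \<and> z0 \<in> N x \<and>
        (\<forall>z\<in>N x. H z ` C x \<subseteq> V \<and> Ck_norm k (\<phi> ` C x) (\<lambda>y. ?h (H z0) y - ?h (H z) y) < \<eta>)" by (elim exE)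
    have "\<forall>T\<in>A ` K. openin (mtop X) T" "K \<subseteq> \<Union> (A ` K)" using ACN by auto
    then obtain \<F> where "finite \<F>" "\<F> \<subseteq> A ` K" "K \<subseteq> \<Union>\<F>"
      using K(1) unfolding compactin_def by (metis (no_types, lifting))
    then obtain I where I: "finite I" "I \<subseteq> K" "K \<subseteq> \<Union> (A ` I)" using finite_subset_image by metis
    \<comment> \<open>Intersecting with the whole space keeps this an open subset of
      \<open>Z\<close> when the index set is empty.\<close>
    define N' where "N' = topspace Z \<inter> \<Inter> (N ` I)"
    have "openin Z N'"
    proof (cases "I = {}")
      case False
      have "openin Z (\<Inter> (N ` I))" using ACN I False by (intro openin_Inter) auto
      then show ?thesis unfolding N'_def by blast
    qed (simp add: N'_def)
    moreover have "z0 \<in> N'" using ACN I z0 by (auto simp: N'_def)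
    moreover have "N' \<subseteq> H -` W \<inter> topspace Z"
    proof
      fix z assume z: "z \<in> N'"
      then have zZ: "z \<in> topspace Z" by (simp add: N'_def)
      have sm: "{f, H z0, H z} \<subseteq> smooth_maps X Y" using f H z0 zZ by auto
      have KV: "H z ` K \<subseteq> V"
      proof (rule image_subsetI)
        fix x assume "x \<in> K"
        then obtain i where "i \<in> I" "x \<in> A i" using I by auto
        moreover from this have "i \<in> K" "z \<in> N i" using I(2) z by (auto simp: N'_def)
        ultimately show "H z x \<in> V" using bspec[OF ACN \<open>i \<in> K\<close>] by blast
      qed
      define D where "D = \<phi> ` {x \<in> U. \<forall>g\<in>{f, H z0, H z}. g x \<in> V}"
      have oD: "open D" unfolding D_def
        by (rule chart_open_image[OF c open_chart_vimages(1)[OF X Y c d sm]]) auto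
      have sD: "smooth_on D (?h f)" "smooth_on D (?h (H z0))" "smooth_on D (?h (H z))"
        unfolding D_def by (rule open_chart_vimages(2)[OF X Y c d sm], simp, simp)+
      have KD: "\<phi> ` K \<subseteq> D" unfolding D_def using K K0 KV by (intro image_mono) auto
      have cK: "compact (\<phi> ` K)" by (rule chart_compact_image[OF c K(1,2)])
      have "Ck_norm k (\<phi> ` K) (\<lambda>y. ?h (H z0) y - ?h (H z) y) \<le> \<eta>"
      proof (rule Ck_norm_leI)
        show "0 \<le> \<eta>" using \<eta> by simp
        fix vs :: "'a list" and y assume vs: "y \<in> \<phi> ` K" "length vs \<le> k" "\<forall>v\<in>set vs. norm v \<le> 1"
        then obtain x where x: "x \<in> K" "y = \<phi> x" by auto
        then obtain i where i: "i \<in> I" "x \<in> A i" using I by auto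
        then have iK: "i \<in> K" "z \<in> N i" using I(2) z by (auto simp: N'_def)
        note Ai = bspec[OF ACN iK(1)]
        have Ci: "compactin (mtop X) (C i)" "C i \<subseteq> U" "x \<in> C i" "H z ` C i \<subseteq> V" "H z0 ` C i \<subseteq> V"
          "Ck_norm k (\<phi> ` C i) (\<lambda>y. ?h (H z0) y - ?h (H z) y) < \<eta>"
          using Ai iK(2) i(2) by blast+
        have sm2: "{H z0, H z} \<subseteq> smooth_maps X Y" using sm by simp
        \<comment> \<open>\<open>f\<close> need not map all of \<open>C i\<close> into
          \<open>V\<close>, so the open set for the local estimate involves \<open>H z0\<close> and
          \<open>H z\<close> only.\<close>
        define E where "E = \<phi> ` {x \<in> U. \<forall>g\<in>{H z0, H z}. g x \<in> V}"
        have oE: "open E" unfolding E_def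
          by (rule chart_open_image[OF c open_chart_vimages(1)[OF X Y c d sm2]]) auto
        have sE: "smooth_on E (?h (H z0))" "smooth_on E (?h (H z))"
          unfolding E_def by (rule open_chart_vimages(2)[OF X Y c d sm2], simp, simp)+
        have CE: "\<phi> ` C i \<subseteq> E" unfolding E_def using Ci by (intro image_mono) auto
        have "norm (iter_deriv vs (\<lambda>y. ?h (H z0) y - ?h (H z) y) y) \<le> Ck_norm k (\<phi> ` C i) (\<lambda>y. ?h (H z0) y - ?h (H z) y)"
          by (rule iter_deriv_le_Ck_norm[OF fda oE chart_compact_image[OF c Ci(1,2)] CE smooth_on_diff[OF oE sE] _ vs(2,3)])
             (use Ci x in simp)
        then show "norm (iter_deriv vs (\<lambda>y. ?h (H z0) y - ?h (H z) y) y) \<le> \<eta>" using Ci(6) by linarith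
      qed
      with Ck_norm_triangle[OF fda oD cK KD sD, of k]
      have "Ck_norm k (\<phi> ` K) (\<lambda>y. ?h f y - ?h (H z) y) \<le> Ck_norm k (\<phi> ` K) (\<lambda>y. ?h f y - ?h (H z0) y) + \<eta>"
        by linarith
      also have "\<dots> < \<epsilon>" unfolding \<eta>_def by (rule midpoint[OF less])
      finally have "H z \<in> W" unfolding W mem_weak_nbhd using KV sm by simp
      then show "z \<in> H -` W \<inter> topspace Z" using zZ by simp
    qed
    ultimately show "\<exists>T. openin Z T \<and> z0 \<in> T \<and> T \<subseteq> H -` W \<inter> topspace Z" by (intro exI conjI)
  qed
qed

text \<open>In charts transported along \<open>q\<close>, the representation of a map
  \<open>F\<close> lifted by \<open>f\<close> is that of \<open>f\<close> conjugated by linear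
  isomorphisms, and so is a difference of two representations. The first estimate serves the
  continuity of the push-forward, the second that of lifting.\<close>

lemma Ck_norm_transport:
  fixes X :: "('p, 'a::real_normed_vector) manifold" and Y :: "('q, 'b::real_normed_vector) manifold"
    and L :: "'a \<Rightarrow> 'b" and L' :: "'a \<Rightarrow> 'b"
  assumes X: "premanifold X" and Y: "premanifold Y"
    and q: "diffeo_between X Y S T q r" and q': "diffeo_between X Y S' T' q r'"
    and L: "linear_iso_pair L M" and L': "linear_iso_pair L' M'"
    and c: "(U, \<phi>) \<in> charts X" "U \<subseteq> S" and d: "(V, \<psi>) \<in> charts X" "V \<subseteq> S'"
  obtains B where "B > 0"
    "\<And>f g F G K. f \<in> smooth_maps X X \<Longrightarrow> g \<in> smooth_maps X X \<Longrightarrow> compactin (mtop X) K \<Longrightarrow> K \<subseteq> U \<Longrightarrow>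
      f ` K \<subseteq> V \<Longrightarrow> g ` K \<subseteq> V \<Longrightarrow> (\<And>x. x \<in> mpoints X \<Longrightarrow> F (q x) = q (f x)) \<Longrightarrow> (\<And>x. x \<in> mpoints X \<Longrightarrow> G (q x) = q (g x)) \<Longrightarrow>
      Ck_norm k ((\<lambda>y. L (\<phi> (r y))) ` q ` K)
        (\<lambda>y. L' (\<psi> (r' (F (inv_into (q ` U) (\<lambda>y. L (\<phi> (r y))) y)))) - L' (\<psi> (r' (G (inv_into (q ` U) (\<lambda>y. L (\<phi> (r y))) y)))))
      \<le> B * Ck_norm k (\<phi> ` K) (\<lambda>y. \<psi> (f (inv_into U \<phi> y)) - \<psi> (g (inv_into U \<phi> y)))"
    "\<And>f g F G K. f \<in> smooth_maps X X \<Longrightarrow> g \<in> smooth_maps X X \<Longrightarrow> compactin (mtop X) K \<Longrightarrow> K \<subseteq> U \<Longrightarrow>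
      f ` K \<subseteq> V \<Longrightarrow> g ` K \<subseteq> V \<Longrightarrow> (\<And>x. x \<in> mpoints X \<Longrightarrow> F (q x) = q (f x)) \<Longrightarrow> (\<And>x. x \<in> mpoints X \<Longrightarrow> G (q x) = q (g x)) \<Longrightarrow>
      Ck_norm k (\<phi> ` K) (\<lambda>y. \<psi> (f (inv_into U \<phi> y)) - \<psi> (g (inv_into U \<phi> y)))
      \<le> B * Ck_norm k ((\<lambda>y. L (\<phi> (r y))) ` q ` K)
        (\<lambda>y. L' (\<psi> (r' (F (inv_into (q ` U) (\<lambda>y. L (\<phi> (r y))) y)))) - L' (\<psi> (r' (G (inv_into (q ` U) (\<lambda>y. L (\<phi> (r y))) y)))))"
proof -
  have fda: "fin_dim TYPE('a)" "fin_dim TYPE('b)" using X Y by (auto simp: premanifold_def)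
  have Lb: "bounded_linear L" "bounded_linear M" "\<And>x. M (L x) = x" "\<And>x. L (M x) = x"
    using L by (auto simp: linear_iso_pair_def)
  have Lb': "bounded_linear L'" "bounded_linear M'" "\<And>x. M' (L' x) = x"
    using L' by (auto simp: linear_iso_pair_def)
  obtain B1 where B1: "B1 > 0" "\<And>D K h. open D \<Longrightarrow> compact K \<Longrightarrow> K \<subseteq> D \<Longrightarrow> smooth_on D h \<Longrightarrow>
       Ck_norm k (L ` K) (\<lambda>y. L' (h (M y))) \<le> B1 * Ck_norm k K h"
    by (rule Ck_norm_linear_coordinates[OF fda(1) L Lb'(1), of k]) blast
  obtain B2 where B2: "B2 > 0" "\<And>D K h. open D \<Longrightarrow> compact K \<Longrightarrow> K \<subseteq> D \<Longrightarrow> smooth_on D h \<Longrightarrow>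
       Ck_norm k (M ` K) (\<lambda>y. M' (h (L y))) \<le> B2 * Ck_norm k K h"
    by (rule Ck_norm_linear_coordinates[OF fda(2) linear_iso_pair_sym[OF L] Lb'(2), of k]) blast
  show ?thesis
  proof (rule that[of "max B1 B2"])
    show "max B1 B2 > 0" using B1(1) by simp
    fix f g F G K
    assume f: "f \<in> smooth_maps X X" and g: "g \<in> smooth_maps X X" and K: "compactin (mtop X) K" "K \<subseteq> U"
      and KV: "f ` K \<subseteq> V" "g ` K \<subseteq> V"
      and F: "\<And>x. x \<in> mpoints X \<Longrightarrow> F (q x) = q (f x)" and G: "\<And>x. x \<in> mpoints X \<Longrightarrow> G (q x) = q (g x)"
    let ?h = "\<lambda>y. \<psi> (f (inv_into U \<phi> y)) - \<psi> (g (inv_into U \<phi> y))"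
    let ?\<phi> = "\<lambda>y. L (\<phi> (r y))"
    let ?H = "\<lambda>y. L' (\<psi> (r' (F (inv_into (q ` U) ?\<phi> y)))) - L' (\<psi> (r' (G (inv_into (q ` U) ?\<phi> y))))"
    have sm: "{f, g} \<subseteq> smooth_maps X X" using f g by simp
    define D where "D = \<phi> ` {x \<in> U. \<forall>g\<in>{f, g}. g x \<in> V}"
    have oD: "open D" unfolding D_def
      by (rule chart_open_image[OF c(1) open_chart_vimages(1)[OF X X c(1) d(1) sm]]) auto
    have "smooth_on D (\<lambda>y. \<psi> (f (inv_into U \<phi> y)))" "smooth_on D (\<lambda>y. \<psi> (g (inv_into U \<phi> y)))"
      unfolding D_def by (rule open_chart_vimages(2)[OF X X c(1) d(1) sm], simp, simp)+
    then have sD: "smooth_on D ?h" by (rule smooth_on_diff[OF oD])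
    have KD: "\<phi> ` K \<subseteq> D" unfolding D_def using K KV by (intro image_mono) auto
    have cK: "compact (\<phi> ` K)" by (rule chart_compact_image[OF c(1) K])
    have im: "?\<phi> ` q ` K = L ` \<phi> ` K" by (rule diffeo_between_chart(2)[OF X Y q L c K(2)])
    have oL: "open (L ` D)" by (rule linear_iso_pair_open_image[OF L oD])
    have r': "r' (q v) = v" if "v \<in> V" for v using q' d(2) that by (auto simp: diffeo_between_def)
    have eq: "?H y = L' (?h (M y))" if "y \<in> L ` D" for y
    proof -
      obtain x where x: "x \<in> U" "f x \<in> V" "g x \<in> V" "y = L (\<phi> x)"
        using \<open>y \<in> L ` D\<close> by (auto simp: D_def)
      then have "x \<in> mpoints X" using chart_subset[OF c(1)] by blast
      moreover have "inv_into (q ` U) ?\<phi> y = q x"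
        unfolding x(4) by (rule diffeo_between_chart(3)[OF X Y q L c x(1)])
      ultimately show ?thesis
        using x r' chart_inv[OF c(1)] F G Lb(3) by (simp add: linear_simps[OF Lb'(1)])
    qed
    have N1: "Ck_norm k (?\<phi> ` q ` K) ?H = Ck_norm k (L ` \<phi> ` K) (\<lambda>y. L' (?h (M y)))"
      unfolding im by (rule Ck_norm_cong[OF oL _ eq]) (use KD in auto)
    have b1: "Ck_norm k (L ` \<phi> ` K) (\<lambda>y. L' (?h (M y))) \<le> B1 * Ck_norm k (\<phi> ` K) ?h"
      by (rule B1(2)[OF oD cK KD sD])
    have sL: "smooth_on (L ` D) (\<lambda>y. L' (?h (M y)))"
    proof (rule smooth_on_linear[OF oL Lb'(1)])
      show "smooth_on (L ` D) (\<lambda>y. ?h (M y))"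
        by (rule smooth_on_compose[OF fda(1) oL oD smooth_on_linear[OF oL Lb(2) smooth_on_ident[OF oL]] sD])
           (use Lb(3) in auto)
    qed
    have cL: "compact (L ` \<phi> ` K)"
      by (rule compact_continuous_image[OF _ cK]) (rule linear_continuous_on[OF Lb(1)])
    have "Ck_norm k (M ` L ` \<phi> ` K) (\<lambda>y. M' (L' (?h (M (L y))))) \<le> B2 * Ck_norm k (L ` \<phi> ` K) (\<lambda>y. L' (?h (M y)))"
      by (rule B2(2)[OF oL cL _ sL]) (use KD in auto)
    moreover have "M ` L ` A = A" for A using Lb(3) by (simp add: image_image)
    ultimately have b2: "Ck_norm k (\<phi> ` K) ?h \<le> B2 * Ck_norm k (L ` \<phi> ` K) (\<lambda>y. L' (?h (M y)))"
      by (simp only: Lb(3) Lb'(3))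
    have p1: "0 \<le> Ck_norm k (\<phi> ` K) ?h" by (rule Ck_norm_nonneg[OF fda(1) oD cK KD sD])
    have p2: "0 \<le> Ck_norm k (L ` \<phi> ` K) (\<lambda>y. L' (?h (M y)))"
      by (rule Ck_norm_nonneg[OF fda(2) oL cL _ sL]) (use KD in auto)
    show "Ck_norm k (?\<phi> ` q ` K) ?H \<le> max B1 B2 * Ck_norm k (\<phi> ` K) ?h"
        "Ck_norm k (\<phi> ` K) ?h \<le> max B1 B2 * Ck_norm k (?\<phi> ` q ` K) ?H"
      unfolding N1
      by (rule order_trans[OF b1 mult_right_mono[OF max.cobounded1 p1]])
         (rule order_trans[OF b2 mult_right_mono[OF max.cobounded2 p2]])
  qed
qed

section \<open>Pushing maps forward along a two-fold covering\<close>

text \<open>The bundle geometry is reduced to an involution exchanging the two points of each fibre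
  of \<open>q\<close>, and a set \<open>\<G>\<close> of smooth maps stable under composition with
  it. \<open>H\<close> sends such a map to the one it covers.\<close>

locale deck_involution =
  fixes X :: "('p, 'a::real_normed_vector) manifold" and Y :: "('q, 'b::real_normed_vector) manifold"
    and q :: "'p \<Rightarrow> 'q" and \<kappa> :: "'p \<Rightarrow> 'p" and \<G> :: "('p \<Rightarrow> 'p) set" and H :: "('p \<Rightarrow> 'p) \<Rightarrow> 'q \<Rightarrow> 'q" and p0 :: 'p
  assumes X: "premanifold X" and Y: "premanifold Y"
    and conn: "connected_space (mtop X)" and p0: "p0 \<in> mpoints X"
    and surj: "q ` mpoints X = mpoints Y"
    and local_diffeo: "\<And>x. x \<in> mpoints X \<Longrightarrow> \<exists>S T r. x \<in> S \<and> diffeo_between X Y S T q r"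
    and \<kappa>_smooth: "\<And>x. x \<in> mpoints X \<Longrightarrow> smooth_near X X \<kappa> x"
    and \<kappa>_\<kappa>: "\<And>x. x \<in> mpoints X \<Longrightarrow> \<kappa> (\<kappa> x) = x"
    and \<kappa>_neq: "\<And>x. x \<in> mpoints X \<Longrightarrow> \<kappa> x \<noteq> x"
    and q_\<kappa>: "\<And>x. x \<in> mpoints X \<Longrightarrow> q (\<kappa> x) = q x"
    and q_fibre: "\<And>x y. x \<in> mpoints X \<Longrightarrow> y \<in> mpoints X \<Longrightarrow> q x = q y \<Longrightarrow> y = x \<or> y = \<kappa> x"
    and \<G>: "\<G> \<subseteq> smooth_maps X X"
    and \<G>_\<kappa>: "\<And>f. f \<in> \<G> \<Longrightarrow> (\<lambda>x\<in>mpoints X. \<kappa> (f x)) \<in> \<G>"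
    and H_smooth: "\<And>f. f \<in> \<G> \<Longrightarrow> H f \<in> smooth_maps Y Y"
    and H_q: "\<And>f x. f \<in> \<G> \<Longrightarrow> x \<in> mpoints X \<Longrightarrow> H f (q x) = q (f x)"
begin

section \<open>Elementary properties of the deck involution\<close>

lemma \<kappa>_in: "x \<in> mpoints X \<Longrightarrow> \<kappa> x \<in> mpoints X"
  using \<kappa>_smooth smooth_near_in_space(2) by metis

lemma \<G>_in: "f \<in> \<G> \<Longrightarrow> x \<in> mpoints X \<Longrightarrow> f x \<in> mpoints X"
  using \<G> smooth_maps_smooth_near[OF X X] smooth_near_in_space(2) by (metis subsetD)

lemma \<G>_smooth: "f \<in> \<G> \<Longrightarrow> x \<in> mpoints X \<Longrightarrow> smooth_near X X f x"
  using \<G> smooth_maps_smooth_near[OF X X] by (metis subsetD)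

lemma q_smooth: "x \<in> mpoints X \<Longrightarrow> smooth_near X Y q x"
  using local_diffeo unfolding diffeo_between_def by metis

lemma q_in: "x \<in> mpoints X \<Longrightarrow> q x \<in> mpoints Y"
  using surj by auto

lemma diffeo_inj: "diffeo_between X Y S T q r \<Longrightarrow> inj_on q S"
  unfolding diffeo_between_def inj_on_def by metis

lemma openin_q_image:
  assumes A: "openin (mtop X) A"
  shows "openin (mtop Y) (q ` A)"
proof (subst openin_subopen, rule ballI)
  fix y assume "y \<in> q ` A"
  then obtain x where x: "x \<in> A" "y = q x" by auto
  then have "x \<in> mpoints X" using openin_subset[OF A] by auto
  then obtain S T r where S: "x \<in> S" "diffeo_between X Y S T q r" using local_diffeo by meson
  then have "openin (mtop X) (A \<inter> S)" using A by (auto simp: diffeo_between_def)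
  then have "openin (mtop Y) (q ` (A \<inter> S))" by (rule diffeo_between_open_image[OF S(2)]) simp
  moreover have "y \<in> q ` (A \<inter> S)" "q ` (A \<inter> S) \<subseteq> q ` A" using x S by auto
  ultimately show "\<exists>T. openin (mtop Y) T \<and> y \<in> T \<and> T \<subseteq> q ` A" by (intro exI conjI)
qed

lemma openin_\<kappa>_image:
  assumes A: "openin (mtop X) A"
  shows "openin (mtop X) (\<kappa> ` A)"
proof -
  have "openin (mtop X) {x \<in> mpoints X. \<kappa> x \<in> A}"
    by (rule openin_smooth_vimage[OF openin_topspace \<kappa>_smooth A])
  moreover have "{x \<in> mpoints X. \<kappa> x \<in> A} = \<kappa> ` A"
  proof
    show "{x \<in> mpoints X. \<kappa> x \<in> A} \<subseteq> \<kappa> ` A"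
    proof
      fix x assume "x \<in> {x \<in> mpoints X. \<kappa> x \<in> A}"
      then show "x \<in> \<kappa> ` A" using \<kappa>_\<kappa>[of x] by (intro image_eqI[of _ _ "\<kappa> x"]) auto
    qed
    show "\<kappa> ` A \<subseteq> {x \<in> mpoints X. \<kappa> x \<in> A}"
      using openin_subset[OF A] \<kappa>_\<kappa> \<kappa>_in by (auto simp: subset_iff)
  qed
  ultimately show ?thesis by simp
qed

text \<open>\<open>\<kappa>\<close> stays in the fibre and moves every point, so a set on which
  \<open>q\<close> is injective never contains a point together with its partner.\<close>

lemma disjoint_\<kappa>_image:
  assumes "A \<subseteq> mpoints X" "inj_on q A"
  shows "A \<inter> \<kappa> ` A = {}"
proof -
  have False if "x \<in> A" "\<kappa> x \<in> A" for x
  proof -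
    have "x \<in> mpoints X" using that assms by auto
    then show False using inj_onD[OF assms(2) q_\<kappa> that(2,1)] \<kappa>_neq by simp
  qed
  then show ?thesis by blast
qed

lemma in_q_image:
  assumes "A \<subseteq> mpoints X" "x \<in> mpoints X" "q x \<in> q ` A"
  shows "x \<in> A \<or> x \<in> \<kappa> ` A"
proof -
  obtain y where y: "y \<in> A" "q y = q x" using assms(3) by force
  then show ?thesis using q_fibre[of y x] assms by auto
qed

lemma inj_on_\<kappa>_image:
  assumes "A \<subseteq> mpoints X" "inj_on q A"
  shows "inj_on q (\<kappa> ` A)" "q ` \<kappa> ` A = q ` A"
proof -
  have *: "q (\<kappa> x) = q x" if "x \<in> A" for x using q_\<kappa> assms that by blast
  then show "inj_on q (\<kappa> ` A)" using assms(2) by (auto simp: inj_on_def)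
  show "q ` \<kappa> ` A = q ` A" using * by (simp add: image_image)
qed

text \<open>Near a point of agreement both maps have values in a common set on which
  \<open>q\<close> is injective; there equality after applying \<open>q\<close> forces
  equality.\<close>

lemma openin_agree:
  assumes f: "f \<in> \<G>" and g: "g \<in> \<G>" and eq: "H f = H g"
  shows "openin (mtop X) {x \<in> mpoints X. f x = g x}"
proof (subst openin_subopen, rule ballI)
  fix x assume x: "x \<in> {x \<in> mpoints X. f x = g x}"
  then have "f x \<in> mpoints X" using \<G>_in f by blast
  then obtain S T r where S: "f x \<in> S" "diffeo_between X Y S T q r" using local_diffeo by meson
  have oS: "openin (mtop X) S" using S(2) by (simp add: diffeo_between_def)
  let ?A = "{z \<in> mpoints X. f z \<in> S} \<inter> {z \<in> mpoints X. g z \<in> S}"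
  have "openin (mtop X) ?A"
    by (intro openin_Int openin_smooth_vimage[OF openin_topspace _ oS] \<G>_smooth f g)
  moreover have "x \<in> ?A" using x S by auto
  moreover have "?A \<subseteq> {x \<in> mpoints X. f x = g x}"
  proof clarsimp
    fix z assume z: "z \<in> mpoints X" "f z \<in> S" "g z \<in> S"
    have "q (f z) = q (g z)" using H_q[OF f z(1)] H_q[OF g z(1)] eq by simp
    then show "f z = g z" using inj_onD[OF diffeo_inj[OF S(2)] _ z(2,3)] by blast
  qed
  ultimately show "\<exists>T. openin (mtop X) T \<and> x \<in> T \<and> T \<subseteq> {x \<in> mpoints X. f x = g x}" by (intro exI conjI)
qed

lemma \<G>_ext: "f \<in> \<G> \<Longrightarrow> f \<in> extensional (mpoints X)"
  using \<G> by (auto simp: smooth_maps_def)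

lemma H_\<kappa>: "f \<in> \<G> \<Longrightarrow> H (\<lambda>x\<in>mpoints X. \<kappa> (f x)) = H f"
proof -
  assume f: "f \<in> \<G>"
  let ?g = "\<lambda>x\<in>mpoints X. \<kappa> (f x)"
  have g: "?g \<in> \<G>" using \<G>_\<kappa> f by blast
  have "H ?g y = H f y" if "y \<in> mpoints Y" for y
  proof -
    obtain x where x: "x \<in> mpoints X" "y = q x" using \<open>y \<in> mpoints Y\<close> surj by auto
    then show ?thesis using H_q[OF f x(1)] H_q[OF g x(1)] q_\<kappa> \<G>_in f by simp
  qed
  moreover have "H ?g \<in> extensional (mpoints Y)" "H f \<in> extensional (mpoints Y)"
    using H_smooth f g by (auto simp: smooth_maps_def)
  ultimately show ?thesis by (intro extensionalityI)
qed

text \<open>At each point \<open>g x\<close> is either \<open>f x\<close> or its partner, never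
  both. The two agreement sets are therefore complementary, both are open by
  \<open>openin_agree\<close>, and connectedness leaves one of them empty.\<close>

lemma H_eq_cases:
  assumes f: "f \<in> \<G>" and g: "g \<in> \<G>" and eq: "H f = H g"
  shows "g = f \<or> g = (\<lambda>x\<in>mpoints X. \<kappa> (f x))"
proof -
  let ?k = "\<lambda>x\<in>mpoints X. \<kappa> (f x)"
  let ?A = "{x \<in> mpoints X. f x = g x}" and ?B = "{x \<in> mpoints X. ?k x = g x}"
  have k: "?k \<in> \<G>" by (rule \<G>_\<kappa>[OF f])
  have oA: "openin (mtop X) ?A" by (rule openin_agree[OF f g eq])
  have oB: "openin (mtop X) ?B" by (rule openin_agree[OF k g]) (simp add: H_\<kappa>[OF f] eq)
  have "?B = mpoints X - ?A"
  proof -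
    have "g x = f x \<or> g x = \<kappa> (f x)" if "x \<in> mpoints X" for x
      using q_fibre[OF \<G>_in[OF f that] \<G>_in[OF g that]] H_q[OF f that] H_q[OF g that] eq by simp
    moreover have "\<kappa> (f x) \<noteq> f x" if "x \<in> mpoints X" for x using \<kappa>_neq \<G>_in f that by blast
    ultimately have "(\<kappa> (f x) = g x) = (f x \<noteq> g x)" if "x \<in> mpoints X" for x using that by metis
    then show ?thesis by auto
  qed
  then have "closedin (mtop X) ?A" using oA oB by (auto simp: closedin_def)
  then have "?A = {} \<or> ?A = mpoints X" using conn oA unfolding connected_space_clopen_in by blast
  then show ?thesis
  proof
    assume "?A = mpoints X"
    have "g x = f x" if "x \<in> mpoints X" for x
    proof -
      have "x \<in> ?A" unfolding \<open>?A = mpoints X\<close> by (rule that)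
      then show ?thesis by simp
    qed
    then have "g = f" using \<G>_ext[OF f] \<G>_ext[OF g] by (intro extensionalityI[of g "mpoints X"]) auto
    then show ?thesis ..
  next
    assume "?A = {}"
    then have "?B = mpoints X" using \<open>?B = mpoints X - ?A\<close> by (simp only: Diff_empty)
    have "g x = ?k x" if "x \<in> mpoints X" for x
    proof -
      have "x \<in> ?B" unfolding \<open>?B = mpoints X\<close> by (rule that)
      then show ?thesis using that by auto
    qed
    then have "g = ?k" using \<G>_ext[OF k] \<G>_ext[OF g] by (intro extensionalityI[of g "mpoints X"]) auto
    then show ?thesis ..
  qed
qed

lemma continuous_map_q: "continuous_map (mtop X) (mtop Y) q"
  by (rule smooth_near_continuous_map) (rule q_smooth)

section \<open>Local control of lifts by the maps below\<close>

abbreviation "WX \<equiv> subtopology (weak_Cinf_topology X X) \<G>"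
abbreviation "WY \<equiv> subtopology (weak_Cinf_topology Y Y) (H ` \<G>)"

lemma topspace_WX: "topspace WX = \<G>"
  using \<G> by (auto simp: topspace_weak_Cinf)

lemma topspace_WY: "topspace WY = H ` \<G>"
  using H_smooth by (auto simp: topspace_weak_Cinf)

text \<open>If the map below keeps the image of \<open>C\<close> inside the image of
  \<open>W'\<close>, every \<open>f x\<close> lies in \<open>W'\<close> or in its partner set. The
  two are disjoint and open and \<open>A\<close> is connected, so a single one of them receives all
  of \<open>A\<close>.\<close>

lemma local_step:
  assumes f0: "f0 \<in> \<G>" and x0: "x0 \<in> mpoints X" and W: "openin (mtop X) W" "f0 x0 \<in> W"
  obtains A W' N where "openin (mtop X) A" "x0 \<in> A" "openin (mtop X) W'" "W' \<subseteq> W" "inj_on q W'" "f0 ` A \<subseteq> W'"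
    "openin WY N" "H f0 \<in> N"
    "\<And>f. f \<in> \<G> \<Longrightarrow> H f \<in> N \<Longrightarrow> f ` A \<subseteq> W' \<or> f ` A \<subseteq> \<kappa> ` W'"
proof -
  have f0x: "f0 x0 \<in> mpoints X" by (rule \<G>_in[OF f0 x0])
  then obtain S T r where S: "f0 x0 \<in> S" "diffeo_between X Y S T q r" using local_diffeo by meson
  obtain V \<psi> where V: "(V, \<psi>) \<in> charts Y" "q (f0 x0) \<in> V" using atlas_cover[OF Y q_in[OF f0x]] by metis
  obtain U \<phi> where U: "(U, \<phi>) \<in> charts Y" "q x0 \<in> U" using atlas_cover[OF Y q_in[OF x0]] by metis
  \<comment> \<open>Besides making \<open>q\<close> injective, the set is cut down to a chart domain
    \<open>V\<close> below, since weak neighbourhoods prescribe values only inside charts.\<close>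
  define W' where "W' = {x \<in> W \<inter> S. q x \<in> V}"
  have oS: "openin (mtop X) S" using S(2) by (simp add: diffeo_between_def)
  have oW': "openin (mtop X) W'" unfolding W'_def
  proof (rule openin_smooth_vimage[OF _ q_smooth chart_openin[OF V(1)]])
    show o: "openin (mtop X) (W \<inter> S)" using W oS by blast
    show "x \<in> mpoints X" if "x \<in> W \<inter> S" for x using openin_subset[OF o] that by blast
  qed
  have W'X: "W' \<subseteq> mpoints X" by (rule openin_subset[OF oW'])
  have inj: "inj_on q W'" by (rule inj_on_subset[OF diffeo_inj[OF S(2)]]) (auto simp: W'_def)
  have d: "(V \<inter> q ` W', \<psi>) \<in> charts Y" by (rule charts_restrict[OF Y V(1) openin_q_image[OF oW']])
  define B where "B = {x \<in> mpoints X. q x \<in> U} \<inter> {x \<in> mpoints X. f0 x \<in> W'}"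
  have oB: "openin (mtop X) B" unfolding B_def
    by (intro openin_Int openin_smooth_vimage[OF openin_topspace q_smooth chart_openin[OF U(1)]]
        openin_smooth_vimage[OF openin_topspace \<G>_smooth[OF f0] oW'])
  have "x0 \<in> B" using x0 U V W S f0 by (auto simp: B_def W'_def)
  then obtain A C where A: "openin (mtop X) A" "x0 \<in> A" "A \<subseteq> C" "C \<subseteq> B" "compactin (mtop X) C" "connectedin (mtop X) A"
    using compact_connected_neighbourhood[OF X oB] by blast
  have CX: "C \<subseteq> mpoints X" using A(4) by (auto simp: B_def)
  have qC: "compactin (mtop Y) (q ` C)" by (rule image_compactin[OF A(5) continuous_map_q])
  have qCU: "q ` C \<subseteq> U" using A(4) by (auto simp: B_def)
  have "H f0 (q x) \<in> V \<inter> q ` W'" if "x \<in> C" for x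
  proof -
    have "x \<in> mpoints X" "f0 x \<in> W'" using that A(4) by (auto simp: B_def)
    then show ?thesis using H_q[OF f0] by (auto simp: W'_def)
  qed
  then have H0: "H f0 ` q ` C \<subseteq> V \<inter> q ` W'" by blast
  obtain N where N: "openin (weak_Cinf_topology Y Y) N" "H f0 \<in> N" "\<And>g. g \<in> N \<Longrightarrow> g ` q ` C \<subseteq> V \<inter> q ` W'"
    by (rule compact_open_neighbourhood[OF H_smooth[OF f0] U(1) d qC qCU H0]) blast
  show ?thesis
  proof (rule that[OF A(1,2) oW' _ inj _ _ _])
    show "W' \<subseteq> W" by (auto simp: W'_def)
    show "f0 ` A \<subseteq> W'" using A(3,4) by (auto simp: B_def)
    show "openin WY (N \<inter> H ` \<G>)" using N(1) by (auto simp: openin_subtopology)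
    show "H f0 \<in> N \<inter> H ` \<G>" using N f0 by blast
    fix f assume f: "f \<in> \<G>" and "H f \<in> N \<inter> H ` \<G>"
    then have HC: "H f ` q ` C \<subseteq> V \<inter> q ` W'" using N(3) by blast
    have sub: "f x \<in> W' \<or> f x \<in> \<kappa> ` W'" if "x \<in> A" for x
    proof -
      have x: "x \<in> mpoints X" "x \<in> C" using that A(3) CX by auto
      then have "H f (q x) \<in> q ` W'" using HC by blast
      then have "q (f x) \<in> q ` W'" using H_q[OF f x(1)] by simp
      then show ?thesis by (rule in_q_image[OF W'X \<G>_in[OF f x(1)]])
    qed
    have "connectedin (mtop X) (f ` A)"
      by (rule connectedin_continuous_map_image[OF smooth_near_continuous_map A(6)]) (rule \<G>_smooth[OF f])
    note cc = connectedinD[OF this oW' openin_\<kappa>_image[OF oW']]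
    have "f ` A \<subseteq> W' \<union> \<kappa> ` W'" using sub by blast
    moreover have "W' \<inter> \<kappa> ` W' \<inter> f ` A = {}" using disjoint_\<kappa>_image[OF W'X inj] by blast
    ultimately have "W' \<inter> f ` A = {} \<or> \<kappa> ` W' \<inter> f ` A = {}" using cc by blast
    then show "f ` A \<subseteq> W' \<or> f ` A \<subseteq> \<kappa> ` W'" using \<open>f ` A \<subseteq> W' \<union> \<kappa> ` W'\<close> by blast
  qed
qed

text \<open>The set of points at which this holds is open and closed, and \<open>p0\<close> belongs to it.\<close>

lemma lift_compact_open:
  assumes S0: "openin (mtop X) S0" "inj_on q S0" and f0: "f0 \<in> \<G>" "f0 p0 \<in> S0"
    and x: "x \<in> mpoints X" and W: "openin (mtop X) W" "f0 x \<in> W"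
  shows "\<exists>A N. openin (mtop X) A \<and> x \<in> A \<and> openin WY N \<and> H f0 \<in> N \<and>
     (\<forall>f\<in>\<G>. f p0 \<in> S0 \<longrightarrow> H f \<in> N \<longrightarrow> f ` A \<subseteq> W)"
proof -
  \<comment> \<open>Quantifying over all \<open>W\<close> makes this a property of the point alone,
    as the connectedness argument requires.\<close>
  define good where "good = {x \<in> mpoints X. \<forall>W. openin (mtop X) W \<longrightarrow> f0 x \<in> W \<longrightarrow>
     (\<exists>A N. openin (mtop X) A \<and> x \<in> A \<and> openin WY N \<and> H f0 \<in> N \<and>
     (\<forall>f\<in>\<G>. f p0 \<in> S0 \<longrightarrow> H f \<in> N \<longrightarrow> f ` A \<subseteq> W))}"
  \<comment> \<open>One neighbourhood \<open>W0\<close> with injective \<open>q\<close> is enough: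
    for another \<open>W\<close> the alternative of \<open>local_step\<close> is decided because the
    partner of \<open>W1\<close> avoids \<open>W0\<close>.\<close>
  have goodI: "z \<in> good" if z: "z \<in> mpoints X" "z \<in> A" "openin (mtop X) W0" "f0 ` A \<subseteq> W0" "inj_on q W0"
      and N: "openin WY N" "H f0 \<in> N" "\<And>f. f \<in> \<G> \<Longrightarrow> f p0 \<in> S0 \<Longrightarrow> H f \<in> N \<Longrightarrow> f ` A \<subseteq> W0"
    for z A W0 N
    unfolding good_def
  proof (intro CollectI conjI allI impI z(1))
    fix W assume W: "openin (mtop X) W" "f0 z \<in> W"
    have "openin (mtop X) (W \<inter> W0)" "f0 z \<in> W \<inter> W0" using W z by auto
    from local_step[OF f0(1) z(1) this]
    obtain A1 W1 N1 where 1: "openin (mtop X) A1" "z \<in> A1" "openin (mtop X) W1" "W1 \<subseteq> W \<inter> W0" "inj_on q W1" "f0 ` A1 \<subseteq> W1"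
      "openin WY N1" "H f0 \<in> N1" "\<And>f. f \<in> \<G> \<Longrightarrow> H f \<in> N1 \<Longrightarrow> f ` A1 \<subseteq> W1 \<or> f ` A1 \<subseteq> \<kappa> ` W1"
      by metis
    show "\<exists>A N. openin (mtop X) A \<and> z \<in> A \<and> openin WY N \<and> H f0 \<in> N \<and>
     (\<forall>f\<in>\<G>. f p0 \<in> S0 \<longrightarrow> H f \<in> N \<longrightarrow> f ` A \<subseteq> W)"
    proof (intro exI conjI ballI impI)
      show "openin WY (N \<inter> N1)" using N 1 by blast
      show "H f0 \<in> N \<inter> N1" using N 1 by blast
      fix f assume f: "f \<in> \<G>" "f p0 \<in> S0" "H f \<in> N \<inter> N1"
      have "f z \<in> W0" using N(3)[OF f(1,2)] f(3) z by blast
      moreover have "\<kappa> ` W1 \<inter> W0 = {}"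
        using disjoint_\<kappa>_image[OF openin_subset[OF z(3)] z(5)] 1(4) by blast
      ultimately have "\<not> f ` A1 \<subseteq> \<kappa> ` W1" using 1(2) by blast
      then show "f ` A1 \<subseteq> W" using 1(9)[OF f(1)] f(3) 1(4) by blast
    qed (use 1 in auto)
  qed
  \<comment> \<open>The alternative of \<open>local_step\<close> is the same on all of
    \<open>A\<close>, so a single good point of \<open>A\<close> decides it for the others. This
    gives openness of the good set and of its complement at once.\<close>
  have spread: "\<exists>A. openin (mtop X) A \<and> z \<in> A \<and> (\<forall>y\<in>A \<inter> good. A \<subseteq> good)" if z: "z \<in> mpoints X" for z
  proof -
    have "f0 z \<in> mpoints X" by (rule \<G>_in[OF f0(1) z])
    from local_step[OF f0(1) z openin_topspace this]
    obtain A W' N where 1: "openin (mtop X) A" "z \<in> A" "openin (mtop X) W'" "inj_on q W'" "f0 ` A \<subseteq> W'"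
      "openin WY N" "H f0 \<in> N" "\<And>f. f \<in> \<G> \<Longrightarrow> H f \<in> N \<Longrightarrow> f ` A \<subseteq> W' \<or> f ` A \<subseteq> \<kappa> ` W'"
      by metis
    have "A \<subseteq> good" if y: "y \<in> A" "y \<in> good" for y
    proof
      fix w assume w: "w \<in> A"
      have "f0 y \<in> W'" using 1 y by blast
      then obtain A' N' where 2: "openin (mtop X) A'" "y \<in> A'" "openin WY N'" "H f0 \<in> N'"
        "\<forall>f\<in>\<G>. f p0 \<in> S0 \<longrightarrow> H f \<in> N' \<longrightarrow> f ` A' \<subseteq> W'"
        using y(2) 1(3) unfolding good_def by blast
      show "w \<in> good"
      proof (rule goodI[OF _ w 1(3,5,4)])
        show "w \<in> mpoints X" using w openin_subset[OF 1(1)] by blast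
        show "openin WY (N \<inter> N')" "H f0 \<in> N \<inter> N'" using 1 2 by blast+
        fix f assume f: "f \<in> \<G>" "f p0 \<in> S0" "H f \<in> N \<inter> N'"
        then have "f y \<in> W'" using 2 by blast
        then have "\<not> f ` A \<subseteq> \<kappa> ` W'" using disjoint_\<kappa>_image[OF openin_subset[OF 1(3)] 1(4)] y(1) by blast
        then show "f ` A \<subseteq> W'" using 1(8)[OF f(1)] f(3) by blast
      qed
    qed
    then show ?thesis using 1 by blast
  qed
  \<comment> \<open>At the base point the condition \<open>f p0 \<in> S0\<close> excludes the
    partner of \<open>W'\<close>.\<close>
  have "p0 \<in> good"
  proof -
    from local_step[OF f0(1) p0 S0(1) f0(2)]
    obtain A W' N where 1: "openin (mtop X) A" "p0 \<in> A" "openin (mtop X) W'" "W' \<subseteq> S0" "inj_on q W'" "f0 ` A \<subseteq> W'"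
      "openin WY N" "H f0 \<in> N" "\<And>f. f \<in> \<G> \<Longrightarrow> H f \<in> N \<Longrightarrow> f ` A \<subseteq> W' \<or> f ` A \<subseteq> \<kappa> ` W'"
      by metis
    show ?thesis
    proof (rule goodI[OF p0 1(2,3,6,5,7,8)])
      fix f assume f: "f \<in> \<G>" "f p0 \<in> S0" "H f \<in> N"
      have "\<kappa> ` W' \<inter> S0 = {}" using disjoint_\<kappa>_image[OF openin_subset[OF S0(1)] S0(2)] 1(4) by blast
      then have "\<not> f ` A \<subseteq> \<kappa> ` W'" using f(2) 1(2) by blast
      then show "f ` A \<subseteq> W'" using 1(9)[OF f(1,3)] by blast
    qed
  qed
  moreover have "openin (mtop X) good"
  proof (subst openin_subopen, rule ballI)
    fix z assume z: "z \<in> good"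
    then have "z \<in> mpoints X" by (simp add: good_def)
    from spread[OF this] obtain A where "openin (mtop X) A" "z \<in> A" "\<forall>y\<in>A \<inter> good. A \<subseteq> good" by (elim exE conjE)
    moreover from this z have "A \<subseteq> good" by blast
    ultimately show "\<exists>T. openin (mtop X) T \<and> z \<in> T \<and> T \<subseteq> good" by (intro exI conjI)
  qed
  moreover have "openin (mtop X) (mpoints X - good)"
  proof (subst openin_subopen, rule ballI)
    fix z assume z: "z \<in> mpoints X - good"
    then have "z \<in> mpoints X" by simp
    from spread[OF this] obtain A where A: "openin (mtop X) A" "z \<in> A" "\<forall>y\<in>A \<inter> good. A \<subseteq> good" by (elim exE conjE)
    then have "A \<subseteq> mpoints X - good" using openin_subset[OF A(1)] z by blast
    with A(1,2) show "\<exists>T. openin (mtop X) T \<and> z \<in> T \<and> T \<subseteq> mpoints X - good" by (intro exI conjI)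
  qed
  moreover have "good \<subseteq> mpoints X" unfolding good_def by (rule Collect_restrict)
  ultimately have "openin (mtop X) good" "closedin (mtop X) good" "good \<noteq> {}"
    unfolding closedin_def by auto
  then have "good = mpoints X" using conn unfolding connected_space_clopen_in by blast
  then have "x \<in> good" using x by simp
  then show ?thesis using W unfolding good_def by simp
qed

text \<open>The charts prescribed below are pulled back along \<open>q\<close>; transported again
  they return the original coordinates, so the first estimate of \<open>Ck_norm_transport\<close>
  applies. The local test at a point of \<open>Y\<close> is made at one of its preimages.\<close>

lemma continuous_map_H: "continuous_map WX WY H"
proof -
  have "continuous_map WX (weak_Cinf_topology Y Y) H"
  proof (rule continuous_map_weak_Cinf[OF Y Y])
    show "H f \<in> smooth_maps Y Y" if "f \<in> topspace WX" for f
      using that H_smooth unfolding topspace_WX by blast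
    fix f0 y U \<phi> V \<psi> k and \<epsilon> :: real
    assume "f0 \<in> topspace WX" and U: "(U, \<phi>) \<in> charts Y" "y \<in> U" and V: "(V, \<psi>) \<in> charts Y" "H f0 y \<in> V" and \<epsilon>: "\<epsilon> > 0"
    then have f0: "f0 \<in> \<G>" unfolding topspace_WX by simp
    have "y \<in> mpoints Y" using U chart_subset by blast
    then obtain x where x: "x \<in> mpoints X" "y = q x" using surj by auto
    obtain S T r where S: "x \<in> S" "diffeo_between X Y S T q r" using local_diffeo[OF x(1)] by (elim exE conjE)
    have f0x: "f0 x \<in> mpoints X" by (rule \<G>_in[OF f0 x(1)])
    obtain S' T' r' where S': "f0 x \<in> S'" "diffeo_between X Y S' T' q r'" using local_diffeo[OF f0x] by (elim exE conjE)
    obtain L :: "'a \<Rightarrow> 'b" and M where L: "linear_iso_pair L M" by (rule diffeo_between_linear_iso[OF X Y S(2,1)])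
    have Lb: "\<And>x. L (M x) = x" using L by (simp add: linear_iso_pair_def)
    define V1 where "V1 = {z \<in> S'. q z \<in> V}"
    have oV1: "openin (mtop X) V1" unfolding V1_def
      by (rule openin_smooth_vimage[OF _ _ chart_openin[OF V(1)]])
         (use S'(2) in \<open>auto simp: diffeo_between_def\<close>)
    have V1: "V1 \<subseteq> S'" "q ` V1 \<subseteq> V" by (auto simp: V1_def)
    define U1 where "U1 = {z \<in> S. q z \<in> U} \<inter> {z \<in> mpoints X. f0 z \<in> V1}"
    have oU1: "openin (mtop X) U1" unfolding U1_def
    proof (rule openin_Int)
      show "openin (mtop X) {z \<in> S. q z \<in> U}"
        by (rule openin_smooth_vimage[OF _ _ chart_openin[OF U(1)]])
           (use S(2) in \<open>auto simp: diffeo_between_def\<close>)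
      show "openin (mtop X) {z \<in> mpoints X. f0 z \<in> V1}"
        by (rule openin_smooth_vimage[OF openin_topspace \<G>_smooth[OF f0] oV1])
    qed
    have U1: "U1 \<subseteq> S" "x \<in> U1" "q ` U1 \<subseteq> U" "f0 ` U1 \<subseteq> V1"
      using S(1) S'(1) U(2) V(2) x H_q[OF f0 x(1)] by (auto simp: U1_def V1_def)
    obtain A C where A: "openin (mtop X) A" "x \<in> A" "A \<subseteq> C" "C \<subseteq> U1" "compactin (mtop X) C"
      using compact_connected_neighbourhood[OF X oU1 U1(2)] by metis
    have rq: "r (q z) = z" if "z \<in> U1" for z using that U1(1) S(2) by (auto simp: diffeo_between_def)
    have rq': "r' (q z) = z" if "z \<in> V1" for z using that V1(1) S'(2) by (auto simp: diffeo_between_def)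
    have cU: "(q ` U1, \<phi>) \<in> charts Y"
      using charts_restrict[OF Y U(1) openin_q_image[OF oU1]] U1(3) by (simp add: Int_absorb1)
    have cV: "(q ` V1, \<psi>) \<in> charts Y"
      using charts_restrict[OF Y V(1) openin_q_image[OF oV1]] V1(2) by (simp add: Int_absorb1)
    \<comment> \<open>\<open>M\<close> brings the coordinates into the model space of
      \<open>X\<close>; the outer \<open>L\<close> in \<open>?\<Phi>\<close> undoes it.\<close>
    define \<phi>1 where "\<phi>1 = (\<lambda>x. M (\<phi> (q x)))"
    define \<psi>1 where "\<psi>1 = (\<lambda>x. M (\<psi> (q x)))"
    have "r ` q ` U1 = U1" using rq by force
    then have c1: "(U1, \<phi>1) \<in> charts X"
      using diffeo_between_chart(1)[OF Y X diffeo_between_sym[OF diffeo_between_subset[OF S(2) oU1 U1(1)]]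
          linear_iso_pair_sym[OF L] cU order_refl] by (simp add: \<phi>1_def)
    have "r' ` q ` V1 = V1" using rq' by force
    then have d1: "(V1, \<psi>1) \<in> charts X"
      using diffeo_between_chart(1)[OF Y X diffeo_between_sym[OF diffeo_between_subset[OF S'(2) oV1 V1(1)]]
          linear_iso_pair_sym[OF L] cV order_refl] by (simp add: \<psi>1_def)
    let ?\<Phi> = "\<lambda>y. L (\<phi>1 (r y))"
    have \<Phi>: "?\<Phi> z = \<phi> z" if "z \<in> q ` U1" for z
      using that rq Lb by (auto simp: \<phi>1_def)
    obtain B where B: "B > 0" "\<And>f g F G K. f \<in> smooth_maps X X \<Longrightarrow> g \<in> smooth_maps X X \<Longrightarrow> compactin (mtop X) K \<Longrightarrow> K \<subseteq> U1 \<Longrightarrow>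
      f ` K \<subseteq> V1 \<Longrightarrow> g ` K \<subseteq> V1 \<Longrightarrow> (\<And>x. x \<in> mpoints X \<Longrightarrow> F (q x) = q (f x)) \<Longrightarrow> (\<And>x. x \<in> mpoints X \<Longrightarrow> G (q x) = q (g x)) \<Longrightarrow>
      Ck_norm k (?\<Phi> ` q ` K)
        (\<lambda>y. L (\<psi>1 (r' (F (inv_into (q ` U1) ?\<Phi> y)))) - L (\<psi>1 (r' (G (inv_into (q ` U1) ?\<Phi> y)))))
      \<le> B * Ck_norm k (\<phi>1 ` K) (\<lambda>y. \<psi>1 (f (inv_into U1 \<phi>1 y)) - \<psi>1 (g (inv_into U1 \<phi>1 y)))"
      proof (rule Ck_norm_transport[OF X Y S(2) S'(2) L L c1 U1(1) d1 V1(1), of k], goal_cases)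
      case (1 B)
      show ?case by (rule that[OF 1(2) 1(3)])
    qed
    \<comment> \<open>The radius is divided by \<open>B\<close> to absorb the factor in the
      estimate.\<close>
    define N where "N = weak_nbhd X X f0 (U1, \<phi>1) (V1, \<psi>1) C k (\<epsilon> / B) \<inter> \<G>"
    have f0s: "f0 \<in> smooth_maps X X" using f0 \<G> by blast
    have f0C: "f0 ` C \<subseteq> V1" using A(4) U1(4) by blast
    have "openin WX N" unfolding N_def
      using openin_weak_nbhd[OF f0s c1 d1 A(5,4) f0C, of "\<epsilon> / B" k] \<epsilon> B(1)
      by (auto simp: openin_subtopology)
    moreover have "f0 \<in> N" unfolding N_def using f0 f0s f0C \<epsilon> B(1) by (auto simp: mem_weak_nbhd)
    moreover have *: "H f ` q ` C \<subseteq> V \<and>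
        Ck_norm k (\<phi> ` q ` C) (\<lambda>y. \<psi> (H f0 (inv_into U \<phi> y)) - \<psi> (H f (inv_into U \<phi> y))) < \<epsilon>"
      if f: "f \<in> N" for f
    proof
      have fG: "f \<in> \<G>" and fs: "f \<in> smooth_maps X X" and fC: "f ` C \<subseteq> V1"
        and less: "Ck_norm k (\<phi>1 ` C) (\<lambda>y. \<psi>1 (f0 (inv_into U1 \<phi>1 y)) - \<psi>1 (f (inv_into U1 \<phi>1 y))) < \<epsilon> / B"
        using f unfolding N_def Int_iff mem_weak_nbhd by auto
      have CX: "C \<subseteq> mpoints X" using A(5) by (rule compactin_subset_topspace)
      have Hq: "H f (q z) = q (f z)" if "z \<in> C" for z using H_q[OF fG] CX that by blast
      have HC: "H f ` q ` C \<subseteq> q ` V1" using Hq fC by auto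
      then show "H f ` q ` C \<subseteq> V" using V1(2) by blast
      have H0C: "H f0 ` q ` C \<subseteq> q ` V1" using H_q[OF f0] CX f0C by (auto simp: subset_iff image_subset_iff)
      have sm: "{H f0, H f} \<subseteq> smooth_maps Y Y" using H_smooth f0 fG by blast
      define D where "D = \<phi> ` {y \<in> q ` U1. \<forall>g\<in>{H f0, H f}. g y \<in> q ` V1}"
      have oD: "open D" unfolding D_def
        by (rule chart_open_image[OF cU open_chart_vimages(1)[OF Y Y cU cV sm]]) auto
      have CD: "\<phi> ` q ` C \<subseteq> D" unfolding D_def using A(4) HC H0C by (intro image_mono) auto
      have im: "?\<Phi> ` q ` C = \<phi> ` q ` C" by (rule image_cong[OF refl \<Phi>]) (use A(4) in auto)
      have "Ck_norm k (\<phi> ` q ` C) (\<lambda>y. \<psi> (H f0 (inv_into U \<phi> y)) - \<psi> (H f (inv_into U \<phi> y)))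
         = Ck_norm k (?\<Phi> ` q ` C) (\<lambda>y. L (\<psi>1 (r' (H f0 (inv_into (q ` U1) ?\<Phi> y)))) - L (\<psi>1 (r' (H f (inv_into (q ` U1) ?\<Phi> y)))))"
        unfolding im
      proof (rule Ck_norm_cong[OF oD CD])
        fix y assume "y \<in> D"
        then obtain z where z: "z \<in> U1" "y = \<phi> (q z)" "H f0 (q z) \<in> q ` V1" "H f (q z) \<in> q ` V1"
          by (auto simp: D_def)
        have "inv_into U \<phi> y = q z" unfolding z(2) by (rule chart_inv[OF U(1)]) (use U1(3) z in blast)
        moreover have "inv_into (q ` U1) ?\<Phi> y = q z"
        proof -
          have "y = ?\<Phi> (q z)" using \<Phi>[of "q z"] z by simp
          moreover have "inj_on ?\<Phi> (q ` U1)" using inj_on_cong[of "q ` U1" ?\<Phi> \<phi>] \<Phi> chart_inj[OF cU] by blast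
          from inv_into_f_f[OF this imageI[OF z(1)]] have "inv_into (q ` U1) ?\<Phi> (?\<Phi> (q z)) = q z" .
          ultimately show ?thesis by (rule ssubst)
        qed
        moreover have "L (\<psi>1 (r' w)) = \<psi> w" if "w \<in> q ` V1" for w
          using that rq' Lb by (auto simp: \<psi>1_def)
        ultimately show "\<psi> (H f0 (inv_into U \<phi> y)) - \<psi> (H f (inv_into U \<phi> y)) =
           L (\<psi>1 (r' (H f0 (inv_into (q ` U1) ?\<Phi> y)))) - L (\<psi>1 (r' (H f (inv_into (q ` U1) ?\<Phi> y))))"
          using z by simp
      qed
      also have "\<dots> \<le> B * Ck_norm k (\<phi>1 ` C) (\<lambda>y. \<psi>1 (f0 (inv_into U1 \<phi>1 y)) - \<psi>1 (f (inv_into U1 \<phi>1 y)))"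
        by (rule B(2)[OF f0s fs A(5,4) f0C fC H_q[OF f0] H_q[OF fG]])
      also have "\<dots> < B * (\<epsilon> / B)" by (rule mult_strict_left_mono[OF less B(1)])
      also have "\<dots> = \<epsilon>" using B(1) by simp
      finally show "Ck_norm k (\<phi> ` q ` C) (\<lambda>y. \<psi> (H f0 (inv_into U \<phi> y)) - \<psi> (H f (inv_into U \<phi> y))) < \<epsilon>" .
    qed
    have "\<forall>f\<in>N. H f ` q ` C \<subseteq> V \<and>
        Ck_norm k (\<phi> ` q ` C) (\<lambda>y. \<psi> (H f0 (inv_into U \<phi> y)) - \<psi> (H f (inv_into U \<phi> y))) < \<epsilon>"
      by (rule ballI) (rule *)
    moreover have "openin (mtop Y) (q ` A)" "y \<in> q ` A" "q ` A \<subseteq> q ` C" "compactin (mtop Y) (q ` C)" "q ` C \<subseteq> U"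
      using openin_q_image[OF A(1)] x A image_compactin[OF A(5) continuous_map_q] U1(3) by auto
    ultimately show "\<exists>A C N. openin (mtop Y) A \<and> y \<in> A \<and> A \<subseteq> C \<and> compactin (mtop Y) C \<and> C \<subseteq> U \<and> openin WX N \<and> f0 \<in> N \<and>
        (\<forall>z\<in>N. H z ` C \<subseteq> V \<and>
          Ck_norm k (\<phi> ` C) (\<lambda>y. \<psi> (H f0 (inv_into U \<phi> y)) - \<psi> (H z (inv_into U \<phi> y))) < \<epsilon>)"
      by (intro exI conjI)
  qed
  then show ?thesis using topspace_WX by (auto simp: continuous_map_in_subtopology)
qed

text \<open>A single point is compact, and a chart of the target shrunk to \<open>W\<close> turns
  the compact-open condition at this point into a condition on one value.\<close>

lemma openin_evaluation:
  fixes Z :: "('r, 'c::real_normed_vector) manifold"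
  assumes Z: "premanifold Z" and z: "z \<in> mpoints Z" and W: "openin (mtop Z) W"
  shows "openin (weak_Cinf_topology Z Z) {f \<in> smooth_maps Z Z. f z \<in> W}"
proof (subst openin_subopen, rule ballI)
  fix f assume "f \<in> {f \<in> smooth_maps Z Z. f z \<in> W}"
  then have f: "f \<in> smooth_maps Z Z" "f z \<in> W" by auto
  then have "f z \<in> mpoints Z" using openin_subset[OF W] by blast
  then obtain V \<psi> where V: "(V, \<psi>) \<in> charts Z" "f z \<in> V" by (rule atlas_cover[OF Z])
  obtain U \<phi> where U: "(U, \<phi>) \<in> charts Z" "z \<in> U" by (rule atlas_cover[OF Z z])
  have d: "(V \<inter> W, \<psi>) \<in> charts Z" by (rule charts_restrict[OF Z V(1) W])
  have "compactin (mtop Z) {z}" using z by simp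
  then obtain N where N: "openin (weak_Cinf_topology Z Z) N" "f \<in> N" "\<And>g. g \<in> N \<Longrightarrow> g ` {z} \<subseteq> V \<inter> W"
    by (rule compact_open_neighbourhood[OF f(1) U(1) d]) (use f U V in auto)
  have "N \<subseteq> smooth_maps Z Z" using openin_subset[OF N(1)] by (simp add: topspace_weak_Cinf)
  then have "N \<subseteq> {f \<in> smooth_maps Z Z. f z \<in> W}" using N(3) by blast
  then show "\<exists>T. openin (weak_Cinf_topology Z Z) T \<and> f \<in> T \<and> T \<subseteq> {f \<in> smooth_maps Z Z. f z \<in> W}"
    using N(1,2) by (intro exI conjI)
qed

section \<open>Sheets over a neighbourhood and continuity of lifting\<close>

definition sheet :: "'p set \<Rightarrow> ('p \<Rightarrow> 'p) set" where
  "sheet S = {f \<in> \<G>. f p0 \<in> S}"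

text \<open>A choice, which \<open>H_inj_sheet\<close> makes unique as soon as \<open>S\<close> is
  open and \<open>q\<close> is injective on it.\<close>

definition lift :: "'p set \<Rightarrow> ('q \<Rightarrow> 'q) \<Rightarrow> 'p \<Rightarrow> 'p" where
  "lift S F = (SOME f. f \<in> sheet S \<and> H f = F)"

text \<open>The only other candidate has the partner of \<open>f p0\<close> as its value at the base
  point, and that lies outside \<open>S\<close>.\<close>

lemma H_inj_sheet:
  assumes S: "openin (mtop X) S" "inj_on q S" and "f \<in> sheet S" "g \<in> sheet S" "H f = H g"
  shows "f = g"
proof (rule ccontr)
  assume "f \<noteq> g"
  then have "g = (\<lambda>x\<in>mpoints X. \<kappa> (f x))" using H_eq_cases[of f g] assms by (auto simp: sheet_def)
  then have "g p0 = \<kappa> (f p0)" using p0 by simp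
  then show False
    using disjoint_\<kappa>_image[OF openin_subset[OF S(1)] S(2)] assms(3,4) by (auto simp: sheet_def)
qed

text \<open>If \<open>f p0\<close> falls into the partner of \<open>S\<close>, composing with
  \<open>\<kappa>\<close> moves it into \<open>S\<close> without changing the map below. The
  right-hand side sees only the image of \<open>S\<close>, so \<open>S\<close> and its partner have
  the same image of sheets, and this image is open.\<close>

lemma H_sheet_image:
  assumes S: "openin (mtop X) S"
  shows "H ` sheet S = {F \<in> H ` \<G>. F (q p0) \<in> q ` S}"
proof
  show "H ` sheet S \<subseteq> {F \<in> H ` \<G>. F (q p0) \<in> q ` S}"
    using H_q[OF _ p0] by (auto simp: sheet_def)
  show "{F \<in> H ` \<G>. F (q p0) \<in> q ` S} \<subseteq> H ` sheet S"
  proof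
    fix F assume "F \<in> {F \<in> H ` \<G>. F (q p0) \<in> q ` S}"
    then obtain f where f: "f \<in> \<G>" "F = H f" "q (f p0) \<in> q ` S" using H_q[OF _ p0] by auto
    have "f p0 \<in> mpoints X" by (rule \<G>_in[OF f(1) p0])
    from in_q_image[OF openin_subset[OF S] this f(3)]
    show "F \<in> H ` sheet S"
    proof
      assume "f p0 \<in> S"
      then show ?thesis using f by (auto simp: sheet_def)
    next
      assume "f p0 \<in> \<kappa> ` S"
      then have "\<kappa> (f p0) \<in> S" using \<kappa>_\<kappa> openin_subset[OF S] by auto
      then have "(\<lambda>x\<in>mpoints X. \<kappa> (f x)) \<in> sheet S" using \<G>_\<kappa>[OF f(1)] p0 by (simp add: sheet_def)
      moreover have "F = H (\<lambda>x\<in>mpoints X. \<kappa> (f x))" using H_\<kappa>[OF f(1)] f(2) by simp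
      ultimately show ?thesis by blast
    qed
  qed
qed

lemma lift:
  assumes S: "openin (mtop X) S" and "F \<in> H ` sheet S"
  shows "lift S F \<in> sheet S" "H (lift S F) = F"
proof -
  have "\<exists>f. f \<in> sheet S \<and> H f = F" using assms(2) by auto
  from someI_ex[OF this] show "lift S F \<in> sheet S" "H (lift S F) = F" unfolding lift_def by auto
qed

lemma openin_sheet:
  assumes S: "openin (mtop X) S"
  shows "openin WX (sheet S)" "openin WY (H ` sheet S)"
proof -
  have "sheet S = {f \<in> smooth_maps X X. f p0 \<in> S} \<inter> \<G>" using \<G> by (auto simp: sheet_def)
  then show "openin WX (sheet S)"
    using openin_evaluation[OF X p0 S] by (auto simp: openin_subtopology)
  have "H ` sheet S = {F \<in> smooth_maps Y Y. F (q p0) \<in> q ` S} \<inter> H ` \<G>"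
    unfolding H_sheet_image[OF S] using H_smooth by auto
  then show "openin WY (H ` sheet S)"
    using openin_evaluation[OF Y q_in[OF p0] openin_q_image[OF S]] by (auto simp: openin_subtopology)
qed

text \<open>Closeness below does not by itself say where a lift goes; that is supplied by
  \<open>lift_compact_open\<close>. Once the lifts send \<open>C\<close> into one chart, the second
  estimate of \<open>Ck_norm_transport\<close> controls their derivatives.\<close>

lemma continuous_map_lift:
  assumes S0: "openin (mtop X) S0" "inj_on q S0"
  shows "continuous_map (subtopology WY (H ` sheet S0)) (weak_Cinf_topology X X) (lift S0)" (is "continuous_map ?Z _ _")
proof (rule continuous_map_weak_Cinf[OF X X])
  have Z: "topspace ?Z = H ` sheet S0"
    using topspace_WY unfolding topspace_subtopology by (auto simp: sheet_def)
  show "lift S0 F \<in> smooth_maps X X" if "F \<in> topspace ?Z" for F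
    using lift(1)[OF S0(1)] that \<G> unfolding Z by (auto simp: sheet_def)
  fix F0 x U \<phi> V \<psi> k and \<epsilon> :: real
  assume "F0 \<in> topspace ?Z" and U: "(U, \<phi>) \<in> charts X" "x \<in> U" and V: "(V, \<psi>) \<in> charts X" "lift S0 F0 x \<in> V" and \<epsilon>: "\<epsilon> > 0"
  define f0 where "f0 = lift S0 F0"
  have F0: "F0 \<in> H ` sheet S0" using \<open>F0 \<in> topspace ?Z\<close> unfolding Z .
  have f0: "f0 \<in> \<G>" "f0 p0 \<in> S0" "H f0 = F0"
    using lift[OF S0(1) F0] by (auto simp: f0_def sheet_def)
  have f0s: "f0 \<in> smooth_maps X X" using f0 \<G> by blast
  have x: "x \<in> mpoints X" using U chart_subset by blast
  obtain S T r where S: "x \<in> S" "diffeo_between X Y S T q r" using local_diffeo[OF x] by (elim exE conjE)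
  have f0x: "f0 x \<in> mpoints X" by (rule \<G>_in[OF f0(1) x])
  obtain S' T' r' where S': "f0 x \<in> S'" "diffeo_between X Y S' T' q r'" using local_diffeo[OF f0x] by (elim exE conjE)
  obtain L :: "'a \<Rightarrow> 'b" and M where L: "linear_iso_pair L M" by (rule diffeo_between_linear_iso[OF X Y S(2,1)])
  have oS: "openin (mtop X) S" "openin (mtop X) S'" using S S' by (auto simp: diffeo_between_def)
  define V1 where "V1 = V \<inter> S'"
  have d1: "(V1, \<psi>) \<in> charts X" unfolding V1_def by (rule charts_restrict[OF X V(1) oS(2)])
  have V1: "V1 \<subseteq> S'" "f0 x \<in> V1" "V1 \<subseteq> V" using V S' by (auto simp: V1_def f0_def)
  obtain A1 N1 where A1: "openin (mtop X) A1" "x \<in> A1" "openin WY N1" "H f0 \<in> N1"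
     "\<forall>f\<in>\<G>. f p0 \<in> S0 \<longrightarrow> H f \<in> N1 \<longrightarrow> f ` A1 \<subseteq> V1"
    using lift_compact_open[OF S0 f0(1,2) x chart_openin[OF d1] V1(2)] by (elim exE conjE)
  have f0A: "f0 ` A1 \<subseteq> V1" using A1(4,5) f0 by blast
  \<comment> \<open>Contained in \<open>A1\<close>, so that lifts of maps in \<open>N1\<close> send
    it into \<open>V1\<close>, and in \<open>S\<close>, so that its chart can be transported along
    \<open>q\<close>.\<close>
  define U1 where "U1 = U \<inter> (S \<inter> A1)"
  have c1: "(U1, \<phi>) \<in> charts X" unfolding U1_def
    by (rule charts_restrict[OF X U(1)]) (use oS A1 in blast)
  have U1: "U1 \<subseteq> S" "x \<in> U1" "U1 \<subseteq> U" "U1 \<subseteq> A1" using S U A1 by (auto simp: U1_def)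
  obtain A C where A: "openin (mtop X) A" "x \<in> A" "A \<subseteq> C" "C \<subseteq> U1" "compactin (mtop X) C"
    using compact_connected_neighbourhood[OF X chart_openin[OF c1] U1(2)] by metis
  have CX: "C \<subseteq> mpoints X" using A(5) by (rule compactin_subset_topspace)
  let ?\<Phi> = "\<lambda>y. L (\<phi> (r y))" and ?\<Psi> = "\<lambda>y. L (\<psi> (r' y))"
  obtain B where B: "B > 0" "\<And>f g F G K. f \<in> smooth_maps X X \<Longrightarrow> g \<in> smooth_maps X X \<Longrightarrow> compactin (mtop X) K \<Longrightarrow> K \<subseteq> U1 \<Longrightarrow>
      f ` K \<subseteq> V1 \<Longrightarrow> g ` K \<subseteq> V1 \<Longrightarrow> (\<And>x. x \<in> mpoints X \<Longrightarrow> F (q x) = q (f x)) \<Longrightarrow> (\<And>x. x \<in> mpoints X \<Longrightarrow> G (q x) = q (g x)) \<Longrightarrow>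
      Ck_norm k (\<phi> ` K) (\<lambda>y. \<psi> (f (inv_into U1 \<phi> y)) - \<psi> (g (inv_into U1 \<phi> y)))
      \<le> B * Ck_norm k (?\<Phi> ` q ` K)
        (\<lambda>y. ?\<Psi> (F (inv_into (q ` U1) ?\<Phi> y)) - ?\<Psi> (G (inv_into (q ` U1) ?\<Phi> y)))"
    proof (rule Ck_norm_transport[OF X Y S(2) S'(2) L L c1 U1(1) d1 V1(1), of k], goal_cases)
      case (1 B)
      show ?case by (rule that[OF 1(2) 1(4)])
    qed
  have cY: "(q ` U1, ?\<Phi>) \<in> charts Y" by (rule diffeo_between_chart(1)[OF X Y S(2) L c1 U1(1)])
  have dY: "(q ` V1, ?\<Psi>) \<in> charts Y" by (rule diffeo_between_chart(1)[OF X Y S'(2) L d1 V1(1)])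
  have qC: "compactin (mtop Y) (q ` C)" by (rule image_compactin[OF A(5) continuous_map_q])
  have qCU: "q ` C \<subseteq> q ` U1" using A(4) by blast
  have H0C: "H f0 ` q ` C \<subseteq> q ` V1"
  proof -
    have "H f0 (q z) \<in> q ` V1" if "z \<in> C" for z
    proof -
      have "z \<in> mpoints X" "f0 z \<in> V1" using that CX A(4) U1(4) f0A by blast+
      then show ?thesis using H_q[OF f0(1)] by simp
    qed
    then show ?thesis by blast
  qed
  have H0s: "H f0 \<in> smooth_maps Y Y" by (rule H_smooth[OF f0(1)])
  define N2 where "N2 = weak_nbhd Y Y (H f0) (q ` U1, ?\<Phi>) (q ` V1, ?\<Psi>) (q ` C) k (\<epsilon> / B)"
  have oN2: "openin (weak_Cinf_topology Y Y) N2" unfolding N2_def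
    by (rule openin_weak_nbhd[OF H0s cY dY qC qCU H0C]) (use \<epsilon> B in simp)
  have H0N2: "H f0 \<in> N2" unfolding N2_def mem_weak_nbhd using H0s H0C \<epsilon> B(1) by simp
  \<comment> \<open>\<open>N1\<close> selects the local values of the lift, \<open>N2\<close> bounds
    its derivatives.\<close>
  define N where "N = N1 \<inter> N2 \<inter> H ` sheet S0"
  have "openin ?Z N"
  proof -
    have "openin WY (N2 \<inter> H ` \<G>)" using oN2 by (auto simp: openin_subtopology)
    then have "openin WY (N1 \<inter> (N2 \<inter> H ` \<G>))" using A1(3) by blast
    then have "openin ?Z (N1 \<inter> (N2 \<inter> H ` \<G>) \<inter> H ` sheet S0)" by (rule openin_subtopology_Int)
    moreover have "N1 \<inter> (N2 \<inter> H ` \<G>) \<inter> H ` sheet S0 = N" by (auto simp: N_def sheet_def)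
    ultimately show ?thesis by simp
  qed
  moreover have "F0 \<in> N" using A1(4) H0N2 F0 f0(3) by (simp add: N_def)
  moreover have *: "lift S0 F ` C \<subseteq> V \<and>
      Ck_norm k (\<phi> ` C) (\<lambda>y. \<psi> (lift S0 F0 (inv_into U \<phi> y)) - \<psi> (lift S0 F (inv_into U \<phi> y))) < \<epsilon>"
    if FN: "F \<in> N" for F
  proof -
    have "F \<in> H ` sheet S0" using FN by (simp add: N_def)
    define f where "f = lift S0 F"
    have f: "f \<in> \<G>" "f p0 \<in> S0" "H f = F"
      using lift[OF S0(1) \<open>F \<in> H ` sheet S0\<close>] by (auto simp: f_def sheet_def)
    have fs: "f \<in> smooth_maps X X" using f \<G> by blast
    have fA: "f ` A1 \<subseteq> V1" using A1(5) f FN by (auto simp: N_def)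
    have fC: "f ` C \<subseteq> V1" "f0 ` C \<subseteq> V1" using fA f0A A(4) U1(4) by blast+
    have less: "Ck_norm k (?\<Phi> ` q ` C) (\<lambda>y. ?\<Psi> (H f0 (inv_into (q ` U1) ?\<Phi> y)) - ?\<Psi> (H f (inv_into (q ` U1) ?\<Phi> y))) < \<epsilon> / B"
      using FN f(3) unfolding N_def N2_def by (simp add: mem_weak_nbhd)
    have "Ck_norm k (\<phi> ` C) (\<lambda>y. \<psi> (f0 (inv_into U \<phi> y)) - \<psi> (f (inv_into U \<phi> y)))
       = Ck_norm k (\<phi> ` C) (\<lambda>y. \<psi> (f0 (inv_into U1 \<phi> y)) - \<psi> (f (inv_into U1 \<phi> y)))"
    proof (rule Ck_norm_cong)
      show "open (\<phi> ` U1)" by (rule chart_open_image[OF c1 chart_openin[OF c1]]) simp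
      show "\<phi> ` C \<subseteq> \<phi> ` U1" using A(4) by (rule image_mono)
      fix y assume "y \<in> \<phi> ` U1"
      then obtain z where "z \<in> U1" "y = \<phi> z" by auto
      then show "\<psi> (f0 (inv_into U \<phi> y)) - \<psi> (f (inv_into U \<phi> y)) = \<psi> (f0 (inv_into U1 \<phi> y)) - \<psi> (f (inv_into U1 \<phi> y))"
        using chart_inv[OF c1] chart_inv[OF U(1)] U1(3) by (simp add: subset_iff)
    qed
    also have "\<dots> \<le> B * Ck_norm k (?\<Phi> ` q ` C) (\<lambda>y. ?\<Psi> (H f0 (inv_into (q ` U1) ?\<Phi> y)) - ?\<Psi> (H f (inv_into (q ` U1) ?\<Phi> y)))"
      by (rule B(2)[OF f0s fs A(5,4) fC(2,1) H_q[OF f0(1)] H_q[OF f(1)]])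
    also have "\<dots> < B * (\<epsilon> / B)" by (rule mult_strict_left_mono[OF less B(1)])
    also have "\<dots> = \<epsilon>" using B(1) by simp
    finally show ?thesis using order_trans[OF fC(1) V1(3)] unfolding f_def f0_def by (intro conjI)
  qed
  have "\<forall>F\<in>N. lift S0 F ` C \<subseteq> V \<and>
      Ck_norm k (\<phi> ` C) (\<lambda>y. \<psi> (lift S0 F0 (inv_into U \<phi> y)) - \<psi> (lift S0 F (inv_into U \<phi> y))) < \<epsilon>"
    by (rule ballI) (rule *)
  moreover have "C \<subseteq> U" using A(4) U1(3) by blast
  ultimately show "\<exists>A C N. openin (mtop X) A \<and> x \<in> A \<and> A \<subseteq> C \<and> compactin (mtop X) C \<and> C \<subseteq> U \<and> openin ?Z N \<and> F0 \<in> N \<and>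
        (\<forall>z\<in>N. lift S0 z ` C \<subseteq> V \<and>
          Ck_norm k (\<phi> ` C) (\<lambda>y. \<psi> (lift S0 F0 (inv_into U \<phi> y)) - \<psi> (lift S0 z (inv_into U \<phi> y))) < \<epsilon>)"
    using A(1,2,3,5) by (intro exI conjI)
qed

lemma homeomorphic_sheet:
  assumes S: "openin (mtop X) S" "inj_on q S"
  shows "homeomorphic_map (subtopology WX (sheet S)) (subtopology WY (H ` sheet S)) H"
proof -
  have tX: "topspace (subtopology WX (sheet S)) = sheet S"
    using topspace_WX unfolding topspace_subtopology by (auto simp: sheet_def)
  have tY: "topspace (subtopology WY (H ` sheet S)) = H ` sheet S"
    using topspace_WY unfolding topspace_subtopology by (auto simp: sheet_def)
  have "continuous_map (subtopology WX (sheet S)) WY H"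
    by (rule continuous_map_from_subtopology[OF continuous_map_H])
  then have "continuous_map (subtopology WX (sheet S)) (subtopology WY (H ` sheet S)) H"
    by (rule continuous_map_into_subtopology) (use tX in auto)
  moreover have "continuous_map (subtopology WY (H ` sheet S)) (subtopology WX (sheet S)) (lift S)"
  proof (rule continuous_map_into_subtopology)
    show "lift S \<in> topspace (subtopology WY (H ` sheet S)) \<rightarrow> sheet S"
      unfolding tY using lift(1)[OF S(1)] by blast
    show "continuous_map (subtopology WY (H ` sheet S)) WX (lift S)"
    proof (rule continuous_map_into_subtopology[OF continuous_map_lift[OF S]])
      show "lift S \<in> topspace (subtopology WY (H ` sheet S)) \<rightarrow> \<G>"
        unfolding tY using lift(1)[OF S(1)] by (auto simp: sheet_def)
    qed
  qed
  moreover have "lift S (H f) = f" if "f \<in> sheet S" for f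
    using H_inj_sheet[OF S _ that] lift[OF S(1), of "H f"] that by blast
  ultimately have "homeomorphic_maps (subtopology WX (sheet S)) (subtopology WY (H ` sheet S)) H (lift S)"
    unfolding homeomorphic_maps_def tX tY using lift(2)[OF S(1)] by blast
  then show ?thesis by (rule homeomorphic_maps_imp_map)
qed

theorem two_fold_covering_H: "two_fold_covering WX WY H"
  unfolding two_fold_covering_def covering_def
proof (intro conjI ballI continuous_map_H)
  show "H ` topspace WX = topspace WY" unfolding topspace_WX topspace_WY ..
  fix F assume "F \<in> topspace WY"
  then obtain f0 where f0: "f0 \<in> \<G>" "F = H f0" unfolding topspace_WY by auto
  define k where "k = (\<lambda>x\<in>mpoints X. \<kappa> (f0 x))"
  have "f0 p0 \<in> mpoints X" by (rule \<G>_in[OF f0(1) p0])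
  then obtain S T r where S: "f0 p0 \<in> S" "diffeo_between X Y S T q r" using local_diffeo by meson
  have oS: "openin (mtop X) S" and inj: "inj_on q S" using S(2) diffeo_inj by (auto simp: diffeo_between_def)
  have SX: "S \<subseteq> mpoints X" by (rule openin_subset[OF oS])
  have o\<kappa>: "openin (mtop X) (\<kappa> ` S)" by (rule openin_\<kappa>_image[OF oS])
  note inj\<kappa> = inj_on_\<kappa>_image[OF SX inj]
  have im: "H ` sheet (\<kappa> ` S) = H ` sheet S"
    unfolding H_sheet_image[OF oS] H_sheet_image[OF o\<kappa>] inj\<kappa>(2) ..
  \<comment> \<open>The evenly covered neighbourhood is the common image of the sheets of
    \<open>S\<close> and of its partner; injectivity of \<open>q\<close> on \<open>S\<close> makes
    these two sheets disjoint.\<close>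
  show "\<exists>V. openin WY V \<and> F \<in> V \<and> (\<exists>\<U>. \<Union>\<U> = {f \<in> topspace WX. H f \<in> V} \<and> pairwise disjnt \<U> \<and>
      (\<forall>U\<in>\<U>. openin WX U \<and> homeomorphic_map (subtopology WX U) (subtopology WY V) H))"
  proof (intro exI[of _ "H ` sheet S"] exI[of _ "{sheet S, sheet (\<kappa> ` S)}"] conjI ballI)
    show "openin WY (H ` sheet S)" by (rule openin_sheet(2)[OF oS])
    show "F \<in> H ` sheet S" using f0 S(1) by (auto simp: sheet_def)
    have "sheet S \<inter> sheet (\<kappa> ` S) = {}" using disjoint_\<kappa>_image[OF SX inj] by (auto simp: sheet_def)
    then show "pairwise disjnt {sheet S, sheet (\<kappa> ` S)}" by (auto simp: pairwise_def disjnt_def)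
    have "f \<in> sheet S \<or> f \<in> sheet (\<kappa> ` S)" if "f \<in> \<G>" "H f \<in> H ` sheet S" for f
    proof -
      have "q (f p0) \<in> q ` S" using that H_q[OF that(1) p0] unfolding H_sheet_image[OF oS] by auto
      from in_q_image[OF SX \<G>_in[OF that(1) p0] this] show ?thesis using that(1) by (auto simp: sheet_def)
    qed
    moreover have "sheet S \<subseteq> \<G>" "sheet (\<kappa> ` S) \<subseteq> \<G>" by (auto simp: sheet_def)
    ultimately show "\<Union>{sheet S, sheet (\<kappa> ` S)} = {f \<in> topspace WX. H f \<in> H ` sheet S}"
      unfolding topspace_WX using im by blast
    fix U assume "U \<in> {sheet S, sheet (\<kappa> ` S)}"
    then show "openin WX U" "homeomorphic_map (subtopology WX U) (subtopology WY (H ` sheet S)) H"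
      using openin_sheet(1)[OF oS] openin_sheet(1)[OF o\<kappa>] homeomorphic_sheet[OF oS inj]
        homeomorphic_sheet[OF o\<kappa> inj\<kappa>(1)] im by auto
  qed
  have cases: "f = f0 \<or> f = k" if "f \<in> \<G>" "H f = F" for f
    using H_eq_cases[OF f0(1) that(1)] that(2) f0(2) unfolding k_def by simp
  have k: "k \<in> \<G>" "H k = F" using \<G>_\<kappa>[OF f0(1)] H_\<kappa>[OF f0(1)] f0(2) unfolding k_def by auto
  have "{f \<in> topspace WX. H f = F} = {f0, k}"
    unfolding topspace_WX
  proof (rule Set.set_eqI, rule iffI)
    fix f assume "f \<in> {f \<in> \<G>. H f = F}"
    then show "f \<in> {f0, k}" using cases[of f] by simp
  next
    fix f assume "f \<in> {f0, k}"
    then show "f \<in> {f \<in> \<G>. H f = F}" using f0 k by auto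
  qed
  moreover have "f0 \<noteq> k"
  proof
    assume "f0 = k"
    from fun_cong[OF this, of p0] show False unfolding k_def using p0 \<kappa>_neq[OF \<G>_in[OF f0(1) p0]] by simp
  qed
  ultimately show "card {f \<in> topspace WX. H f = F} = 2" by simp
qed

end

section \<open>Matrix-valued smooth functions and inverse functions\<close>

lemma vec_sum_axis: "x = (\<Sum>i\<in>UNIV. axis i (x $ i))" for x :: "'v::comm_monoid_add ^ 'n"
  by (simp add: vec_eq_iff axis_def)

lemma bounded_linear_axis: "bounded_linear (axis i :: 'v::real_normed_vector \<Rightarrow> 'v ^ 'n)"
proof (rule bounded_linear_intro[where K = 1])
  show "norm (axis i x :: 'v ^ 'n) \<le> norm x * 1" for x :: 'v
  proof -
    have "norm (axis i x :: 'v ^ 'n) \<le> (\<Sum>j\<in>UNIV. norm ((axis i x :: 'v ^ 'n) $ j))"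
      unfolding norm_vec_def by (rule L2_set_le_sum) simp
    also have "\<dots> = (\<Sum>j\<in>UNIV. if j = i then norm x else 0)"
      by (intro sum.cong) (auto simp: axis_def)
    finally show ?thesis by simp
  qed
qed (auto simp: axis_def vec_eq_iff)

lemma diff_order_on_vec:
  fixes f :: "'a::real_normed_vector \<Rightarrow> 'v::real_normed_vector ^ 'n"
  assumes "open S" "\<And>i. diff_order_on k S (\<lambda>x. f x $ i)"
  shows "diff_order_on k S f"
proof -
  have "diff_order_on k S (\<lambda>x. \<Sum>i\<in>UNIV. axis i (f x $ i))"
    by (intro diff_order_on_sum diff_order_on_linear[OF _ bounded_linear_axis] assms)
  then show ?thesis unfolding vec_sum_axis[symmetric] .
qed

lemma diff_order_on_nth:
  "open S \<Longrightarrow> diff_order_on k S f \<Longrightarrow> diff_order_on k S (\<lambda>x. f x $ i)"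
  by (rule diff_order_on_linear[OF _ bounded_linear_vec_nth])

lemma diff_order_on_mult:
  fixes f g :: "'a::real_normed_vector \<Rightarrow> real"
  shows "open S \<Longrightarrow> diff_order_on k S f \<Longrightarrow> diff_order_on k S g \<Longrightarrow> diff_order_on k S (\<lambda>x. f x * g x)"
  by (rule diff_order_on_bilinear[OF _ bounded_bilinear_mult])

lemma diff_order_on_prod:
  fixes f :: "'i \<Rightarrow> 'a::real_normed_vector \<Rightarrow> real"
  assumes "open S" "\<And>i. i \<in> I \<Longrightarrow> diff_order_on k S (f i)"
  shows "diff_order_on k S (\<lambda>x. \<Prod>i\<in>I. f i x)"
proof (cases "finite I")
  case True
  then show ?thesis using assms(2)
    by (induction I) (auto intro!: diff_order_on_const diff_order_on_mult[OF assms(1)])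
qed (simp add: diff_order_on_const)

lemma diff_order_on_det:
  fixes A :: "'a::real_normed_vector \<Rightarrow> real ^ 'n ^ 'n"
  assumes "open S" "\<And>i j. diff_order_on k S (\<lambda>x. A x $ i $ j)"
  shows "diff_order_on k S (\<lambda>x. det (A x))"
  unfolding det_def
  by (intro diff_order_on_sum diff_order_on_mult diff_order_on_prod diff_order_on_const assms)

lemma smooth_on_matrix_mult:
  fixes A :: "'a::real_normed_vector \<Rightarrow> real ^ 'n ^ 'm" and B :: "'a \<Rightarrow> real ^ 'l ^ 'n"
  assumes "open S" "smooth_on S A" "smooth_on S B"
  shows "smooth_on S (\<lambda>x. A x ** B x)"
proof (rule smooth_onI)
  fix k
  have "diff_order_on k S (\<lambda>x. A x $ i $ j)" "diff_order_on k S (\<lambda>x. B x $ i' $ j')" for i j i' j'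
    by (intro diff_order_on_nth smooth_onD assms)+
  then have "diff_order_on k S (\<lambda>x. (A x ** B x) $ i $ j)" for i j
    unfolding matrix_matrix_mult_def by (simp add: diff_order_on_sum diff_order_on_mult assms(1))
  then show "diff_order_on k S (\<lambda>x. A x ** B x)" by (intro diff_order_on_vec assms(1))
qed

lemma smooth_on_det: "smooth_on UNIV (det :: real ^ 'n ^ 'n \<Rightarrow> real)"
  by (intro smooth_onI diff_order_on_det diff_order_on_nth diff_order_on_ident open_UNIV)

lemma open_det_pos: "open {A :: real ^ 'n ^ 'n. det A > 0}"
proof -
  have "continuous_on UNIV (det :: real ^ 'n ^ 'n \<Rightarrow> real)" by (rule smooth_on_continuous_on[OF smooth_on_det])
  then have "open (det -` {0<..} :: (real ^ 'n ^ 'n) set)" by (intro open_vimage) auto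
  then show ?thesis by (simp add: vimage_def)
qed

text \<open>The derivative of \<open>g\<close> is the inverse of that of \<open>f\<close> taken at
  \<open>g y\<close>. Written with determinants it is as often differentiable as \<open>g\<close>,
  which raises the order of \<open>g\<close> by one in each induction step; continuity of
  \<open>g\<close> starts the process.\<close>

lemma smooth_on_inverse_function:
  fixes f :: "real ^ 'k \<Rightarrow> real ^ 'k"
  assumes D: "open D" "open (f ` D)" and f: "smooth_on D f"
    and g: "continuous_on (f ` D) g" "\<And>x. x \<in> D \<Longrightarrow> g (f x) = x"
    and det: "\<And>x. x \<in> D \<Longrightarrow> det (matrix (frechet_derivative f (at x))) \<noteq> 0"
  shows "smooth_on (f ` D) g"
proof (rule smooth_onI)
  let ?A = "\<lambda>y. matrix (frechet_derivative f (at (g y)))"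
  \<comment> \<open>Cramer's rule for the equation with right-hand side \<open>v\<close>: the
    inverse derivative becomes a rational expression in the entries of \<open>?A y\<close>.\<close>
  define w where "w = (\<lambda>v y. \<chi> k. det (\<chi> i j. if j = k then v $ i else ?A y $ i $ j) / det (?A y))"
  have w: "?A y *v x = v \<longleftrightarrow> x = w v y" if "y \<in> f ` D" for x y v
    unfolding w_def by (rule cramer) (use that g det in auto)
  have f': "(f has_derivative frechet_derivative f (at x)) (at x)" if "x \<in> D" for x
    by (rule frechet_has_derivative[OF smooth_onD[OF f] that])
  have Av: "?A (f x) *v u = frechet_derivative f (at x) u" if "x \<in> D" for x u
    using matrix_vector_mul(3)[OF has_derivative_bounded_linear[OF f'[OF that]]] g(2)[OF that] by metis
  have deriv: "(g has_derivative (\<lambda>v. w v y)) (at y)" if y: "y \<in> f ` D" for y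
  proof -
    obtain x where x: "x \<in> D" "y = f x" using y by auto
    have "invertible (?A y)" using det x g by (simp add: invertible_det_nz)
    then obtain A' where A': "?A y ** A' = mat 1" by (auto simp: invertible_def)
    have wl: "w v y = A' *v v" for v
    proof -
      have "?A y *v (A' *v v) = v" using A' by (simp add: matrix_vector_mul_assoc)
      then show ?thesis using w[OF y, of "A' *v v" v] by simp
    qed
    have "bounded_linear (\<lambda>v. w v y)" unfolding wl by (rule matrix_vector_mul_bounded_linear)
    moreover have "(\<lambda>v. w v y) \<circ> frechet_derivative f (at x) = id"
    proof
      fix u
      have "?A y *v u = frechet_derivative f (at x) u" using Av x by simp
      then show "((\<lambda>v. w v y) \<circ> frechet_derivative f (at x)) u = id u" using w[OF y] by auto
    qed
    ultimately have "(g has_derivative (\<lambda>v. w v y)) (at (f x))"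
      using x g D f' smooth_on_continuous_on[OF f]
      by (intro has_derivative_inverse_dieudonne[OF D(1,2)]) auto
    then show ?thesis using x by simp
  qed
  show "diff_order_on k (f ` D) g" for k
  proof (induction k)
    case 0
    show ?case unfolding diff_order_on_0 using deriv differentiableI by blast
  next
    case (Suc k)
    have gD: "g ` f ` D \<subseteq> D" using g(2) by auto
    have A: "diff_order_on k (f ` D) (\<lambda>y. ?A y $ i $ j)" for i j
    proof -
      have "diff_order_on k (f ` D) (\<lambda>y. frechet_derivative f (at (g y)) (axis j 1))"
        by (rule diff_order_on_compose[OF _ D(2,1) Suc.IH _ gD])
           (auto intro: smooth_onD smooth_on_derivative f)
      then show ?thesis unfolding matrix_def by (simp add: diff_order_on_nth D(2))
    qed
    show ?case
    proof (rule diff_order_on_SucI[OF D(2) deriv])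
      fix v
      have n: "det (?A y) \<noteq> 0" if "y \<in> f ` D" for y using that g det by auto
      have "diff_order_on k (f ` D) (\<lambda>y. det (\<chi> i j. if j = l then v $ i else ?A y $ i $ j) * inverse (det (?A y)))" for l
      proof (intro diff_order_on_mult D(2) diff_order_on_inverse diff_order_on_det A n)
        show "diff_order_on k (f ` D) (\<lambda>y. (\<chi> i j. if j = l then v $ i else ?A y $ i $ j) $ i' $ j')" for i' j'
          using A[of i' j'] by (cases "j' = l") (simp_all add: diff_order_on_const)
      qed
      then show "diff_order_on k (f ` D) (\<lambda>y. w v y)"
        by (intro diff_order_on_vec D(2)) (simp add: w_def divide_inverse)
    qed
  qed
qed

section \<open>Homeomorphisms and dimension\<close>

text \<open>The library's form of Sard's theorem wants a well-ordered index type.\<close>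

typedef (overloaded) 'n index_square = "{..<CARD('n::finite) * CARD('n)}"
  by (rule exI[of _ 0]) (simp add: card_gt_0_iff)

setup_lifting type_definition_index_square

instantiation index_square :: (finite) linorder
begin
lift_definition less_eq_index_square :: "'a index_square \<Rightarrow> 'a index_square \<Rightarrow> bool" is "(\<le>)" .
lift_definition less_index_square :: "'a index_square \<Rightarrow> 'a index_square \<Rightarrow> bool" is "(<)" .
instance by standard (transfer; auto)+
end

instance index_square :: (finite) finite
proof
  show "finite (UNIV :: 'a index_square set)"
    unfolding type_definition.univ[OF type_definition_index_square] by simp
qed

instance index_square :: (finite) wellorder
proof
  fix P :: "'a index_square \<Rightarrow> bool" and a
  assume step: "\<And>x. (\<And>y. y < x \<Longrightarrow> P y) \<Longrightarrow> P x"
  show "P a"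
  proof (induction "Rep_index_square a" arbitrary: a rule: less_induct)
    case less
    then show ?case using step[of a] by (simp add: less_index_square.rep_eq)
  qed
qed

lemma card_index_square: "CARD('n::finite index_square) = CARD('n) * CARD('n)"
  unfolding type_definition.card[OF type_definition_index_square] by simp

lemma linear_coordinate_map:
  fixes B :: "'h::real_normed_vector set" and e :: "'h \<Rightarrow> 'c::real_normed_vector"
  assumes "finite B" "independent B" "span B = UNIV"
  shows "bounded_linear (\<lambda>v. \<Sum>b\<in>B. representation B v b *\<^sub>R e b)"
  by (intro bounded_linear_sum bounded_linear_scaleR_const bounded_linear_representation assms)

text \<open>The determinants in Sard's theorem call for equal dimensions, so these are matched
  first, from the homeomorphism alone: invariance of dimension is applied to \<open>g\<close> and to
  \<open>f\<close>, and a bijection between bases gives the isomorphism.\<close>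

lemma fin_dim_homeomorphic_iso:
  fixes f :: "'h::real_normed_vector \<Rightarrow> 'e::euclidean_space"
  assumes fd: "fin_dim TYPE('h)" and D: "open D" "D \<noteq> {}" and f: "continuous_on D f" "inj_on f D" "open (f ` D)"
    and g: "continuous_on (f ` D) g" "\<And>x. x \<in> D \<Longrightarrow> g (f x) = x"
  obtains L :: "'e \<Rightarrow> 'h" and M where "linear_iso_pair L M"
proof -
  obtain B :: "'h set" where B: "finite B" "independent B" "span B = UNIV" by (rule fin_dim_basis[OF fd])
  have fB: "finite (Basis :: 'e set)" by simp
  \<comment> \<open>With too few basis vectors, \<open>g\<close> followed by an injective linear map
    would embed an open subset of \<open>'e\<close> into a proper subspace.\<close>
  have "\<not> card B < DIM('e)"
  proof
    assume less: "card B < DIM('e)"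
    then obtain e :: "'h \<Rightarrow> 'e" where e: "e ` B \<subseteq> Basis" "inj_on e B"
      using card_le_inj[OF B(1) fB] by auto
    let ?J = "\<lambda>v. \<Sum>b\<in>B. representation B v b *\<^sub>R e b"
    have bl: "bounded_linear ?J" by (rule linear_coordinate_map[OF B])
    have inj: "inj ?J"
    proof (rule injI)
      fix v w assume eq: "?J v = ?J w"
      have "representation B v b = representation B w b" if b: "b \<in> B" for b
      proof -
        have "?J u \<bullet> e b = representation B u b" for u
        proof -
          have "e c \<bullet> e b = (if c = b then 1 else 0)" if "c \<in> B" for c
          proof -
            have "e c \<in> Basis" "e b \<in> Basis" using that b e(1) by blast+
            then show ?thesis using that b e(2) by (auto simp: inner_Basis inj_on_def)
          qed
          then have "?J u \<bullet> e b = (\<Sum>c\<in>B. if c = b then representation B u b else 0)"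
            unfolding inner_sum_left by (intro sum.cong) auto
          then show ?thesis using b B(1) by simp
        qed
        then show ?thesis using eq by metis
      qed
      then have "(\<Sum>b\<in>B. representation B v b *\<^sub>R b) = (\<Sum>b\<in>B. representation B w b *\<^sub>R b)" by simp
      then show "v = w" using representation_expansion[OF B] by simp
    qed
    have "DIM('e) \<le> dim (span (e ` B))"
    proof (rule order_trans[OF _ invariance_of_dimension_subspaces[of UNIV "f ` D" "span (e ` B)" "?J \<circ> g"]])
      show "continuous_on (f ` D) (?J \<circ> g)"
        by (intro continuous_on_compose g(1) linear_continuous_on bl)
      have "?J v \<in> span (e ` B)" for v
        by (rule span_sum, rule span_scale, rule span_base, rule imageI)
      then show "?J \<circ> g \<in> f ` D \<rightarrow> span (e ` B)" by (simp add: Pi_def)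
      have "inj_on g (f ` D)" using g(2) by (auto simp: inj_on_def)
      then show "inj_on (?J \<circ> g) (f ` D)" using inj by (auto simp: inj_on_def)
    qed (use D f in auto)
    also have "dim (span (e ` B)) \<le> card (e ` B)" using dim_le_card'[of "e ` B"] B(1) by simp
    also have "\<dots> \<le> card B" by (rule card_image_le[OF B(1)])
    finally show False using less by simp
  qed
  \<comment> \<open>Otherwise a space of one dimension more embeds linearly into \<open>'h\<close>,
    and \<open>f\<close> would inject an open part of it into \<open>'e\<close>. Translation by
    \<open>u\<close> makes that part a neighbourhood of 0.\<close>
  moreover have "\<not> DIM('e) < card B"
  proof
    assume "DIM('e) < card B"
    then have "DIM('e \<times> real) \<le> card B" by simp
    from card_le_inj[OF finite_Basis B(1) this]
    obtain e :: "'e \<times> real \<Rightarrow> 'h" where e: "e ` Basis \<subseteq> B" "inj_on e Basis" by blast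
    obtain u where u: "u \<in> D" using D by auto
    let ?J = "\<lambda>x::'e \<times> real. \<Sum>i\<in>Basis. (x \<bullet> i) *\<^sub>R e i"
    have bl: "bounded_linear ?J"
      by (intro bounded_linear_sum bounded_linear_scaleR_const bounded_linear_inner_left)
    have inj: "inj ?J"
    proof (rule injI)
      fix x y assume eq: "?J x = ?J y"
      have *: "?J z = (\<Sum>b\<in>e ` Basis. (z \<bullet> the_inv_into Basis e b) *\<^sub>R b)" for z
        unfolding sum.reindex[OF e(2)] by (intro sum.cong) (auto simp: the_inv_into_f_f[OF e(2)])
      have "(\<Sum>b\<in>e ` Basis. (x \<bullet> the_inv_into Basis e b - y \<bullet> the_inv_into Basis e b) *\<^sub>R b) = 0"
        using eq unfolding * by (simp add: scaleR_left_diff_distrib sum_subtractf)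
      then have "x \<bullet> the_inv_into Basis e b - y \<bullet> the_inv_into Basis e b = 0" if "b \<in> e ` Basis" for b
        using independentD[OF B(2) _ e(1), of "\<lambda>b. x \<bullet> the_inv_into Basis e b - y \<bullet> the_inv_into Basis e b"] that
        by simp
      note coeff = this
      have "x \<bullet> i = y \<bullet> i" if "i \<in> Basis" for i
        using coeff[OF imageI[OF that]] by (simp add: the_inv_into_f_f[OF e(2) that])
      then show "x = y" by (rule euclidean_eqI)
    qed
    let ?S = "(\<lambda>x. u + ?J x) -` D"
    have c: "continuous_on A (\<lambda>x. u + ?J x)" for A by (intro continuous_intros linear_continuous_on bl)
    have "DIM('e \<times> real) \<le> DIM('e)"
    proof (rule invariance_of_dimension[of ?S "\<lambda>x. f (u + ?J x)"])
      show "continuous_on ?S (\<lambda>x. f (u + ?J x))"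
        by (rule continuous_on_compose2[OF f(1) c]) auto
      show "open ?S" by (rule open_vimage[OF D(1) c])
      show "inj_on (\<lambda>x. f (u + ?J x)) ?S"
      proof (rule inj_onI)
        fix x y assume "x \<in> ?S" "y \<in> ?S" "f (u + ?J x) = f (u + ?J y)"
        then have "u + ?J x = u + ?J y" by (intro inj_onD[OF f(2)]) auto
        then show "x = y" using injD[OF inj] by (simp only: add_left_cancel)
      qed
      have "0 \<in> ?S" using u by simp
      then show "?S \<noteq> {}" by blast
    qed
    then show False by simp
  qed
  ultimately have "card B = card (Basis :: 'e set)" by simp
  then obtain e where e: "bij_betw e B (Basis :: 'e set)"
    using finite_same_card_bij[OF B(1) fB] by blast
  let ?M = "\<lambda>v. \<Sum>b\<in>B. representation B v b *\<^sub>R e b"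
  let ?L = "\<lambda>x. \<Sum>b\<in>B. (x \<bullet> e b) *\<^sub>R b"
  have eB: "e c \<bullet> e b = (if c = b then 1 else 0)" if "c \<in> B" "b \<in> B" for b c
  proof -
    have "e c \<in> Basis" "e b \<in> Basis" using that bij_betwE[OF e] by blast+
    then show ?thesis using that bij_betw_imp_inj_on[OF e] by (auto simp: inner_Basis inj_on_def)
  qed
  have Me: "?M v \<bullet> e b = representation B v b" if b: "b \<in> B" for v b
  proof -
    have "?M v \<bullet> e b = (\<Sum>c\<in>B. if c = b then representation B v b else 0)"
      unfolding inner_sum_left by (intro sum.cong) (auto simp: eB b)
    then show ?thesis using b B(1) by simp
  qed
  have "linear_iso_pair ?L ?M"
    unfolding linear_iso_pair_def
  proof (intro conjI allI)
    show "bounded_linear ?L" by (intro bounded_linear_sum bounded_linear_scaleR_const bounded_linear_inner_left)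
    show "bounded_linear ?M" by (rule linear_coordinate_map[OF B])
    show "?L (?M v) = v" for v
      using representation_expansion[OF B, of v] Me[of _ v] by simp
    show "?M (?L x) = x" for x
    proof -
      have "representation B (?L x) b = x \<bullet> e b" if b: "b \<in> B" for b
      proof -
        have "(\<Sum>b\<in>B. (representation B (?L x) b - x \<bullet> e b) *\<^sub>R b) = 0"
          using representation_expansion[OF B, of "?L x"] by (simp add: scaleR_left_diff_distrib sum_subtractf)
        from independentD[OF B(2,1) order_refl this b] show ?thesis by simp
      qed
      then have "?M (?L x) = (\<Sum>b\<in>B. (x \<bullet> e b) *\<^sub>R e b)" by simp
      also have "\<dots> = (\<Sum>i\<in>Basis. (x \<bullet> i) *\<^sub>R i)" using sum.reindex_bij_betw[OF e, of "\<lambda>i. (x \<bullet> i) *\<^sub>R i"] .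
      also have "\<dots> = x" by (rule euclidean_representation)
      finally show ?thesis .
    qed
  qed
  then show ?thesis by (rule that)
qed

text \<open>If every point were critical, the image would be negligible by Sard's theorem, but it is
  open and nonempty.\<close>

lemma exists_regular_point:
  fixes f :: "real ^ 'k::{finite,wellorder} \<Rightarrow> real ^ 'k::{finite,wellorder}"
  assumes D: "open D" "D \<noteq> {}" and f: "smooth_on D f" "open (f ` D)"
  obtains x where "x \<in> D" "det (matrix (frechet_derivative f (at x))) \<noteq> 0"
proof (cases "\<exists>x\<in>D. det (matrix (frechet_derivative f (at x))) \<noteq> 0")
  case False
  have "negligible (f ` D)"
  proof (rule baby_Sard[where f' = "\<lambda>x. frechet_derivative f (at x)"])
    fix x assume x: "x \<in> D"
    show "(f has_derivative frechet_derivative f (at x)) (at x within D)"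
      using frechet_has_derivative[OF smooth_onD[OF f(1)] x] by (rule has_derivative_at_withinI)
    show "rank (matrix (frechet_derivative f (at x))) < CARD('k)"
      using False x det_eq_0_rank by blast
  qed simp
  moreover have "\<not> negligible (f ` D)" using open_not_negligible[OF f(2)] D(2) by auto
  ultimately show ?thesis by blast
qed (use that in blast)

section \<open>The double cover is a local diffeomorphism\<close>

lemma GLp_simps [simp]:
  "carrier GLp = {A. det A > 0}" "monoid.mult GLp = (**)" "one GLp = mat 1"
  "gmfd GLp = open_submfd model_mfd {A. det A > 0}"
  by (simp_all add: GLp_def)

lemma model_mfd_top [simp]: "mtop model_mfd = euclidean"
  by (simp add: model_mfd_def)

lemma premanifold_GLp: "premanifold (gmfd (GLp :: (real^'n^'n, real^'n^'n) lie))"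
  by (simp del: open_submfd_simps add: premanifold_open_submfd premanifold_model open_det_pos)

lemma openin_GLp: "openin (mtop (gmfd GLp)) W \<longleftrightarrow> open W \<and> W \<subseteq> {A :: real^'n^'n. det A > 0}"
  by (simp add: openin_open_subtopology open_det_pos)

lemma smooth_near_GLp_cod:
  fixes f :: "'p \<Rightarrow> real^'n^'n"
  assumes "premanifold X"
  shows "smooth_near X (gmfd GLp) f x \<longleftrightarrow> det (f x) > 0 \<and> smooth_near X model_mfd f x"
  using smooth_near_open_submfd_cod[OF assms premanifold_model, of "{A. det A > 0}" f x]
  by (simp del: open_submfd_simps add: open_det_pos)

lemma smooth_near_GLp_dom:
  fixes f :: "real^'n^'n \<Rightarrow> 'p"
  assumes "premanifold X"
  shows "smooth_near (gmfd GLp) X f x \<longleftrightarrow> det x > 0 \<and> smooth_near model_mfd X f x"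
  using smooth_near_open_submfd_dom[OF premanifold_model assms, of "{A. det A > 0}" f x]
  by (simp del: open_submfd_simps add: open_det_pos)

lemma smooth_near_GLp_mult:
  fixes B :: "real^'n^'n"
  assumes "det B > 0" "det A > 0"
  shows "smooth_near (gmfd GLp) (gmfd GLp) (\<lambda>A. B ** A) A"
proof -
  have "smooth_on UNIV (\<lambda>A. B ** A)"
    by (intro smooth_on_matrix_mult smooth_on_const smooth_on_ident open_UNIV)
  then have "smooth_near model_mfd model_mfd (\<lambda>A. B ** A) A"
    by (rule smooth_near_model_modelI[OF open_UNIV UNIV_I])
  then show ?thesis
    unfolding smooth_near_GLp_cod[OF premanifold_GLp] smooth_near_GLp_dom[OF premanifold_model[OF fin_dim_euclidean]]
    using assms by (simp add: det_mul)
qed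

lemma lie_group_premanifold: "lie_group G \<Longrightarrow> premanifold (gmfd G)"
  by (simp add: lie_group_def smooth_manifold_premanifold)

lemma lie_group_smooth_mult:
  assumes G: "lie_group G" and X: "premanifold X"
    and f: "smooth_near X (gmfd G) f x" and g: "smooth_near X (gmfd G) g x"
  shows "smooth_near X (gmfd G) (\<lambda>x. f x \<otimes>\<^bsub>G\<^esub> g x) x"
proof -
  note P = lie_group_premanifold[OF G]
  have fg: "smooth_near X (prod_mfd (gmfd G) (gmfd G)) (\<lambda>x. (f x, g x)) x"
    by (rule smooth_near_Pair[OF P P X f g])
  have "smooth_near (prod_mfd (gmfd G) (gmfd G)) (gmfd G) (\<lambda>(g, h). g \<otimes>\<^bsub>G\<^esub> h) (f x, g x)"
    using G smooth_near_in_space(2)[OF fg] smooth_map_iff[OF premanifold_prod[OF P P] P]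
    unfolding lie_group_def by blast
  from smooth_near_compose[OF X premanifold_prod[OF P P] P fg this] show ?thesis by simp
qed

lemma lie_group_smooth_inv:
  assumes G: "lie_group G" and X: "premanifold X" and f: "smooth_near X (gmfd G) f x"
  shows "smooth_near X (gmfd G) (\<lambda>x. inv\<^bsub>G\<^esub> f x) x"
proof -
  note P = lie_group_premanifold[OF G]
  have "smooth_near (gmfd G) (gmfd G) (\<lambda>g. inv\<^bsub>G\<^esub> g) (f x)"
    using G smooth_near_in_space(2)[OF f] smooth_map_iff[OF P P] unfolding lie_group_def by blast
  from smooth_near_compose[OF X P P f this] show ?thesis .
qed

text \<open>The sheet through \<open>x\<close>, reduced to the two properties that later arguments
  use: injectivity and open images.\<close>

lemma covering_local_section:
  assumes "covering X Y p" "x \<in> topspace X"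
  obtains U where "openin X U" "x \<in> U" "inj_on p U"
    "\<forall>A. openin X A \<longrightarrow> A \<subseteq> U \<longrightarrow> openin Y (p ` A)"
proof -
  have "p x \<in> topspace Y" using assms unfolding covering_def by blast
  then obtain V where V0: "openin Y V" "p x \<in> V" "\<exists>\<U>. \<Union>\<U> = {x\<in>topspace X. p x \<in> V} \<and> pairwise disjnt \<U> \<and>
           (\<forall>U\<in>\<U>. openin X U \<and> homeomorphic_map (subtopology X U) (subtopology Y V) p)"
    using assms(1) unfolding covering_def by meson
  from V0(3) obtain \<U> where V: "\<Union>\<U> = {x\<in>topspace X. p x \<in> V}"
      "\<forall>U\<in>\<U>. openin X U \<and> homeomorphic_map (subtopology X U) (subtopology Y V) p" by (elim exE conjE)
  have "x \<in> \<Union>\<U>" unfolding V(1) using assms(2) V0(2) by simp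
  then obtain U where U: "U \<in> \<U>" "x \<in> U" by blast
  then have oU: "openin X U" and h: "homeomorphic_map (subtopology X U) (subtopology Y V) p" using V(2) by auto
  have t: "topspace (subtopology X U) = U" using openin_subset[OF oU] by auto
  have "openin Y (p ` A)" if "openin X A" "A \<subseteq> U" for A
  proof -
    have "openin (subtopology X U) A" using that by (auto simp: openin_subtopology)
    then have "openin (subtopology Y V) (p ` A)"
      using homeomorphic_imp_open_map[OF h] by (simp add: open_map_def)
    then show ?thesis using V0(1) openin_trans_full by blast
  qed
  moreover have "inj_on p U" using homeomorphic_imp_injective_map[OF h] t by simp
  ultimately show ?thesis using that oU U(2) by blast
qed

lemma index_square_iso:
  obtains P :: "real^'n^'n \<Rightarrow> real^('n index_square)" and Q where "linear_iso_pair P Q"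
proof -
  have "DIM(real^'n^'n) = DIM(real^('n index_square))" by (simp add: card_index_square)
  then obtain f :: "real^'n^'n \<Rightarrow> real^('n index_square)" and g where
    "linear f" "linear g" "\<And>x. norm (f x) = norm x" "\<And>y. norm (g y) = norm y" "\<And>x. g (f x) = x" "\<And>y. f (g y) = y"
    by (rule isomorphisms_UNIV_UNIV) blast
  then have "linear_iso_pair f g" by (simp add: linear_iso_pair_def linear_conv_bounded_linear)
  then show ?thesis by (rule that)
qed

text \<open>Sard's theorem gives one regular point; homogeneity moves it everywhere.\<close>

lemma double_cover_regular_point:
  fixes \<theta> :: "'g \<Rightarrow> real^'n^'n" and Gt :: "('g, 'h::real_normed_vector) lie"
  assumes c: "connected_double_cover_GLp Gt \<theta>"
  obtains S T r g where "g \<in> S" "diffeo_between (gmfd Gt) (gmfd GLp) S T \<theta> r"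
proof -
  have G: "lie_group Gt" and sm: "smooth_map (gmfd Gt) (gmfd GLp) \<theta>"
    and cov: "covering (mtop (gmfd Gt)) (mtop (gmfd GLp)) \<theta>"
    using c by (auto simp: connected_double_cover_GLp_def two_fold_covering_def)
  interpret group Gt using G by (simp add: lie_group_def)
  have car: "mpoints (gmfd Gt) = carrier Gt" using G by (simp add: lie_group_def)
  note P = lie_group_premanifold[OF G]
  have \<theta>s: "smooth_near (gmfd Gt) (gmfd GLp) \<theta> g" if "g \<in> mpoints (gmfd Gt)" for g
    using bspec[OF smooth_map_iff[OF P premanifold_GLp, THEN iffD1, OF sm] that] .
  have one: "\<one>\<^bsub>Gt\<^esub> \<in> mpoints (gmfd Gt)" using car by simp
  obtain U1 where U1: "openin (mtop (gmfd Gt)) U1" "\<one>\<^bsub>Gt\<^esub> \<in> U1" "inj_on \<theta> U1"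
    "\<forall>A. openin (mtop (gmfd Gt)) A \<longrightarrow> A \<subseteq> U1 \<longrightarrow> openin (mtop (gmfd GLp)) (\<theta> ` A)"
    by (rule covering_local_section[OF cov one])
  obtain U0 \<phi> where c0: "(U0, \<phi>) \<in> charts (gmfd Gt)" "\<one>\<^bsub>Gt\<^esub> \<in> U0" by (rule atlas_cover[OF P one])
  define U where "U = U0 \<inter> U1"
  have cU: "(U, \<phi>) \<in> charts (gmfd Gt)" unfolding U_def by (rule charts_restrict[OF P c0(1) U1(1)])
  have UU: "\<one>\<^bsub>Gt\<^esub> \<in> U" "U \<subseteq> U1" using c0 U1 by (auto simp: U_def)
  have injU: "inj_on \<theta> U" using U1(3) UU(2) by (rule inj_on_subset)
  have oU: "openin (mtop (gmfd Gt)) U" by (rule chart_openin[OF cU])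
  have UX: "U \<subseteq> mpoints (gmfd Gt)" by (rule openin_subset[OF oU])
  define D where "D = \<phi> ` U"
  have oD: "open D" unfolding D_def by (rule chart_open_image[OF cU oU order_refl])
  have op\<theta>: "open (\<theta> ` A)" "\<theta> ` A \<subseteq> {A. det A > 0}" if "openin (mtop (gmfd Gt)) A" "A \<subseteq> U" for A
    using mp[OF mp[OF spec[OF U1(4)] that(1)] order_trans[OF that(2) UU(2)]] unfolding openin_GLp by blast+
  let ?i = "inv_into U \<phi>"
  let ?f = "\<lambda>y. \<theta> (?i y)"
  have i: "?i (\<phi> x) = x" if "x \<in> U" for x using chart_inv[OF cU that] .
  have sf: "smooth_on D ?f"
  proof -
    have "smooth_near (gmfd Gt) model_mfd \<theta> x" if "x \<in> U" for x
      using \<theta>s that UX smooth_near_GLp_cod[OF P] by blast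
    from smooth_near_chart_rep[OF P premanifold_model[OF fin_dim_euclidean] cU model_chart order_refl _ this]
    show ?thesis by (simp add: D_def)
  qed
  have imf: "?f ` D = \<theta> ` U" unfolding D_def by (auto simp: i image_image cong: image_cong_simp)
  let ?s = "\<lambda>A. \<phi> (the_inv_into U \<theta> A)"
  have s: "?s (\<theta> x) = \<phi> x" if "x \<in> U" for x using the_inv_into_f_f[OF injU that] by simp
  have sf_id: "?s (?f y) = y" if "y \<in> D" for y using that s i by (auto simp: D_def)
  have cs: "continuous_on (\<theta> ` U) ?s"
  proof (subst continuous_on_open_vimage[OF op\<theta>(1)[OF oU order_refl]], intro allI impI)
    fix B :: "'h set" assume B: "open B"
    have o: "openin (mtop (gmfd Gt)) {x \<in> U. \<phi> x \<in> B}" by (rule chart_open_vimage[OF cU B])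
    have "?s -` B \<inter> \<theta> ` U = \<theta> ` {x \<in> U. \<phi> x \<in> B}" using s by auto
    then show "open (?s -` B \<inter> \<theta> ` U)" using op\<theta>(1)[OF o] by auto
  qed
  obtain P1 :: "real^'n^'n \<Rightarrow> real^('n index_square)" and Q1 where PQ: "linear_iso_pair P1 Q1"
    by (rule index_square_iso)
  have fdh: "fin_dim TYPE('h)" using P by (simp add: premanifold_def)
  have injf: "inj_on ?f D" by (rule inj_on_inverseI[where g = ?s]) (rule sf_id)
  have opf: "open (?f ` D)" unfolding imf by (rule op\<theta>(1)[OF oU order_refl])
  have csf: "continuous_on (?f ` D) ?s" unfolding imf by (rule cs)
  have neD: "D \<noteq> {}" using UU by (auto simp: D_def)
  \<comment> \<open>As a local homeomorphism, \<theta> identifies the model space of the group with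
    the space of matrices; composing with \<open>Q1\<close> then replaces matrices by vectors over
    the well-ordered index type.\<close>
  obtain L1 :: "real^'n^'n \<Rightarrow> 'h" and M1 where LM1: "linear_iso_pair L1 M1"
    by (rule fin_dim_homeomorphic_iso[OF fdh oD neD smooth_on_continuous_on[OF sf] injf opf csf sf_id])
  define L where "L = L1 \<circ> Q1"
  define M where "M = P1 \<circ> M1"
  have LM: "linear_iso_pair L M"
    using LM1 PQ by (auto simp: linear_iso_pair_def L_def M_def o_def intro: bounded_linear_compose)
  have Lb: "bounded_linear L" "bounded_linear M" "\<And>x. M (L x) = x" "\<And>y. L (M y) = y"
    using LM by (auto simp: linear_iso_pair_def)
  have Pb: "bounded_linear P1" "bounded_linear Q1" "\<And>x. Q1 (P1 x) = x" "\<And>y. P1 (Q1 y) = y"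
    using PQ by (auto simp: linear_iso_pair_def)
  \<comment> \<open>The map \<theta> in coordinates with the same vector space on both sides, so
    that the determinant of its derivative makes sense.\<close>
  define F where "F = (\<lambda>y. P1 (?f (L y)))"
  have oMD: "open (M ` A)" if "open A" for A by (rule linear_iso_pair_open_image[OF linear_iso_pair_sym[OF LM] that])
  have sF: "smooth_on (M ` D) F" unfolding F_def
    by (intro smooth_on_linear[OF oMD[OF oD] Pb(1)] smooth_on_compose[OF fdh oMD[OF oD] oD _ sf]
        smooth_on_linear[OF oMD[OF oD] Lb(1)] smooth_on_ident oMD oD) (auto simp: Lb)
  have imF: "F ` M ` \<phi> ` A = P1 ` \<theta> ` A" if "A \<subseteq> U" for A
    using that i unfolding F_def by (auto simp: image_image Lb subset_iff cong: image_cong_simp)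
  have opF: "open (F ` M ` \<phi> ` A)" if "openin (mtop (gmfd Gt)) A" "A \<subseteq> U" for A
    unfolding imF[OF that(2)] by (rule linear_iso_pair_open_image[OF PQ op\<theta>(1)[OF that]])
  obtain x where x: "x \<in> M ` D" "det (matrix (frechet_derivative F (at x))) \<noteq> 0"
  proof (rule exists_regular_point[OF oMD[OF oD] _ sF])
    show "M ` D \<noteq> {}" using neD by simp
    show "open (F ` M ` D)" unfolding D_def by (rule opF[OF oU order_refl])
  qed
  \<comment> \<open>This determinant is continuous, so the regular points form an open set, and the
    regular point found has a neighbourhood on which the inverse is smooth.\<close>
  let ?d = "\<lambda>y. det (matrix (frechet_derivative F (at y)))"
  have "smooth_on (M ` D) ?d"
  proof (rule smooth_onI)
    fix k
    have "diff_order_on k (M ` D) (\<lambda>y. frechet_derivative F (at y) (axis j 1) $ i)" for i j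
      by (intro diff_order_on_nth oMD oD smooth_onD smooth_on_derivative sF)
    then show "diff_order_on k (M ` D) ?d"
      by (intro diff_order_on_det oMD oD) (simp add: matrix_def)
  qed
  from smooth_on_continuous_on[OF this]
  have "open (?d -` (- {0}) \<inter> M ` D)"
    using continuous_on_open_vimage[OF oMD[OF oD], of ?d] by (metis open_Compl closed_singleton)
  then have oD2: "open (L ` (?d -` (- {0}) \<inter> M ` D))" by (rule linear_iso_pair_open_image[OF LM])
  define S where "S = {z \<in> U. \<phi> z \<in> L ` (?d -` (- {0}) \<inter> M ` D)}"
  have oS: "openin (mtop (gmfd Gt)) S" unfolding S_def by (rule chart_open_vimage[OF cU oD2])
  have SU: "S \<subseteq> U" by (auto simp: S_def)
  define D' where "D' = M ` \<phi> ` S"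
  have oD': "open D'" unfolding D'_def by (rule oMD[OF chart_open_image[OF cU oS SU]])
  have D'd: "?d y \<noteq> 0" if "y \<in> D'" for y using that by (auto simp: D'_def S_def Lb)
  have D'D: "D' \<subseteq> M ` D" using SU by (auto simp: D'_def D_def)
  \<comment> \<open>The continuous inverse of \<open>F\<close> inherited from the sheet;
    \<open>smooth_on_inverse_function\<close> makes it smooth.\<close>
  define K where "K = (\<lambda>w. M (?s (Q1 w)))"
  have KF: "K (F y) = y" if "y \<in> D'" for y
  proof -
    obtain z where z: "z \<in> S" "y = M (\<phi> z)" using \<open>y \<in> D'\<close> by (auto simp: D'_def)
    then have "z \<in> U" using SU by blast
    then show ?thesis using z by (simp add: K_def F_def Lb Pb i s)
  qed
  have imD': "F ` D' = P1 ` \<theta> ` S" unfolding D'_def by (rule imF[OF SU])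
  have cK: "continuous_on (F ` D') K" unfolding K_def
  proof (rule continuous_on_compose2[OF linear_continuous_on[OF Lb(2), of UNIV]])
    show "continuous_on (F ` D') (\<lambda>w. ?s (Q1 w))"
      by (rule continuous_on_compose2[OF cs linear_continuous_on[OF Pb(2)]])
         (use SU in \<open>auto simp: imD' Pb\<close>)
  qed simp
  have sK: "smooth_on (F ` D') K"
    by (rule smooth_on_inverse_function[OF oD' _ smooth_on_subset[OF sF D'D] cK KF D'd])
       (simp add: D'_def opF[OF oS SU])
  define r where "r = the_inv_into U \<theta>"
  have r: "r (\<theta> z) = z" if "z \<in> S" for z using the_inv_into_f_f[OF injU] SU that by (auto simp: r_def)
  have o\<theta>S: "open (\<theta> ` S)" "\<theta> ` S \<subseteq> {A. det A > 0}" by (rule op\<theta>[OF oS SU])+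
  have cS: "(S, \<phi>) \<in> charts (gmfd Gt)"
    using charts_restrict[OF P cU oS] SU by (simp add: Int_absorb1)
  have srep: "smooth_on (\<theta> ` S) (\<lambda>A. \<phi> (r A))"
  proof -
    have oF: "open (F ` D')" unfolding D'_def by (rule opF[OF oS SU])
    have "smooth_on (\<theta> ` S) (\<lambda>A. L (K (P1 A)))"
      by (intro smooth_on_linear[OF o\<theta>S(1) Lb(1)] smooth_on_compose[OF fin_dim_euclidean o\<theta>S(1) oF _ sK]
          smooth_on_linear[OF o\<theta>S(1) Pb(1)] smooth_on_ident o\<theta>S(1)) (simp add: imD')
    then show ?thesis
      by (rule smooth_on_congI[OF _ o\<theta>S(1)]) (auto simp: K_def Lb Pb r_def)
  qed
  have "diffeo_between (gmfd Gt) (gmfd GLp) S (\<theta> ` S) \<theta> r"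
    unfolding diffeo_between_def
  proof (intro conjI ballI)
    show "openin (mtop (gmfd GLp)) (\<theta> ` S)" unfolding openin_GLp using o\<theta>S by blast
    show "smooth_near (gmfd Gt) (gmfd GLp) \<theta> z" if "z \<in> S" for z
      using \<theta>s that SU UX by blast
    fix A assume A: "A \<in> \<theta> ` S"
    show "smooth_near (gmfd GLp) (gmfd Gt) r A"
      unfolding smooth_near_GLp_dom[OF P]
    proof
      show "det A > 0" using A o\<theta>S by auto
      show "smooth_near model_mfd (gmfd Gt) r A"
        by (rule smooth_nearI[OF model_chart cS, of "\<theta> ` S"]) (use A o\<theta>S srep r in \<open>auto simp: inv_id\<close>)
    qed
  qed (use oS r in auto)
  moreover obtain g where "g \<in> S"
  proof -
    obtain z where "z \<in> U" "x = M (\<phi> z)" using x(1) by (auto simp: D_def)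
    moreover from this have "\<phi> z \<in> L ` (?d -` (- {0}) \<inter> M ` D)"
      using x by (intro image_eqI[of _ _ x]) (auto simp: Lb)
    ultimately have "z \<in> S" by (simp add: S_def)
    then show ?thesis by (rule that)
  qed
  ultimately show ?thesis using that by blast
qed

text \<open>Left translation by \<open>h\<close> carries \<open>g\<close> to the known point
  \<open>g1\<close>. As \<theta> is a homomorphism, it corresponds to multiplication by
  \<open>\<theta> h\<close> below, so the local inverse at \<open>g1\<close> is translated back by
  the inverse of \<open>h\<close>.\<close>

lemma double_cover_local_diffeo:
  fixes \<theta> :: "'g \<Rightarrow> real^'n^'n" and Gt :: "('g, 'h::real_normed_vector) lie"
  assumes c: "connected_double_cover_GLp Gt \<theta>" and g: "g \<in> carrier Gt"
  obtains S T r where "g \<in> S" "diffeo_between (gmfd Gt) (gmfd GLp) S T \<theta> r"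
proof -
  have G: "lie_group Gt" and sm: "smooth_map (gmfd Gt) (gmfd GLp) \<theta>" and hom: "\<theta> \<in> hom Gt GLp"
    using c by (auto simp: connected_double_cover_GLp_def)
  interpret group Gt using G by (simp add: lie_group_def)
  have car: "mpoints (gmfd Gt) = carrier Gt" using G by (simp add: lie_group_def)
  note P = lie_group_premanifold[OF G]
  have \<theta>m: "\<theta> (a \<otimes>\<^bsub>Gt\<^esub> b) = \<theta> a ** \<theta> b" if "a \<in> carrier Gt" "b \<in> carrier Gt" for a b
    using hom_mult[OF hom that] by simp
  have \<theta>p: "det (\<theta> a) > 0" if "a \<in> carrier Gt" for a using hom_in_carrier[OF hom that] by simp
  obtain S1 T1 r1 g1 where 1: "g1 \<in> S1" "diffeo_between (gmfd Gt) (gmfd GLp) S1 T1 \<theta> r1"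
    by (rule double_cover_regular_point[OF c])
  have oS1: "openin (mtop (gmfd Gt)) S1" and oT1: "openin (mtop (gmfd GLp)) T1"
    and st: "\<theta> ` S1 \<subseteq> T1" "r1 ` T1 \<subseteq> S1" "\<And>x. x \<in> S1 \<Longrightarrow> r1 (\<theta> x) = x" "\<And>y. y \<in> T1 \<Longrightarrow> \<theta> (r1 y) = y"
    and s1: "\<And>y. y \<in> T1 \<Longrightarrow> smooth_near (gmfd GLp) (gmfd Gt) r1 y"
    using 1(2) by (auto simp: diffeo_between_def)
  have S1c: "S1 \<subseteq> carrier Gt" using openin_subset[OF oS1] car by simp
  define h where "h = g1 \<otimes>\<^bsub>Gt\<^esub> inv\<^bsub>Gt\<^esub> g"
  have g1: "g1 \<in> carrier Gt" using 1(1) S1c by blast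
  have h: "h \<in> carrier Gt" "inv\<^bsub>Gt\<^esub> h \<in> carrier Gt" using g1 g by (auto simp: h_def)
  have hg: "h \<otimes>\<^bsub>Gt\<^esub> g = g1" using g g1 by (simp add: h_def m_assoc)
  define S where "S = {x \<in> mpoints (gmfd Gt). h \<otimes>\<^bsub>Gt\<^esub> x \<in> S1}"
  define T where "T = {A \<in> mpoints (gmfd GLp). \<theta> h ** A \<in> T1}"
  define r where "r = (\<lambda>A. inv\<^bsub>Gt\<^esub> h \<otimes>\<^bsub>Gt\<^esub> r1 (\<theta> h ** A))"
  have sl: "smooth_near (gmfd Gt) (gmfd Gt) (\<lambda>x. a \<otimes>\<^bsub>Gt\<^esub> x) x" if "a \<in> carrier Gt" "x \<in> mpoints (gmfd Gt)" for a x
    using that by (intro lie_group_smooth_mult[OF G P] smooth_near_const[OF P P] smooth_near_ident[OF P]) (auto simp: car)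
  have sG: "smooth_near (gmfd GLp) (gmfd GLp) (\<lambda>A. \<theta> h ** A) A" if "A \<in> mpoints (gmfd GLp)" for A
    by (rule smooth_near_GLp_mult) (use that \<theta>p[OF h(1)] in auto)
  \<comment> \<open>The image of the identity is idempotent and invertible, hence the identity
    matrix.\<close>
  have \<theta>inv: "\<theta> (inv\<^bsub>Gt\<^esub> h) ** \<theta> h = mat 1"
  proof -
    have "\<theta> \<one>\<^bsub>Gt\<^esub> ** \<theta> \<one>\<^bsub>Gt\<^esub> = \<theta> \<one>\<^bsub>Gt\<^esub>" using \<theta>m[of "\<one>\<^bsub>Gt\<^esub>" "\<one>\<^bsub>Gt\<^esub>"] by simp
    moreover obtain B where "B ** \<theta> \<one>\<^bsub>Gt\<^esub> = mat 1"
      using \<theta>p[of "\<one>\<^bsub>Gt\<^esub>"] invertible_det_nz[of "\<theta> \<one>\<^bsub>Gt\<^esub>"] by (auto simp: invertible_def)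
    ultimately have "\<theta> \<one>\<^bsub>Gt\<^esub> = mat 1" by (metis matrix_mul_assoc matrix_mul_lid)
    then show ?thesis using \<theta>m[OF h(2,1)] h by simp
  qed
  have "diffeo_between (gmfd Gt) (gmfd GLp) S T \<theta> r"
    unfolding diffeo_between_def
  proof (intro conjI ballI)
    show "openin (mtop (gmfd Gt)) S" unfolding S_def
      by (rule openin_smooth_vimage[OF openin_topspace sl[OF h(1)] oS1])
    show "openin (mtop (gmfd GLp)) T" unfolding T_def
      by (rule openin_smooth_vimage[OF openin_topspace sG oT1])
    show "\<theta> ` S \<subseteq> T"
      using st(1) \<theta>m[OF h(1)] \<theta>p car by (auto simp: S_def T_def image_subset_iff)
    have rT: "r1 (\<theta> h ** A) \<in> S1" "r1 (\<theta> h ** A) \<in> carrier Gt" if "A \<in> T" for A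
      using that st(2) S1c by (auto simp: T_def)
    show "r ` T \<subseteq> S"
    proof (rule image_subsetI)
      fix A assume A: "A \<in> T"
      have "h \<otimes>\<^bsub>Gt\<^esub> r A = r1 (\<theta> h ** A)"
        using h rT(2)[OF A] by (simp add: r_def m_assoc[symmetric])
      then show "r A \<in> S" using rT[OF A] h car by (simp add: S_def r_def)
    qed
    show "r (\<theta> x) = x" if "x \<in> S" for x
    proof -
      have x: "x \<in> carrier Gt" "h \<otimes>\<^bsub>Gt\<^esub> x \<in> S1" using that car by (auto simp: S_def)
      have "r1 (\<theta> h ** \<theta> x) = h \<otimes>\<^bsub>Gt\<^esub> x" using st(3)[OF x(2)] \<theta>m[OF h(1) x(1)] by simp
      then show ?thesis using h x by (simp add: r_def m_assoc[symmetric])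
    qed
    show "\<theta> (r A) = A" if "A \<in> T" for A
    proof -
      have "\<theta> (r A) = \<theta> (inv\<^bsub>Gt\<^esub> h) ** (\<theta> h ** A)"
        using \<theta>m[OF h(2) rT(2)[OF that]] st(4) that by (simp add: r_def T_def)
      also have "\<dots> = A" by (simp only: matrix_mul_assoc \<theta>inv matrix_mul_lid)
      finally show ?thesis .
    qed
    show "smooth_near (gmfd Gt) (gmfd GLp) \<theta> x" if "x \<in> S" for x
      using bspec[OF smooth_map_iff[OF P premanifold_GLp, THEN iffD1, OF sm]] that unfolding S_def by blast
    show "smooth_near (gmfd GLp) (gmfd Gt) r A" if "A \<in> T" for A
    proof -
      have A: "A \<in> mpoints (gmfd GLp)" "\<theta> h ** A \<in> T1" using that by (auto simp: T_def)
      have "smooth_near (gmfd GLp) (gmfd Gt) (\<lambda>A. r1 (\<theta> h ** A)) A"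
        by (rule smooth_near_compose[OF premanifold_GLp premanifold_GLp P sG[OF A(1)] s1[OF A(2)]])
      then show ?thesis unfolding r_def
        by (intro lie_group_smooth_mult[OF G premanifold_GLp] smooth_near_const[OF premanifold_GLp P A(1)])
           (use h car in simp)
    qed
  qed
  moreover have "g \<in> S" using 1(1) hg g car by (simp add: S_def)
  ultimately show ?thesis using that by blast
qed

section \<open>Local trivialisations\<close>

lemma atlas_open_submfd: "atlas (open_submfd X W) = (\<lambda>c. (fst c \<inter> W, snd c)) ` atlas X"
  by force

lemma atlas_prod_mfd:
  "atlas (prod_mfd X Y) = (\<lambda>(c, d). (fst c \<times> fst d, map_prod (snd c) (snd d))) ` (atlas X \<times> atlas Y)"
  by force

text \<open>Turns the target of a trivialisation into an open piece of a product, to which the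
  lemmas on open submanifolds apply.\<close>

lemma prod_open_submfd:
  "prod_mfd (open_submfd M U) N = open_submfd (prod_mfd M N) (U \<times> UNIV)"
proof -
  have t: "prod_topology (subtopology (mtop M) U) (mtop N) = subtopology (prod_topology (mtop M) (mtop N)) (U \<times> UNIV)"
    by (simp add: subtopology_Times)
  let ?f = "\<lambda>c d. ((fst c \<inter> U) \<times> fst d, map_prod (snd c) (snd d))"
  have "atlas (prod_mfd (open_submfd M U) N) = (\<lambda>(c, d). ?f c d) ` (atlas M \<times> atlas N)"
    unfolding atlas_prod_mfd atlas_open_submfd by (force simp del: prod_mfd_simps open_submfd_simps)
  moreover have "atlas (open_submfd (prod_mfd M N) (U \<times> UNIV)) = (\<lambda>(c, d). ?f c d) ` (atlas M \<times> atlas N)"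
    unfolding atlas_prod_mfd atlas_open_submfd image_image
    by (intro image_cong refl) (auto simp: Times_Int_Times)
  ultimately have a: "atlas (prod_mfd (open_submfd M U) N) = atlas (open_submfd (prod_mfd M N) (U \<times> UNIV))" by simp
  show ?thesis using t a by (simp add: prod_mfd_def open_submfd_def)
qed

text \<open>The inverse of a local trivialisation: the point over \<open>x\<close> with fibre
  coordinate \<open>w\<close>.\<close>

definition triv_inv :: "('x, 'b) manifold \<Rightarrow> ('x \<Rightarrow> 'm) \<Rightarrow> 'm set \<Rightarrow> ('x \<Rightarrow> 'w) \<Rightarrow> 'm \<Rightarrow> 'w \<Rightarrow> 'x" where
  "triv_inv X \<pi> U \<tau> x w = inv_into {v \<in> mpoints X. \<pi> v \<in> U} (\<lambda>v. (\<pi> v, \<tau> v)) (x, w)"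

text \<open>Common ground of vector bundles, with \<open>N\<close> a coordinate space, and principal
  bundles, with \<open>N\<close> the structure group.\<close>

locale fibre_projection =
  fixes X :: "('x, 'b::real_normed_vector) manifold" and M :: "('m, 'a::real_normed_vector) manifold"
    and N :: "('w, 'c::real_normed_vector) manifold" and \<pi> :: "'x \<Rightarrow> 'm"
  assumes X: "premanifold X" and M: "premanifold M" and N: "premanifold N"
    and \<pi>: "\<And>v. v \<in> mpoints X \<Longrightarrow> smooth_near X M \<pi> v"
begin

abbreviation "over U \<equiv> {v \<in> mpoints X. \<pi> v \<in> U}"

definition triv :: "'m set \<Rightarrow> ('x \<Rightarrow> 'w) \<Rightarrow> bool" where
  "triv U \<tau> \<longleftrightarrow> openin (mtop M) U \<and>
     diffeo (open_submfd X (over U)) (prod_mfd (open_submfd M U) N) (\<lambda>v. (\<pi> v, \<tau> v))"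

lemma openin_over: "openin (mtop M) U \<Longrightarrow> openin (mtop X) (over U)"
  by (rule openin_smooth_vimage[OF openin_topspace \<pi>])

text \<open>The submanifolds on both sides are eliminated in favour of smoothness in the ambient
  manifolds, so that maps built from trivialisations are smooth by composition.\<close>

lemma triv_iff:
  "triv U \<tau> \<longleftrightarrow> openin (mtop M) U \<and> bij_betw (\<lambda>v. (\<pi> v, \<tau> v)) (over U) (U \<times> mpoints N) \<and>
     (\<forall>v\<in>over U. smooth_near X (prod_mfd M N) (\<lambda>v. (\<pi> v, \<tau> v)) v) \<and>
     (\<forall>p\<in>U \<times> mpoints N. smooth_near (prod_mfd M N) X (inv_into (over U) (\<lambda>v. (\<pi> v, \<tau> v))) p)"
proof (cases "openin (mtop M) U")
  case True
  let ?f = "\<lambda>v. (\<pi> v, \<tau> v)" and ?X' = "open_submfd X (over U)" and ?Y = "prod_mfd M N"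
  let ?Y' = "open_submfd ?Y (U \<times> UNIV)"
  have oX: "openin (mtop X) (over U)" by (rule openin_over[OF True])
  have Y: "premanifold ?Y" by (rule premanifold_prod[OF M N])
  have "openin (prod_topology (mtop M) (mtop N)) (U \<times> mpoints N)"
    using True by (simp add: openin_prod_Times_iff)
  have oY: "openin (mtop ?Y) (U \<times> mpoints N)" using True by (simp add: openin_prod_Times_iff)
  \<comment> \<open>Chart domains of \<open>N\<close> consist of points of \<open>N\<close>, so
    cutting with \<open>UNIV\<close> or with the points of \<open>N\<close> yields the same
    atlas.\<close>
  have Y'eq: "?Y' = open_submfd ?Y (U \<times> mpoints N)"
  proof -
    have "fst d \<inter> (U \<times> UNIV) = fst d \<inter> (U \<times> mpoints N)" if "d \<in> atlas ?Y" for d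
    proof -
      obtain A B \<psi> where d: "fst d = A \<times> B" "(B, \<psi>) \<in> atlas N" using \<open>d \<in> atlas ?Y\<close> by auto
      show ?thesis unfolding d(1) using chart_subset[OF atlas_charts[OF N d(2)]] by auto
    qed
    then have "atlas ?Y' = atlas (open_submfd ?Y (U \<times> mpoints N))"
      unfolding atlas_open_submfd by (intro image_cong refl) simp
    moreover have "subtopology (mtop ?Y) (U \<times> UNIV) = subtopology (mtop ?Y) (U \<times> mpoints N)"
      using subtopology_restrict[of "mtop ?Y" "U \<times> UNIV"] subtopology_restrict[of "mtop ?Y" "U \<times> mpoints N"]
      by (simp add: Times_Int_Times)
    ultimately show ?thesis by (simp add: open_submfd_def)
  qed
  have pX': "premanifold ?X'" by (rule premanifold_open_submfd[OF X oX])
  have pY': "premanifold (open_submfd ?Y (U \<times> mpoints N))" by (rule premanifold_open_submfd[OF Y oY])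
  have mX': "mpoints ?X' = over U" by auto
  have mY': "mpoints (open_submfd ?Y (U \<times> mpoints N)) = U \<times> mpoints N"
    using openin_subset[OF True] by auto
  have 1: "smooth_map ?X' (open_submfd ?Y (U \<times> mpoints N)) ?f \<longleftrightarrow>
      (\<forall>v\<in>over U. smooth_near X ?Y ?f v)" if "bij_betw ?f (over U) (U \<times> mpoints N)"
    unfolding smooth_map_iff[OF pX' pY'] mX' smooth_near_open_submfd_dom[OF X pY' oX]
      smooth_near_open_submfd_cod[OF X Y oY] using bij_betwE[OF that] by blast
  have 2: "smooth_map (open_submfd ?Y (U \<times> mpoints N)) ?X' (inv_into (over U) ?f) \<longleftrightarrow>
      (\<forall>p\<in>U \<times> mpoints N. smooth_near ?Y X (inv_into (over U) ?f) p)" if "bij_betw ?f (over U) (U \<times> mpoints N)"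
    unfolding smooth_map_iff[OF pY' pX'] mY' smooth_near_open_submfd_dom[OF Y pX' oY]
      smooth_near_open_submfd_cod[OF Y X oX] using bij_betwE[OF bij_betw_inv_into[OF that]] by blast
  show ?thesis unfolding triv_def prod_open_submfd Y'eq diffeo_def mX' mY' using 1 2 True by blast
qed (simp add: triv_def)

context
  fixes U \<tau> assumes t: "triv U \<tau>"
begin

lemma triv_open: "openin (mtop M) U"
  using t by (simp add: triv_def)

lemma triv_inv_eq: "v \<in> mpoints X \<Longrightarrow> \<pi> v \<in> U \<Longrightarrow> triv_inv X \<pi> U \<tau> (\<pi> v) (\<tau> v) = v"
  unfolding triv_inv_def using t inv_into_f_f[of "\<lambda>v. (\<pi> v, \<tau> v)" "over U" v]
  by (simp add: triv_iff bij_betw_def)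

lemma triv_inv:
  assumes "x \<in> U" "w \<in> mpoints N"
  shows "triv_inv X \<pi> U \<tau> x w \<in> mpoints X" "\<pi> (triv_inv X \<pi> U \<tau> x w) = x" "\<tau> (triv_inv X \<pi> U \<tau> x w) = w"
proof -
  have b: "(\<lambda>v. (\<pi> v, \<tau> v)) ` over U = U \<times> mpoints N" using t by (simp add: triv_iff bij_betw_def)
  have xw: "(x, w) \<in> (\<lambda>v. (\<pi> v, \<tau> v)) ` over U" unfolding b using assms by simp
  show "triv_inv X \<pi> U \<tau> x w \<in> mpoints X" "\<pi> (triv_inv X \<pi> U \<tau> x w) = x" "\<tau> (triv_inv X \<pi> U \<tau> x w) = w"
    unfolding triv_inv_def using inv_into_into[OF xw] f_inv_into_f[OF xw] by auto
qed

lemma triv_smooth: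
  assumes "v \<in> mpoints X" "\<pi> v \<in> U"
  shows "smooth_near X N \<tau> v"
proof -
  have s: "smooth_near X (prod_mfd M N) (\<lambda>v. (\<pi> v, \<tau> v)) v" using t assms unfolding triv_iff by blast
  from smooth_near_compose[OF X premanifold_prod[OF M N] N s smooth_near_fst(2)[OF M N smooth_near_in_space(2)[OF s]]]
  show ?thesis by simp
qed

lemma triv_in: "v \<in> mpoints X \<Longrightarrow> \<pi> v \<in> U \<Longrightarrow> \<tau> v \<in> mpoints N"
  using triv_smooth smooth_near_in_space(2) by metis

lemma triv_inv_smooth:
  assumes Z: "premanifold Z" and f: "smooth_near Z M f z" "f z \<in> U" and g: "smooth_near Z N g z"
  shows "smooth_near Z X (\<lambda>z. triv_inv X \<pi> U \<tau> (f z) (g z)) z"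
proof -
  have fg: "smooth_near Z (prod_mfd M N) (\<lambda>z. (f z, g z)) z" by (rule smooth_near_Pair[OF M N Z f(1) g])
  have "(f z, g z) \<in> U \<times> mpoints N" using f(2) smooth_near_in_space(2)[OF g] by simp
  then have "smooth_near (prod_mfd M N) X (inv_into (over U) (\<lambda>v. (\<pi> v, \<tau> v))) (f z, g z)"
    using t unfolding triv_iff by blast
  from smooth_near_compose[OF Z premanifold_prod[OF M N] X fg this] show ?thesis
    unfolding triv_inv_def .
qed

lemma triv_restrict:
  assumes o: "openin (mtop M) U'" and sub: "U' \<subseteq> U"
  shows "triv U' \<tau>"
  unfolding triv_iff
proof (intro conjI o ballI)
  let ?f = "\<lambda>v. (\<pi> v, \<tau> v)"
  have b: "bij_betw ?f (over U) (U \<times> mpoints N)" using t by (simp add: triv_iff)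
  have sub2: "over U' \<subseteq> over U" using sub by blast
  have "?f ` over U' = U' \<times> mpoints N"
  proof
    show "?f ` over U' \<subseteq> U' \<times> mpoints N" using triv_in sub by auto
    show "U' \<times> mpoints N \<subseteq> ?f ` over U'"
    proof
      fix p assume "p \<in> U' \<times> mpoints N"
      then obtain x w where p: "p = (x, w)" "x \<in> U'" "w \<in> mpoints N" by auto
      then have "x \<in> U" using sub by blast
      note i = triv_inv[OF this p(3)]
      show "p \<in> ?f ` over U'" by (rule image_eqI[of _ _ "triv_inv X \<pi> U \<tau> x w"]) (use i p in auto)
    qed
  qed
  moreover have inj: "inj_on ?f (over U')" using inj_on_subset[OF bij_betw_imp_inj_on[OF b] sub2] .
  ultimately show "bij_betw ?f (over U') (U' \<times> mpoints N)" by (simp add: bij_betw_def)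
  show "smooth_near X (prod_mfd M N) ?f v" if "v \<in> over U'" for v
    using t that sub unfolding triv_iff by blast
  fix p assume p: "p \<in> U' \<times> mpoints N"
  then have "p \<in> U \<times> mpoints N" using sub by auto
  then have "smooth_near (prod_mfd M N) X (inv_into (over U) ?f) p" using t unfolding triv_iff by blast
  then show "smooth_near (prod_mfd M N) X (inv_into (over U') ?f) p"
  proof (rule smooth_near_cong[OF _ _ p])
    show "openin (mtop (prod_mfd M N)) (U' \<times> mpoints N)" using o by (simp add: openin_prod_Times_iff)
    fix z assume "z \<in> U' \<times> mpoints N"
    then have "z \<in> ?f ` over U'" using \<open>?f ` over U' = U' \<times> mpoints N\<close> by blast
    then obtain v where "v \<in> over U'" "z = ?f v" by blast
    then show "inv_into (over U) ?f z = inv_into (over U') ?f z"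
      using inv_into_f_f[OF inj] inv_into_f_f[OF bij_betw_imp_inj_on[OF b]] sub2 by (simp only: subset_iff)
  qed
qed

end

end

section \<open>The bundle of positively oriented frames\<close>

locale oriented_bundle =
  fixes E :: "('m, 'a::real_normed_vector, 'v, 'c::real_normed_vector, 'n::finite) vbundle"
  assumes E: "oriented_vector_bundle E"
begin

lemma vector_bundle: "vector_bundle E"
  using E by (simp add: oriented_vector_bundle_def)

lemma premanifolds: "premanifold (vbase E)" "premanifold (vtotal E)"
  using vector_bundle by (auto simp: vector_bundle_def smooth_manifold_premanifold)

sublocale fibre_projection "vtotal E" "vbase E" "model_mfd :: (real^'n, real^'n) manifold" "vproj E"
proof
  show "smooth_near (vtotal E) (vbase E) (vproj E) v" if "v \<in> mpoints (vtotal E)" for v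
    using vector_bundle smooth_map_iff[OF premanifolds(2,1)] that unfolding vector_bundle_def by blast
qed (use premanifolds in \<open>auto simp: premanifold_model\<close>)

lemma vtriv_triv: "vtriv E U \<tau> \<Longrightarrow> triv U \<tau>"
  by (simp add: vtriv_def triv_def)

lemma vtriv_restrict:
  assumes "vtriv E U \<tau>" "openin (mtop (vbase E)) U'" "U' \<subseteq> U"
  shows "vtriv E U' \<tau>"
  using triv_restrict[OF vtriv_triv[OF assms(1)] assms(2,3)] assms by (auto simp: vtriv_def triv_def)

abbreviation "\<iota> U \<tau> \<equiv> triv_inv (vtotal E) (vproj E) U \<tau>"

lemma fibre_inj:
  assumes "vtriv E U \<tau>" "x \<in> U" "v \<in> vfibre E x" "w \<in> vfibre E x" "\<tau> v = \<tau> w"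
  shows "v = w"
  using triv_inv_eq[OF vtriv_triv[OF assms(1)], of v] triv_inv_eq[OF vtriv_triv[OF assms(1)], of w] assms
  by (simp add: vfibre_def)

lemma \<iota>_fibre:
  assumes "vtriv E U \<tau>" "x \<in> U"
  shows "\<iota> U \<tau> x w \<in> vfibre E x" "\<tau> (\<iota> U \<tau> x w) = w"
  using triv_inv[OF vtriv_triv[OF assms(1)] assms(2), of w] by (auto simp: vfibre_def)

lemma \<iota>_linear:
  assumes t: "vtriv E U \<tau>" and x: "x \<in> U"
  shows "\<iota> U \<tau> x (u + w) = vadd E (\<iota> U \<tau> x u) (\<iota> U \<tau> x w)" "\<iota> U \<tau> x (c *\<^sub>R w) = vscale E c (\<iota> U \<tau> x w)"
proof -
  note i = \<iota>_fibre[OF t x]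
  have "vadd E (\<iota> U \<tau> x u) (\<iota> U \<tau> x w) \<in> vfibre E x"
    "\<tau> (vadd E (\<iota> U \<tau> x u) (\<iota> U \<tau> x w)) = \<tau> (\<iota> U \<tau> x u) + \<tau> (\<iota> U \<tau> x w)"
    using t x i(1) unfolding vtriv_def by blast+
  then show "\<iota> U \<tau> x (u + w) = vadd E (\<iota> U \<tau> x u) (\<iota> U \<tau> x w)"
    by (intro fibre_inj[OF t x i(1)]) (simp_all add: i(2))
  have "vscale E c (\<iota> U \<tau> x w) \<in> vfibre E x" "\<tau> (vscale E c (\<iota> U \<tau> x w)) = c *\<^sub>R \<tau> (\<iota> U \<tau> x w)"
    using t x i(1) unfolding vtriv_def by blast+
  then show "\<iota> U \<tau> x (c *\<^sub>R w) = vscale E c (\<iota> U \<tau> x w)"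
    by (intro fibre_inj[OF t x i(1)]) (simp_all add: i(2))
qed

lemma vtriv_linear:
  assumes t: "vtriv E U \<tau>" and x: "x \<in> U" and b: "\<And>u w. b (u + w) = vadd E (b u) (b w)"
    "\<And>c w. b (c *\<^sub>R w) = vscale E c (b w)" "\<And>w. b w \<in> vfibre E x"
  shows "linear (\<tau> \<circ> b)"
  using t x b unfolding vtriv_def by (intro linearI) auto

text \<open>The transition function from the coordinates \<open>\<tau>\<close> to
  \<open>\<tau>'\<close> on the fibre over \<open>x\<close>.\<close>

definition transition :: "'m set \<Rightarrow> ('v \<Rightarrow> real^'n) \<Rightarrow> ('v \<Rightarrow> real^'n) \<Rightarrow> 'm \<Rightarrow> real^'n^'n" where
  "transition U \<tau> \<tau>' x = matrix (\<lambda>w. \<tau>' (\<iota> U \<tau> x w))"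

lemma frame_proj: "vframe E x b \<Longrightarrow> vproj E (b w) = x" and frame_fibre: "vframe E x b \<Longrightarrow> b w \<in> vfibre E x"
  unfolding vframe_def bij_betw_def vfibre_def by blast+

lemma frame_linear:
  assumes "vtriv E U \<tau>" "x \<in> U" "vframe E x b"
  shows "linear (\<tau> \<circ> b)"
  using assms(3) by (intro vtriv_linear[OF assms(1,2)] frame_fibre[OF assms(3)]) (auto simp: vframe_def)

lemma frame_matrix:
  assumes t: "vtriv E U \<tau>" "x \<in> U" and b: "vframe E x b"
  shows "matrix (\<tau> \<circ> b) *v w = \<tau> (b w)" "b w = \<iota> U \<tau> x (matrix (\<tau> \<circ> b) *v w)" "det (matrix (\<tau> \<circ> b)) \<noteq> 0"
proof -
  note l = frame_linear[OF t b]
  show *: "matrix (\<tau> \<circ> b) *v w = \<tau> (b w)" for w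
    using fun_cong[OF matrix_vector_mul(2)[OF l], of w] by simp
  show "b w = \<iota> U \<tau> x (matrix (\<tau> \<circ> b) *v w)"
    unfolding * using triv_inv_eq[OF vtriv_triv[OF t(1)], of "b w"] frame_fibre[OF b, of w] t(2)
    by (simp add: vfibre_def)
  have "inj (\<tau> \<circ> b)"
  proof (rule injI)
    fix u v assume "(\<tau> \<circ> b) u = (\<tau> \<circ> b) v"
    then have "b u = b v" using fibre_inj[OF t frame_fibre[OF b] frame_fibre[OF b], of u v] by simp
    then show "u = v" using b by (auto simp: vframe_def bij_betw_def dest: injD)
  qed
  then show "det (matrix (\<tau> \<circ> b)) \<noteq> 0" using det_nz_iff_inj[OF l] by blast
qed

lemma frame_of_matrix:
  assumes t: "vtriv E U \<tau>" "x \<in> U" and A: "det A \<noteq> 0"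
  shows "vframe E x (\<lambda>w. \<iota> U \<tau> x (A *v w))" "matrix (\<tau> \<circ> (\<lambda>w. \<iota> U \<tau> x (A *v w))) = A"
proof -
  let ?b = "\<lambda>w. \<iota> U \<tau> x (A *v w)"
  have "invertible A" using A by (simp add: invertible_det_nz)
  then obtain B where B: "A ** B = mat 1" "B ** A = mat 1" by (auto simp: invertible_def)
  have i: "\<iota> U \<tau> x w \<in> vfibre E x" "\<tau> (\<iota> U \<tau> x w) = w" for w by (rule \<iota>_fibre[OF t])+
  have "bij_betw ?b UNIV (vfibre E x)"
  proof (rule bij_betwI[where g = "\<lambda>v. B *v \<tau> v"])
    show "B *v \<tau> (\<iota> U \<tau> x (A *v w)) = w" for w by (simp add: i(2) matrix_vector_mul_assoc B)
    show "\<iota> U \<tau> x (A *v (B *v \<tau> v)) = v" if "v \<in> vfibre E x" for v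
      using triv_inv_eq[OF vtriv_triv[OF t(1)], of v] that t(2)
      by (simp add: matrix_vector_mul_assoc B vfibre_def)
  qed (use i in auto)
  moreover have "x \<in> mpoints (vbase E)" using t openin_subset[of "mtop (vbase E)" U] by (auto simp: vtriv_def)
  ultimately show "vframe E x ?b"
    unfolding vframe_def
    by (auto simp: \<iota>_linear[OF t] matrix_vector_right_distrib matrix_vector_mult_scaleR)
  have "\<tau> \<circ> ?b = (*v) A" by (auto simp: i(2))
  then show "matrix (\<tau> \<circ> ?b) = A" by simp
qed

lemma frame_transition:
  assumes t: "vtriv E U \<tau>" "x \<in> U" and t': "vtriv E U' \<tau>'" "x \<in> U'" and b: "vframe E x b"
  shows "matrix (\<tau>' \<circ> b) = transition U \<tau> \<tau>' x ** matrix (\<tau> \<circ> b)"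
proof -
  have l: "linear (\<lambda>w. \<tau>' (\<iota> U \<tau> x w))"
    using vtriv_linear[OF t', of "\<iota> U \<tau> x"] \<iota>_linear[OF t] \<iota>_fibre[OF t] by (simp add: o_def)
  have "matrix (\<tau>' \<circ> b) = matrix ((\<lambda>w. \<tau>' (\<iota> U \<tau> x w)) \<circ> (\<tau> \<circ> b))"
  proof -
    have "\<tau>' \<circ> b = (\<lambda>w. \<tau>' (\<iota> U \<tau> x w)) \<circ> (\<tau> \<circ> b)"
    proof
      fix w
      have "b w = \<iota> U \<tau> x (\<tau> (b w))" using frame_matrix(1,2)[OF t b, of w] by simp
      then show "(\<tau>' \<circ> b) w = ((\<lambda>w. \<tau>' (\<iota> U \<tau> x w)) \<circ> (\<tau> \<circ> b)) w" by simp
    qed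
    then show ?thesis by simp
  qed
  also have "\<dots> = matrix (\<lambda>w. \<tau>' (\<iota> U \<tau> x w)) ** matrix (\<tau> \<circ> b)"
    by (rule matrix_compose[OF frame_linear[OF t b] l])
  finally show ?thesis by (simp add: transition_def)
qed

text \<open>The columns are \<open>\<tau>'\<close> applied to the local sections of constant
  coordinate with respect to \<open>\<tau>\<close>, one for each basis vector.\<close>

lemma smooth_transition:
  assumes t: "vtriv E U \<tau>" and t': "vtriv E U' \<tau>'" and c: "(W, \<phi>) \<in> charts (vbase E)"
    and A: "A \<subseteq> W \<inter> U \<inter> U'" "openin (mtop (vbase E)) A"
  shows "smooth_on (\<phi> ` A) (\<lambda>y. transition U \<tau> \<tau>' (inv_into W \<phi> y))"
proof (rule smooth_onI)
  have oA: "open (\<phi> ` A)" by (rule chart_open_image[OF c A(2)]) (use A in auto)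
  fix k
  have s: "smooth_on (\<phi> ` A) (\<lambda>y. \<tau>' (\<iota> U \<tau> (inv_into W \<phi> y) w))" for w
  proof -
    have "smooth_near (vbase E) model_mfd (\<lambda>x. \<tau>' (\<iota> U \<tau> x w)) x" if x: "x \<in> A" for x
    proof -
      have xU: "x \<in> U" "x \<in> U'" "x \<in> mpoints (vbase E)" using A x openin_subset[OF A(2)] by auto
      have 1: "smooth_near (vbase E) (vtotal E) (\<lambda>x. \<iota> U \<tau> x w) x"
        by (rule triv_inv_smooth[OF vtriv_triv[OF t] M smooth_near_ident[OF M xU(3)] xU(1)
            smooth_near_const[OF M N xU(3)]]) simp
      have 2: "smooth_near (vtotal E) model_mfd \<tau>' (\<iota> U \<tau> x w)"
        by (rule triv_smooth[OF vtriv_triv[OF t']])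
           (use \<iota>_fibre(1)[OF t xU(1), of w] xU in \<open>auto simp: vfibre_def\<close>)
      show ?thesis by (rule smooth_near_compose[OF M X N 1 2])
    qed
    from smooth_near_chart_rep[OF M N c model_chart _ _ this] A(1) show ?thesis by auto
  qed
  show "diff_order_on k (\<phi> ` A) (\<lambda>y. transition U \<tau> \<tau>' (inv_into W \<phi> y))"
    unfolding transition_def matrix_def
    by (intro diff_order_on_vec oA) (simp add: diff_order_on_nth[OF oA smooth_onD[OF s]])
qed

lemma orientation:
  assumes "p \<in> mpoints (vbase E)"
  obtains U \<tau> where "p \<in> U" "vtriv E U \<tau>"
    "\<forall>x\<in>U. \<forall>b. vframe E x b \<longrightarrow> (b \<in> vpos E \<longleftrightarrow> det (matrix (\<tau> \<circ> b)) > 0)"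
  using E assms unfolding oriented_vector_bundle_def by meson

lemma vpos_frame: "b \<in> vpos E \<Longrightarrow> vframe E (vproj E (b 0)) b"
  using E frame_proj unfolding oriented_vector_bundle_def by metis

section \<open>The atlas and the topology of the frame bundle\<close>

abbreviation "Fr \<equiv> ptotal (GLp_bundle E)"

definition frames_over :: "'m set \<Rightarrow> (real^'n \<Rightarrow> 'v) set" where
  "frames_over U = {b \<in> vpos E. vproj E (b 0) \<in> U}"

definition frame_chart :: "('m \<Rightarrow> 'a) \<Rightarrow> ('v \<Rightarrow> real^'n) \<Rightarrow> (real^'n \<Rightarrow> 'v) \<Rightarrow> 'a \<times> (real^'n^'n)" where
  "frame_chart \<phi> \<tau> b = (\<phi> (vproj E (b 0)), matrix (\<tau> \<circ> b))"

lemma frame_atlas_iff: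
  "(W, \<Phi>) \<in> frame_atlas E \<longleftrightarrow> (\<exists>U \<phi> \<tau>. W = frames_over U \<and> \<Phi> = frame_chart \<phi> \<tau> \<and> (U, \<phi>) \<in> charts (vbase E) \<and> vtriv E U \<tau>)"
  unfolding frame_atlas_def frames_over_def frame_chart_def[abs_def] by auto

lemma frame_chart_inj:
  assumes c: "(U, \<phi>) \<in> charts (vbase E)" and t: "vtriv E U \<tau>"
  shows "inj_on (frame_chart \<phi> \<tau>) (frames_over U)"
proof (rule inj_onI)
  fix b b' assume b: "b \<in> frames_over U" "b' \<in> frames_over U" and eq: "frame_chart \<phi> \<tau> b = frame_chart \<phi> \<tau> b'"
  then have x: "vproj E (b 0) = vproj E (b' 0)"
    using inj_onD[OF chart_inj[OF c]] by (auto simp: frames_over_def frame_chart_def)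
  have f: "vframe E (vproj E (b 0)) b" "vframe E (vproj E (b 0)) b'" "vproj E (b 0) \<in> U"
    unfolding frames_over_def
    using vpos_frame[of b] vpos_frame[of b'] b x by (simp_all add: frames_over_def)
  show "b = b'"
  proof
    fix w
    show "b w = b' w"
      using frame_matrix(2)[OF t f(3) f(1), of w] frame_matrix(2)[OF t f(3) f(2), of w] eq
      by (simp add: frame_chart_def)
  qed
qed

text \<open>The orientation is known only through a trivialisation \<open>\<tau>'\<close> that may
  differ from \<open>\<tau>\<close>. Near a point, the chart reaches every pair whose matrix
  acquires positive determinant after the transition to \<open>\<tau>'\<close>, and continuity of
  the transition makes this an open condition.\<close>

lemma frame_chart_image:
  assumes c: "(U, \<phi>) \<in> charts (vbase E)" and t: "vtriv E U \<tau>" and A: "openin (mtop (vbase E)) A" "A \<subseteq> U"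
  shows "open (frame_chart \<phi> \<tau> ` frames_over A)"
proof (rule open_subopen[THEN iffD2], rule ballI)
  fix p assume "p \<in> frame_chart \<phi> \<tau> ` frames_over A"
  then obtain b0 where b0: "b0 \<in> vpos E" "vproj E (b0 0) \<in> A" "p = frame_chart \<phi> \<tau> b0"
    by (auto simp: frames_over_def)
  define x0 where "x0 = vproj E (b0 0)"
  have x0: "x0 \<in> A" "x0 \<in> U" "x0 \<in> mpoints (vbase E)" "vframe E x0 b0"
    using b0 A openin_subset[OF A(1)] vpos_frame by (auto simp: x0_def)
  obtain U' \<tau>' where o: "x0 \<in> U'" "vtriv E U' \<tau>'"
    "\<forall>x\<in>U'. \<forall>b. vframe E x b \<longrightarrow> (b \<in> vpos E \<longleftrightarrow> det (matrix (\<tau>' \<circ> b)) > 0)"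
    by (rule orientation[OF x0(3)])
  define B where "B = A \<inter> U'"
  have B: "openin (mtop (vbase E)) B" "B \<subseteq> U \<inter> U \<inter> U'" "x0 \<in> B" "B \<subseteq> A" "B \<subseteq> U"
    using A o x0 by (auto simp: B_def vtriv_def)
  have oB: "open (\<phi> ` B)" by (rule chart_open_image[OF c B(1,5)])
  let ?T = "\<lambda>y. transition U \<tau> \<tau>' (inv_into U \<phi> y)"
  have sT: "smooth_on (\<phi> ` B) ?T" by (rule smooth_transition[OF t o(2) c B(2,1)])
  define D where "D = \<phi> ` B \<times> (UNIV :: (real^'n^'n) set)"
  have oD: "open D" unfolding D_def by (intro open_Times oB open_UNIV)
  have "smooth_on D (\<lambda>p. ?T (fst p) ** snd p)"
    by (intro smooth_on_matrix_mult oD smooth_on_snd smooth_on_ident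
        smooth_on_compose[OF _ oD oB _ sT] smooth_on_fst)
       (use M in \<open>auto simp: premanifold_def D_def\<close>)
  then have "continuous_on D (\<lambda>p. ?T (fst p) ** snd p)" by (rule smooth_on_continuous_on)
  then have oG: "open ((\<lambda>p. ?T (fst p) ** snd p) -` {A. det A > 0} \<inter> D)"
    using continuous_on_open_vimage[OF oD] open_det_pos by blast
  have T: "transition U \<tau> \<tau>' x ** matrix (\<tau> \<circ> b) = matrix (\<tau>' \<circ> b)" if "x \<in> B" "vframe E x b" for x b
    using frame_transition[OF t _ o(2) _ that(2)] that(1) B by (auto simp: subset_iff)
  show "\<exists>T. open T \<and> p \<in> T \<and> T \<subseteq> frame_chart \<phi> \<tau> ` frames_over A"
  proof (intro exI conjI)
    show "open ((\<lambda>p. ?T (fst p) ** snd p) -` {A. det A > 0} \<inter> D)" by (rule oG)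
    have "det (matrix (\<tau>' \<circ> b0)) > 0" using o(3)[rule_format, OF o(1) x0(4)] b0(1) by simp
    then show "p \<in> (\<lambda>p. ?T (fst p) ** snd p) -` {A. det A > 0} \<inter> D"
      using b0(3) B(3) x0(2) by (auto simp: frame_chart_def D_def x0_def[symmetric] chart_inv[OF c] T[OF B(3) x0(4)])
    show "(\<lambda>p. ?T (fst p) ** snd p) -` {A. det A > 0} \<inter> D \<subseteq> frame_chart \<phi> \<tau> ` frames_over A"
    proof
      fix z assume "z \<in> (\<lambda>p. ?T (fst p) ** snd p) -` {A. det A > 0} \<inter> D"
      then obtain x Q where z: "z = (\<phi> x, Q)" "x \<in> B" "det (?T (\<phi> x) ** Q) > 0" by (auto simp: D_def)
      have xU: "x \<in> U" "x \<in> A" "x \<in> U'" using z(2) B by auto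
      have d: "det (transition U \<tau> \<tau>' x ** Q) > 0" using z(3) chart_inv[OF c xU(1)] by simp
      then have "det Q \<noteq> 0" by (auto simp: det_mul)
      note fr = frame_of_matrix[OF t xU(1) this]
      have "(\<lambda>w. \<iota> U \<tau> x (Q *v w)) \<in> vpos E"
        using o(3)[rule_format, OF xU(3) fr(1)] T[OF z(2) fr(1)] fr(2) d by simp
      moreover have "vproj E (\<iota> U \<tau> x 0) = x" using frame_proj[OF fr(1), of 0] by simp
      ultimately show "z \<in> frame_chart \<phi> \<tau> ` frames_over A"
        using fr xU z(1)
        by (intro image_eqI[of _ _ "\<lambda>w. \<iota> U \<tau> x (Q *v w)"]) (auto simp: frame_chart_def frames_over_def)
    qed
  qed
qed

lemma frames_over_Int: "frames_over U \<inter> frames_over U' = frames_over (U \<inter> U')"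
  by (auto simp: frames_over_def)

text \<open>The matrix part changes by left multiplication with the transition function, the base
  part by the change of base charts; both depend smoothly on the coordinates.\<close>

lemma frame_chart_transition:
  assumes c: "(U, \<phi>) \<in> charts (vbase E)" and t: "vtriv E U \<tau>"
    and c': "(U', \<phi>') \<in> charts (vbase E)" and t': "vtriv E U' \<tau>'"
  shows "smooth_on (frame_chart \<phi> \<tau> ` frames_over (U \<inter> U'))
    (\<lambda>p. frame_chart \<phi>' \<tau>' (inv_into (frames_over U) (frame_chart \<phi> \<tau>) p))"
proof -
  let ?A = "U \<inter> U'"
  have A: "openin (mtop (vbase E)) ?A" using chart_openin[OF c] chart_openin[OF c'] by blast
  define D where "D = frame_chart \<phi> \<tau> ` frames_over ?A"
  have oD: "open D" unfolding D_def by (rule frame_chart_image[OF c t A]) auto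
  have oA: "open (\<phi> ` ?A)" by (rule chart_open_image[OF c A]) auto
  have DA: "fst ` D \<subseteq> \<phi> ` ?A" by (auto simp: D_def frame_chart_def frames_over_def)
  have fda: "fin_dim TYPE('a)" using M by (simp add: premanifold_def)
  have 1: "smooth_on D (\<lambda>p. \<phi>' (inv_into U \<phi> (fst p)))"
    by (rule smooth_on_compose[OF fda oD oA smooth_on_fst[OF oD smooth_on_ident[OF oD]] charts_compatible[OF M c c'] DA])
  have "smooth_on (\<phi> ` ?A) (\<lambda>y. transition U \<tau> \<tau>' (inv_into U \<phi> y))"
    by (rule smooth_transition[OF t t' c _ A]) auto
  from smooth_on_compose[OF fda oD oA smooth_on_fst[OF oD smooth_on_ident[OF oD]] this DA]
  have 2: "smooth_on D (\<lambda>p. transition U \<tau> \<tau>' (inv_into U \<phi> (fst p)) ** snd p)"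
    by (intro smooth_on_matrix_mult[OF oD] smooth_on_snd smooth_on_ident oD)
  have "smooth_on D (\<lambda>p. (\<phi>' (inv_into U \<phi> (fst p)), transition U \<tau> \<tau>' (inv_into U \<phi> (fst p)) ** snd p))"
    by (rule smooth_on_Pair[OF oD 1 2])
  then have "smooth_on D (\<lambda>p. frame_chart \<phi>' \<tau>' (inv_into (frames_over U) (frame_chart \<phi> \<tau>) p))"
  proof (rule smooth_on_congI[OF _ oD])
    fix p assume "p \<in> D"
    then obtain b where b: "b \<in> frames_over ?A" "p = frame_chart \<phi> \<tau> b" by (auto simp: D_def)
    then have bU: "b \<in> frames_over U" "vproj E (b 0) \<in> U" "vproj E (b 0) \<in> U'" "vframe E (vproj E (b 0)) b"
      using vpos_frame by (auto simp: frames_over_def)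
    show "(\<phi>' (inv_into U \<phi> (fst p)), transition U \<tau> \<tau>' (inv_into U \<phi> (fst p)) ** snd p) =
       frame_chart \<phi>' \<tau>' (inv_into (frames_over U) (frame_chart \<phi> \<tau>) p)"
      unfolding b(2) inv_into_f_f[OF frame_chart_inj[OF c t] bU(1)]
      using frame_transition[OF t bU(2) t' bU(3,4)] chart_inv[OF c bU(2)] by (simp add: frame_chart_def)
  qed
  then show ?thesis by (simp add: D_def)
qed

lemma Fr_simps:
  "atlas Fr = frame_atlas E"
  "mtop Fr = topology_generated_by {{b \<in> W. \<Phi> b \<in> D} | W \<Phi> D. (W, \<Phi>) \<in> frame_atlas E \<and> open D}"
  by (simp_all add: GLp_bundle_def)

text \<open>Open sets of frames are only known to be generated by chart preimages, so openness of
  the charts is proved along the generation. Generators are handled by the change of frame charts;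
  injectivity takes care of intersections.\<close>

lemma Fr_open_image:
  assumes "openin (mtop Fr) A" and c: "(U, \<phi>) \<in> charts (vbase E)" and t: "vtriv E U \<tau>"
  shows "open (frame_chart \<phi> \<tau> ` (A \<inter> frames_over U))"
proof -
  let ?\<Phi> = "frame_chart \<phi> \<tau>" and ?W = "frames_over U"
  have inj: "inj_on ?\<Phi> ?W" by (rule frame_chart_inj[OF c t])
  have "generate_topology_on {{b \<in> W. \<Phi> b \<in> D} | W \<Phi> D. (W, \<Phi>) \<in> frame_atlas E \<and> open D} A"
    using assms(1) unfolding Fr_simps openin_topology_generated_by_iff .
  then show ?thesis
  proof (induction A rule: generate_topology_on.induct)
    case Empty
    then show ?case by simp
  next
    case (Int A B)
    have "?\<Phi> ` (A \<inter> B \<inter> ?W) = ?\<Phi> ` (A \<inter> ?W) \<inter> ?\<Phi> ` (B \<inter> ?W)"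
      using inj_on_image_Int[OF inj, of "A \<inter> ?W" "B \<inter> ?W"] by (simp add: Int_ac)
    then show ?case using Int.IH by (simp only: open_Int)
  next
    case (UN K)
    have eq: "?\<Phi> ` (\<Union>K \<inter> ?W) = (\<Union>k\<in>K. ?\<Phi> ` (k \<inter> ?W))" by blast
    show ?case unfolding eq by (intro open_UN ballI UN.IH)
  next
    case (Basis s)
    then obtain U' \<phi>' \<tau>' D where s: "s = {b \<in> frames_over U'. frame_chart \<phi>' \<tau>' b \<in> D}" "open D"
      and c': "(U', \<phi>') \<in> charts (vbase E)" and t': "vtriv E U' \<tau>'"
      unfolding frame_atlas_iff by auto
    let ?G = "\<lambda>p. frame_chart \<phi>' \<tau>' (inv_into ?W ?\<Phi> p)" and ?D = "?\<Phi> ` frames_over (U \<inter> U')"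
    have "openin (mtop (vbase E)) (U \<inter> U')" using chart_openin[OF c] chart_openin[OF c'] by blast
    then have oD: "open ?D" by (rule frame_chart_image[OF c t]) auto
    have "open (?G -` D \<inter> ?D)"
      using continuous_on_open_vimage[OF oD] smooth_on_continuous_on[OF frame_chart_transition[OF c t c' t']] s(2) by blast
    moreover have "?\<Phi> ` (s \<inter> ?W) = ?G -` D \<inter> ?D"
    proof
      show "?\<Phi> ` (s \<inter> ?W) \<subseteq> ?G -` D \<inter> ?D"
        using inv_into_f_f[OF inj] by (auto simp: s(1) frames_over_def)
      show "?G -` D \<inter> ?D \<subseteq> ?\<Phi> ` (s \<inter> ?W)"
      proof
        fix p assume p: "p \<in> ?G -` D \<inter> ?D"
        then obtain b where b: "b \<in> frames_over (U \<inter> U')" "p = ?\<Phi> b" by blast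
        then have "b \<in> ?W" "b \<in> frames_over U'" by (auto simp: frames_over_def)
        moreover have "frame_chart \<phi>' \<tau>' b \<in> D" using p b(2) inv_into_f_f[OF inj \<open>b \<in> ?W\<close>] by simp
        ultimately show "p \<in> ?\<Phi> ` (s \<inter> ?W)" using b(2) s(1) by blast
      qed
    qed
    ultimately show ?case by simp
  qed
qed

lemma frame_is_chart:
  assumes c: "(U, \<phi>) \<in> charts (vbase E)" and t: "vtriv E U \<tau>"
  shows "is_chart (mtop Fr) (frames_over U, frame_chart \<phi> \<tau>)"
proof (rule is_chartI)
  have a: "(frames_over U, frame_chart \<phi> \<tau>) \<in> frame_atlas E" unfolding frame_atlas_iff using c t by blast
  show v: "openin (mtop Fr) {b \<in> frames_over U. frame_chart \<phi> \<tau> b \<in> D}" if "open D" for D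
    unfolding Fr_simps by (rule topology_generated_by_Basis) (use a that in blast)
  show "openin (mtop Fr) (frames_over U)" using v[OF open_UNIV] by simp
  show "inj_on (frame_chart \<phi> \<tau>) (frames_over U)" by (rule frame_chart_inj[OF c t])
  show "open (frame_chart \<phi> \<tau> ` A)" if "openin (mtop Fr) A" "A \<subseteq> frames_over U" for A
    using Fr_open_image[OF that(1) c t] that(2) by (simp add: Int_absorb2)
qed

lemma premanifold_Fr: "premanifold Fr"
proof -
  have "fin_dim TYPE('a)" using M by (simp add: premanifold_def)
  then have "fin_dim TYPE('a \<times> (real^'n^'n))" by (rule fin_dim_prod) simp
  moreover have ch: "is_chart (mtop Fr) d" if "d \<in> atlas Fr" for d
    using that frame_is_chart unfolding Fr_simps by (cases d) (auto simp: frame_atlas_iff)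
  moreover have "(\<Union>d\<in>atlas Fr. fst d) = mpoints Fr"
  proof
    show "(\<Union>d\<in>atlas Fr. fst d) \<subseteq> mpoints Fr"
    proof (rule UN_least)
      fix d assume "d \<in> atlas Fr"
      then have "is_chart (mtop Fr) (fst d, snd d)" using ch by simp
      from openin_subset[OF is_chart_openin[OF this]] show "fst d \<subseteq> mpoints Fr" .
    qed
    show "mpoints Fr \<subseteq> (\<Union>d\<in>atlas Fr. fst d)"
    proof
      fix b assume "b \<in> mpoints Fr"
      then obtain W \<Phi> where "(W, \<Phi>) \<in> frame_atlas E" "b \<in> W"
        unfolding Fr_simps topology_generated_by_topspace by auto
      then show "b \<in> (\<Union>d\<in>atlas Fr. fst d)" unfolding Fr_simps by (intro UN_I[of "(W, \<Phi>)"]) simp_all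
    qed
  qed
  moreover have "compatible_charts d d'" if "d \<in> atlas Fr" "d' \<in> atlas Fr" for d d'
  proof -
    obtain U \<phi> \<tau> where d: "d = (frames_over U, frame_chart \<phi> \<tau>)" and c: "(U, \<phi>) \<in> charts (vbase E)" and t: "vtriv E U \<tau>"
      using \<open>d \<in> atlas Fr\<close> unfolding Fr_simps by (cases d) (auto simp: frame_atlas_iff)
    obtain U' \<phi>' \<tau>' where d': "d' = (frames_over U', frame_chart \<phi>' \<tau>')" and c': "(U', \<phi>') \<in> charts (vbase E)" and t': "vtriv E U' \<tau>'"
      using \<open>d' \<in> atlas Fr\<close> unfolding Fr_simps by (cases d') (auto simp: frame_atlas_iff)
    show ?thesis
      unfolding d d' compatible_charts_def using frame_chart_transition[OF c t c' t'] frame_chart_transition[OF c' t' c t]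
      by (simp add: frames_over_Int o_def Int_commute)
  qed
  ultimately show ?thesis unfolding premanifold_def by (intro conjI ballI)
qed

lemma frame_chart_exists:
  assumes "x \<in> mpoints (vbase E)" "vtriv E U \<tau>" "x \<in> U"
  obtains U' \<phi> where "x \<in> U'" "U' \<subseteq> U" "(U', \<phi>) \<in> charts (vbase E)" "vtriv E U' \<tau>"
    "(frames_over U', frame_chart \<phi> \<tau>) \<in> charts Fr"
proof -
  have oU: "openin (mtop (vbase E)) U" using assms(2) by (simp add: vtriv_def)
  obtain W \<phi> where W: "(W, \<phi>) \<in> charts (vbase E)" "x \<in> W" by (rule atlas_cover[OF M assms(1)])
  have c: "(W \<inter> U, \<phi>) \<in> charts (vbase E)" by (rule charts_restrict[OF M W(1) oU])
  have t: "vtriv E (W \<inter> U) \<tau>" by (rule vtriv_restrict[OF assms(2) chart_openin[OF c]]) auto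
  have "(frames_over (W \<inter> U), frame_chart \<phi> \<tau>) \<in> atlas Fr" unfolding Fr_simps frame_atlas_iff using c t by blast
  then have "(frames_over (W \<inter> U), frame_chart \<phi> \<tau>) \<in> charts Fr" by (rule atlas_charts[OF premanifold_Fr])
  then show ?thesis using that[of "W \<inter> U" \<phi>] c t W assms by auto
qed

lemma mpoints_Fr: "mpoints Fr = vpos E"
proof
  show "mpoints Fr \<subseteq> vpos E"
    unfolding Fr_simps topology_generated_by_topspace frame_atlas_def by auto
  show "vpos E \<subseteq> mpoints Fr"
  proof
    fix b assume b: "b \<in> vpos E"
    then have x: "vproj E (b 0) \<in> mpoints (vbase E)" using vpos_frame by (auto simp: vframe_def)
    obtain U \<tau> where "vproj E (b 0) \<in> U" "vtriv E U \<tau>" using orientation[OF x] by metis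
    then obtain U' \<phi> where "vproj E (b 0) \<in> U'" "(frames_over U', frame_chart \<phi> \<tau>) \<in> charts Fr"
      using frame_chart_exists[OF x] by metis
    then show "b \<in> mpoints Fr" using chart_subset b by (fastforce simp: frames_over_def)
  qed
qed

text \<open>In a frame chart the two maps are represented by the first and the second
  coordinate.\<close>

lemma smooth_frame_proj:
  assumes "b \<in> mpoints Fr"
  shows "smooth_near Fr (vbase E) (\<lambda>b. vproj E (b 0)) b"
    and "\<And>U \<tau>. vtriv E U \<tau> \<Longrightarrow> vproj E (b 0) \<in> U \<Longrightarrow> smooth_near Fr model_mfd (\<lambda>b. matrix (\<tau> \<circ> b)) b"
proof -
  have b: "b \<in> vpos E" using assms mpoints_Fr by blast
  then have x: "vproj E (b 0) \<in> mpoints (vbase E)" using vpos_frame by (auto simp: vframe_def)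
  have both: "smooth_near Fr (vbase E) (\<lambda>b. vproj E (b 0)) b \<and> smooth_near Fr model_mfd (\<lambda>b. matrix (\<tau> \<circ> b)) b"
    if t: "vtriv E U \<tau>" "vproj E (b 0) \<in> U" for U \<tau>
  proof -
    obtain U' \<phi> where U': "vproj E (b 0) \<in> U'" "U' \<subseteq> U" "(U', \<phi>) \<in> charts (vbase E)" "vtriv E U' \<tau>"
      "(frames_over U', frame_chart \<phi> \<tau>) \<in> charts Fr" by (rule frame_chart_exists[OF x t])
    let ?W = "frames_over U'" and ?\<Phi> = "frame_chart \<phi> \<tau>"
    have oW: "openin (mtop Fr) ?W" by (rule chart_openin[OF U'(5)])
    have oD: "open (?\<Phi> ` ?W)" by (rule chart_open_image[OF U'(5) oW order_refl])
    have bW: "b \<in> ?W" using b U'(1) by (simp add: frames_over_def)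
    have "smooth_on (?\<Phi> ` ?W) (\<lambda>p. snd p)" by (rule smooth_on_snd[OF oD smooth_on_ident[OF oD]])
    then have 1: "smooth_on (?\<Phi> ` ?W) (\<lambda>y. matrix (\<tau> \<circ> inv_into ?W ?\<Phi> y))"
      by (rule smooth_on_congI[OF _ oD]) (erule imageE, simp only: chart_inv[OF U'(5)], simp add: frame_chart_def)
    have "smooth_on (?\<Phi> ` ?W) (\<lambda>p. fst p)" by (rule smooth_on_fst[OF oD smooth_on_ident[OF oD]])
    then have 2: "smooth_on (?\<Phi> ` ?W) (\<lambda>y. \<phi> (vproj E (inv_into ?W ?\<Phi> y 0)))"
      by (rule smooth_on_congI[OF _ oD]) (erule imageE, simp only: chart_inv[OF U'(5)], simp add: frame_chart_def)
    have "smooth_near Fr (vbase E) (\<lambda>b. vproj E (b 0)) b"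
      by (rule smooth_nearI[OF U'(5,3) oW bW order_refl _ 2]) (auto simp: frames_over_def)
    moreover have "smooth_near Fr model_mfd (\<lambda>b. matrix (\<tau> \<circ> b)) b"
      by (rule smooth_near_modelI[OF U'(5) oW bW order_refl 1])
    ultimately show ?thesis ..
  qed
  then show "\<And>U \<tau>. vtriv E U \<tau> \<Longrightarrow> vproj E (b 0) \<in> U \<Longrightarrow> smooth_near Fr model_mfd (\<lambda>b. matrix (\<tau> \<circ> b)) b" by blast
  obtain U \<tau> where "vproj E (b 0) \<in> U" "vtriv E U \<tau>" using orientation[OF x] by metis
  then show "smooth_near Fr (vbase E) (\<lambda>b. vproj E (b 0)) b" using both by blast
qed

end

section \<open>Principal bundles\<close>

locale principal =
  fixes P :: "('m, 'a::real_normed_vector, 'p, 'b::real_normed_vector, 'g, 'h::real_normed_vector) pbundle"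
  assumes P: "principal_bundle P"
begin

abbreviation "G \<equiv> pgroup P"

lemma lie: "lie_group G" using P by (simp add: principal_bundle_def)

lemma premanifolds: "premanifold (ptotal P)" "premanifold (pbase P)" "premanifold (gmfd G)"
  using P lie_group_premanifold[OF lie] by (auto simp: principal_bundle_def smooth_manifold_premanifold)

sublocale group G using lie by (simp add: lie_group_def)

lemma group_points: "mpoints (gmfd G) = carrier G" using lie by (simp add: lie_group_def)

sublocale pr: fibre_projection "ptotal P" "pbase P" "gmfd G" "pproj P"
proof
  show "smooth_near (ptotal P) (pbase P) (pproj P) v" if "v \<in> pspace P" for v
    using P smooth_map_iff[OF premanifolds(1,2)] that unfolding principal_bundle_def by blast
qed (use premanifolds in auto)

definition eqtriv :: "'m set \<Rightarrow> ('p \<Rightarrow> 'g) \<Rightarrow> bool" where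
  "eqtriv U \<tau> \<longleftrightarrow> pr.triv U \<tau> \<and> (\<forall>b\<in>pspace P. \<forall>g\<in>carrier G. pproj P b \<in> U \<longrightarrow> \<tau> (pact P b g) = \<tau> b \<otimes>\<^bsub>G\<^esub> g)"

lemma eqtriv_exists:
  assumes "x \<in> mpoints (pbase P)"
  obtains U \<tau> where "x \<in> U" "eqtriv U \<tau>"
proof -
  have "\<forall>x\<in>mpoints (pbase P). \<exists>U \<tau>. x \<in> U \<and> openin (mtop (pbase P)) U \<and>
        diffeo (open_submfd (ptotal P) {b \<in> pspace P. pproj P b \<in> U})
          (prod_mfd (open_submfd (pbase P) U) (gmfd (pgroup P))) (\<lambda>b. (pproj P b, \<tau> b)) \<and>
        (\<forall>b\<in>pspace P. \<forall>g\<in>carrier (pgroup P).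
           pproj P b \<in> U \<longrightarrow> \<tau> (pact P b g) = \<tau> b \<otimes>\<^bsub>pgroup P\<^esub> g)"
    using P unfolding principal_bundle_def by (elim conjE)
  from bspec[OF this assms] show ?thesis using that unfolding eqtriv_def pr.triv_def by (elim exE conjE) simp
qed

lemma eqtriv_triv: "eqtriv U \<tau> \<Longrightarrow> pr.triv U \<tau>"
  and eqtriv_act: "eqtriv U \<tau> \<Longrightarrow> b \<in> pspace P \<Longrightarrow> g \<in> carrier G \<Longrightarrow> pproj P b \<in> U \<Longrightarrow> \<tau> (pact P b g) = \<tau> b \<otimes>\<^bsub>G\<^esub> g"
  by (auto simp: eqtriv_def)

lemma eqtriv_eqI:
  assumes "eqtriv U \<tau>" "b \<in> pspace P" "b' \<in> pspace P" "pproj P b \<in> U" "pproj P b = pproj P b'" "\<tau> b = \<tau> b'"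
  shows "b = b'"
proof -
  have "b = triv_inv (ptotal P) (pproj P) U \<tau> (pproj P b) (\<tau> b)"
    by (rule pr.triv_inv_eq[OF eqtriv_triv[OF assms(1)] assms(2,4), symmetric])
  also have "\<dots> = triv_inv (ptotal P) (pproj P) U \<tau> (pproj P b') (\<tau> b')" by (simp only: assms(5,6))
  also have "\<dots> = b'" by (rule pr.triv_inv_eq[OF eqtriv_triv[OF assms(1)] assms(3)]) (use assms(4,5) in simp)
  finally show ?thesis .
qed

lemma smooth_act:
  assumes Z: "premanifold Z" and f: "smooth_near Z (ptotal P) f z" and g: "smooth_near Z (gmfd G) g z"
  shows "smooth_near Z (ptotal P) (\<lambda>z. pact P (f z) (g z)) z"
proof -
  note pm = premanifold_prod[OF premanifolds(1,3)]
  have fg: "smooth_near Z (prod_mfd (ptotal P) (gmfd G)) (\<lambda>z. (f z, g z)) z"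
    by (rule smooth_near_Pair[OF premanifolds(1,3) Z f g])
  have "smooth_map (prod_mfd (ptotal P) (gmfd G)) (ptotal P) (\<lambda>(b, g). pact P b g)"
    using P by (simp add: principal_bundle_def)
  from bspec[OF smooth_map_iff[OF pm premanifolds(1), THEN iffD1, OF this] smooth_near_in_space(2)[OF fg]]
  have "smooth_near (prod_mfd (ptotal P) (gmfd G)) (ptotal P) (\<lambda>(b, g). pact P b g) (f z, g z)" .
  from smooth_near_compose[OF Z pm premanifolds(1) fg this] show ?thesis by simp
qed

lemma smooth_act_right: "b \<in> pspace P \<Longrightarrow> g \<in> carrier G \<Longrightarrow> smooth_near (ptotal P) (ptotal P) (\<lambda>b. pact P b g) b"
  and smooth_orbit: "b \<in> pspace P \<Longrightarrow> g \<in> carrier G \<Longrightarrow> smooth_near (gmfd G) (ptotal P) (\<lambda>g. pact P b g) g"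
  by (intro smooth_act smooth_near_ident smooth_near_const premanifolds; simp add: group_points)+

lemma act_in: "b \<in> pspace P \<Longrightarrow> g \<in> carrier G \<Longrightarrow> pact P b g \<in> pspace P"
  using smooth_near_in_space(2)[OF smooth_act_right] .

lemma act_one: "b \<in> pspace P \<Longrightarrow> pact P b \<one>\<^bsub>G\<^esub> = b"
  and act_act: "b \<in> pspace P \<Longrightarrow> g \<in> carrier G \<Longrightarrow> h \<in> carrier G \<Longrightarrow> pact P (pact P b g) h = pact P b (g \<otimes>\<^bsub>G\<^esub> h)"
  and proj_act: "b \<in> pspace P \<Longrightarrow> g \<in> carrier G \<Longrightarrow> pproj P (pact P b g) = pproj P b"
  using P by (auto simp: principal_bundle_def)

lemma proj_in: "b \<in> pspace P \<Longrightarrow> pproj P b \<in> mpoints (pbase P)"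
  using smooth_near_in_space(2)[OF pr.\<pi>] .

lemma act_free:
  assumes "b \<in> pspace P" "g \<in> carrier G" "pact P b g = b"
  shows "g = \<one>\<^bsub>G\<^esub>"
proof -
  obtain U \<tau> where t: "pproj P b \<in> U" "eqtriv U \<tau>" by (rule eqtriv_exists[OF proj_in[OF assms(1)]])
  have "\<tau> b \<otimes>\<^bsub>G\<^esub> g = \<tau> b" using eqtriv_act[OF t(2) assms(1,2) t(1)] assms(3) by simp
  moreover have "\<tau> b \<in> carrier G" using pr.triv_in[OF eqtriv_triv[OF t(2)] assms(1) t(1)] group_points by simp
  ultimately show ?thesis using assms(2) by simp
qed

text \<open>In a trivialisation the group element is the quotient of the two fibre
  coordinates.\<close>

lemma act_transitive:
  assumes "b \<in> pspace P" "b' \<in> pspace P" "pproj P b = pproj P b'"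
  obtains g where "g \<in> carrier G" "b' = pact P b g"
proof -
  obtain U \<tau> where t: "pproj P b \<in> U" "eqtriv U \<tau>" by (rule eqtriv_exists[OF proj_in[OF assms(1)]])
  note tt = eqtriv_triv[OF t(2)]
  have c: "\<tau> b \<in> carrier G" "\<tau> b' \<in> carrier G"
    using pr.triv_in[OF tt] assms t(1) group_points by auto
  define g where "g = inv\<^bsub>G\<^esub> \<tau> b \<otimes>\<^bsub>G\<^esub> \<tau> b'"
  have g: "g \<in> carrier G" using c by (simp add: g_def)
  have "\<tau> (pact P b g) = \<tau> b'" using eqtriv_act[OF t(2) assms(1) g t(1)] c by (simp add: g_def m_assoc[symmetric])
  then have "pact P b g = b'"
    by (intro eqtriv_eqI[OF t(2) act_in[OF assms(1) g] assms(2)]) (simp_all only: proj_act[OF assms(1) g] assms(3)[symmetric] t(1))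
  then show ?thesis using that g by blast
qed

lemma proj_surj:
  assumes "x \<in> mpoints (pbase P)"
  obtains b where "b \<in> pspace P" "pproj P b = x"
proof -
  obtain U \<tau> where t: "x \<in> U" "eqtriv U \<tau>" by (rule eqtriv_exists[OF assms])
  show ?thesis using that pr.triv_inv(1,2)[OF eqtriv_triv[OF t(2)] t(1), of "\<one>\<^bsub>G\<^esub>"] by (simp add: group_points)
qed

text \<open>A clopen set contains, with a point, its whole orbit, because the group is connected,
  and the orbits are the fibres. Its image under the open projection is then clopen in the connected
  base.\<close>

lemma connected_total:
  assumes M: "connected_space (mtop (pbase P))" and C: "connected_space (mtop (gmfd G))"
  shows "connected_space (mtop (ptotal P))"
  unfolding connected_space_clopen_in
proof (intro allI impI)
  fix T assume "openin (mtop (ptotal P)) T \<and> closedin (mtop (ptotal P)) T"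
  then have T: "openin (mtop (ptotal P)) T" "openin (mtop (ptotal P)) (pspace P - T)" "T \<subseteq> pspace P"
    by (auto simp: closedin_def)
  have orbit: "pact P b g \<in> T" if b: "b \<in> T" and g: "g \<in> carrier G" for b g
  proof -
    have bP: "b \<in> pspace P" using b T by blast
    have sm: "smooth_near (gmfd G) (ptotal P) (pact P b) h" if "h \<in> mpoints (gmfd G)" for h
      using smooth_orbit[OF bP] that group_points by simp
    let ?A = "{h \<in> mpoints (gmfd G). pact P b h \<in> T}" and ?B = "{h \<in> mpoints (gmfd G). pact P b h \<in> pspace P - T}"
    have A: "openin (mtop (gmfd G)) ?A" "openin (mtop (gmfd G)) ?B"
      by (rule openin_smooth_vimage[OF openin_topspace sm T(1)], assumption,
          rule openin_smooth_vimage[OF openin_topspace sm T(2)], assumption)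
    have "?B = mpoints (gmfd G) - ?A" using act_in[OF bP] group_points by auto
    then have "closedin (mtop (gmfd G)) ?A" using A by (auto simp: closedin_def)
    moreover have "\<one>\<^bsub>G\<^esub> \<in> ?A" using b act_one[OF bP] group_points by simp
    ultimately have "?A = mpoints (gmfd G)" using C A(1) unfolding connected_space_clopen_in by blast
    moreover have "g \<in> mpoints (gmfd G)" using g group_points by simp
    ultimately show ?thesis by blast
  qed
  have sat: "b' \<in> T" if "b \<in> T" "b' \<in> pspace P" "pproj P b = pproj P b'" for b b'
    by (rule act_transitive[OF _ that(2,3)]) (use that T orbit in auto)
  \<comment> \<open>The projection is open since a local section passes through each point of the
    total space: keep the fibre coordinate of that point constant.\<close>
  have op: "openin (mtop (pbase P)) (pproj P ` W)" if W: "openin (mtop (ptotal P)) W" for W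
  proof (subst openin_subopen, rule ballI)
    fix x assume "x \<in> pproj P ` W"
    then obtain b where b: "b \<in> W" "x = pproj P b" by blast
    have bP: "b \<in> pspace P" using b(1) openin_subset[OF W] by blast
    obtain U \<tau> where t: "x \<in> U" "eqtriv U \<tau>" using eqtriv_exists[OF proj_in[OF bP]] b(2) by metis
    note tt = eqtriv_triv[OF t(2)]
    have oU: "openin (mtop (pbase P)) U" by (rule pr.triv_open[OF tt])
    have \<tau>b: "\<tau> b \<in> mpoints (gmfd G)" by (rule pr.triv_in[OF tt bP]) (use t b in simp)
    let ?s = "\<lambda>x. triv_inv (ptotal P) (pproj P) U \<tau> x (\<tau> b)"
    have "smooth_near (pbase P) (ptotal P) ?s y" if "y \<in> U" for y
    proof -
      have y: "y \<in> mpoints (pbase P)" using that openin_subset[OF oU] by blast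
      show ?thesis
        by (rule pr.triv_inv_smooth[OF tt premanifolds(2) smooth_near_ident[OF premanifolds(2) y] that
            smooth_near_const[OF premanifolds(2,3) y \<tau>b]])
    qed
    then have "openin (mtop (pbase P)) {y \<in> U. ?s y \<in> W}" by (rule openin_smooth_vimage[OF oU _ W])
    moreover have "x \<in> {y \<in> U. ?s y \<in> W}" using t b pr.triv_inv_eq[OF tt bP] by simp
    moreover have "{y \<in> U. ?s y \<in> W} \<subseteq> pproj P ` W"
    proof
      fix y assume "y \<in> {y \<in> U. ?s y \<in> W}"
      then show "y \<in> pproj P ` W" using pr.triv_inv(2)[OF tt _ \<tau>b, of y] by (intro image_eqI[of _ _ "?s y"]) auto
    qed
    ultimately show "\<exists>T. openin (mtop (pbase P)) T \<and> x \<in> T \<and> T \<subseteq> pproj P ` W" by (intro exI conjI)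
  qed
  have "pproj P ` (pspace P - T) = mpoints (pbase P) - pproj P ` T"
  proof
    show "pproj P ` (pspace P - T) \<subseteq> mpoints (pbase P) - pproj P ` T" using proj_in sat by blast
    show "mpoints (pbase P) - pproj P ` T \<subseteq> pproj P ` (pspace P - T)"
    proof
      fix x assume x: "x \<in> mpoints (pbase P) - pproj P ` T"
      then have "x \<in> mpoints (pbase P)" by simp
      then obtain b where "b \<in> pspace P" "pproj P b = x" by (rule proj_surj)
      then show "x \<in> pproj P ` (pspace P - T)" using x by blast
    qed
  qed
  then have "closedin (mtop (pbase P)) (pproj P ` T)"
    using op[OF T(1)] op[OF T(2)] openin_subset[OF op[OF T(1)]] by (simp add: closedin_def)
  then have "pproj P ` T = {} \<or> pproj P ` T = mpoints (pbase P)"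
    using M op[OF T(1)] unfolding connected_space_clopen_in by blast
  then show "T = {} \<or> T = pspace P"
  proof
    assume "pproj P ` T = mpoints (pbase P)"
    then have "b \<in> T" if "b \<in> pspace P" for b using proj_in[OF that] sat[OF _ that] by (metis imageE)
    then show ?thesis using T(3) by blast
  qed simp
qed

section \<open>The group of gauge transformations\<close>

lemma gauge_smooth: "gauge_transformation P F \<Longrightarrow> b \<in> pspace P \<Longrightarrow> smooth_near (ptotal P) (ptotal P) F b"
  using smooth_maps_smooth_near[OF premanifolds(1,1)] by (simp add: gauge_transformation_def)

lemma gauge_in: "gauge_transformation P F \<Longrightarrow> b \<in> pspace P \<Longrightarrow> F b \<in> pspace P"
  using smooth_near_in_space(2)[OF gauge_smooth] .

lemma gauge_act: "gauge_transformation P F \<Longrightarrow> b \<in> pspace P \<Longrightarrow> g \<in> carrier G \<Longrightarrow> F (pact P b g) = pact P (F b) g"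
  and gauge_proj: "gauge_transformation P F \<Longrightarrow> b \<in> pspace P \<Longrightarrow> pproj P (F b) = pproj P b"
  and gauge_ext: "gauge_transformation P F \<Longrightarrow> F \<in> extensional (pspace P)"
  by (auto simp: gauge_transformation_def smooth_maps_def)

lemma gaugeI:
  assumes "F \<in> extensional (pspace P)" "\<And>b. b \<in> pspace P \<Longrightarrow> smooth_near (ptotal P) (ptotal P) F b"
    "\<And>b g. b \<in> pspace P \<Longrightarrow> g \<in> carrier G \<Longrightarrow> F (pact P b g) = pact P (F b) g"
    "\<And>b. b \<in> pspace P \<Longrightarrow> pproj P (F b) = pproj P b"
  shows "gauge_transformation P F"
  using assms by (simp add: gauge_transformation_def smooth_maps_def smooth_map_iff[OF premanifolds(1,1)])

lemma smooth_near_restrict: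
  assumes "smooth_near (ptotal P) Y F b"
  shows "smooth_near (ptotal P) Y (\<lambda>b\<in>pspace P. F b) b"
  by (rule smooth_near_cong[OF assms openin_topspace smooth_near_in_space(1)[OF assms]]) simp

lemma gauge_compose:
  assumes F: "gauge_transformation P F" and H: "gauge_transformation P H"
  shows "gauge_transformation P (compose (pspace P) F H)"
proof (rule gaugeI)
  show "smooth_near (ptotal P) (ptotal P) (compose (pspace P) F H) b" if b: "b \<in> pspace P" for b
    unfolding compose_def
    by (rule smooth_near_restrict[OF smooth_near_compose[OF premanifolds(1,1,1) gauge_smooth[OF H b]
          gauge_smooth[OF F gauge_in[OF H b]]]])
qed (auto simp: compose_def act_in proj_act gauge_act[OF F] gauge_act[OF H] gauge_in[OF H] gauge_proj[OF F] gauge_proj[OF H])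

lemma gauge_ident: "gauge_transformation P (\<lambda>b\<in>pspace P. b)"
  by (rule gaugeI) (auto simp: act_in intro: smooth_near_restrict[OF smooth_near_ident[OF premanifolds(1)]])

text \<open>Freeness and transitivity of the action on fibres make \<open>F\<close> bijective. For
  smoothness of the inverse, note that in a trivialisation \<open>F\<close> is left multiplication
  by a smooth function \<open>?u\<close> of the base point, so its inverse is left multiplication by
  the group inverse of \<open>?u\<close>.\<close>

lemma gauge_inverse:
  assumes F: "gauge_transformation P F"
  obtains H where "gauge_transformation P H" "\<And>b. b \<in> pspace P \<Longrightarrow> H (F b) = b" "\<And>b. b \<in> pspace P \<Longrightarrow> F (H b) = b"
proof -
  have inj: "inj_on F (pspace P)"
  proof (rule inj_onI)
    fix b b' assume b: "b \<in> pspace P" "b' \<in> pspace P" "F b = F b'"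
    then have "pproj P b = pproj P b'" using gauge_proj[OF F] by metis
    then obtain g where g: "g \<in> carrier G" "b' = pact P b g" using act_transitive[OF b(1,2)] by blast
    have "pact P (F b) g = F b" using gauge_act[OF F b(1) g(1)] g(2) b(3) by simp
    then have "g = \<one>\<^bsub>G\<^esub>" by (rule act_free[OF gauge_in[OF F b(1)] g(1)])
    then show "b = b'" using g(2) act_one[OF b(1)] by simp
  qed
  have surj: "\<exists>b'\<in>pspace P. F b' = b" if b: "b \<in> pspace P" for b
  proof -
    have "pproj P b = pproj P (F b)" using gauge_proj[OF F b] by simp
    then obtain g where g: "g \<in> carrier G" "F b = pact P b g" using act_transitive[OF b gauge_in[OF F b]] by blast
    \<comment> \<open>As \<open>F\<close> moves \<open>b\<close> by \<open>g\<close>, equivariance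
      shows that moving \<open>b\<close> first by the inverse of \<open>g\<close> makes
      \<open>F\<close> return to \<open>b\<close>.\<close>
    have "F (pact P b (inv\<^bsub>G\<^esub> g)) = b"
      using gauge_act[OF F b, of "inv\<^bsub>G\<^esub> g"] g act_act[OF b g(1), of "inv\<^bsub>G\<^esub> g"] act_one[OF b] by simp
    then show ?thesis using act_in[OF b, of "inv\<^bsub>G\<^esub> g"] g(1) by auto
  qed
  define H where "H = (\<lambda>b\<in>pspace P. inv_into (pspace P) F b)"
  have im: "b \<in> F ` pspace P" if "b \<in> pspace P" for b using surj[OF that] by blast
  have H: "H b \<in> pspace P" "F (H b) = b" if "b \<in> pspace P" for b
    using that inv_into_into[OF im[OF that]] f_inv_into_f[OF im[OF that]] by (auto simp: H_def)
  have HF: "H (F b) = b" if "b \<in> pspace P" for b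
    using that gauge_in[OF F that] inv_into_f_f[OF inj that] by (simp add: H_def)
  have Hp: "pproj P (H b) = pproj P b" if "b \<in> pspace P" for b
    using gauge_proj[OF F H(1)[OF that]] H(2)[OF that] by simp
  have "gauge_transformation P H"
  proof (rule gaugeI)
    show "H \<in> extensional (pspace P)" by (simp add: H_def)
    show "pproj P (H b) = pproj P b" if "b \<in> pspace P" for b by (rule Hp[OF that])
    show "H (pact P b g) = pact P (H b) g" if b: "b \<in> pspace P" and g: "g \<in> carrier G" for b g
    proof -
      have "F (pact P (H b) g) = pact P b g" using gauge_act[OF F H(1)[OF b] g] H(2)[OF b] by simp
      then show ?thesis using HF[OF act_in[OF H(1)[OF b] g]] by simp
    qed
    fix b0 assume b0: "b0 \<in> pspace P"
    obtain U \<tau> where t: "pproj P b0 \<in> U" "eqtriv U \<tau>" by (rule eqtriv_exists[OF proj_in[OF b0]])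
    note tt = eqtriv_triv[OF t(2)]
    let ?i = "triv_inv (ptotal P) (pproj P) U \<tau>"
    \<comment> \<open>The fibre coordinate of the image of the section with coordinate one; by
      equivariance it determines \<open>F\<close> on the whole fibre.\<close>
    let ?u = "\<lambda>b. \<tau> (F (?i (pproj P b) \<one>\<^bsub>G\<^esub>))"
    have cancel: "a \<otimes>\<^bsub>G\<^esub> (inv\<^bsub>G\<^esub> a \<otimes>\<^bsub>G\<^esub> c) = c" if "a \<in> carrier G" "c \<in> carrier G" for a c
      using that by (simp add: m_assoc[symmetric])
    have one: "\<one>\<^bsub>G\<^esub> \<in> mpoints (gmfd G)" by (simp add: group_points)
    have \<sigma>: "smooth_near (ptotal P) (ptotal P) (\<lambda>b. ?i (pproj P b) \<one>\<^bsub>G\<^esub>) b0"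
      by (rule pr.triv_inv_smooth[OF tt premanifolds(1) pr.\<pi>[OF b0] t(1) smooth_near_const[OF premanifolds(1,3) b0 one]])
    note \<sigma>0 = pr.triv_inv[OF tt t(1) one]
    have F\<sigma>: "smooth_near (ptotal P) (ptotal P) (\<lambda>b. F (?i (pproj P b) \<one>\<^bsub>G\<^esub>)) b0"
      by (rule smooth_near_compose[OF premanifolds(1,1,1) \<sigma> gauge_smooth[OF F \<sigma>0(1)]])
    have "smooth_near (ptotal P) (gmfd G) \<tau> (F (?i (pproj P b0) \<one>\<^bsub>G\<^esub>))"
      by (rule pr.triv_smooth[OF tt gauge_in[OF F \<sigma>0(1)]]) (simp add: gauge_proj[OF F \<sigma>0(1)] \<sigma>0 t)
    then have u: "smooth_near (ptotal P) (gmfd G) ?u b0"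
      by (rule smooth_near_compose[OF premanifolds(1,1,3) F\<sigma>])
    have "smooth_near (ptotal P) (ptotal P) (\<lambda>b. ?i (pproj P b) (inv\<^bsub>G\<^esub> ?u b \<otimes>\<^bsub>G\<^esub> \<tau> b)) b0"
      by (rule pr.triv_inv_smooth[OF tt premanifolds(1) pr.\<pi>[OF b0] t(1)
          lie_group_smooth_mult[OF lie premanifolds(1) lie_group_smooth_inv[OF lie premanifolds(1) u] pr.triv_smooth[OF tt b0 t(1)]]])
    then show "smooth_near (ptotal P) (ptotal P) H b0"
    proof (rule smooth_near_cong[OF _ pr.openin_over[OF pr.triv_open[OF tt]]])
      show "b0 \<in> {v \<in> pspace P. pproj P v \<in> U}" using b0 t(1) by simp
      fix b assume "b \<in> {v \<in> pspace P. pproj P v \<in> U}"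
      then have b: "b \<in> pspace P" "pproj P b \<in> U" by auto
      let ?g = "inv\<^bsub>G\<^esub> ?u b \<otimes>\<^bsub>G\<^esub> \<tau> b"
      note \<sigma>b = pr.triv_inv[OF tt b(2) one]
      have F\<sigma>b: "F (?i (pproj P b) \<one>\<^bsub>G\<^esub>) \<in> pspace P" "pproj P (F (?i (pproj P b) \<one>\<^bsub>G\<^esub>)) = pproj P b"
        using gauge_in[OF F \<sigma>b(1)] gauge_proj[OF F \<sigma>b(1)] \<sigma>b(2) by auto
      have c: "?u b \<in> carrier G" "\<tau> b \<in> carrier G"
        using pr.triv_in[OF tt F\<sigma>b(1)] F\<sigma>b(2) b pr.triv_in[OF tt b] group_points by auto
      then have g: "?g \<in> carrier G" by simp
      then have gm: "?g \<in> mpoints (gmfd G)" by (simp add: group_points)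
      note \<sigma>g = pr.triv_inv[OF tt b(2) gm]
      have "pact P (?i (pproj P b) \<one>\<^bsub>G\<^esub>) ?g = ?i (pproj P b) ?g"
      proof -
        have "\<tau> (pact P (?i (pproj P b) \<one>\<^bsub>G\<^esub>) ?g) = \<tau> (?i (pproj P b) \<one>\<^bsub>G\<^esub>) \<otimes>\<^bsub>G\<^esub> ?g"
          by (rule eqtriv_act[OF t(2) \<sigma>b(1) g]) (simp only: \<sigma>b(2) b(2))
        also have "\<dots> = ?g" unfolding \<sigma>b(3) by (rule l_one[OF g])
        finally have "\<tau> (pact P (?i (pproj P b) \<one>\<^bsub>G\<^esub>) ?g) = ?g" .
        then show ?thesis
          by (intro eqtriv_eqI[OF t(2) act_in[OF \<sigma>b(1) g] \<sigma>g(1)])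
             (simp_all only: proj_act[OF \<sigma>b(1) g] \<sigma>b(2) b(2) \<sigma>g(2,3))
      qed
      then have Fi: "F (?i (pproj P b) ?g) = pact P (F (?i (pproj P b) \<one>\<^bsub>G\<^esub>)) ?g"
        using gauge_act[OF F \<sigma>b(1) g] by (simp only:)
      have "\<tau> (pact P (F (?i (pproj P b) \<one>\<^bsub>G\<^esub>)) ?g) = ?u b \<otimes>\<^bsub>G\<^esub> ?g"
        by (rule eqtriv_act[OF t(2) F\<sigma>b(1) g]) (simp only: F\<sigma>b(2) b(2))
      also have "\<dots> = \<tau> b" by (rule cancel[OF c])
      finally have "pact P (F (?i (pproj P b) \<one>\<^bsub>G\<^esub>)) ?g = b"
        by (intro eqtriv_eqI[OF t(2) act_in[OF F\<sigma>b(1) g] b(1)])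
           (simp_all only: proj_act[OF F\<sigma>b(1) g] F\<sigma>b(2) b(2))
      then have "F (?i (pproj P b) ?g) = b" using Fi by (simp only:)
      with HF[OF \<sigma>g(1)] show "?i (pproj P b) ?g = H b" by (simp only:)
    qed
  qed
  then show ?thesis using that HF H(2) by blast
qed

lemma gauge_group_simps [simp]:
  "carrier (gauge_group P) = {F. gauge_transformation P F}"
  "monoid.mult (gauge_group P) = (\<lambda>F H. compose (pspace P) F H)"
  "one (gauge_group P) = (\<lambda>b\<in>pspace P. b)"
  by (simp_all add: gauge_group_def)

lemma group_gauge_group: "group (gauge_group P)"
proof (rule groupI)
  show "x \<otimes>\<^bsub>gauge_group P\<^esub> y \<in> carrier (gauge_group P)" if "x \<in> carrier (gauge_group P)" "y \<in> carrier (gauge_group P)" for x y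
    using that gauge_compose by simp
  show "\<one>\<^bsub>gauge_group P\<^esub> \<in> carrier (gauge_group P)" using gauge_ident by simp
  show "x \<otimes>\<^bsub>gauge_group P\<^esub> y \<otimes>\<^bsub>gauge_group P\<^esub> z = x \<otimes>\<^bsub>gauge_group P\<^esub> (y \<otimes>\<^bsub>gauge_group P\<^esub> z)"
    if "x \<in> carrier (gauge_group P)" "y \<in> carrier (gauge_group P)" "z \<in> carrier (gauge_group P)" for x y z
    using that gauge_in[of z] by (auto simp: compose_def fun_eq_iff)
  show "\<one>\<^bsub>gauge_group P\<^esub> \<otimes>\<^bsub>gauge_group P\<^esub> x = x" if "x \<in> carrier (gauge_group P)" for x
  proof -
    have x: "gauge_transformation P x" using that by simp
    show ?thesis unfolding gauge_group_simps
      by (rule extensionalityI[of _ "pspace P"]) (auto simp: compose_def gauge_in[OF x] gauge_ext[OF x])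
  qed
  show "\<exists>y\<in>carrier (gauge_group P). y \<otimes>\<^bsub>gauge_group P\<^esub> x = \<one>\<^bsub>gauge_group P\<^esub>" if "x \<in> carrier (gauge_group P)" for x
  proof -
    have "gauge_transformation P x" using that by simp
    then obtain H where H: "gauge_transformation P H" "\<And>b. b \<in> pspace P \<Longrightarrow> H (x b) = b" by (rule gauge_inverse) blast
    have "compose (pspace P) H x = (\<lambda>b\<in>pspace P. b)" using H(2) by (auto simp: compose_def fun_eq_iff)
    then show ?thesis using H(1) by (intro bexI[of _ H]) simp_all
  qed
qed

end

section \<open>Spin structures\<close>

locale spin =
  fixes E :: "('m, 'a::real_normed_vector, 'v, 'c::real_normed_vector, 'n::finite) vbundle"
    and Gt :: "('g, 'h::real_normed_vector) lie"
    and \<theta> :: "'g \<Rightarrow> real^'n^'n"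
    and P :: "('m, 'a, 'p, 'b::real_normed_vector, 'g, 'h) pbundle"
    and \<Theta> :: "'p \<Rightarrow> real^'n \<Rightarrow> 'v"
  assumes ne: "mpoints (vbase E) \<noteq> {}" and conn: "connected_space (mtop (vbase E))"
    and E: "oriented_vector_bundle E"
    and cover: "connected_double_cover_GLp Gt \<theta>"
    and spin: "spin_structure E Gt \<theta> P \<Theta>"
begin

sublocale fr: oriented_bundle E by standard (rule E)

lemma base_eq: "pbase P = vbase E" and group_eq: "pgroup P = Gt"
  using spin by (auto simp: spin_structure_def)

sublocale P: principal P by standard (use spin in \<open>simp add: spin_structure_def\<close>)

lemma \<theta>_cover: "two_fold_covering (mtop (gmfd Gt)) (mtop (gmfd GLp)) \<theta>"
  and \<theta>_hom: "\<theta> \<in> hom Gt GLp" and Gt_conn: "connected_space (mtop (gmfd Gt))"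
  using cover by (auto simp: connected_double_cover_GLp_def)

sublocale Gt: group Gt using P.lie by (simp add: group_eq lie_group_def)

lemma Gt_points: "mpoints (gmfd Gt) = carrier Gt" using P.group_points by (simp add: group_eq)

lemma lie_Gt: "lie_group Gt" using P.lie by (simp add: group_eq)

lemma premanifold_Gt: "premanifold (gmfd Gt)" by (rule lie_group_premanifold[OF lie_Gt])

lemma \<theta>_mult: "a \<in> carrier Gt \<Longrightarrow> b \<in> carrier Gt \<Longrightarrow> \<theta> (a \<otimes>\<^bsub>Gt\<^esub> b) = \<theta> a ** \<theta> b"
  using hom_mult[OF \<theta>_hom] by simp

lemma \<theta>_pos: "a \<in> carrier Gt \<Longrightarrow> det (\<theta> a) > 0"
  using hom_in_carrier[OF \<theta>_hom] by simp

lemma \<theta>_surj: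
  assumes "det A > 0" obtains a where "a \<in> carrier Gt" "\<theta> a = A"
proof -
  have "A \<in> \<theta> ` topspace (mtop (gmfd Gt))"
    using \<theta>_cover assms unfolding two_fold_covering_def covering_def by simp
  then show ?thesis using that Gt_points by auto
qed

lemma matrix_cancel:
  fixes A B C :: "real^'n^'n"
  assumes "det A \<noteq> 0" "A ** B = A ** C" shows "B = C"
proof -
  obtain D where "D ** A = mat 1" using assms(1) invertible_det_nz[of A] by (auto simp: invertible_def)
  then show ?thesis using arg_cong[OF assms(2), of "\<lambda>X. D ** X"] by (simp add: matrix_mul_assoc)
qed

lemma \<theta>_one: "\<theta> \<one>\<^bsub>Gt\<^esub> = mat 1"
proof (rule matrix_cancel)
  show "det (\<theta> \<one>\<^bsub>Gt\<^esub>) \<noteq> 0" using \<theta>_pos[of "\<one>\<^bsub>Gt\<^esub>"] by simp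
  show "\<theta> \<one>\<^bsub>Gt\<^esub> ** \<theta> \<one>\<^bsub>Gt\<^esub> = \<theta> \<one>\<^bsub>Gt\<^esub> ** mat 1" using \<theta>_mult[of "\<one>\<^bsub>Gt\<^esub>" "\<one>\<^bsub>Gt\<^esub>"] by simp
qed

lemma kernel_card: "card {g \<in> carrier Gt. \<theta> g = mat 1} = 2"
proof -
  have "(mat 1 :: real^'n^'n) \<in> topspace (mtop (gmfd GLp))" by simp
  then have "card {x \<in> topspace (mtop (gmfd Gt)). \<theta> x = mat 1} = 2"
    using \<theta>_cover unfolding two_fold_covering_def by blast
  then show ?thesis by (simp add: Gt_points)
qed

definition "\<epsilon> = (SOME g. g \<in> carrier Gt \<and> \<theta> g = mat 1 \<and> g \<noteq> \<one>\<^bsub>Gt\<^esub>)"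

lemma \<epsilon>: "\<epsilon> \<in> carrier Gt" "\<theta> \<epsilon> = mat 1" "\<epsilon> \<noteq> \<one>\<^bsub>Gt\<^esub>"
  and kernel_cases: "g \<in> carrier Gt \<Longrightarrow> \<theta> g = mat 1 \<Longrightarrow> g = \<one>\<^bsub>Gt\<^esub> \<or> g = \<epsilon>"
proof -
  let ?K = "{g \<in> carrier Gt. \<theta> g = mat 1}"
  obtain a b where ab: "?K = {a, b}" "a \<noteq> b" using kernel_card unfolding card_2_iff by blast
  have one: "\<one>\<^bsub>Gt\<^esub> \<in> ?K" using \<theta>_one by simp
  have "\<exists>c. ?K = {\<one>\<^bsub>Gt\<^esub>, c} \<and> c \<noteq> \<one>\<^bsub>Gt\<^esub>"
    using one ab(2) unfolding ab(1) by auto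
  then obtain c where c: "?K = {\<one>\<^bsub>Gt\<^esub>, c}" "c \<noteq> \<one>\<^bsub>Gt\<^esub>" by blast
  then have "c \<in> ?K" by blast
  then have "\<exists>g. g \<in> carrier Gt \<and> \<theta> g = mat 1 \<and> g \<noteq> \<one>\<^bsub>Gt\<^esub>" using c(2) by blast
  from someI_ex[OF this] show e: "\<epsilon> \<in> carrier Gt" "\<theta> \<epsilon> = mat 1" "\<epsilon> \<noteq> \<one>\<^bsub>Gt\<^esub>" unfolding \<epsilon>_def by auto
  then have "\<epsilon> \<in> ?K" by blast
  then have "\<epsilon> = c" using c(1) e(3) by blast
  then show "g = \<one>\<^bsub>Gt\<^esub> \<or> g = \<epsilon>" if "g \<in> carrier Gt" "\<theta> g = mat 1" using that c(1) by blast
qed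

text \<open>The square lies in the kernel of two elements and cannot be \<open>\<epsilon>\<close>,
  as \<open>\<epsilon>\<close> is not the identity.\<close>

lemma \<epsilon>_\<epsilon>: "\<epsilon> \<otimes>\<^bsub>Gt\<^esub> \<epsilon> = \<one>\<^bsub>Gt\<^esub>"
proof -
  have "\<theta> (\<epsilon> \<otimes>\<^bsub>Gt\<^esub> \<epsilon>) = mat 1" using \<theta>_mult[OF \<epsilon>(1,1)] \<epsilon>(2) by simp
  then have "\<epsilon> \<otimes>\<^bsub>Gt\<^esub> \<epsilon> = \<one>\<^bsub>Gt\<^esub> \<or> \<epsilon> \<otimes>\<^bsub>Gt\<^esub> \<epsilon> = \<epsilon>" using kernel_cases[OF Gt.m_closed[OF \<epsilon>(1,1)]] by blast
  moreover have "\<epsilon> \<otimes>\<^bsub>Gt\<^esub> \<epsilon> \<noteq> \<epsilon>" using \<epsilon>(1,3) by simp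
  ultimately show ?thesis by blast
qed

text \<open>Conjugates of \<open>\<epsilon>\<close> lie in the kernel of two elements and differ
  from the identity.\<close>

lemma \<epsilon>_central:
  assumes g: "g \<in> carrier Gt" shows "g \<otimes>\<^bsub>Gt\<^esub> \<epsilon> = \<epsilon> \<otimes>\<^bsub>Gt\<^esub> g"
proof -
  let ?c = "g \<otimes>\<^bsub>Gt\<^esub> \<epsilon> \<otimes>\<^bsub>Gt\<^esub> inv\<^bsub>Gt\<^esub> g"
  have "\<theta> ?c = \<theta> (g \<otimes>\<^bsub>Gt\<^esub> inv\<^bsub>Gt\<^esub> g)"
    using g \<epsilon>(1,2) \<theta>_mult[of "g \<otimes>\<^bsub>Gt\<^esub> \<epsilon>" "inv\<^bsub>Gt\<^esub> g"] \<theta>_mult[of g \<epsilon>] \<theta>_mult[of g "inv\<^bsub>Gt\<^esub> g"] by simp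
  then have "\<theta> ?c = mat 1" using g \<theta>_one by simp
  then have "?c = \<one>\<^bsub>Gt\<^esub> \<or> ?c = \<epsilon>" by (rule kernel_cases[rotated]) (use g \<epsilon>(1) in simp)
  moreover have cg: "?c \<otimes>\<^bsub>Gt\<^esub> g = g \<otimes>\<^bsub>Gt\<^esub> \<epsilon>" using g \<epsilon>(1) by (simp add: Gt.m_assoc)
  moreover have "?c \<noteq> \<one>\<^bsub>Gt\<^esub>"
  proof
    assume "?c = \<one>\<^bsub>Gt\<^esub>"
    then have "g = g \<otimes>\<^bsub>Gt\<^esub> \<epsilon>" using cg g by simp
    then show False using g \<epsilon>(1,3) by simp
  qed
  ultimately show ?thesis by metis
qed

abbreviation "Fr \<equiv> ptotal (GLp_bundle E)"

lemma \<Theta>_smooth: "b \<in> pspace P \<Longrightarrow> smooth_near (ptotal P) Fr \<Theta> b"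
  using spin smooth_map_iff[OF P.premanifolds(1) fr.premanifold_Fr] unfolding spin_structure_def by blast

lemma \<Theta>_in: "b \<in> pspace P \<Longrightarrow> \<Theta> b \<in> mpoints Fr"
  using smooth_near_in_space(2)[OF \<Theta>_smooth] .

lemma \<Theta>_covering: "two_fold_covering (mtop (ptotal P)) (mtop Fr) \<Theta>"
  using spin by (simp add: spin_structure_def)

lemma \<Theta>_surj: "\<Theta> ` pspace P = mpoints Fr"
  using \<Theta>_covering by (simp add: two_fold_covering_def covering_def)

lemma \<Theta>_proj: "b \<in> pspace P \<Longrightarrow> vproj E (\<Theta> b 0) = pproj P b"
  and \<Theta>_act: "b \<in> pspace P \<Longrightarrow> g \<in> carrier Gt \<Longrightarrow> \<Theta> (pact P b g) = \<Theta> b \<circ> (*v) (\<theta> g)"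
  using spin by (auto simp: spin_structure_def GLp_bundle_def)

lemma \<Theta>_frame: "b \<in> pspace P \<Longrightarrow> vframe E (pproj P b) (\<Theta> b)"
  using fr.vpos_frame[of "\<Theta> b"] \<Theta>_in[of b] by (simp add: fr.mpoints_Fr \<Theta>_proj)

lemma act_in: "b \<in> pspace P \<Longrightarrow> g \<in> carrier Gt \<Longrightarrow> pact P b g \<in> pspace P"
  and act_act: "b \<in> pspace P \<Longrightarrow> g \<in> carrier Gt \<Longrightarrow> h \<in> carrier Gt \<Longrightarrow> pact P (pact P b g) h = pact P b (g \<otimes>\<^bsub>Gt\<^esub> h)"
  and proj_act: "b \<in> pspace P \<Longrightarrow> g \<in> carrier Gt \<Longrightarrow> pproj P (pact P b g) = pproj P b"
  and act_one: "b \<in> pspace P \<Longrightarrow> pact P b \<one>\<^bsub>Gt\<^esub> = b"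
  using P.act_in P.act_act P.proj_act P.act_one by (auto simp: group_eq)

text \<open>Points with the same frame lie over the same base point, hence differ by a group element
  \<open>g\<close>. A frame is injective, so \<open>\<theta> g\<close> fixes every vector and
  \<open>g\<close> belongs to the kernel.\<close>

lemma \<Theta>_fibre:
  assumes b: "b \<in> pspace P" "b' \<in> pspace P" and eq: "\<Theta> b = \<Theta> b'"
  shows "b' = b \<or> b' = pact P b \<epsilon>"
proof -
  have "pproj P b = pproj P b'" using \<Theta>_proj[OF b(1)] \<Theta>_proj[OF b(2)] eq by simp
  then obtain g where g: "g \<in> carrier Gt" "b' = pact P b g"
    using P.act_transitive[OF b] unfolding group_eq by blast
  have "\<Theta> b \<circ> (*v) (\<theta> g) = \<Theta> b" using \<Theta>_act[OF b(1) g(1)] g(2) eq by simp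
  then have "\<Theta> b (\<theta> g *v w) = \<Theta> b w" for w by (metis comp_apply)
  moreover have "inj (\<Theta> b)" using \<Theta>_frame[OF b(1)] by (simp add: vframe_def bij_betw_def)
  ultimately have "\<theta> g *v w = w" for w by (metis injD)
  then have "\<theta> g = mat 1" by (simp add: matrix_eq)
  then have "g = \<one>\<^bsub>Gt\<^esub> \<or> g = \<epsilon>" by (rule kernel_cases[OF g(1)])
  then show ?thesis using g(2) act_one[OF b(1)] by auto
qed

lemma frame_eqI:
  assumes "vtriv E V \<tau>" "x \<in> V" "vframe E x y" "vframe E x y'" "matrix (\<tau> \<circ> y) = matrix (\<tau> \<circ> y')"
  shows "y = y'"
  using fr.frame_matrix(2)[OF assms(1-3)] fr.frame_matrix(2)[OF assms(1,2,4)] assms(5) by (intro ext) simp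

lemma matrix_act:
  assumes "vtriv E V \<tau>" "x \<in> V" "vframe E x y"
  shows "matrix (\<tau> \<circ> (y \<circ> (*v) A)) = matrix (\<tau> \<circ> y) ** A"
proof -
  have "matrix ((\<tau> \<circ> y) \<circ> (*v) A) = matrix (\<tau> \<circ> y) ** matrix ((*v) A)"
    by (rule matrix_compose[OF matrix_vector_mul_linear fr.frame_linear[OF assms]])
  then show ?thesis by (simp add: o_assoc)
qed

text \<open>A local section of \<open>P\<close> can be corrected, using a local inverse of \<open>\<theta>\<close>, so that \<open>\<Theta>\<close> maps it to the
  frame given by a local trivialisation of \<open>E\<close>.\<close>

lemma adapted_section:
  assumes x0: "x0 \<in> mpoints (vbase E)"
  obtains A V \<tau> \<sigma> where "openin (mtop (vbase E)) A" "x0 \<in> A" "A \<subseteq> V" "vtriv E V \<tau>"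
    "\<And>x y. x \<in> A \<Longrightarrow> vframe E x y \<Longrightarrow> y \<in> mpoints Fr \<Longrightarrow> det (matrix (\<tau> \<circ> y)) > 0"
    "\<And>x. x \<in> A \<Longrightarrow> smooth_near (vbase E) (ptotal P) \<sigma> x"
    "\<And>x. x \<in> A \<Longrightarrow> pproj P (\<sigma> x) = x"
    "\<And>x. x \<in> A \<Longrightarrow> matrix (\<tau> \<circ> \<Theta> (\<sigma> x)) = mat 1"
proof -
  note M = fr.premanifolds(1) and PP = P.premanifolds(1)
  obtain V \<tau> where V: "x0 \<in> V" "vtriv E V \<tau>"
    "\<forall>x\<in>V. \<forall>b. vframe E x b \<longrightarrow> (b \<in> vpos E \<longleftrightarrow> det (matrix (\<tau> \<circ> b)) > 0)"
    by (rule fr.orientation[OF x0])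
  have pos: "det (matrix (\<tau> \<circ> y)) > 0" if "x \<in> V" "vframe E x y" "y \<in> mpoints Fr" for x y
    using V(3) that by (simp add: fr.mpoints_Fr)
  obtain U \<tau>' where U: "x0 \<in> U" "P.eqtriv U \<tau>'" using P.eqtriv_exists[of x0] x0 unfolding base_eq by blast
  note tt = P.eqtriv_triv[OF U(2)]
  have oU: "openin (mtop (vbase E)) U" using P.pr.triv_open[OF tt] by (simp add: base_eq)
  have oV: "openin (mtop (vbase E)) V" using V(2) by (simp add: vtriv_def)
  \<comment> \<open>A smooth section of the spin bundle whose frames are still unrelated to
    \<open>\<tau>\<close>.\<close>
  define \<sigma>0 where "\<sigma>0 = (\<lambda>x. triv_inv (ptotal P) (pproj P) U \<tau>' x \<one>\<^bsub>Gt\<^esub>)"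
  have one: "\<one>\<^bsub>Gt\<^esub> \<in> mpoints (gmfd (pgroup P))" by (simp add: group_eq Gt_points)
  have \<sigma>0: "\<sigma>0 x \<in> pspace P" "pproj P (\<sigma>0 x) = x" if "x \<in> U" for x
    using P.pr.triv_inv[OF tt that one] by (auto simp: \<sigma>0_def)
  have mU: "x \<in> mpoints (vbase E)" if "x \<in> U" for x using that openin_subset[OF oU] by blast
  have \<sigma>0s: "smooth_near (vbase E) (ptotal P) \<sigma>0 x" if x: "x \<in> U" for x
  proof -
    have 1: "smooth_near (vbase E) (pbase P) (\<lambda>x. x) x" unfolding base_eq by (rule smooth_near_ident[OF M mU[OF x]])
    have 2: "smooth_near (vbase E) (gmfd (pgroup P)) (\<lambda>_. \<one>\<^bsub>Gt\<^esub>) x"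
      by (rule smooth_near_const[OF M P.premanifolds(3) mU[OF x] one])
    show ?thesis unfolding \<sigma>0_def by (rule P.pr.triv_inv_smooth[OF tt M 1 x 2])
  qed
  \<comment> \<open>The matrix by which these frames differ from the ones given by
    \<open>\<tau>\<close>.\<close>
  define s where "s = (\<lambda>x. matrix (\<tau> \<circ> \<Theta> (\<sigma>0 x)))"
  have ss: "smooth_near (vbase E) (gmfd GLp) s x" if x: "x \<in> U \<inter> V" for x
  proof -
    have xU: "x \<in> U" "x \<in> V" using x by auto
    have b: "\<sigma>0 x \<in> pspace P" by (rule \<sigma>0(1)[OF xU(1)])
    have pr: "vproj E (\<Theta> (\<sigma>0 x) 0) = x" using \<Theta>_proj[OF b] \<sigma>0(2)[OF xU(1)] by simp
    have 1: "smooth_near (vbase E) Fr (\<lambda>x. \<Theta> (\<sigma>0 x)) x"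
      by (rule smooth_near_compose[OF M PP fr.premanifold_Fr \<sigma>0s[OF xU(1)] \<Theta>_smooth[OF b]])
    have 2: "smooth_near Fr model_mfd (\<lambda>b. matrix (\<tau> \<circ> b)) (\<Theta> (\<sigma>0 x))"
      by (rule fr.smooth_frame_proj(2)[OF \<Theta>_in[OF b] V(2)]) (simp add: pr xU)
    have "smooth_near (vbase E) model_mfd s x" unfolding s_def
      by (rule smooth_near_compose[OF M fr.premanifold_Fr premanifold_model[OF fin_dim_euclidean] 1 2])
    moreover have "det (s x) > 0" unfolding s_def
      by (rule pos[OF xU(2) _ \<Theta>_in[OF b]]) (use \<Theta>_frame[OF b] \<sigma>0(2)[OF xU(1)] in simp)
    ultimately show ?thesis using smooth_near_GLp_cod[OF M] by blast
  qed
  have x0UV: "x0 \<in> U \<inter> V" using U V by blast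
  have "det (s x0) > 0" using ss[OF x0UV] smooth_near_GLp_cod[OF M] by blast
  then obtain t0 where t0: "t0 \<in> carrier Gt" "\<theta> t0 = s x0" by (rule \<theta>_surj)
  obtain S1 T1 r1 where S1: "t0 \<in> S1" "diffeo_between (gmfd Gt) (gmfd GLp) S1 T1 \<theta> r1"
    by (rule double_cover_local_diffeo[OF cover t0(1)])
  have r1: "openin (mtop (gmfd GLp)) T1" "\<theta> t0 \<in> T1" "\<And>y. y \<in> T1 \<Longrightarrow> r1 y \<in> S1" "\<And>y. y \<in> T1 \<Longrightarrow> \<theta> (r1 y) = y"
    "\<And>y. y \<in> T1 \<Longrightarrow> smooth_near (gmfd GLp) (gmfd Gt) r1 y" "S1 \<subseteq> carrier Gt"
    using S1 openin_subset[of "mtop (gmfd Gt)" S1] Gt_points unfolding diffeo_between_def by blast+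
  \<comment> \<open>Here the matrices \<open>s x\<close> stay in the domain of one smooth branch of
    the inverse of \<theta>.\<close>
  define A where "A = {x \<in> U \<inter> V. s x \<in> T1}"
  have oA: "openin (mtop (vbase E)) A" unfolding A_def
    by (rule openin_smooth_vimage[OF _ ss r1(1)]) (use oU oV in blast)
  define t where "t = (\<lambda>x. r1 (s x))"
  have t: "t x \<in> carrier Gt" "\<theta> (t x) = s x" if "x \<in> A" for x
    using that r1(3,4,6) by (auto simp: A_def t_def)
  have ts: "smooth_near (vbase E) (gmfd Gt) t x" if "x \<in> A" for x
    unfolding t_def by (rule smooth_near_compose[OF M premanifold_GLp premanifold_Gt ss r1(5)]) (use that in \<open>auto simp: A_def\<close>)
  \<comment> \<open>Acting by the inverse of the lifted matrix cancels \<open>s x\<close>.\<close>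
  define \<sigma> where "\<sigma> = (\<lambda>x. pact P (\<sigma>0 x) (inv\<^bsub>Gt\<^esub> t x))"
  show ?thesis
  proof (rule that[OF oA _ _ V(2)])
    show "x0 \<in> A" using x0UV t0 r1(2) by (simp add: A_def)
    show "A \<subseteq> V" by (auto simp: A_def)
    show "det (matrix (\<tau> \<circ> y)) > 0" if "x \<in> A" "vframe E x y" "y \<in> mpoints Fr" for x y
      by (rule pos[OF _ that(2,3)]) (use that(1) in \<open>simp add: A_def\<close>)
    fix x assume x: "x \<in> A"
    then have xU: "x \<in> U" "x \<in> V" by (auto simp: A_def)
    have ti: "inv\<^bsub>Gt\<^esub> t x \<in> carrier Gt" using t(1)[OF x] by simp
    note b = \<sigma>0[OF xU(1)]
    have "smooth_near (vbase E) (gmfd (pgroup P)) (\<lambda>x. inv\<^bsub>Gt\<^esub> t x) x"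
      unfolding group_eq by (rule lie_group_smooth_inv[OF lie_Gt M ts[OF x]])
    then show "smooth_near (vbase E) (ptotal P) \<sigma> x"
      unfolding \<sigma>_def by (rule P.smooth_act[OF M \<sigma>0s[OF xU(1)]])
    show "pproj P (\<sigma> x) = x" unfolding \<sigma>_def using proj_act[OF b(1) ti] b(2) by simp
    have fr0: "vframe E x (\<Theta> (\<sigma>0 x))" using \<Theta>_frame[OF b(1)] b(2) by simp
    have "matrix (\<tau> \<circ> \<Theta> (\<sigma> x)) = s x ** \<theta> (inv\<^bsub>Gt\<^esub> t x)"
      unfolding \<sigma>_def \<Theta>_act[OF b(1) ti] s_def by (rule matrix_act[OF V(2) xU(2) fr0])
    also have "\<dots> = \<theta> (t x \<otimes>\<^bsub>Gt\<^esub> inv\<^bsub>Gt\<^esub> t x)" using \<theta>_mult[OF t(1)[OF x] ti] t(2)[OF x] by simp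
    also have "\<dots> = mat 1" using t(1)[OF x] \<theta>_one by simp
    finally show "matrix (\<tau> \<circ> \<Theta> (\<sigma> x)) = mat 1" .
  qed
qed

text \<open>Over an adapted section, a frame at \<open>x\<close> is reached from
  \<open>\<sigma> x\<close> by acting with a preimage of its matrix under \<theta>. The branch of
  that preimage is chosen so that \<open>b0\<close> itself is recovered from its frame.\<close>

lemma \<Theta>_local_diffeo:
  assumes b0: "b0 \<in> pspace P"
  shows "\<exists>S T r. b0 \<in> S \<and> diffeo_between (ptotal P) Fr S T \<Theta> r"
proof -
  note M = fr.premanifolds(1) and PP = P.premanifolds(1) and FF = fr.premanifold_Fr
  define x0 where "x0 = pproj P b0"
  have x0: "x0 \<in> mpoints (vbase E)" using P.proj_in[OF b0] by (simp add: x0_def base_eq)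
  obtain A V \<tau> \<sigma> where A: "openin (mtop (vbase E)) A" "x0 \<in> A" "A \<subseteq> V" "vtriv E V \<tau>"
    and pos: "\<And>x y. x \<in> A \<Longrightarrow> vframe E x y \<Longrightarrow> y \<in> mpoints Fr \<Longrightarrow> det (matrix (\<tau> \<circ> y)) > 0"
    and \<sigma>s: "\<And>x. x \<in> A \<Longrightarrow> smooth_near (vbase E) (ptotal P) \<sigma> x"
    and \<sigma>p: "\<And>x. x \<in> A \<Longrightarrow> pproj P (\<sigma> x) = x"
    and \<sigma>m: "\<And>x. x \<in> A \<Longrightarrow> matrix (\<tau> \<circ> \<Theta> (\<sigma> x)) = mat 1"
    by (rule adapted_section[OF x0], rule that)
  have \<sigma>in: "\<sigma> x \<in> pspace P" if "x \<in> A" for x using smooth_near_in_space(2)[OF \<sigma>s[OF that]] .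
  have "pproj P (\<sigma> x0) = pproj P b0" using \<sigma>p[OF A(2)] by (simp add: x0_def)
  then obtain g0 where g0: "g0 \<in> carrier Gt" "b0 = pact P (\<sigma> x0) g0"
    using P.act_transitive[OF \<sigma>in[OF A(2)] b0] unfolding group_eq by blast
  obtain S2 T2 r2 where S2: "g0 \<in> S2" "diffeo_between (gmfd Gt) (gmfd GLp) S2 T2 \<theta> r2"
    by (rule double_cover_local_diffeo[OF cover g0(1)])
  have r2: "openin (mtop (gmfd GLp)) T2" "\<theta> g0 \<in> T2" "r2 (\<theta> g0) = g0" "\<And>y. y \<in> T2 \<Longrightarrow> r2 y \<in> S2" "\<And>y. y \<in> T2 \<Longrightarrow> \<theta> (r2 y) = y"
    "\<And>y. y \<in> T2 \<Longrightarrow> smooth_near (gmfd GLp) (gmfd Gt) r2 y" "S2 \<subseteq> carrier Gt"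
    using S2 openin_subset[of "mtop (gmfd Gt)" S2] Gt_points unfolding diffeo_between_def by blast+
  let ?\<pi> = "\<lambda>y. vproj E (y 0)" and ?m = "\<lambda>y. matrix (\<tau> \<circ> y)"
  have \<sigma>act: "?m (\<Theta> (pact P (\<sigma> x) g)) = \<theta> g" if "x \<in> A" "g \<in> carrier Gt" for x g
  proof -
    have f: "vframe E x (\<Theta> (\<sigma> x))" using \<Theta>_frame[OF \<sigma>in[OF that(1)]] \<sigma>p[OF that(1)] by simp
    have xV: "x \<in> V" using that A(3) by blast
    show ?thesis
      unfolding \<Theta>_act[OF \<sigma>in[OF that(1)] that(2)] matrix_act[OF A(4) xV f] \<sigma>m[OF that(1)] by simp
  qed
  define N0 where "N0 = {y \<in> mpoints Fr. ?\<pi> y \<in> A}"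
  have N0: "openin (mtop Fr) N0" unfolding N0_def
    by (rule openin_smooth_vimage[OF openin_topspace fr.smooth_frame_proj(1) A(1)])
  have frN: "vframe E (?\<pi> y) y" if "y \<in> N0" for y
    using that fr.vpos_frame by (simp add: N0_def fr.mpoints_Fr)
  have ms: "smooth_near Fr (gmfd GLp) ?m y" if y: "y \<in> N0" for y
  proof -
    have yA: "?\<pi> y \<in> A" "y \<in> mpoints Fr" using y by (auto simp: N0_def)
    have "smooth_near Fr model_mfd ?m y" by (rule fr.smooth_frame_proj(2)[OF yA(2) A(4)]) (use yA A(3) in blast)
    then show ?thesis using smooth_near_GLp_cod[OF FF] pos[OF yA(1) frN[OF y] yA(2)] by blast
  qed
  define N where "N = {y \<in> N0. ?m y \<in> T2}"
  have oN: "openin (mtop Fr) N" unfolding N_def by (rule openin_smooth_vimage[OF N0 ms r2(1)])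
  define q where "q = (\<lambda>y. pact P (\<sigma> (?\<pi> y)) (r2 (?m y)))"
  have Nd: "?\<pi> y \<in> A" "y \<in> mpoints Fr" "?m y \<in> T2" "r2 (?m y) \<in> carrier Gt" "y \<in> N0" if "y \<in> N" for y
    using that r2(4,7) by (auto simp: N_def N0_def)
  have qs: "smooth_near Fr (ptotal P) q y" if y: "y \<in> N" for y
    unfolding q_def
  proof (rule P.smooth_act[OF FF])
    show "smooth_near Fr (ptotal P) (\<lambda>y. \<sigma> (?\<pi> y)) y"
      by (rule smooth_near_compose[where f="?\<pi>" and g=\<sigma> and x=y, OF FF M PP fr.smooth_frame_proj(1)[OF Nd(2)[OF y]] \<sigma>s[OF Nd(1)[OF y]]])
    show "smooth_near Fr (gmfd (pgroup P)) (\<lambda>y. r2 (?m y)) y"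
      unfolding group_eq by (rule smooth_near_compose[where f="?m" and g=r2 and x=y, OF FF premanifold_GLp premanifold_Gt ms[OF Nd(5)[OF y]] r2(6)[OF Nd(3)[OF y]]])
  qed
  have \<Theta>q: "\<Theta> (q y) = y" if y: "y \<in> N" for y
  proof -
    have qP: "q y \<in> pspace P" using smooth_near_in_space(2)[OF qs[OF y]] .
    have "pproj P (q y) = ?\<pi> y"
      unfolding q_def using proj_act[OF \<sigma>in[OF Nd(1)[OF y]] Nd(4)[OF y]] \<sigma>p[OF Nd(1)[OF y]] by simp
    then have f: "vframe E (?\<pi> y) (\<Theta> (q y))" using \<Theta>_frame[OF qP] by simp
    have m: "?m (\<Theta> (q y)) = ?m y"
      unfolding q_def \<sigma>act[OF Nd(1)[OF y] Nd(4)[OF y]] by (rule r2(5)[OF Nd(3)[OF y]])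
    show ?thesis by (rule frame_eqI[OF A(4) _ f frN[OF Nd(5)[OF y]] m]) (use Nd(1)[OF y] A(3) in blast)
  qed
  have y0: "\<Theta> b0 \<in> N" "q (\<Theta> b0) = b0"
  proof -
    have "?\<pi> (\<Theta> b0) = x0" using \<Theta>_proj[OF b0] by (simp add: x0_def)
    moreover have m0: "?m (\<Theta> b0) = \<theta> g0" unfolding g0(2) by (rule \<sigma>act[OF A(2) g0(1)])
    ultimately show "\<Theta> b0 \<in> N" using A(2) \<Theta>_in[OF b0] r2(2) by (simp add: N_def N0_def)
    show "q (\<Theta> b0) = b0" unfolding q_def \<open>?\<pi> (\<Theta> b0) = x0\<close> m0 r2(3) by (rule g0(2)[symmetric])
  qed
  have cov: "covering (mtop (ptotal P)) (mtop Fr) \<Theta>" using \<Theta>_covering by (simp add: two_fold_covering_def)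
  obtain S0 where S0: "openin (mtop (ptotal P)) S0" "b0 \<in> S0" "inj_on \<Theta> S0"
    by (rule covering_local_section[OF cov b0])
  have S0P: "S0 \<subseteq> pspace P" by (rule openin_subset[OF S0(1)])
  \<comment> \<open>So far \<open>q\<close> is a right inverse of \<open>\<Theta>\<close>. Keeping
    only frames that it sends into a set where \<open>\<Theta>\<close> is injective makes it a left
    inverse as well.\<close>
  define T where "T = {y \<in> N. q y \<in> S0}"
  have oT: "openin (mtop Fr) T" unfolding T_def by (rule openin_smooth_vimage[OF oN qs S0(1)])
  define S where "S = {b \<in> S0. \<Theta> b \<in> T}"
  have oS: "openin (mtop (ptotal P)) S" unfolding S_def
    by (rule openin_smooth_vimage[OF S0(1) \<Theta>_smooth oT]) (use S0P in blast)
  have "diffeo_between (ptotal P) Fr S T \<Theta> q"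
    unfolding diffeo_between_def
  proof (intro conjI ballI oS oT)
    show "\<Theta> ` S \<subseteq> T" by (auto simp: S_def)
    show "q ` T \<subseteq> S" using \<Theta>q by (auto simp: S_def T_def)
    show "q (\<Theta> b) = b" if "b \<in> S" for b
      by (rule inj_onD[OF S0(3) \<Theta>q]) (use that in \<open>auto simp: S_def T_def\<close>)
    show "\<Theta> (q y) = y" if "y \<in> T" for y by (rule \<Theta>q) (use that in \<open>simp add: T_def\<close>)
    show "smooth_near (ptotal P) Fr \<Theta> b" if "b \<in> S" for b by (rule \<Theta>_smooth) (use that S0P in \<open>auto simp: S_def\<close>)
    show "smooth_near Fr (ptotal P) q y" if "y \<in> T" for y by (rule qs) (use that in \<open>simp add: T_def\<close>)
  qed
  moreover have "b0 \<in> S" using y0 S0(2) by (simp add: S_def T_def)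
  ultimately show ?thesis by blast
qed

section \<open>Push-forward of gauge transformations along the spin structure\<close>

definition \<kappa> :: "'p \<Rightarrow> 'p" where "\<kappa> b = pact P b \<epsilon>"

lemma gauge_\<kappa>: "gauge_transformation P F \<Longrightarrow> b \<in> pspace P \<Longrightarrow> F (\<kappa> b) = \<kappa> (F b)"
  unfolding \<kappa>_def using P.gauge_act \<epsilon>(1) by (simp add: group_eq)

lemma \<Theta>_\<kappa>: "b \<in> pspace P \<Longrightarrow> \<Theta> (\<kappa> b) = \<Theta> b"
  by (simp add: \<kappa>_def \<Theta>_act \<epsilon> fun_eq_iff)

lemma \<Theta>_gauge:
  assumes F: "gauge_transformation P F" and b: "b \<in> pspace P" "b' \<in> pspace P" "\<Theta> b = \<Theta> b'"
  shows "\<Theta> (F b) = \<Theta> (F b')"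
  using \<Theta>_fibre[OF b] gauge_\<kappa>[OF F b(1)] \<Theta>_\<kappa>[OF P.gauge_in[OF F b(1)]] by (auto simp: \<kappa>_def[symmetric])

abbreviation "H \<equiv> Theta_star E P \<Theta>"

lemma H_\<Theta>:
  assumes F: "gauge_transformation P F" and b: "b \<in> pspace P"
  shows "H F (\<Theta> b) = \<Theta> (F b)"
proof -
  have im: "\<Theta> b \<in> \<Theta> ` pspace P" using b by blast
  have "\<Theta> (F (inv_into (pspace P) \<Theta> (\<Theta> b))) = \<Theta> (F b)"
    by (rule \<Theta>_gauge[OF F inv_into_into[OF im] b f_inv_into_f[OF im]])
  then show ?thesis using \<Theta>_in[OF b] by (simp add: Theta_star_def)
qed

text \<open>Locally the push-forward is \<open>\<Theta>\<close> after \<open>F\<close> after a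
  smooth local inverse of \<open>\<Theta>\<close>.\<close>

lemma H_smooth:
  assumes F: "gauge_transformation P F"
  shows "H F \<in> smooth_maps Fr Fr"
proof -
  have "smooth_near Fr Fr (H F) y" if "y \<in> mpoints Fr" for y
  proof -
    obtain b where b: "b \<in> pspace P" "y = \<Theta> b" using \<Theta>_surj \<open>y \<in> mpoints Fr\<close> by auto
    obtain S T r where S: "b \<in> S" "diffeo_between (ptotal P) Fr S T \<Theta> r"
      using \<Theta>_local_diffeo[OF b(1)] by (elim exE conjE)
    have r: "openin (mtop Fr) T" "y \<in> T" "r y = b" "smooth_near Fr (ptotal P) r y"
      "\<And>z. z \<in> T \<Longrightarrow> \<Theta> (r z) = z" "\<And>z. z \<in> T \<Longrightarrow> r z \<in> pspace P"
      using S b openin_subset[of "mtop (ptotal P)" S] unfolding diffeo_between_def by blast+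
    have 1: "smooth_near (ptotal P) Fr (\<lambda>b. \<Theta> (F b)) (r y)"
      unfolding r(3)
      by (rule smooth_near_compose[OF P.premanifolds(1,1) fr.premanifold_Fr P.gauge_smooth[OF F b(1)] \<Theta>_smooth[OF P.gauge_in[OF F b(1)]]])
    have "smooth_near Fr Fr (\<lambda>y. \<Theta> (F (r y))) y"
      by (rule smooth_near_compose[where f=r and g="\<lambda>b. \<Theta> (F b)" and x=y, OF fr.premanifold_Fr P.premanifolds(1) fr.premanifold_Fr r(4) 1])
    then show ?thesis
    proof (rule smooth_near_cong[OF _ r(1,2)])
      fix z assume "z \<in> T"
      then show "\<Theta> (F (r z)) = H F z" using H_\<Theta>[OF F r(6)] r(5) by simp
    qed
  qed
  then show ?thesis
    unfolding smooth_maps_def smooth_map_iff[OF fr.premanifold_Fr fr.premanifold_Fr] by (simp add: Theta_star_def)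
qed

text \<open>Equivariance rests on \<open>\<epsilon>\<close> being central: the action of
  \<open>\<epsilon>\<close> commutes with that of every \<open>g\<close>.\<close>

lemma gauge_\<kappa>_compose:
  assumes F: "gauge_transformation P F"
  shows "gauge_transformation P (\<lambda>b\<in>pspace P. \<kappa> (F b))"
proof (rule P.gaugeI)
  have e: "\<epsilon> \<in> carrier (pgroup P)" using \<epsilon>(1) by (simp add: group_eq)
  show "smooth_near (ptotal P) (ptotal P) (\<lambda>b\<in>pspace P. \<kappa> (F b)) b" if b: "b \<in> pspace P" for b
    unfolding \<kappa>_def
    by (rule P.smooth_near_restrict[OF smooth_near_compose[OF P.premanifolds(1,1,1) P.gauge_smooth[OF F b]
        P.smooth_act_right[OF P.gauge_in[OF F b] e]]])
  show "(\<lambda>b\<in>pspace P. \<kappa> (F b)) (pact P b g) = pact P ((\<lambda>b\<in>pspace P. \<kappa> (F b)) b) g"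
    if b: "b \<in> pspace P" and g: "g \<in> carrier (pgroup P)" for b g
  proof -
    have g': "g \<in> carrier Gt" using g by (simp add: group_eq)
    have "pact P (pact P (F b) g) \<epsilon> = pact P (pact P (F b) \<epsilon>) g"
      using act_act[OF P.gauge_in[OF F b] g' \<epsilon>(1)] act_act[OF P.gauge_in[OF F b] \<epsilon>(1) g'] \<epsilon>_central[OF g'] by simp
    then show ?thesis using P.act_in[OF b g] b P.gauge_act[OF F b g] by (simp add: \<kappa>_def)
  qed
  show "pproj P ((\<lambda>b\<in>pspace P. \<kappa> (F b)) b) = pproj P b" if b: "b \<in> pspace P" for b
    using b P.proj_act[OF P.gauge_in[OF F b] e] P.gauge_proj[OF F b] by (simp add: \<kappa>_def)
qed simp

definition p0 :: 'p where "p0 = (SOME b. b \<in> pspace P)"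

lemma p0: "p0 \<in> pspace P"
proof -
  obtain x where "x \<in> mpoints (pbase P)" using ne unfolding base_eq by blast
  then obtain b where "b \<in> pspace P" by (rule P.proj_surj)
  then show ?thesis unfolding p0_def by (rule someI)
qed

sublocale deck: deck_involution "ptotal P" Fr \<Theta> \<kappa> "{F. gauge_transformation P F}" H p0
proof
  have e: "\<epsilon> \<in> carrier (pgroup P)" using \<epsilon>(1) by (simp add: group_eq)
  show "connected_space (mtop (ptotal P))"
    by (rule P.connected_total) (use conn Gt_conn in \<open>simp_all add: base_eq group_eq\<close>)
  show "smooth_near (ptotal P) (ptotal P) \<kappa> x" if "x \<in> pspace P" for x
    using P.smooth_act_right[OF that e] by (simp add: \<kappa>_def[abs_def])
  show "\<kappa> (\<kappa> x) = x" if "x \<in> pspace P" for x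
    using act_act[OF that \<epsilon>(1,1)] \<epsilon>_\<epsilon> act_one[OF that] by (simp add: \<kappa>_def)
  show "\<kappa> x \<noteq> x" if "x \<in> pspace P" for x
    using P.act_free[OF that e] \<epsilon>(3) by (auto simp: \<kappa>_def group_eq)
  show "y = x \<or> y = \<kappa> x" if "x \<in> pspace P" "y \<in> pspace P" "\<Theta> x = \<Theta> y" for x y
    unfolding \<kappa>_def by (rule \<Theta>_fibre[OF that])
  show "{F. gauge_transformation P F} \<subseteq> smooth_maps (ptotal P) (ptotal P)"
    by (auto simp: gauge_transformation_def)
qed (use P.premanifolds(1) fr.premanifold_Fr p0 \<Theta>_surj \<Theta>_local_diffeo \<Theta>_\<kappa> gauge_\<kappa>_compose H_smooth H_\<Theta> in auto)

lemma GLp_bundle_simps [simp]: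
  "pgroup (GLp_bundle E) = GLp" "pact (GLp_bundle E) = (\<lambda>b A. b \<circ> (*v) A)" "pproj (GLp_bundle E) = (\<lambda>b. vproj E (b 0))"
  by (simp_all add: GLp_bundle_def)

text \<open>Equivariance under a matrix is obtained by lifting the matrix to the double cover and
  using equivariance of \<open>F\<close> there.\<close>

lemma H_gauge:
  assumes F: "gauge_transformation P F"
  shows "gauge_transformation (GLp_bundle E) (H F)"
  unfolding gauge_transformation_def GLp_bundle_simps
proof (intro conjI ballI H_smooth[OF F])
  fix y assume "y \<in> mpoints Fr"
  then obtain b where b: "b \<in> pspace P" "y = \<Theta> b" using \<Theta>_surj by auto
  show "vproj E (H F y 0) = vproj E (y 0)"
    using H_\<Theta>[OF F b(1)] \<Theta>_proj[OF P.gauge_in[OF F b(1)]] \<Theta>_proj[OF b(1)] P.gauge_proj[OF F b(1)] b(2) by simp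
  fix A :: "real^'n^'n" assume "A \<in> carrier GLp"
  then have "det A > 0" by simp
  then obtain g where g: "g \<in> carrier Gt" "\<theta> g = A" by (rule \<theta>_surj)
  have g': "g \<in> carrier (pgroup P)" using g by (simp add: group_eq)
  have "y \<circ> (*v) A = \<Theta> (pact P b g)" using \<Theta>_act[OF b(1) g(1)] g(2) b(2) by simp
  then have "H F (y \<circ> (*v) A) = \<Theta> (F (pact P b g))" using H_\<Theta>[OF F act_in[OF b(1) g(1)]] by simp
  also have "\<dots> = \<Theta> (F b) \<circ> (*v) A"
    using P.gauge_act[OF F b(1) g'] \<Theta>_act[OF P.gauge_in[OF F b(1)] g(1)] g(2) by simp
  finally show "H F (y \<circ> (*v) A) = H F y \<circ> (*v) A" using H_\<Theta>[OF F b(1)] b(2) by simp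
qed

text \<open>A spin gauge transformation and the push-forward of its lift agree on frames and are
  both normalised elsewhere, so surjectivity is part of the definition of being spin.\<close>

lemma spin_carrier: "carrier (spin_gauge_group E P \<Theta>) = H ` {F. gauge_transformation P F}"
proof
  show "carrier (spin_gauge_group E P \<Theta>) \<subseteq> H ` {F. gauge_transformation P F}"
  proof
    fix F assume "F \<in> carrier (spin_gauge_group E P \<Theta>)"
    then obtain Ft where F: "gauge_transformation (GLp_bundle E) F" and Ft: "gauge_transformation P Ft"
      and eq: "\<forall>b\<in>pspace P. \<Theta> (Ft b) = F (\<Theta> b)"
      by (auto simp: spin_gauge_group_def gauge_group_def)
    have "F y = H Ft y" if "y \<in> mpoints Fr" for y
    proof -
      obtain b where "b \<in> pspace P" "y = \<Theta> b" using \<Theta>_surj \<open>y \<in> mpoints Fr\<close> by auto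
      then show ?thesis using eq H_\<Theta>[OF Ft] by simp
    qed
    moreover have "F \<in> extensional (mpoints Fr)" using F by (simp add: gauge_transformation_def smooth_maps_def)
    moreover have "H Ft \<in> extensional (mpoints Fr)" using H_smooth[OF Ft] by (simp add: smooth_maps_def)
    ultimately have "F = H Ft" using extensionalityI[of F "mpoints Fr" "H Ft"] by blast
    then show "F \<in> H ` {F. gauge_transformation P F}" using Ft by blast
  qed
  show "H ` {F. gauge_transformation P F} \<subseteq> carrier (spin_gauge_group E P \<Theta>)"
  proof
    fix F assume "F \<in> H ` {F. gauge_transformation P F}"
    then obtain Ft where Ft: "F = H Ft" "gauge_transformation P Ft" by blast
    then show "F \<in> carrier (spin_gauge_group E P \<Theta>)"
      using H_gauge[OF Ft(2)] H_\<Theta>[OF Ft(2)] by (auto simp: spin_gauge_group_def gauge_group_def)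
  qed
qed

lemma H_compose:
  assumes F: "gauge_transformation P F" and K: "gauge_transformation P K"
  shows "H (compose (pspace P) F K) = compose (mpoints Fr) (H F) (H K)"
proof (rule extensionalityI[of _ "mpoints Fr"])
  have FK: "gauge_transformation P (compose (pspace P) F K)" by (rule P.gauge_compose[OF F K])
  show "H (compose (pspace P) F K) \<in> extensional (mpoints Fr)" by (simp add: Theta_star_def)
  show "compose (mpoints Fr) (H F) (H K) \<in> extensional (mpoints Fr)" by simp
  fix y assume y: "y \<in> mpoints Fr"
  then obtain b where b: "b \<in> pspace P" "y = \<Theta> b" using \<Theta>_surj by auto
  show "H (compose (pspace P) F K) y = compose (mpoints Fr) (H F) (H K) y"
    using H_\<Theta>[OF FK b(1)] H_\<Theta>[OF K b(1)] H_\<Theta>[OF F P.gauge_in[OF K b(1)]] y b by (simp add: compose_def)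
qed

lemma H_ident: "H (\<lambda>b\<in>pspace P. b) = (\<lambda>y\<in>mpoints Fr. y)"
proof (rule extensionalityI[of _ "mpoints Fr"])
  fix y assume y: "y \<in> mpoints Fr"
  then obtain b where b: "b \<in> pspace P" "y = \<Theta> b" using \<Theta>_surj by auto
  show "H (\<lambda>b\<in>pspace P. b) y = (\<lambda>y\<in>mpoints Fr. y) y" using H_\<Theta>[OF P.gauge_ident b(1)] y b by simp
qed (simp_all add: Theta_star_def)

lemma spin_simps:
  "monoid.mult (spin_gauge_group E P \<Theta>) = (\<lambda>F K. compose (mpoints Fr) F K)"
  "one (spin_gauge_group E P \<Theta>) = (\<lambda>y\<in>mpoints Fr. y)"
  by (simp_all add: spin_gauge_group_def gauge_group_def)

text \<open>The group laws are inherited from the image of a homomorphism defined on a group; the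
  inverse of a spin gauge transformation comes from inverting its lift.\<close>

lemma group_hom_H: "group_hom (gauge_group P) (spin_gauge_group E P \<Theta>) H"
proof -
  interpret G: group "gauge_group P" by (rule P.group_gauge_group)
  have hom: "H \<in> hom (gauge_group P) (spin_gauge_group E P \<Theta>)"
    using H_compose unfolding hom_def spin_carrier by (auto simp: spin_simps)
  have "group (spin_gauge_group E P \<Theta> \<lparr>carrier := H ` carrier (gauge_group P), one := H \<one>\<^bsub>gauge_group P\<^esub>\<rparr>)"
    by (rule G.hom_imp_img_group[OF hom])
  moreover have "spin_gauge_group E P \<Theta> \<lparr>carrier := H ` carrier (gauge_group P), one := H \<one>\<^bsub>gauge_group P\<^esub>\<rparr> = spin_gauge_group E P \<Theta>"
    by (rule monoid.equality) (simp_all add: spin_carrier spin_simps H_ident)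
  ultimately have "group (spin_gauge_group E P \<Theta>)" by simp
  then show ?thesis using hom G.is_group by (simp add: group_hom_def group_hom_axioms_def)
qed

text \<open>A kernel element and the identity have the same push-forward, so
  \<open>H_eq_cases\<close> leaves only the identity and the deck involution.\<close>

lemma kernel_H: "kernel (gauge_group P) (spin_gauge_group E P \<Theta>) H = {\<lambda>b\<in>pspace P. b, \<lambda>b\<in>pspace P. \<kappa> b}"
proof -
  let ?i = "\<lambda>b\<in>pspace P. b"
  have k: "(\<lambda>b\<in>pspace P. \<kappa> (?i b)) = (\<lambda>b\<in>pspace P. \<kappa> b)" by auto
  have i: "?i \<in> {F. gauge_transformation P F}" using P.gauge_ident by simp
  have "F = ?i \<or> F = (\<lambda>b\<in>pspace P. \<kappa> b)" if "gauge_transformation P F" "H F = (\<lambda>y\<in>mpoints Fr. y)" for F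
    using deck.H_eq_cases[OF i, of F] that H_ident unfolding k by simp
  moreover have "gauge_transformation P (\<lambda>b\<in>pspace P. \<kappa> b)" "H (\<lambda>b\<in>pspace P. \<kappa> b) = (\<lambda>y\<in>mpoints Fr. y)"
    using deck.\<G>_\<kappa>[OF i] deck.H_\<kappa>[OF i] H_ident unfolding k by auto
  ultimately show ?thesis
    unfolding kernel_def using P.gauge_ident H_ident by (auto simp: spin_simps)
qed

lemma kernel_iso:
  "(gauge_group P)\<lparr>carrier := kernel (gauge_group P) (spin_gauge_group E P \<Theta>) H\<rparr> \<cong> integer_mod_group 2"
proof -
  define e where "e = (\<lambda>b\<in>pspace P. b)"
  define k where "k = (\<lambda>b\<in>pspace P. \<kappa> b)"
  have ne: "e \<noteq> k"
  proof
    assume "e = k"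
    from fun_cong[OF this, of p0] show False using p0 deck.\<kappa>_neq[OF p0] by (simp add: e_def k_def)
  qed
  have m: "compose (pspace P) e e = e" "compose (pspace P) e k = k" "compose (pspace P) k e = k" "compose (pspace P) k k = e"
    using deck.\<kappa>_in deck.\<kappa>_\<kappa> by (auto simp: e_def k_def compose_def fun_eq_iff)
  have K: "kernel (gauge_group P) (spin_gauge_group E P \<Theta>) H = {e, k}" unfolding kernel_H e_def k_def ..
  let ?f = "\<lambda>F. if F = e then 0 else (1::int)"
  have "?f \<in> iso ((gauge_group P)\<lparr>carrier := {e, k}\<rparr>) (integer_mod_group 2)"
  proof (rule isoI)
    show "?f \<in> hom ((gauge_group P)\<lparr>carrier := {e, k}\<rparr>) (integer_mod_group 2)"
      using ne m by (auto simp: hom_def carrier_integer_mod_group)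
    have "{0..<2} = {0, 1::int}" by auto
    then show "bij_betw ?f (carrier ((gauge_group P)\<lparr>carrier := {e, k}\<rparr>)) (carrier (integer_mod_group 2))"
      using ne by (auto simp: bij_betw_def inj_on_def carrier_integer_mod_group)
  qed
  then show ?thesis unfolding K is_iso_def by blast
qed

lemma two_fold_covering_gauge:
  "two_fold_covering (gauge_topology P (carrier (gauge_group P)))
     (gauge_topology (GLp_bundle E) (carrier (spin_gauge_group E P \<Theta>))) H"
  unfolding gauge_topology_def spin_carrier P.gauge_group_simps(1) by (rule deck.two_fold_covering_H)

end

theorem theorem2p6p4:
  fixes E :: "('m, 'a::real_normed_vector, 'v, 'c::real_normed_vector, 'n::finite) vbundle"
    and Gt :: "('g, 'h::real_normed_vector) lie"
    and \<theta> :: "'g \<Rightarrow> real^'n^'n"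
    and P :: "('m, 'a, 'p, 'b::real_normed_vector, 'g, 'h) pbundle"
    and \<Theta> :: "'p \<Rightarrow> real^'n \<Rightarrow> 'v"
  assumes "mpoints (vbase E) \<noteq> {}" and "connected_space (mtop (vbase E))"
    and "oriented_vector_bundle E"
    and "CARD('n) \<ge> 2"
    and "connected_double_cover_GLp Gt \<theta>"
    and "spin_structure E Gt \<theta> P \<Theta>"
  shows "(\<forall>Ft\<in>carrier (gauge_group P). \<forall>b\<in>pspace P. \<forall>b'\<in>pspace P.
            \<Theta> b = \<Theta> b' \<longrightarrow> \<Theta> (Ft b) = \<Theta> (Ft b'))
       \<and> group_hom (gauge_group P) (spin_gauge_group E P \<Theta>) (Theta_star E P \<Theta>)
       \<and> (gauge_group P)\<lparr>carrier := kernel (gauge_group P) (spin_gauge_group E P \<Theta>) (Theta_star E P \<Theta>)\<rparr>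
            \<cong> integer_mod_group 2
       \<and> two_fold_covering
            (gauge_topology P (carrier (gauge_group P)))
            (gauge_topology (GLp_bundle E) (carrier (spin_gauge_group E P \<Theta>)))
            (Theta_star E P \<Theta>)"
proof -
  have S: "spin E Gt \<theta> P \<Theta>" by (rule spin.intro[OF assms(1-3,5,6)])
  show ?thesis
  proof (intro conjI ballI impI spin.group_hom_H[OF S] spin.kernel_iso[OF S] spin.two_fold_covering_gauge[OF S])
    fix F b b' assume "F \<in> carrier (gauge_group P)" and b: "b \<in> pspace P" "b' \<in> pspace P" "\<Theta> b = \<Theta> b'"
    then have "gauge_transformation P F" by (simp add: gauge_group_def)
    then show "\<Theta> (F b) = \<Theta> (F b')" by (rule spin.\<Theta>_gauge[OF S _ b])
  qed
qed

end
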